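(* Let $A$ be a nonnegative locally integrable function on $[0,\infty)$ with associated complete Bernstein function $\psi$, and suppose that $A$ is positive and locally Lipschitz continuous on $(0,\infty)$, or that $A$ is given by $A(\sigma(t))=(a(t))^2$ for a coefficient $a$ which is positive and locally Lipschitz continuous on $(0,\infty)$. Suppose that $\exp(-t\psi(|\xi|^2))$ is integrable over $\mathbb{R}^d$ for every $t>0$, and that $V$ is a locally bounded confining potential on $\mathbb{R}^d$. Let $f_n$ be the $n$-th eigenfunction of the operator $\psi(-\Delta)+V(x)$, and let $u_n=\operatorname{ext}(f_n)$ be its harmonic extension to $\mathbb{H}$. Then $u_n$ has no more than $n$ nodal parts.
   Context: $\mathbb{H}=(0,\infty)\times\mathbb{R}^d$, $d\ge1$; $\mathcal{F}$ is the unitary Fourier transform; locally integrable on $[0,\infty)$ means integrable on $[0,S]$ for every $S<\infty$. For $\lambda\ge0$ let $\varphi_\lambda$ be the unique non-increasing function on $[0,\infty)$ such that $\varphi_\lambda''=\lambda A\varphi_\lambda$ weakly on $(0,\infty)$, $\varphi_\lambda(0)=1$, $\lim_{s\to\infty}\varphi_\lambda(s)\ge0$; the associated complete Bernstein function is $\psi(\lambda)=-\varphi_\lambda'(0)$. A coefficient $a$ is a nonnegative locally integrable function on $[0,\infty)$ such that $1/a$ is locally integrable but not integrable on $[0,\infty)$, and $\sigma(T)=\int_0^T(a(t))^{-1}dt$. The harmonic extension $u=\operatorname{ext}(f)$ of $f\in L^2(\mathbb{R}^d)$ is defined by $\mathcal{F}_xu(s,\xi)=\varphi_{|\xi|^2}(s)\mathcal{F}f(\xi)$,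 where $\mathcal{F}_xu(s,\cdot)$ is the Fourier transform of $u(s,\cdot)$. (In variable $t$ the extension is $u(\sigma(t),x)$; the number of nodal parts is the same.) $V$ confining means $V(x)\to\infty$ as $|x|\to\infty$. The operator $\psi(-\Delta)+V(x)$ is the self-adjoint operator with quadratic form $\int\psi(|\xi|^2)|\mathcal{F}f(\xi)|^2d\xi+\int V(x)|f(x)|^2dx$, whose domain is the set of $f\in L^2(\mathbb{R}^d)$ for which both integrals converge absolutely. It has discrete spectrum; $(f_n)_{n\ge1}$ is a complete orthonormal sequence of real-valued eigenfunctions arranged so that the corresponding eigenvalues $\mu_1\le\mu_2\le\dots$ are non-decreasing. Under the integrability assumption, $f_n$ is (has a version that is) continuous on $\mathbb{R}^d$ and $u_n$ is continuous on $\mathbb{H}$. A nodal domain of $u_n$ is a connected component $D$ of $\{(s,x)\in\mathbb{H}:u_n(s,x)\ne0\}$, and the corresponding nodal part is $\mathbf{1}_Du_n$. *)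

theory Defs
  imports "HOL-Analysis.Analysis"
begin

subsection \<open>Coefficients\<close>

text \<open>Local integrability on the half-line means integrability up to and including \<open>0\<close>.\<close>

definition locally_integrable :: "(real \<Rightarrow> real) \<Rightarrow> bool" where
  "locally_integrable A \<longleftrightarrow> (\<forall>S\<ge>0. set_integrable lebesgue {0..S} A)"

definition locally_lipschitz_on :: "'a::metric_space set \<Rightarrow> ('a \<Rightarrow> 'b::metric_space) \<Rightarrow> bool" where
  "locally_lipschitz_on S f \<longleftrightarrow> (\<forall>x\<in>S. \<exists>e>0. \<exists>L. L-lipschitz_on (ball x e \<inter> S) f)"

text \<open>Since \<open>1 / 0 = 0\<close> in HOL, the requirement that \<open>a\<close> vanishes only on a null set, which is
  implicit in the local integrability of \<open>1 / a\<close>, is stated separately.\<close>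

definition coefficient :: "(real \<Rightarrow> real) \<Rightarrow> bool" where
  "coefficient a \<longleftrightarrow>
     (\<forall>t\<ge>0. a t \<ge> 0) \<and> locally_integrable a \<and>
     (AE t in lebesgue. t \<ge> 0 \<longrightarrow> a t \<noteq> 0) \<and>
     locally_integrable (\<lambda>t. 1 / a t) \<and>
     \<not> set_integrable lebesgue {0..} (\<lambda>t. 1 / a t)"

definition change_of_scale :: "(real \<Rightarrow> real) \<Rightarrow> real \<Rightarrow> real" where
  "change_of_scale a T = (LINT t:{0..T}|lebesgue. 1 / a t)"


subsection \<open>The functions \<open>\<phi>\<^sub>\<lambda>\<close> and the associated complete Bernstein function\<close>

definition test_function :: "(real \<Rightarrow> real) \<Rightarrow> bool" where
  "test_function g \<longleftrightarrow>
     (\<forall>k x. (deriv ^^ k) g differentiable (at x)) \<and>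
     (\<exists>a b. 0 < a \<and> (\<forall>x. x \<notin> {a..b} \<longrightarrow> g x = 0))"

text \<open>The differential equation is imposed on the open half-line only, so continuity up to \<open>0\<close> is
  needed to tie the boundary value to the solution.\<close>

definition is_profile :: "(real \<Rightarrow> real) \<Rightarrow> real \<Rightarrow> (real \<Rightarrow> real) \<Rightarrow> bool" where
  "is_profile A l \<phi> \<longleftrightarrow>
     antimono_on {0..} \<phi> \<and> continuous_on {0..} \<phi> \<and>
     (\<forall>g. test_function g \<longrightarrow>
        (LINT s:{0..}|lebesgue. \<phi> s * deriv (deriv g) s) =
        l * (LINT s:{0..}|lebesgue. A s * \<phi> s * g s)) \<and>
     \<phi> 0 = 1 \<and> (\<exists>L\<ge>0. (\<phi> \<longlongrightarrow> L) at_top)"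

text \<open>For \<open>l \<ge> 0\<close> the choice is unique on \<open>{0..}\<close>, and only those values are ever used.\<close>

definition profile :: "(real \<Rightarrow> real) \<Rightarrow> real \<Rightarrow> real \<Rightarrow> real" where
  "profile A l = (SOME \<phi>. is_profile A l \<phi>)"

definition associated_cbf :: "(real \<Rightarrow> real) \<Rightarrow> real \<Rightarrow> real" where
  "associated_cbf A l = - vector_derivative (profile A l) (at 0 within {0..})"


subsection \<open>The unitary Fourier transform on \<open>L\<^sup>2\<close>\<close>

text \<open>Elements of \<open>L\<^sup>2\<close> are represented by functions; every notion below is invariant under
  changing them on a null set.\<close>

definition L2 :: "('a::euclidean_space \<Rightarrow> complex) set" where
  "L2 = {f. f \<in> borel_measurable lebesgue \<and> integrable lebesgue (\<lambda>x. (cmod (f x))\<^sup>2)}"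

definition L2_inner :: "('a::euclidean_space \<Rightarrow> complex) \<Rightarrow> ('a \<Rightarrow> complex) \<Rightarrow> complex" where
  "L2_inner f g = (LINT x|lebesgue. f x * cnj (g x))"

definition fourier_integral :: "('a::euclidean_space \<Rightarrow> complex) \<Rightarrow> 'a \<Rightarrow> complex" where
  "fourier_integral f \<xi> =
     (2 * pi) powr (- real DIM('a) / 2) *\<^sub>R (LINT x|lebesgue. exp (- (\<i> * of_real (\<xi> \<bullet> x))) * f x)"

text \<open>The transform of \<open>f\<close> is the \<open>L\<^sup>2\<close> limit of the Fourier integrals of the restrictions of
  \<open>f\<close> to balls, which are integrable as well as square integrable.\<close>

definition is_fourier_transform ::
  "('a::euclidean_space \<Rightarrow> complex) \<Rightarrow> ('a \<Rightarrow> complex) \<Rightarrow> bool" where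
  "is_fourier_transform f g \<longleftrightarrow> f \<in> L2 \<and> g \<in> L2 \<and>
     ((\<lambda>R. \<integral>\<^sup>+\<xi>. ennreal ((cmod (fourier_integral (\<lambda>x. indicator (cball 0 R) x * f x) \<xi> - g \<xi>))\<^sup>2)
        \<partial>lebesgue) \<longlongrightarrow> 0) at_top"

definition fourier :: "('a::euclidean_space \<Rightarrow> complex) \<Rightarrow> 'a \<Rightarrow> complex" where
  "fourier f = (SOME g. is_fourier_transform f g)"


subsection \<open>The operator \<open>\<psi>(-\<Delta>) + V\<close>\<close>

definition confining :: "('a::euclidean_space \<Rightarrow> real) \<Rightarrow> bool" where
  "confining V \<longleftrightarrow> filterlim V at_top at_infinity"

definition locally_bounded :: "('a::euclidean_space \<Rightarrow> real) \<Rightarrow> bool" where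
  "locally_bounded V \<longleftrightarrow> (\<forall>K. compact K \<longrightarrow> bounded (V ` K))"

definition form_domain ::
  "(real \<Rightarrow> real) \<Rightarrow> ('a::euclidean_space \<Rightarrow> real) \<Rightarrow> ('a \<Rightarrow> complex) set" where
  "form_domain \<psi> V =
     {f \<in> L2. integrable lebesgue (\<lambda>\<xi>. \<psi> ((norm \<xi>)\<^sup>2) * (cmod (fourier f \<xi>))\<^sup>2) \<and>
              integrable lebesgue (\<lambda>x. V x * (cmod (f x))\<^sup>2)}"

text \<open>The sesquilinear form whose diagonal is the quadratic form
  \<open>\<integral> \<psi>(|\<xi>|\<^sup>2) |fourier f|\<^sup>2 + \<integral> V |f|\<^sup>2\<close>.\<close>

definition energy_form ::
  "(real \<Rightarrow> real) \<Rightarrow> ('a::euclidean_space \<Rightarrow> real) \<Rightarrow> ('a \<Rightarrow> complex) \<Rightarrow> ('a \<Rightarrow> complex) \<Rightarrow> complex" where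
  "energy_form \<psi> V f g =
     (LINT \<xi>|lebesgue. of_real (\<psi> ((norm \<xi>)\<^sup>2)) * (fourier f \<xi> * cnj (fourier g \<xi>))) +
     (LINT x|lebesgue. of_real (V x) * (f x * cnj (g x)))"

text \<open>Graph of the self-adjoint operator determined by the form (first representation theorem).\<close>

definition schroedinger_operator ::
  "(real \<Rightarrow> real) \<Rightarrow> ('a::euclidean_space \<Rightarrow> real) \<Rightarrow> (('a \<Rightarrow> complex) \<times> ('a \<Rightarrow> complex)) set" where
  "schroedinger_operator \<psi> V =
     {(f, h). f \<in> form_domain \<psi> V \<and> h \<in> L2 \<and>
        (\<forall>g\<in>form_domain \<psi> V. energy_form \<psi> V f g = L2_inner h g)}"

definition complete_orthonormal :: "(nat \<Rightarrow> 'a::euclidean_space \<Rightarrow> complex) \<Rightarrow> bool" where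
  "complete_orthonormal f \<longleftrightarrow>
     (\<forall>n\<ge>1. f n \<in> L2) \<and>
     (\<forall>m\<ge>1. \<forall>n\<ge>1. L2_inner (f m) (f n) = (if m = n then 1 else 0)) \<and>
     (\<forall>g\<in>L2. (\<forall>n\<ge>1. L2_inner g (f n) = 0) \<longrightarrow> (AE x in lebesgue. g x = 0))"

definition ordered_eigensystem ::
  "(real \<Rightarrow> real) \<Rightarrow> ('a::euclidean_space \<Rightarrow> real) \<Rightarrow> (nat \<Rightarrow> real) \<Rightarrow>
   (nat \<Rightarrow> 'a \<Rightarrow> complex) \<Rightarrow> bool" where
  "ordered_eigensystem \<psi> V \<mu> f \<longleftrightarrow>
     complete_orthonormal f \<and> (\<forall>n\<ge>1. \<forall>x. f n x \<in> \<real>) \<and>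
     (\<forall>n\<ge>1. (f n, \<lambda>x. of_real (\<mu> n) * f n x) \<in> schroedinger_operator \<psi> V) \<and>
     mono_on {1..} \<mu>"


subsection \<open>Harmonic extensions and nodal parts\<close>

definition half_space :: "(real \<times> 'a::euclidean_space) set" where
  "half_space = {0<..} \<times> UNIV"

text \<open>The harmonic extension of an \<open>L\<^sup>2\<close> function is determined by its Fourier transform only up
  to null sets on each slice; a continuous version on the half-space is unique.\<close>

definition harmonic_extension ::
  "(real \<Rightarrow> real) \<Rightarrow> ('a::euclidean_space \<Rightarrow> complex) \<Rightarrow> (real \<times> 'a \<Rightarrow> complex) \<Rightarrow> bool" where
  "harmonic_extension A f u \<longleftrightarrow>
     (\<forall>s>0. (\<lambda>x. u (s, x)) \<in> L2 \<and>
        (AE \<xi> in lebesgue.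
           fourier (\<lambda>x. u (s, x)) \<xi> = of_real (profile A ((norm \<xi>)\<^sup>2) s) * fourier f \<xi>))"

definition nodal_domains :: "(real \<times> 'a::euclidean_space \<Rightarrow> complex) \<Rightarrow> (real \<times> 'a) set set" where
  "nodal_domains u = components {z \<in> half_space. u z \<noteq> 0}"

definition nodal_parts ::
  "(real \<times> 'a::euclidean_space \<Rightarrow> complex) \<Rightarrow> (real \<times> 'a \<Rightarrow> complex) set" where
  "nodal_parts u = (\<lambda>D z. indicator D z * u z) ` nodal_domains u"

end

theory Submission
  imports Defs "HOL-Probability.Probability" "HOL-Complex_Analysis.Complex_Analysis"
begin

text \<open>Courant's argument, in the half-space. Suppose that \<open>u\<close> has \<open>n + 1\<close> nodal domains and let \<open>k = \<Sum>\<^sub>i c\<^sub>i 1\<^bsub>D\<^sub>i\<^esub>\<close>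
  be a nontrivial combination of the indicators of \<open>n\<close> of them, chosen such that the boundary values \<open>g\<close> of \<open>k u\<close>
  are orthogonal to the first \<open>n - 1\<close> eigenfunctions. The weighted Dirichlet energy \<open>E\<close> of \<open>k u\<close> dominates
  \<open>\<integral> \<psi>(|\<xi>|\<^sup>2) |fourier g|\<^sup>2\<close>, because the extension of \<open>g\<close> minimises the energy. On the other hand Green's formula
  for \<open>u\<close> and \<open>|k|\<^sup>2 u\<close> gives \<open>E = \<mu>\<^sub>n \<integral> |g|\<^sup>2 - \<integral> V |g|\<^sup>2\<close>, which by Rayleigh's inequality is at most \<open>\<integral> \<psi>(|\<xi>|\<^sup>2) |fourier g|\<^sup>2\<close>.
  Hence \<open>k u\<close> is the extension of \<open>g\<close>; its slices are real-analytic and vanish on an open subset of the remaining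
  nodal domain, so \<open>k u = 0\<close>, a contradiction.\<close>

text \<open>The obstacle is that nothing is known about the regularity of the nodal set, so Green's
  formula cannot be integrated over a nodal domain. It is proved for \<open>k u\<close> on the whole
  half-space instead, line by line: along a coordinate line \<open>k\<close> jumps only where
  \<open>u\<close> vanishes, and a truncation vanishing to second order there removes the jump
  before the limit is taken. This asks for differentiability of \<open>u\<close> inside the
  half-space and for square-integrability of its weighted gradient. Differentiability comes from the
  decay of \<open>\<phi>\<^sub>\<lambda>(s)\<close> like \<open>exp (- c sqrt \<lambda>)\<close>,
  locally uniform in \<open>s > 0\<close>, which positivity and continuity of \<open>A\<close>
  supply. The same decay makes horizontal slices analytic, so that unique continuation inside a
  slice is the identity theorem for holomorphic functions. The reason for testing with
  \<open>|k|^2 u\<close> is that its boundary values \<open>h\<close> satisfy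
  \<open>h * cnj f = |g|^2\<close>. The eigenvalue equation tested with \<open>h\<close> thus
  produces the integrals of \<open>|g|^2\<close> and \<open>V |g|^2\<close>, although
  \<open>k\<close> itself is given no boundary values.\<close>

abbreviation (input) seq_limit :: "(nat => 'a::topological_space) => 'a => bool" (\<open>((_)/ ----> (_))\<close> [60, 60] 60) where
  "X ----> L \<equiv> X \<longlonglongrightarrow> L"

abbreviation (input) borel_fun :: "('a::topological_space => 'b::topological_space) set" where
  "borel_fun \<equiv> borel_measurable borel"

subsection \<open>Square-integrable functions\<close>

abbreviation (input) csq :: "complex => real" where "csq c \<equiv> (cmod c)\<^sup>2"

abbreviation (input) nsq :: "'a::real_normed_vector => real" where "nsq x \<equiv> (norm x)\<^sup>2"

text \<open>One notion of square-integrability for all measures in play: \<open>lebesgue\<close>, in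
  which \<open>L2\<close> and the operator are stated, and \<open>lborel\<close>, for which Fubini's
  theorem is available, both on the boundary and on the product with the height variable.\<close>

definition sqi :: "'a measure => ('a => complex) => bool" where
  "sqi M f \<longleftrightarrow> f \<in> borel_measurable M \<and> integrable M (\<lambda>x. csq (f x))"

definition sqnorm :: "'a measure => ('a => complex) => real" where
  "sqnorm M f = (\<integral>x. csq (f x) \<partial>M)"

definition ip :: "'a measure => ('a => complex) => ('a => complex) => complex" where
  "ip M f g = (\<integral>x. f x * cnj (g x) \<partial>M)"

lemma sqi_measurable [measurable_dest]: "sqi M f ==> f \<in> borel_measurable M"
  by (simp add: sqi_def)

lemma sqi_integrable: "sqi M f ==> integrable M (\<lambda>x. csq (f x))"
  by (simp add: sqi_def)

lemma cmod_add_sq_le: "csq (a + b) \<le> 2 * csq a + 2 * csq b"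
proof -
  have "csq (a + b) \<le> (cmod a + cmod b)\<^sup>2"
    by (intro power_mono norm_triangle_ineq) auto
  also have "\<dots> \<le> 2 * csq a + 2 * csq b"
    using sum_squares_bound[of "cmod a" "cmod b"] by (simp add: power2_sum)
  finally show ?thesis .
qed

lemma sqi_dominated:
  assumes "sqi M f" "g \<in> borel_measurable M" "AE x in M. cmod (g x) \<le> C * cmod (f x)"
  shows "sqi M g"
  unfolding sqi_def
proof
  show "integrable M (\<lambda>x. csq (g x))"
  proof (rule Bochner_Integration.integrable_bound)
    show "integrable M (\<lambda>x. C\<^sup>2 * csq (f x))"
      using sqi_integrable[OF assms(1)] by simp
    show "(\<lambda>x. csq (g x)) \<in> borel_measurable M" using assms(2) by measurable
    show "AE x in M. norm (csq (g x)) \<le> norm (C\<^sup>2 * csq (f x))"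
      using assms(3)
    proof eventually_elim
      case (elim x)
      then have "csq (g x) \<le> (C * cmod (f x))\<^sup>2" by (intro power_mono) auto
      then show ?case by (simp add: power_mult_distrib)
    qed
  qed
qed fact

lemma sqi_add: assumes "sqi M f" "sqi M g" shows "sqi M (\<lambda>x. f x + g x)"
  unfolding sqi_def
proof
  note [measurable] = sqi_measurable[OF assms(1)] sqi_measurable[OF assms(2)]
  show "(\<lambda>x. f x + g x) \<in> borel_measurable M" by measurable
  show "integrable M (\<lambda>x. csq (f x + g x))"
    by (rule Bochner_Integration.integrable_bound[where f = "\<lambda>x. 2 * csq (f x) + 2 * csq (g x)"])
       (use sqi_integrable[OF assms(1)] sqi_integrable[OF assms(2)] in \<open>auto simp: cmod_add_sq_le\<close>)
qed

lemma sqi_cmult: "sqi M f ==> sqi M (\<lambda>x. c * f x)"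
  by (rule sqi_dominated[where C = "cmod c"]) (auto simp: norm_mult sqi_def)

lemma sqi_minus: "sqi M f ==> sqi M (\<lambda>x. - f x)"
  by (auto simp: sqi_def)

lemma borel_measurable_cnj [measurable]: "f \<in> borel_measurable M ==> (\<lambda>x. cnj (f x)) \<in> borel_measurable M"
  by (rule borel_measurable_continuous_on[OF continuous_on_cnj[OF continuous_on_id]])

lemma sqi_cnj: "sqi M f ==> sqi M (\<lambda>x. cnj (f x))"
  by (auto simp: sqi_def)

lemma sqi_diff: "sqi M f ==> sqi M g ==> sqi M (\<lambda>x. f x - g x)"
  using sqi_add[of M f "\<lambda>x. - g x"] sqi_minus[of M g] by simp

lemma sqi_zero [simp]: "sqi M (\<lambda>x. 0)"
  by (simp add: sqi_def)

lemma sqi_mult_bounded: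
  assumes "sqi M f" "k \<in> borel_measurable M" "\<And>x. cmod (k x) \<le> C"
  shows "sqi M (\<lambda>x. k x * f x)"
  by (rule sqi_dominated[OF assms(1), where C = C])
     (use assms in \<open>auto simp: norm_mult sqi_def intro!: mult_right_mono\<close>)

lemma sqi_AE_cong:
  assumes "sqi M f" "g \<in> borel_measurable M" "AE x in M. f x = g x"
  shows "sqi M g"
  by (rule sqi_dominated[OF assms(1,2), where C = 1]) (use assms(3) in auto)

lemma two_mult_le: fixes a b t :: real assumes "t > 0" shows "2 * (a * b) \<le> t * a\<^sup>2 + b\<^sup>2 / t"
proof -
  have "0 \<le> (t * a - b)\<^sup>2 / t" using assms by simp
  also have "\<dots> = t * a\<^sup>2 + b\<^sup>2 / t - 2 * (a * b)"
    using assms by (simp add: field_simps power2_eq_square)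
  finally show ?thesis by simp
qed

lemma sqi_integrable_mult:
  assumes "sqi M f" "sqi M g"
  shows "integrable M (\<lambda>x. f x * g x)"
proof (rule Bochner_Integration.integrable_bound)
  show "integrable M (\<lambda>x. csq (f x) + csq (g x))"
    using assms by (auto simp: sqi_def)
  show "(\<lambda>x. f x * g x) \<in> borel_measurable M" using assms by (auto simp: sqi_def)
  show "AE x in M. norm (f x * g x) \<le> norm (csq (f x) + csq (g x))"
  proof (intro AE_I2)
    fix x
    have "2 * (cmod (f x) * cmod (g x)) \<le> csq (f x) + csq (g x)"
      using two_mult_le[of 1 "cmod (f x)" "cmod (g x)"] by simp
    moreover have "0 \<le> cmod (f x) * cmod (g x)" by simp
    ultimately have "cmod (f x) * cmod (g x) \<le> csq (f x) + csq (g x)" by linarith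
    then show "norm (f x * g x) \<le> norm (csq (f x) + csq (g x))"
      by (simp add: norm_mult)
  qed
qed

lemma sqi_integrable_ip: "sqi M f ==> sqi M g ==> integrable M (\<lambda>x. f x * cnj (g x))"
  by (intro sqi_integrable_mult sqi_cnj)

lemma sqnorm_nonneg [simp]: "0 \<le> sqnorm M f"
  by (simp add: sqnorm_def)

lemma sqnorm_minus [simp]: "sqnorm M (\<lambda>x. - f x) = sqnorm M f"
  by (simp add: sqnorm_def)

lemma sqnorm_diff_commute: "sqnorm M (\<lambda>x. f x - g x) = sqnorm M (\<lambda>x. g x - f x)"
  by (simp add: sqnorm_def norm_minus_commute)

lemma ip_self: "ip M f f = of_real (sqnorm M f)"
  unfolding ip_def sqnorm_def complex_norm_square[symmetric]
  by (rule integral_complex_of_real)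

lemma ip_diff_left: "sqi M f ==> sqi M g ==> sqi M h ==> ip M (\<lambda>x. f x - g x) h = ip M f h - ip M g h"
  by (simp add: ip_def left_diff_distrib sqi_integrable_ip)

lemma ip_diff_right: "sqi M f ==> sqi M g ==> sqi M h ==> ip M h (\<lambda>x. f x - g x) = ip M h f - ip M h g"
  by (simp add: ip_def right_diff_distrib sqi_integrable_ip)

lemma ip_cmult_left: "ip M (\<lambda>x. c * f x) h = c * ip M f h"
  by (simp add: ip_def mult.assoc)

lemma ip_sum_left:
  assumes "\<And>i. i \<in> I ==> sqi M (f i)" "sqi M h"
  shows "ip M (\<lambda>x. \<Sum>i\<in>I. f i x) h = (\<Sum>i\<in>I. ip M (f i) h)"
  unfolding ip_def sum_distrib_right
  by (rule Bochner_Integration.integral_sum) (use assms in \<open>auto intro: sqi_integrable_ip\<close>)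

lemma cnj_ip: "cnj (ip M f g) = ip M g f"
  unfolding ip_def Bochner_Integration.integral_cnj[symmetric]
  by (simp add: mult.commute del: Bochner_Integration.integral_cnj)

text \<open>Integrate \<open>2ab \<le> t a^2 + b^2 / t\<close>; the optimal \<open>t\<close> is the
  quotient of the two norms. Raising both norms by \<open>e\<close> before dividing covers a
  vanishing norm, and \<open>e\<close> then tends to 0.\<close>

lemma cauchy_schwarz_abs:
  assumes "sqi M f" "sqi M g"
  shows "(\<integral>x. cmod (f x) * cmod (g x) \<partial>M) \<le> sqrt (sqnorm M f) * sqrt (sqnorm M g)"
proof -
  let ?I = "\<integral>x. cmod (f x) * cmod (g x) \<partial>M"
  have int: "integrable M (\<lambda>x. cmod (f x) * cmod (g x))"
    using integrable_norm[OF sqi_integrable_mult[OF assms]] by (simp add: norm_mult)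
  have ineq: "2 * ?I \<le> t * sqnorm M f + sqnorm M g / t" if t: "t > 0" for t :: real
  proof -
    have "2 * ?I = (\<integral>x. 2 * (cmod (f x) * cmod (g x)) \<partial>M)" by simp
    also have "\<dots> \<le> (\<integral>x. t * csq (f x) + csq (g x) / t \<partial>M)"
      by (rule integral_mono) (use assms int two_mult_le[OF t] in \<open>auto simp: sqi_def\<close>)
    also have "\<dots> = t * sqnorm M f + sqnorm M g / t"
      using assms by (simp add: sqnorm_def sqi_def)
    finally show ?thesis .
  qed
  define a where "a = sqrt (sqnorm M f)"
  define b where "b = sqrt (sqnorm M g)"
  have ab: "a \<ge> 0" "b \<ge> 0" "sqnorm M f = a\<^sup>2" "sqnorm M g = b\<^sup>2"
    by (auto simp: a_def b_def)
  have ineq': "?I \<le> (a + e) * (b + e)" if e: "e > 0" for e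
  proof -
    define t where "t = (b + e) / (a + e)"
    have t: "t > 0" using ab e by (auto simp: t_def)
    have "2 * ?I \<le> t * a\<^sup>2 + b\<^sup>2 / t" using ineq[OF t] ab by simp
    also have "\<dots> \<le> t * (a + e)\<^sup>2 + (b + e)\<^sup>2 / t"
      using ab e t by (intro add_mono mult_left_mono divide_right_mono power_mono) auto
    also have "t * (a + e)\<^sup>2 = (a + e) * (b + e)"
      using ab e by (simp add: t_def power2_eq_square)
    also have "(b + e)\<^sup>2 / t = (a + e) * (b + e)"
      using ab e by (simp add: t_def power2_eq_square)
    finally show ?thesis by simp
  qed
  have "((\<lambda>e. (a + e) * (b + e)) \<longlongrightarrow> (a + 0) * (b + 0)) (at_right 0)"
    by (intro tendsto_intros)
  then have "?I \<le> (a + 0) * (b + 0)"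
    by (rule tendsto_lowerbound)
       (auto intro!: eventually_at_rightI[of 0 1] ineq')
  then show ?thesis by (simp add: a_def b_def)
qed

lemma cauchy_schwarz:
  assumes "sqi M f" "sqi M g"
  shows "cmod (ip M f g) \<le> sqrt (sqnorm M f) * sqrt (sqnorm M g)"
proof -
  have "cmod (ip M f g) \<le> (\<integral>x. cmod (f x * cnj (g x)) \<partial>M)"
    unfolding ip_def by (rule integral_norm_bound)
  also have "\<dots> \<le> sqrt (sqnorm M f) * sqrt (sqnorm M g)"
    using cauchy_schwarz_abs[OF assms] by (simp add: norm_mult)
  finally show ?thesis .
qed

lemma sqrt_sqnorm_triangle:
  assumes "sqi M f" "sqi M g"
  shows "sqrt (sqnorm M (\<lambda>x. f x + g x)) \<le> sqrt (sqnorm M f) + sqrt (sqnorm M g)"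
proof -
  have int: "integrable M (\<lambda>x. cmod (f x) * cmod (g x))"
    using integrable_norm[OF sqi_integrable_mult[OF assms]] by (simp add: norm_mult)
  have "sqnorm M (\<lambda>x. f x + g x) \<le> (\<integral>x. csq (f x) + csq (g x) + 2 * (cmod (f x) * cmod (g x)) \<partial>M)"
    unfolding sqnorm_def
  proof (rule integral_mono)
    show "integrable M (\<lambda>x. csq (f x + g x))" using sqi_add[OF assms] by (simp add: sqi_def)
    show "integrable M (\<lambda>x. csq (f x) + csq (g x) + 2 * (cmod (f x) * cmod (g x)))"
      using assms int by (simp add: sqi_def)
    fix x show "csq (f x + g x) \<le> csq (f x) + csq (g x) + 2 * (cmod (f x) * cmod (g x))"
      using power_mono[OF norm_triangle_ineq[of "f x" "g x"], of 2] by (simp add: power2_sum)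
  qed
  also have "\<dots> = sqnorm M f + sqnorm M g + 2 * (\<integral>x. cmod (f x) * cmod (g x) \<partial>M)"
    using assms int by (simp add: sqi_def sqnorm_def)
  also have "\<dots> \<le> sqnorm M f + sqnorm M g + 2 * (sqrt (sqnorm M f) * sqrt (sqnorm M g))"
    using cauchy_schwarz_abs[OF assms] by simp
  also have "\<dots> = (sqrt (sqnorm M f) + sqrt (sqnorm M g))\<^sup>2"
    by (simp add: power2_sum)
  finally show ?thesis by (simp add: real_le_lsqrt)
qed

lemma sqnorm_add_le:
  assumes "sqi M f" "sqi M g"
  shows "sqnorm M (\<lambda>x. f x + g x) \<le> 2 * sqnorm M f + 2 * sqnorm M g"
proof -
  have "sqnorm M (\<lambda>x. f x + g x) \<le> (\<integral>x. 2 * csq (f x) + 2 * csq (g x) \<partial>M)"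
    unfolding sqnorm_def
    by (rule integral_mono)
       (use sqi_add[OF assms] assms in \<open>auto simp: sqi_def cmod_add_sq_le\<close>)
  also have "\<dots> = 2 * sqnorm M f + 2 * sqnorm M g"
    using assms by (simp add: sqi_def sqnorm_def)
  finally show ?thesis .
qed

lemma sqrt_sqnorm_diff_le:
  assumes "sqi M f" "sqi M g"
  shows "\<bar>sqrt (sqnorm M f) - sqrt (sqnorm M g)\<bar> \<le> sqrt (sqnorm M (\<lambda>x. f x - g x))"
  using sqrt_sqnorm_triangle[OF sqi_diff[OF assms] assms(2)]
    sqrt_sqnorm_triangle[OF sqi_diff[OF assms(2,1)] assms(1)]
  by (simp add: sqnorm_diff_commute[of M g f] abs_le_iff)

lemma sqnorm_tendsto:
  assumes "\<And>k. sqi M (f k)" "sqi M g" "((\<lambda>k. sqnorm M (\<lambda>x. f k x - g x)) \<longlongrightarrow> 0) F"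
  shows "((\<lambda>k. sqnorm M (f k)) \<longlongrightarrow> sqnorm M g) F"
proof -
  have "((\<lambda>k. sqrt (sqnorm M (f k)) - sqrt (sqnorm M g)) \<longlongrightarrow> 0) F"
  proof (rule Lim_null_comparison)
    show "\<forall>\<^sub>F k in F. norm (sqrt (sqnorm M (f k)) - sqrt (sqnorm M g)) \<le> sqrt (sqnorm M (\<lambda>x. f k x - g x))"
      using sqrt_sqnorm_diff_le[OF assms(1,2)] by simp
    show "((\<lambda>k. sqrt (sqnorm M (\<lambda>x. f k x - g x))) \<longlongrightarrow> 0) F"
      using tendsto_real_sqrt[OF assms(3)] by simp
  qed
  then have "((\<lambda>k. sqrt (sqnorm M (f k))) \<longlongrightarrow> sqrt (sqnorm M g)) F"
    by (simp add: LIM_zero_iff)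
  from tendsto_power[OF this, of 2] show ?thesis by simp
qed

lemma ip_tendsto:
  assumes "\<And>k. sqi M (f k)" "sqi M g" "\<And>k. sqi M (h k)" "sqi M h'"
    and "((\<lambda>k. sqnorm M (\<lambda>x. f k x - g x)) \<longlongrightarrow> 0) F"
    and "((\<lambda>k. sqnorm M (\<lambda>x. h k x - h' x)) \<longlongrightarrow> 0) F"
  shows "((\<lambda>k. ip M (f k) (h k)) \<longlongrightarrow> ip M g h') F"
proof -
  have "((\<lambda>k. ip M (f k) (h k) - ip M g h') \<longlongrightarrow> 0) F"
  proof (rule Lim_null_comparison)
    let ?r = "\<lambda>k. sqrt (sqnorm M (\<lambda>x. f k x - g x)) * sqrt (sqnorm M (h k)) + sqrt (sqnorm M g) * sqrt (sqnorm M (\<lambda>x. h k x - h' x))"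
    show "\<forall>\<^sub>F k in F. norm (ip M (f k) (h k) - ip M g h') \<le> ?r k"
    proof (intro always_eventually allI)
      fix k
      have "ip M (f k) (h k) - ip M g h' = ip M (\<lambda>x. f k x - g x) (h k) + ip M g (\<lambda>x. h k x - h' x)"
        by (simp add: ip_diff_left ip_diff_right assms)
      then have "norm (ip M (f k) (h k) - ip M g h') \<le> norm (ip M (\<lambda>x. f k x - g x) (h k)) + norm (ip M g (\<lambda>x. h k x - h' x))"
        by (simp add: norm_triangle_ineq)
      also have "\<dots> \<le> ?r k"
        by (intro add_mono cauchy_schwarz sqi_diff assms)
      finally show "norm (ip M (f k) (h k) - ip M g h') \<le> ?r k" .
    qed
    have "(?r \<longlongrightarrow> sqrt 0 * sqrt (sqnorm M h') + sqrt (sqnorm M g) * sqrt 0) F"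
      by (intro tendsto_intros assms sqnorm_tendsto[where f = h])
    then show "(?r \<longlongrightarrow> 0) F" by simp
  qed
  then show ?thesis by (simp add: LIM_zero_iff)
qed

lemma sqnorm_eq_0_iff:
  assumes "sqi M f" shows "sqnorm M f = 0 \<longleftrightarrow> (AE x in M. f x = 0)"
  unfolding sqnorm_def
  using integral_nonneg_eq_0_iff_AE[OF sqi_integrable[OF assms]] by simp

text \<open>Fatou's lemma for norms. It serves wherever a bound is known only along approximations:
  for completeness of \<open>L2\<close>, for the isometry of the Fourier integral, and for the
  finite energy of boundary values.\<close>

lemma sqi_Fatou:
  assumes f: "\<And>k. sqi M (f k)" and [measurable]: "g \<in> borel_measurable M"
    and lim: "AE x in M. (\<lambda>k. f k x) ----> g x"
    and B: "\<And>k. sqnorm M (f k) \<le> B"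
  shows "sqi M g \<and> sqnorm M g \<le> B"
proof -
  note [measurable] = sqi_measurable[OF f]
  have B0: "0 \<le> B" using B[of 0] sqnorm_nonneg order_trans by blast
  have "(\<integral>\<^sup>+x. ennreal (csq (g x)) \<partial>M) = (\<integral>\<^sup>+x. liminf (\<lambda>k. ennreal (csq (f k x))) \<partial>M)"
  proof (rule nn_integral_cong_AE)
    show "AE x in M. ennreal (csq (g x)) = liminf (\<lambda>k. ennreal (csq (f k x)))"
      using lim
    proof eventually_elim
      case (elim x)
      then have "(\<lambda>k. ennreal (csq (f k x))) ----> ennreal (csq (g x))"
        by (intro tendsto_ennrealI tendsto_intros)
      then show ?case using lim_imp_Liminf[OF trivial_limit_sequentially] by metis
    qed
  qed
  also have "\<dots> \<le> liminf (\<lambda>k. (\<integral>\<^sup>+x. ennreal (csq (f k x)) \<partial>M))"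
    by (rule nn_integral_liminf) measurable
  also have "\<dots> \<le> ennreal B"
  proof (rule Liminf_le)
    show "\<forall>\<^sub>F k in sequentially. (\<integral>\<^sup>+x. ennreal (csq (f k x)) \<partial>M) \<le> ennreal B"
      using B by (intro always_eventually allI)
        (simp add: nn_integral_eq_integral[OF sqi_integrable[OF f]] sqnorm_def ennreal_leI)
  qed simp
  finally have le: "(\<integral>\<^sup>+x. ennreal (csq (g x)) \<partial>M) \<le> ennreal B" .
  have int: "integrable M (\<lambda>x. csq (g x))"
    by (rule integrableI_bounded) (use le in \<open>auto simp: le_less_trans ennreal_less_top\<close>)
  with le B0 show ?thesis
    by (auto simp: sqi_def sqnorm_def nn_integral_eq_integral)
qed

lemma strict_mono_choice:
  assumes "\<And>k. \<exists>N. \<forall>m\<ge>N. P k (m::nat)"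
  shows "\<exists>r :: nat => nat. strict_mono r \<and> (\<forall>k. \<forall>m\<ge>r k. P k m)"
proof -
  from assms obtain N where N: "\<And>k m. m \<ge> N k ==> P k m" by metis
  \<comment> \<open>Summing the thresholds makes them strictly increasing without lowering any of
    them.\<close>
  define r where "r k = (\<Sum>i\<le>k. Suc (N i))" for k
  have "strict_mono r" unfolding strict_mono_Suc_iff r_def by simp
  moreover have "N k \<le> r k" for k
  proof -
    have "Suc (N k) \<le> r k" unfolding r_def by (rule member_le_sum) auto
    then show ?thesis by simp
  qed
  ultimately show ?thesis using N by (intro exI[of _ r]) (meson order_trans)
qed

text \<open>Pass to a subsequence whose consecutive squared distances are at most
  \<open>4^(-k)\<close>. It converges almost everywhere, and Fatou's lemma turns pointwise into norm
  convergence.\<close>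

lemma riesz_fischer:
  fixes f :: "nat => 'a => complex"
  assumes f: "\<And>k. sqi M (f k)"
    and cauchy: "\<And>e. e > 0 ==> \<exists>N. \<forall>m\<ge>N. \<forall>n\<ge>N. sqnorm M (\<lambda>x. f m x - f n x) \<le> e"
  obtains g where "sqi M g" "(\<lambda>k. sqnorm M (\<lambda>x. f k x - g x)) ----> 0"
    "g \<in> borel_measurable M"
proof -
  note [measurable] = sqi_measurable[OF f]
  define P where "P k m \<longleftrightarrow> (\<forall>n\<ge>m. sqnorm M (\<lambda>x. f n x - f m x) \<le> (1/4)^k)" for k m
  have "\<exists>N. \<forall>m\<ge>N. P k m" for k
  proof -
    obtain N where "\<forall>m\<ge>N. \<forall>n\<ge>N. sqnorm M (\<lambda>x. f m x - f n x) \<le> (1/4)^k"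
      using cauchy[of "(1/4)^k"] by auto
    then have "\<forall>m\<ge>N. P k m" unfolding P_def by simp
    then show ?thesis by (rule exI)
  qed
  from strict_mono_choice[of P, OF this] obtain r :: "nat => nat"
    where r: "strict_mono r" and rk': "\<forall>k. \<forall>m\<ge>r k. P k m" by auto
  have rk: "sqnorm M (\<lambda>x. f n x - f m x) \<le> (1/4)^k" if "m \<ge> r k" "n \<ge> m" for k m n
    using rk' that unfolding P_def by blast
  define d where "d k x = f (r (Suc k)) x - f (r k) x" for k x
  have d: "sqi M (d k)" for k unfolding d_def by (intro sqi_diff f)
  have dn: "sqnorm M (d k) \<le> (1/4)^k" for k
    unfolding d_def using r by (intro rk) (auto simp: strict_mono_less_eq)
  have [measurable]: "d k \<in> borel_measurable M" for k using d by (simp add: sqi_def)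
  \<comment> \<open>The factor \<open>2^k\<close> still leaves a summable series of norms, while its
    finiteness at a point \<open>x\<close> forces \<open>|d k x| \<le> sqrt C * 2^(-k/2)\<close>, a
    summable bound for the increments.\<close>
  have "(\<integral>\<^sup>+x. (\<Sum>k. ennreal (2^k * csq (d k x))) \<partial>M) = (\<Sum>k. \<integral>\<^sup>+x. ennreal (2^k * csq (d k x)) \<partial>M)"
    by (rule nn_integral_suminf) measurable
  also have "\<dots> = (\<Sum>k. ennreal (2^k * sqnorm M (d k)))"
    by (intro suminf_cong)
       (use d in \<open>auto simp: sqi_def sqnorm_def nn_integral_eq_integral ennreal_mult'' nn_integral_cmult\<close>)
  also have "\<dots> \<le> (\<Sum>k. ennreal ((1/2)^k))"
  proof (intro suminf_le allI)
    fix k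
    have "2^k * sqnorm M (d k) \<le> 2^k * (1/4)^k" using dn by simp
    also have "\<dots> = (1/2::real)^k" by (simp add: power_mult_distrib[symmetric])
    finally show "ennreal (2^k * sqnorm M (d k)) \<le> ennreal ((1/2)^k)" by (rule ennreal_leI)
  qed auto
  also have "\<dots> < \<infinity>"
    by (subst suminf_ennreal2) (auto intro: summable_geometric)
  finally have fin: "(\<integral>\<^sup>+x. (\<Sum>k. ennreal (2^k * csq (d k x))) \<partial>M) \<noteq> \<infinity>" by simp
  have "AE x in M. (\<Sum>k. ennreal (2^k * csq (d k x))) \<noteq> \<infinity>"
    by (rule nn_integral_noteq_infinite[OF _ fin]) measurable
  then have conv: "AE x in M. convergent (\<lambda>k. f (r k) x)"
  proof eventually_elim
    case (elim x)
    have sm: "summable (\<lambda>k. 2^k * csq (d k x))"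
      using elim by (intro summable_suminf_not_top) auto
    then obtain C where C: "\<And>k. 2^k * csq (d k x) \<le> C"
      using summable_imp_Bseq[of "\<lambda>k. 2^k * csq (d k x)"]
      unfolding Bseq_def by (auto simp: norm_mult)
    have bnd: "cmod (d k x) \<le> sqrt C * (1 / sqrt 2)^k" for k
    proof -
      have "csq (d k x) \<le> C * (1/2)^k" using C[of k] by (simp add: field_simps power_divide)
      then have "cmod (d k x) \<le> sqrt (C * (1/2)^k)" by (rule real_le_rsqrt)
      also have "\<dots> = sqrt C * (1 / sqrt 2)^k"
        by (simp add: real_sqrt_mult real_sqrt_power real_sqrt_divide)
      finally show ?thesis .
    qed
    have "summable (\<lambda>k. d k x)"
    proof (rule summable_comparison_test)
      show "\<exists>N. \<forall>n\<ge>N. norm (d n x) \<le> sqrt C * (1 / sqrt 2)^n" using bnd by auto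
      show "summable (\<lambda>k. sqrt C * (1 / sqrt 2)^k)"
        by (intro summable_mult summable_geometric) auto
    qed
    then have "convergent (\<lambda>n. \<Sum>k<n. d k x)" by (simp add: summable_iff_convergent)
    moreover have "(\<Sum>k<n. d k x) = f (r n) x - f (r 0) x" for n
      unfolding d_def using sum_lessThan_telescope[of "\<lambda>k. f (r k) x" n] by simp
    ultimately have "convergent (\<lambda>n. f (r n) x - f (r 0) x)" by simp
    then have "convergent (\<lambda>n. (f (r n) x - f (r 0) x) + f (r 0) x)"
      by (intro convergent_add convergent_const)
    then show ?case by simp
  qed
  \<comment> \<open>\<open>lim\<close> is total, so \<open>g\<close> is measurable without removing
    the null set of divergence.\<close>
  define g where "g x = lim (\<lambda>k. f (r k) x)" for x
  have [measurable]: "g \<in> borel_measurable M" unfolding g_def by measurable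
  have lim: "AE x in M. (\<lambda>k. f (r k) x) ----> g x"
    using conv by eventually_elim (auto simp: g_def convergent_LIMSEQ_iff)
  \<comment> \<open>Fatou's lemma along the subsequence with \<open>f m\<close> held fixed: the
    whole sequence converges in norm although only the subsequence converges pointwise.\<close>
  have est: "sqi M (\<lambda>x. f m x - g x) \<and> sqnorm M (\<lambda>x. f m x - g x) \<le> e"
    if N: "\<forall>m\<ge>N. \<forall>n\<ge>N. sqnorm M (\<lambda>x. f m x - f n x) \<le> e" "m \<ge> N" for N m e
  proof (rule sqi_Fatou[where f = "\<lambda>k x. f m x - f (r (k + N)) x"])
    show "AE x in M. (\<lambda>k. f m x - f (r (k + N)) x) ----> f m x - g x"
      using lim by eventually_elim (intro tendsto_intros, rule LIMSEQ_ignore_initial_segment)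
    show "sqnorm M (\<lambda>x. f m x - f (r (k + N)) x) \<le> e" for k
      using N strict_mono_imp_increasing[OF r, of "k + N"] by auto
  qed (use f in \<open>auto intro!: sqi_diff\<close>)
  have g: "sqi M g"
  proof -
    obtain N where "\<forall>m\<ge>N. \<forall>n\<ge>N. sqnorm M (\<lambda>x. f m x - f n x) \<le> 1" using cauchy[of 1] by auto
    from est[OF this order_refl] have a: "sqi M (\<lambda>x. f N x - g x)" ..
    show ?thesis using sqi_diff[OF f[of N] a] by simp
  qed
  moreover have "(\<lambda>k. sqnorm M (\<lambda>x. f k x - g x)) ----> 0"
  proof (rule LIMSEQ_I)
    fix e :: real assume "e > 0"
    then obtain N where "\<forall>m\<ge>N. \<forall>n\<ge>N. sqnorm M (\<lambda>x. f m x - f n x) \<le> e/2"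
      using cauchy[of "e/2"] by auto
    from est[OF this] \<open>e > 0\<close> show "\<exists>no. \<forall>n\<ge>no. norm (sqnorm M (\<lambda>x. f n x - g x) - 0) < e"
      by (intro exI[of _ N]) fastforce
  qed
  ultimately show ?thesis using that \<open>g \<in> borel_measurable M\<close> by blast
qed

subsection \<open>The Fourier transform\<close>

lemma completion_ex_borel_complex:
  fixes g :: "'a => complex"
  assumes [measurable]: "g \<in> borel_measurable (completion M)"
  shows "\<exists>g'\<in>borel_measurable M. (AE x in M. g x = g' x)"
proof -
  obtain g1 g2 where [measurable]: "g1 \<in> borel_measurable M" "g2 \<in> borel_measurable M"
    and eq: "AE x in M. Re (g x) = g1 x" "AE x in M. Im (g x) = g2 x"
    using completion_ex_borel_measurable_real[of "\<lambda>x. Re (g x)" M]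
      completion_ex_borel_measurable_real[of "\<lambda>x. Im (g x)" M] by auto
  show ?thesis
  proof (rule bexI)
    show "AE x in M. g x = Complex (g1 x) (g2 x)"
      using eq by eventually_elim (simp add: complex_eq_iff)
    show "(\<lambda>x. Complex (g1 x) (g2 x)) \<in> borel_measurable M"
      unfolding Complex_eq by measurable
  qed
qed

section \<open>Affine changes of variables and products over coordinates\<close>

lemma lborel_integral_reflect:
  fixes h :: "'a::euclidean_space => 'b::{banach, second_countable_topology}"
  assumes [measurable]: "h \<in> borel_fun"
  shows "(LINT z|lborel. h (x - z)) = (LINT z|lborel. h z)"
    and "integrable lborel (\<lambda>z. h (x - z)) \<longleftrightarrow> integrable lborel h"
proof -
  have *: "lborel = distr lborel borel (\<lambda>z::'a. x - z)"
    using lborel_affine[of "-1::real" x] by (simp add: density_1)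
  show "(LINT z|lborel. h (x - z)) = (LINT z|lborel. h z)"
    by (subst (2) *) (simp add: integral_distr)
  show "integrable lborel (\<lambda>z. h (x - z)) \<longleftrightarrow> integrable lborel h"
    by (subst (2) *) (simp add: integrable_distr_eq)
qed

lemma lborel_integral_shift:
  fixes h :: "'a::euclidean_space => 'b::{banach, second_countable_topology}"
  assumes [measurable]: "h \<in> borel_fun"
  shows "(LINT x|lborel. h (x + z)) = (LINT x|lborel. h x)"
    and "integrable lborel (\<lambda>x. h (x + z)) \<longleftrightarrow> integrable lborel h"
proof -
  have *: "lborel = distr lborel borel (\<lambda>x::'a. x + z)"
    using lborel_distr_plus[of z] by (simp add: add.commute[of _ z])
  show "(LINT x|lborel. h (x + z)) = (LINT x|lborel. h x)"
    by (subst (2) *) (simp add: integral_distr)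
  show "integrable lborel (\<lambda>x. h (x + z)) \<longleftrightarrow> integrable lborel h"
    by (subst (2) *) (simp add: integrable_distr_eq)
qed

lemma lborel_integral_scale:
  fixes h :: "'a::euclidean_space => 'b::{banach, second_countable_topology}"
  assumes [measurable]: "h \<in> borel_fun" and e: "e > 0"
  shows "(LINT z|lborel. h z) = (e ^ DIM('a)) *\<^sub>R (LINT y|lborel. h (e *\<^sub>R y))"
proof -
  have *: "lborel = density (distr lborel borel (\<lambda>x::'a. e *\<^sub>R x)) (\<lambda>_. ennreal (e ^ DIM('a)))"
    using lborel_affine[of e "0::'a"] e by simp
  have "(LINT z|lborel. h z) = (\<integral>z. (e ^ DIM('a)) *\<^sub>R h z \<partial>distr lborel borel (\<lambda>x::'a. e *\<^sub>R x))"
    by (subst *) (use e in \<open>simp add: integral_density\<close>)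
  also have "\<dots> = (LINT y|lborel. (e ^ DIM('a)) *\<^sub>R h (e *\<^sub>R y))"
    by (simp add: integral_distr)
  finally show ?thesis by simp
qed

text \<open>\<open>lborel\<close> is the image of a product measure. This reduces the Gaussian, and
  later the majorant of \<open>exp (- c |x|)\<close>, to one variable.\<close>

lemma lborel_integral_prod_Basis:
  fixes f :: "'a::euclidean_space => real => complex"
  assumes "\<And>b. b \<in> Basis ==> integrable lborel (f b)"
  shows "integrable lborel (\<lambda>x::'a. \<Prod>b\<in>Basis. f b (x \<bullet> b))"
    and "(LINT x|lborel. (\<Prod>b\<in>Basis. f b (x \<bullet> b))) = (\<Prod>b\<in>Basis. (LINT x|lborel. f b x))"
proof -
  interpret product_sigma_finite "\<lambda>_::'a. lborel :: real measure"
    by standard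
  have [measurable]: "b \<in> Basis ==> f b \<in> borel_fun" for b
    using borel_measurable_integrable[OF assms] by simp
  have m: "(\<lambda>f. \<Sum>b\<in>Basis. f b *\<^sub>R b) \<in> measurable (\<Pi>\<^sub>M b\<in>(Basis::'a set). (lborel::real measure)) borel"
    by measurable
  have mf: "(\<lambda>x::'a. \<Prod>b\<in>Basis. f b (x \<bullet> b)) \<in> borel_fun"
    by measurable
  have eq: "(\<Prod>b\<in>Basis. f b ((\<Sum>c\<in>Basis. g c *\<^sub>R c) \<bullet> b)) = (\<Prod>b\<in>Basis. f b (g b))" for g
    by (intro prod.cong) auto
  show "integrable lborel (\<lambda>x::'a. \<Prod>b\<in>Basis. f b (x \<bullet> b))"
    by (subst lborel_eq, subst integrable_distr_eq[OF m mf], subst eq)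
       (intro product_integrable_prod assms finite_Basis)
  show "(LINT x|lborel. (\<Prod>b\<in>Basis. f b (x \<bullet> b))) = (\<Prod>b\<in>Basis. (LINT x|lborel. f b x))"
    by (subst lborel_eq, subst integral_distr[OF m mf], subst eq)
       (intro product_integral_prod assms finite_Basis)
qed

section \<open>The Gaussian and its transform\<close>

text \<open>The characteristic function of the standard normal distribution, rescaled by
  \<open>e\<close>.\<close>

lemma gauss_fourier_real:
  fixes t e :: real assumes e: "e > 0"
  shows "integrable lborel (\<lambda>x. exp (- (\<i> * of_real (t * x))) * of_real (exp (- (e * x)\<^sup>2 / 2)) :: complex)"
    and "(LINT x|lborel. exp (- (\<i> * of_real (t * x))) * of_real (exp (- (e * x)\<^sup>2 / 2))) =
      complex_of_real (sqrt (2 * pi) / e * exp (- (t / e)\<^sup>2 / 2))"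
proof -
  have *: "complex_of_real (exp (- t\<^sup>2 / 2)) =
      (LINT x|lborel. complex_of_real (1 / sqrt (2 * pi)) * (exp (\<i> * of_real (t * x)) * of_real (exp (- x\<^sup>2 / 2))))" for t
  proof -
    have "complex_of_real (exp (- t\<^sup>2 / 2)) = (\<integral>x. exp (\<i> * of_real (t * x)) \<partial>std_normal_distribution)"
      using fun_cong[OF char_std_normal_distribution, of t] by (simp add: char_def)
    also have "\<dots> = (LINT x|lborel. std_normal_density x *\<^sub>R exp (\<i> * of_real (t * x)))"
      by (subst integral_density) (auto simp: normal_density_nonneg)
    finally show ?thesis
      by (simp add: std_normal_density_def scaleR_conv_of_real mult_ac)
  qed
  have **: "(LINT x|lborel. exp (\<i> * of_real (t * x)) * of_real (exp (- x\<^sup>2 / 2))) =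
     complex_of_real (sqrt (2 * pi) * exp (- t\<^sup>2 / 2))" for t
    using *[of t] by (simp add: field_simps)
  let ?h = "\<lambda>y. exp (\<i> * of_real (- t / e * y)) * of_real (exp (- y\<^sup>2 / 2)) :: complex"
  have eq: "?h (e * x) = exp (- (\<i> * of_real (t * x))) * of_real (exp (- (e * x)\<^sup>2 / 2))" for x
    using e by simp
  have "(LINT y|lborel. ?h y) = e *\<^sub>R (LINT x|lborel. ?h (0 + e * x))"
    using lborel_integral_real_affine[of e ?h 0] e by simp
  then show val: "(LINT x|lborel. exp (- (\<i> * of_real (t * x))) * of_real (exp (- (e * x)\<^sup>2 / 2))) =
      complex_of_real (sqrt (2 * pi) / e * exp (- (t / e)\<^sup>2 / 2))"
    unfolding add_0 eq **[of "- t / e"] using e by (simp add: field_simps scaleR_conv_of_real)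
  \<comment> \<open>A non-integrable function has integral 0 by convention, so a nonzero value
    proves integrability.\<close>
  then have "(LINT x|lborel. exp (- (\<i> * of_real (t * x))) * of_real (exp (- (e * x)\<^sup>2 / 2))) \<noteq> 0"
    using e by simp
  then show "integrable lborel (\<lambda>x. exp (- (\<i> * of_real (t * x))) * of_real (exp (- (e * x)\<^sup>2 / 2)) :: complex)"
    using not_integrable_integral_eq by blast
qed

definition gauss :: "'a::euclidean_space => real" where
  "gauss x = exp (- (norm x)\<^sup>2 / 2)"

lemma gauss_le1: "gauss x \<le> 1" and gauss_pos: "0 < gauss x"
  by (auto simp: gauss_def)

lemma gauss_measurable [measurable]: "gauss \<in> borel_fun"
  unfolding gauss_def by measurable

lemma gauss_fourier:
  fixes z :: "'a::euclidean_space" assumes e: "e > 0"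
  shows "integrable lborel (\<lambda>y::'a. exp (- (\<i> * of_real (y \<bullet> z))) * of_real (gauss (e *\<^sub>R y)))"
    and "(LINT y|lborel. exp (- (\<i> * of_real (y \<bullet> z))) * of_real (gauss (e *\<^sub>R y))) =
      complex_of_real ((sqrt (2 * pi) / e) ^ DIM('a) * gauss ((1 / e) *\<^sub>R z))"
proof -
  let ?f = "\<lambda>b x. exp (- (\<i> * of_real ((z \<bullet> b) * x))) * of_real (exp (- (e * x)\<^sup>2 / 2)) :: complex"
  have eq: "exp (- (\<i> * of_real (y \<bullet> z))) * of_real (gauss (e *\<^sub>R y)) = (\<Prod>b\<in>Basis. ?f b (y \<bullet> b))" for y :: 'a
  proof -
    have "y \<bullet> z = (\<Sum>b\<in>Basis. (z \<bullet> b) * (y \<bullet> b))"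
      by (subst euclidean_inner) (simp add: mult.commute)
    moreover have "(norm (e *\<^sub>R y))\<^sup>2 = (\<Sum>b\<in>Basis. (e * (y \<bullet> b))\<^sup>2)"
      unfolding power2_norm_eq_inner by (subst euclidean_inner) (simp add: power2_eq_square)
    moreover have "- (\<i> * complex_of_real (\<Sum>b\<in>Basis. (z \<bullet> b) * (y \<bullet> b))) = (\<Sum>b\<in>Basis. - (\<i> * complex_of_real ((z \<bullet> b) * (y \<bullet> b))))"
      by (simp add: sum_negf sum_distrib_left)
    ultimately show ?thesis
      unfolding gauss_def prod.distrib
      by (simp add: exp_sum[symmetric] sum_negf[symmetric] sum_distrib_left sum_divide_distrib of_real_prod[symmetric]
          flip: of_real_sum of_real_mult of_real_prod)
  qed
  have g2: "gauss ((1 / e) *\<^sub>R z) = (\<Prod>b\<in>Basis. exp (- ((z \<bullet> b) / e)\<^sup>2 / 2))"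
  proof -
    have "(norm ((1 / e) *\<^sub>R z))\<^sup>2 = (\<Sum>b\<in>Basis. ((z \<bullet> b) / e)\<^sup>2)"
      unfolding power2_norm_eq_inner by (subst euclidean_inner) (simp add: power2_eq_square)
    then show ?thesis
      unfolding gauss_def by (simp add: exp_sum[symmetric] sum_negf[symmetric] sum_divide_distrib)
  qed
  show "integrable lborel (\<lambda>y::'a. exp (- (\<i> * of_real (y \<bullet> z))) * of_real (gauss (e *\<^sub>R y)))"
    unfolding eq by (intro lborel_integral_prod_Basis gauss_fourier_real e)
  have "(LINT y|lborel. exp (- (\<i> * of_real (y \<bullet> z))) * of_real (gauss (e *\<^sub>R y))) =
      (\<Prod>b\<in>Basis. complex_of_real (sqrt (2 * pi) / e * exp (- ((z \<bullet> b) / e)\<^sup>2 / 2)))"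
    unfolding eq lborel_integral_prod_Basis(2)[OF gauss_fourier_real(1)[OF e]]
    by (simp only: gauss_fourier_real(2)[OF e])
  also have "\<dots> = complex_of_real ((sqrt (2 * pi) / e) ^ DIM('a) * gauss ((1 / e) *\<^sub>R z))"
    unfolding g2 of_real_prod[symmetric] prod.distrib by simp
  finally show "(LINT y|lborel. exp (- (\<i> * of_real (y \<bullet> z))) * of_real (gauss (e *\<^sub>R y))) =
      complex_of_real ((sqrt (2 * pi) / e) ^ DIM('a) * gauss ((1 / e) *\<^sub>R z))" .
qed

lemma gauss_integral:
  "integrable lborel (gauss :: 'a::euclidean_space => real)"
  "(LINT y|lborel. gauss (y::'a)) = sqrt (2 * pi) ^ DIM('a)"
proof -
  have "integrable lborel (\<lambda>y::'a. Re (complex_of_real (gauss y)))"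
    using gauss_fourier(1)[of 1 "0::'a"] by (intro integrable_Re) simp
  then show *: "integrable lborel (gauss :: 'a => real)" by simp
  have "(LINT y|lborel. complex_of_real (gauss (y::'a))) = complex_of_real (sqrt (2 * pi) ^ DIM('a))"
    using gauss_fourier(2)[of 1 "0::'a"] by (simp add: gauss_def)
  then show "(LINT y|lborel. gauss (y::'a)) = sqrt (2 * pi) ^ DIM('a)"
    unfolding integral_complex_of_real of_real_eq_iff .
qed

section \<open>Continuity of translations in L^1\<close>

text \<open>A set and its shift have equal measure, so the distance of their indicators is twice the
  measure of \<open>T\<close> minus twice that of the intersection. Openness makes the shifted
  indicators converge on \<open>T\<close>, which settles the intersection by dominated
  convergence.\<close>

lemma translation_L1_open:
  fixes T :: "'a::euclidean_space set"
  assumes T: "open T" and fin: "emeasure lborel T < \<infinity>" and z: "z ----> 0"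
  shows "(\<lambda>k. (LINT x|lborel. \<bar>indicator T (x - z k) - indicat_real T x\<bar>)) ----> 0"
proof -
  have [measurable]: "T \<in> sets borel" using T by simp
  have int: "integrable lborel (indicat_real T)" using fin by simp
  have ints: "integrable lborel (\<lambda>x. indicat_real T (x - w))" for w
    using lborel_integral_shift(2)[of "indicat_real T" "- w"] int by simp
  have intp: "integrable lborel (\<lambda>x. indicat_real T (x - w) * indicat_real T x)" for w
    by (rule Bochner_Integration.integrable_bound[OF int]) (auto simp: indicator_def)
  have eq: "(LINT x|lborel. \<bar>indicator T (x - w) - indicat_real T x\<bar>) =
     2 * (LINT x|lborel. indicat_real T x) - 2 * (LINT x|lborel. indicat_real T (x - w) * indicat_real T x)" for w
  proof -
    have "(LINT x|lborel. \<bar>indicator T (x - w) - indicat_real T x\<bar>) =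
      (LINT x|lborel. indicat_real T (x - w) + indicat_real T x - 2 * (indicat_real T (x - w) * indicat_real T x))"
      by (intro Bochner_Integration.integral_cong) (auto simp: indicator_def)
    also have "\<dots> = (LINT x|lborel. indicat_real T (x - w)) + (LINT x|lborel. indicat_real T x)
      - 2 * (LINT x|lborel. indicat_real T (x - w) * indicat_real T x)"
      using int ints intp by simp
    also have "(LINT x|lborel. indicat_real T (x - w)) = (LINT x|lborel. indicat_real T x)"
      using lborel_integral_shift(1)[of "indicat_real T" "- w"] by simp
    finally show ?thesis by simp
  qed
  have "(\<lambda>k. (LINT x|lborel. indicat_real T (x - z k) * indicat_real T x)) ----> (LINT x|lborel. indicat_real T x)"
  proof (rule integral_dominated_convergence[where w = "indicat_real T"])
    show "AE x in lborel. (\<lambda>k. indicat_real T (x - z k) * indicat_real T x) ----> indicat_real T x"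
    proof (intro AE_I2)
      fix x
      show "(\<lambda>k. indicat_real T (x - z k) * indicat_real T x) ----> indicat_real T x"
      proof (cases "x \<in> T")
        case True
        have "(\<lambda>k. x - z k) ----> x - 0" by (intro tendsto_intros z)
        then have "\<forall>\<^sub>F k in sequentially. x - z k \<in> T"
          using T True by (simp add: topological_tendstoD)
        then have "\<forall>\<^sub>F k in sequentially. indicat_real T (x - z k) * indicat_real T x = indicat_real T x"
          by eventually_elim (simp add: True)
        then show ?thesis by (rule tendsto_eventually)
      qed simp
    qed
  qed (use int in \<open>auto simp: indicator_def\<close>)
  then have "(\<lambda>k. 2 * (LINT x|lborel. indicat_real T x) - 2 * (LINT x|lborel. indicat_real T (x - z k) * indicat_real T x))
     ----> 2 * (LINT x|lborel. indicat_real T x) - 2 * (LINT x|lborel. indicat_real T x)"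
    by (intro tendsto_intros)
  then show ?thesis unfolding eq by simp
qed

lemma translation_L1_perturb:
  fixes f g :: "'a::euclidean_space => complex"
  assumes f: "integrable lborel f" and g: "integrable lborel g"
  shows "(LINT x|lborel. cmod (f (x - z) - f x)) \<le> (LINT x|lborel. cmod (g (x - z) - g x)) + 2 * (LINT x|lborel. cmod (f x - g x))"
proof -
  note [measurable] = borel_measurable_integrable[OF f, simplified] borel_measurable_integrable[OF g, simplified]
  have s: "integrable lborel (\<lambda>x. f (x - z))" "integrable lborel (\<lambda>x. g (x - z))"
    using lborel_integral_shift(2)[of f "- z"] lborel_integral_shift(2)[of g "- z"] f g by simp_all
  have fg: "(LINT x|lborel. cmod (f (x - z) - g (x - z))) = (LINT x|lborel. cmod (f x - g x))"
    using lborel_integral_shift(1)[of "\<lambda>x. cmod (f x - g x)" "- z"] by simp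
  have "(LINT x|lborel. cmod (f (x - z) - f x)) \<le>
    (LINT x|lborel. cmod (f (x - z) - g (x - z)) + cmod (g (x - z) - g x) + cmod (f x - g x))"
  proof (rule integral_mono)
    fix x
    have "f (x - z) - f x = (f (x - z) - g (x - z)) + (g (x - z) - g x) - (f x - g x)" by simp
    then show "cmod (f (x - z) - f x) \<le> cmod (f (x - z) - g (x - z)) + cmod (g (x - z) - g x) + cmod (f x - g x)"
      by (metis (no_types, lifting) norm_triangle_ineq norm_triangle_ineq4 add_right_mono order_trans)
  qed (use f g s in auto)
  also have "\<dots> = (LINT x|lborel. cmod (f (x - z) - g (x - z))) + (LINT x|lborel. cmod (g (x - z) - g x))
     + (LINT x|lborel. cmod (f x - g x))"
    using f g s by simp
  finally show ?thesis using fg by simp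
qed

lemma translation_L1_approx:
  fixes f :: "'a::euclidean_space => complex"
  assumes f: "integrable lborel f"
    and g: "\<And>e. e > 0 ==> \<exists>g. integrable lborel g \<and> (LINT x|lborel. cmod (f x - g x)) \<le> e \<and>
      (\<lambda>k. (LINT x|lborel. cmod (g (x - z k) - g x))) ----> 0"
  shows "(\<lambda>k. (LINT x|lborel. cmod (f (x - z k) - f x))) ----> 0"
proof (rule LIMSEQ_I)
  fix r :: real assume r: "r > 0"
  obtain g where g: "integrable lborel g" "(LINT x|lborel. cmod (f x - g x)) \<le> r / 4"
      "(\<lambda>k. (LINT x|lborel. cmod (g (x - z k) - g x))) ----> 0"
    using assms(2)[of "r / 4"] r by auto
  obtain N where N: "\<And>k. k \<ge> N ==> \<bar>(LINT x|lborel. cmod (g (x - z k) - g x))\<bar> < r / 2"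
    using LIMSEQ_D[OF g(3), of "r/2"] r by auto
  show "\<exists>no. \<forall>k\<ge>no. norm ((LINT x|lborel. cmod (f (x - z k) - f x)) - 0) < r"
  proof (intro exI[of _ N] allI impI)
    fix k assume "N \<le> k"
    from N[OF this] translation_L1_perturb[OF f g(1), of "z k"] g(2)
    show "norm ((LINT x|lborel. cmod (f (x - z k) - f x)) - 0) < r"
      by (simp add: integral_nonneg_AE)
  qed
qed

text \<open>By the induction rule for integrable functions; a Borel set of finite measure is
  approximated from outside by an open one, for which the claim is
  \<open>translation_L1_open\<close>.\<close>

lemma translation_L1:
  fixes f :: "'a::euclidean_space => complex"
  assumes "integrable lborel f" and z: "z ----> 0"
  shows "(\<lambda>k. (LINT x|lborel. cmod (f (x - z k) - f x))) ----> 0"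
  using assms(1)
proof (induction rule: integrable_induct)
  case (base A c)
  then have A: "A \<in> sets borel" and fin: "emeasure lborel A < \<infinity>" by auto
  have intA: "integrable lborel (indicat_real A)" using base by simp
  show ?case
  proof (rule translation_L1_approx)
    show "integrable lborel (\<lambda>x. indicat_real A x *\<^sub>R c)"
      using intA by simp
    fix e :: real assume e: "e > 0"
    \<comment> \<open>The distance of the two indicators is later multiplied by
      \<open>cmod c\<close>; adding 1 avoids a division by zero.\<close>
    define e' where "e' = e / (cmod c + 1)"
    have e': "e' > 0" using e by (simp add: e'_def add_nonneg_pos)
    obtain T where T: "open T" "A \<subseteq> T" "T - A \<in> lmeasurable" "emeasure lebesgue (T - A) < ennreal e'"
      using sets_lebesgue_outer_open[of A e'] A e' by (metis lborelD sets_completionI_sets sets_lborel)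
    have TA: "emeasure lborel (T - A) < ennreal e'"
      using T(4) A T(1) by (simp add: emeasure_completion)
    have "emeasure lborel T \<le> emeasure lborel A + emeasure lborel (T - A)"
      using A T(1,2) emeasure_subadditive[of A lborel "T - A"] by (simp add: Un_absorb1)
    also have "\<dots> < \<infinity>" using fin TA by (simp add: less_trans[OF TA ennreal_less_top])
    finally have finT: "emeasure lborel T < \<infinity>" .
    have intT: "integrable lborel (indicat_real T)" using finT T by simp
    have intTA: "integrable lborel (indicat_real (T - A))"
      using A T(1) TA by (simp add: less_trans[OF TA ennreal_less_top])
    show "\<exists>g. integrable lborel g \<and> (LINT x|lborel. cmod (indicat_real A x *\<^sub>R c - g x)) \<le> e \<and>
      (\<lambda>k. (LINT x|lborel. cmod (g (x - z k) - g x))) ----> 0"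
    proof (intro exI conjI)
      show "integrable lborel (\<lambda>x. indicat_real T x *\<^sub>R c)" using intT by simp
      have "(LINT x|lborel. cmod (indicat_real A x *\<^sub>R c - indicat_real T x *\<^sub>R c)) = (LINT x|lborel. indicat_real (T - A) x * cmod c)"
        using T(2) by (intro Bochner_Integration.integral_cong) (auto simp: indicator_def)
      also have "\<dots> = measure lborel (T - A) * cmod c"
        using intTA by (simp add: Bochner_Integration.integral_mult_left_zero)
      also have "\<dots> \<le> e' * (cmod c + 1)"
      proof (rule mult_mono)
        show "measure lborel (T - A) \<le> e'"
          using TA e' unfolding measure_def by (metis enn2real_leI less_imp_le)
      qed (use e' in auto)
      also have "\<dots> = e" by (simp add: e'_def add_nonneg_eq_0_iff)
      finally show "(LINT x|lborel. cmod (indicat_real A x *\<^sub>R c - indicat_real T x *\<^sub>R c)) \<le> e" .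
      have "(\<lambda>k. (LINT x|lborel. \<bar>indicator T (x - z k) - indicat_real T x\<bar>) * cmod c) ----> 0 * cmod c"
        by (intro tendsto_intros translation_L1_open T finT z)
      moreover have "(LINT x|lborel. \<bar>indicator T (x - w) - indicat_real T x\<bar>) * cmod c =
          (LINT x|lborel. cmod (indicat_real T (x - w) *\<^sub>R c - indicat_real T x *\<^sub>R c))" for w
        by (simp flip: Bochner_Integration.integral_mult_left_zero scaleR_left_diff_distrib)
      ultimately show "(\<lambda>k. (LINT x|lborel. cmod (indicat_real T (x - z k) *\<^sub>R c - indicat_real T x *\<^sub>R c))) ----> 0"
        by simp
    qed
  qed
next
  case (add f g)
  have s: "integrable lborel (\<lambda>x. f (x - w))" "integrable lborel (\<lambda>x. g (x - w))" for w
    using lborel_integral_shift(2)[of f "- w"] lborel_integral_shift(2)[of g "- w"] add.hyps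
    by (simp_all add: borel_measurable_integrable)
  show ?case
  proof (rule tendsto_sandwich[OF _ _ tendsto_const])
    show "(\<lambda>k. (LINT x|lborel. cmod (f (x - z k) - f x)) + (LINT x|lborel. cmod (g (x - z k) - g x))) ----> 0"
      using tendsto_add[OF add.IH] by simp
    show "\<forall>\<^sub>F k in sequentially. (LINT x|lborel. cmod (f (x - z k) + g (x - z k) - (f x + g x)))
       \<le> (LINT x|lborel. cmod (f (x - z k) - f x)) + (LINT x|lborel. cmod (g (x - z k) - g x))"
    proof (intro always_eventually allI)
      fix k
      have "(LINT x|lborel. cmod (f (x - z k) + g (x - z k) - (f x + g x)))
        \<le> (LINT x|lborel. cmod (f (x - z k) - f x) + cmod (g (x - z k) - g x))"
        by (rule integral_mono) (use s add.hyps in \<open>auto intro!: norm_diff_triangle_ineq\<close>)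
      then show "(LINT x|lborel. cmod (f (x - z k) + g (x - z k) - (f x + g x)))
       \<le> (LINT x|lborel. cmod (f (x - z k) - f x)) + (LINT x|lborel. cmod (g (x - z k) - g x))"
        using s add.hyps by simp
    qed
  qed (auto intro!: always_eventually)
next
  case (lim f s)
  show ?case
  proof (rule translation_L1_approx[OF lim.hyps(4)])
    fix e :: real assume e: "e > 0"
    have "(\<lambda>i. (LINT x|lborel. cmod (f x - s i x))) ----> (\<integral>x. (0::real) \<partial>(lborel::'a measure))"
    proof (rule integral_dominated_convergence[where w = "\<lambda>x. 3 * cmod (f x)"])
      show "AE x in lborel. (\<lambda>i. cmod (f x - s i x)) ----> 0"
        proof (intro AE_I2)
        fix x :: 'a
        have "(\<lambda>i. cmod (f x - s i x)) ----> cmod (f x - f x)"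
          using lim.hyps(2)[of x] by (intro tendsto_intros) auto
        then show "(\<lambda>i. cmod (f x - s i x)) ----> 0" by simp
      qed
      show "AE x in lborel. norm (cmod (f x - s i x)) \<le> 3 * cmod (f x)" for i
      proof (intro AE_I2)
        fix x :: 'a
        show "norm (cmod (f x - s i x)) \<le> 3 * cmod (f x)"
          using norm_triangle_ineq4[of "f x" "s i x"] lim.hyps(3)[of x i] by simp
      qed
    qed (use lim in \<open>auto simp: borel_measurable_integrable\<close>)
    then have "(\<lambda>i. (LINT x|lborel. cmod (f x - s i x))) ----> 0" by simp
    then obtain i where "\<bar>(LINT x|lborel. cmod (f x - s i x))\<bar> < e"
      using LIMSEQ_D[of _ 0 e] e by fastforce
    then show "\<exists>g. integrable lborel g \<and> (LINT x|lborel. cmod (f x - g x)) \<le> e \<and>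
      (\<lambda>k. (LINT x|lborel. cmod (g (x - z k) - g x))) ----> 0"
      using lim by (intro exI[of _ "s i"]) auto
  qed
qed

section \<open>Plancherel's theorem for integrable functions\<close>

text \<open>The transform of the autocorrelation is the squared modulus of the transform of
  \<open>m\<close>, and its value at 0 is the squared norm of \<open>m\<close>. Boundedness of
  \<open>m\<close> turns the L^1 continuity of translations into its continuity at 0.\<close>

lemma autocorrelation:
  fixes m :: "'a::euclidean_space => complex"
  assumes m: "integrable lborel m" and B: "\<And>x. cmod (m x) \<le> B"
  shows "integrable (lborel \<Otimes>\<^sub>M lborel) (\<lambda>(x, z). m x * cnj (m (x - z)))"
    and "(\<lambda>z. (LINT x|lborel. m x * cnj (m (x - z)))) \<in> borel_fun"
    and "cmod (LINT x|lborel. m x * cnj (m (x - z))) \<le> B * (LINT x|lborel. cmod (m x))"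
    and "w ----> 0 ==> (\<lambda>k. (LINT x|lborel. m x * cnj (m (x - w k)))) ----> (LINT x|lborel. m x * cnj (m x))"
proof -
  have [measurable]: "m \<in> borel_fun" using borel_measurable_integrable[OF m] by simp
  have B0: "0 \<le> B" using B[of 0] norm_ge_zero order_trans by blast
  have mz: "integrable lborel (\<lambda>z. m (x - z))" for x
    using lborel_integral_reflect(2)[of m x] m by simp
  have mx: "integrable lborel (\<lambda>x. m (x - z))" for z
    using lborel_integral_shift(2)[of m "- z"] m by simp
  show "integrable (lborel \<Otimes>\<^sub>M lborel) (\<lambda>(x, z). m x * cnj (m (x - z)))"
  proof (rule lborel_pair.Fubini_integrable)
    show "(\<lambda>(x, z). m x * cnj (m (x - z))) \<in> borel_measurable (lborel \<Otimes>\<^sub>M lborel)"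
      by measurable
    have "(LINT z|lborel. norm (m x * cnj (m (x - z)))) = cmod (m x) * (LINT z|lborel. cmod (m z))" for x
      using lborel_integral_reflect(1)[of "\<lambda>z. cmod (m z)" x] by (simp add: norm_mult)
    then show "integrable lborel (\<lambda>x. (LINT z|lborel. norm (case (x, z) of (x, z) => m x * cnj (m (x - z)))))"
      using m by simp
    show "AE x in lborel. integrable lborel (\<lambda>z. case (x, z) of (x, z) => m x * cnj (m (x - z)))"
      using mz by auto
  qed
  show "(\<lambda>z. (LINT x|lborel. m x * cnj (m (x - z)))) \<in> borel_fun"
    by measurable
  have bnd: "cmod (LINT x|lborel. m x * cnj (g x)) \<le> B * (LINT x|lborel. cmod (g x))" if g: "integrable lborel g" for g
  proof -
    have "cmod (LINT x|lborel. m x * cnj (g x)) \<le> (LINT x|lborel. cmod (m x * cnj (g x)))"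
      by (rule integral_norm_bound)
    also have "\<dots> \<le> (LINT x|lborel. B * cmod (g x))"
    proof (rule integral_mono')
      show "integrable lborel (\<lambda>x. B * cmod (g x))" using g by simp
    qed (use B B0 in \<open>auto simp: norm_mult intro!: mult_right_mono\<close>)
    finally show ?thesis by simp
  qed
  show "cmod (LINT x|lborel. m x * cnj (m (x - z))) \<le> B * (LINT x|lborel. cmod (m x))"
    using bnd[OF mx, of z] lborel_integral_shift(1)[of "\<lambda>x. cmod (m x)" "- z"] by simp
  assume w: "w ----> 0"
  have im: "integrable lborel (\<lambda>x. m x * cnj (g x))" if "integrable lborel g" for g
  proof (rule Bochner_Integration.integrable_bound)
    show "integrable lborel (\<lambda>x. B * cmod (g x))" using that by simp
    show "(\<lambda>x. m x * cnj (g x)) \<in> borel_measurable lborel" using borel_measurable_integrable[OF that] by measurable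
  qed (use B B0 in \<open>auto simp: norm_mult intro!: mult_right_mono\<close>)
  have "(\<lambda>k. (LINT x|lborel. m x * cnj (m (x - w k))) - (LINT x|lborel. m x * cnj (m x))) ----> 0"
  proof (rule Lim_null_comparison)
    show "(\<lambda>k. B * (LINT x|lborel. cmod (m (x - w k) - m x))) ----> 0"
      using tendsto_mult_left[OF translation_L1[OF m w], of B] by simp
    show "\<forall>\<^sub>F k in sequentially. norm ((LINT x|lborel. m x * cnj (m (x - w k))) - (LINT x|lborel. m x * cnj (m x)))
       \<le> B * (LINT x|lborel. cmod (m (x - w k) - m x))"
    proof (intro always_eventually allI)
      fix k
      have "(LINT x|lborel. m x * cnj (m (x - w k))) - (LINT x|lborel. m x * cnj (m x)) =
        (LINT x|lborel. m x * cnj (m (x - w k) - m x))"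
        using im[OF mx] im[OF m] by (simp add: right_diff_distrib)
      then show "norm ((LINT x|lborel. m x * cnj (m (x - w k))) - (LINT x|lborel. m x * cnj (m x)))
       \<le> B * (LINT x|lborel. cmod (m (x - w k) - m x))"
        using bnd[of "\<lambda>x. m (x - w k) - m x"] m mx by simp
    qed
  qed
  then show "(\<lambda>k. (LINT x|lborel. m x * cnj (m (x - w k)))) ----> (LINT x|lborel. m x * cnj (m x))"
    by (simp add: LIM_zero_iff)
qed

text \<open>The constant \<open>(2 pi)^(- d/2)\<close> of the unitary transform; the argument only
  carries the type and with it the dimension.\<close>

definition fconst :: "'a::euclidean_space itself => real" where
  "fconst _ = 1 / sqrt (2 * pi) ^ DIM('a)"

lemma fconst_pos: "0 < fconst TYPE('a::euclidean_space)"
  by (simp add: fconst_def)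

lemma fourier_integral_borel:
  fixes m :: "'a::euclidean_space => complex"
  assumes [measurable]: "m \<in> borel_fun"
  shows "fourier_integral m y = of_real (fconst TYPE('a)) * (LINT x|lborel. exp (- (\<i> * of_real (y \<bullet> x))) * m x)"
proof -
  have "(2 * pi) powr (- real DIM('a) / 2) = inverse ((2 * pi) powr (real DIM('a) * (1/2)))"
    by (simp add: powr_minus[symmetric])
  also have "(2 * pi) powr (real DIM('a) * (1/2)) = sqrt (2 * pi) ^ DIM('a)"
  proof -
    have "sqrt (2 * pi) ^ DIM('a) = ((2 * pi) powr (1/2)) powr real DIM('a)"
      by (simp add: powr_half_sqrt powr_realpow)
    also have "\<dots> = (2 * pi) powr (real DIM('a) * (1/2))"
      by (simp only: powr_powr mult.commute)
    finally show ?thesis ..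
  qed
  finally show ?thesis
    unfolding fourier_integral_def fconst_def
    by (subst integral_completion) (simp_all add: scaleR_conv_of_real inverse_eq_divide)
qed

lemma fourier_integral_measurable_borel [measurable]:
  fixes m :: "'a::euclidean_space => complex"
  assumes [measurable]: "m \<in> borel_fun"
  shows "fourier_integral m \<in> borel_fun"
  unfolding fourier_integral_borel[OF assms, abs_def] by measurable

lemma fourier_integral_cong_AE:
  fixes m m' :: "'a::euclidean_space => complex"
  assumes "AE x in lebesgue. m x = m' x" "m \<in> borel_measurable lebesgue" "m' \<in> borel_measurable lebesgue"
  shows "fourier_integral m = fourier_integral m'"
proof
  fix y :: 'a
  have [measurable]: "(\<lambda>x. exp (- (\<i> * of_real (y \<bullet> x))) :: complex) \<in> borel_measurable lebesgue"
    by (rule measurable_completion) measurable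
  have "(LINT x|lebesgue. exp (- (\<i> * of_real (y \<bullet> x))) * m x) = (LINT x|lebesgue. exp (- (\<i> * of_real (y \<bullet> x))) * m' x)"
    using assms by (intro integral_cong_AE) auto
  then show "fourier_integral m y = fourier_integral m' y" by (simp add: fourier_integral_def)
qed

lemma exp_iu: "exp (- (\<i> * of_real x)) * exp (\<i> * of_real y) = exp (- (\<i> * of_real (x - y)))"
  by (simp add: exp_add[symmetric] algebra_simps)

lemma norm_exp_iu [simp]: "cmod (exp (- (\<i> * of_real x))) = 1"
  using norm_exp_i_times[of "- x"] by simp

lemma integrable_exp_mult:
  assumes "integrable M m" "g \<in> borel_measurable M"
  shows "integrable M (\<lambda>x. exp (- (\<i> * of_real (g x))) * m x)"
  by (rule Bochner_Integration.integrable_bound[OF assms(1)])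
     (use assms borel_measurable_integrable[OF assms(1)] in \<open>auto simp: norm_mult\<close>)

lemma fourier_integral_bound:
  fixes m :: "'a::euclidean_space => complex"
  assumes m: "integrable lborel m"
  shows "cmod (fourier_integral m y) \<le> fconst TYPE('a) * (LINT x|lborel. cmod (m x))"
proof -
  have [measurable]: "m \<in> borel_fun" using borel_measurable_integrable[OF m] by simp
  have "cmod (LINT x|lborel. exp (- (\<i> * of_real (y \<bullet> x))) * m x) \<le> (LINT x|lborel. cmod (exp (- (\<i> * of_real (y \<bullet> x))) * m x))"
    by (rule integral_norm_bound)
  also have "\<dots> = (LINT x|lborel. cmod (m x))"
    by (simp add: norm_mult)
  finally show ?thesis
    unfolding fourier_integral_borel[OF \<open>m \<in> borel_fun\<close>]
    using fconst_pos[where 'a='a] by (simp add: norm_mult mult_left_mono)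
qed

text \<open>The convolution theorem. In the double integral for the transform times its conjugate
  put \<open>y = x - z\<close>; the phases combine to \<open>exp (- i v z)\<close>, and Fubini's
  theorem isolates the autocorrelation.\<close>

lemma fourier_integral_square:
  fixes m :: "'a::euclidean_space => complex"
  assumes m: "integrable lborel m" and B: "\<And>x. cmod (m x) \<le> B"
  shows "complex_of_real (csq (fourier_integral m v)) =
    of_real ((fconst TYPE('a))\<^sup>2) * (LINT z|lborel. exp (- (\<i> * of_real (v \<bullet> z))) * (LINT x|lborel. m x * cnj (m (x - z))))"
proof -
  have [measurable]: "m \<in> borel_fun" using borel_measurable_integrable[OF m] by simp
  let ?e = "\<lambda>x::'a. exp (- (\<i> * of_real (v \<bullet> x)))"
  have cc: "cnj (LINT y|lborel. ?e y * m y) = (LINT z|lborel. exp (\<i> * of_real (v \<bullet> (x - z))) * cnj (m (x - z)))" for x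
  proof -
    have "cnj (LINT y|lborel. ?e y * m y) = (LINT y|lborel. exp (\<i> * of_real (v \<bullet> y)) * cnj (m y))"
      by (subst Bochner_Integration.integral_cnj[symmetric]) (simp add: exp_cnj)
    also have "\<dots> = (LINT z|lborel. exp (\<i> * of_real (v \<bullet> (x - z))) * cnj (m (x - z)))"
      by (rule lborel_integral_reflect(1)[symmetric]) measurable
    finally show ?thesis .
  qed
  have pair: "integrable (lborel \<Otimes>\<^sub>M lborel) (\<lambda>(x, z). ?e z * (m x * cnj (m (x - z))))"
    using integrable_exp_mult[OF autocorrelation(1)[OF m B], of "\<lambda>p. v \<bullet> snd p"]
    by (simp add: case_prod_beta')
  have "(LINT x|lborel. ?e x * m x) * cnj (LINT y|lborel. ?e y * m y)
     = (LINT x|lborel. (?e x * m x) * cnj (LINT y|lborel. ?e y * m y))"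
    by simp
  also have "\<dots> = (LINT x|lborel. (LINT z|lborel. ?e z * (m x * cnj (m (x - z)))))"
  proof (rule Bochner_Integration.integral_cong[OF refl])
    fix x
    have "(?e x * m x) * cnj (LINT y|lborel. ?e y * m y) =
      (LINT z|lborel. (?e x * m x) * (exp (\<i> * of_real (v \<bullet> (x - z))) * cnj (m (x - z))))"
      unfolding cc[of x] by simp
    also have "\<dots> = (LINT z|lborel. ?e z * (m x * cnj (m (x - z))))"
    proof (rule Bochner_Integration.integral_cong[OF refl])
      fix z
      have "?e x * exp (\<i> * of_real (v \<bullet> (x - z))) = ?e z"
        unfolding exp_iu by (simp add: inner_diff_right)
      then show "(?e x * m x) * (exp (\<i> * of_real (v \<bullet> (x - z))) * cnj (m (x - z))) = ?e z * (m x * cnj (m (x - z)))"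
        by (metis (no_types, lifting) mult.assoc mult.commute)
    qed
    finally show "(?e x * m x) * cnj (LINT y|lborel. ?e y * m y) = (LINT z|lborel. ?e z * (m x * cnj (m (x - z))))" .
  qed
  also have "\<dots> = (LINT z|lborel. (LINT x|lborel. ?e z * (m x * cnj (m (x - z)))))"
    using lborel_pair.Fubini_integral[OF pair] by simp
  also have "\<dots> = (LINT z|lborel. ?e z * (LINT x|lborel. m x * cnj (m (x - z))))"
    by simp
  finally have *: "(LINT x|lborel. ?e x * m x) * cnj (LINT y|lborel. ?e y * m y) = (LINT z|lborel. ?e z * (LINT x|lborel. m x * cnj (m (x - z))))" .
  show ?thesis
    unfolding complex_norm_square fourier_integral_borel[OF \<open>m \<in> borel_fun\<close>] *[symmetric]
    by (simp add: power2_eq_square)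
qed

text \<open>The multiplication formula: the Gaussian weight makes the double integral absolutely
  convergent, and exchanging the order replaces it by its own transform, concentrated at scale
  \<open>e\<close>. The substitution \<open>z = e y\<close> shows a Gaussian mean of the
  autocorrelation near 0.\<close>

lemma fourier_integral_gauss_mean:
  fixes m :: "'a::euclidean_space => complex"
  assumes m: "integrable lborel m" and B: "\<And>x. cmod (m x) \<le> B" and e: "e > 0"
  shows "(LINT v|lborel. complex_of_real (gauss (e *\<^sub>R v) * csq (fourier_integral m v))) =
    of_real (fconst TYPE('a)) * (LINT y|lborel. of_real (gauss y) * (LINT x|lborel. m x * cnj (m (x - e *\<^sub>R y))))"
proof -
  have mm [measurable]: "m \<in> borel_fun" using borel_measurable_integrable[OF m] by simp
  define r where "r z = (LINT x|lborel. m x * cnj (m (x - z)))" for z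
  have [measurable]: "r \<in> borel_fun" unfolding r_def using autocorrelation(2)[OF m B] .
  have r: "integrable lborel r"
    unfolding r_def using lborel_pair.integrable_snd[OF autocorrelation(1)[OF m B]] by simp
  let ?c = "complex_of_real ((fconst TYPE('a))\<^sup>2)"
  let ?E = "\<lambda>v z::'a. exp (- (\<i> * of_real (v \<bullet> z)))"
  have ge: "integrable lborel (\<lambda>v::'a. gauss (e *\<^sub>R v))"
    using integrable_Re[OF gauss_fourier(1)[OF e, of "0::'a"]] by simp
  have pair: "integrable (lborel \<Otimes>\<^sub>M lborel) (\<lambda>(v, z). of_real (gauss (e *\<^sub>R v)) * (?E v z * r z))"
  proof (rule lborel_pair.Fubini_integrable)
    show "(\<lambda>(v, z). of_real (gauss (e *\<^sub>R v)) * (?E v z * r z)) \<in> borel_measurable (lborel \<Otimes>\<^sub>M lborel)"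
      by measurable
    have "(LINT z|lborel. norm (of_real (gauss (e *\<^sub>R v)) * (?E v z * r z))) = gauss (e *\<^sub>R v) * (LINT z|lborel. cmod (r z))" for v :: 'a
      by (simp add: norm_mult abs_of_pos gauss_pos)
    then show "integrable lborel (\<lambda>v. (LINT z|lborel. norm (case (v, z) of (v, z) => of_real (gauss (e *\<^sub>R v)) * (?E v z * r z))))"
      using ge by simp
    show "AE v in lborel. integrable lborel (\<lambda>z. case (v, z) of (v, z) => of_real (gauss (e *\<^sub>R v)) * (?E v z * r z))"
      by (auto intro!: integrable_exp_mult r integrable_mult_right)
  qed
  have "(LINT v|lborel. complex_of_real (gauss (e *\<^sub>R v) * csq (fourier_integral m v)))
     = (LINT v|lborel. ?c * (LINT z|lborel. of_real (gauss (e *\<^sub>R v)) * (?E v z * r z)))"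
  proof (rule Bochner_Integration.integral_cong[OF refl])
    fix v :: 'a
    have "(LINT z|lborel. of_real (gauss (e *\<^sub>R v)) * (?E v z * r z)) = of_real (gauss (e *\<^sub>R v)) * (LINT z|lborel. ?E v z * r z)"
      by simp
    then show "complex_of_real (gauss (e *\<^sub>R v) * csq (fourier_integral m v)) =
        ?c * (LINT z|lborel. of_real (gauss (e *\<^sub>R v)) * (?E v z * r z))"
      unfolding of_real_mult fourier_integral_square[OF m B] r_def[symmetric] by (simp add: mult_ac)
  qed
  also have "\<dots> = ?c * (LINT z|lborel. (LINT v|lborel. of_real (gauss (e *\<^sub>R v)) * (?E v z * r z)))"
    using lborel_pair.Fubini_integral[OF pair] by simp
  also have "\<dots> = ?c * (LINT z|lborel. complex_of_real ((sqrt (2 * pi) / e) ^ DIM('a) * gauss ((1 / e) *\<^sub>R z)) * r z)"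
  proof -
    have "(LINT v|lborel. of_real (gauss (e *\<^sub>R v)) * (?E v z * r z)) = complex_of_real ((sqrt (2 * pi) / e) ^ DIM('a) * gauss ((1 / e) *\<^sub>R z)) * r z" for z
    proof -
      have "(LINT v|lborel. of_real (gauss (e *\<^sub>R v)) * (?E v z * r z)) = (LINT v|lborel. (?E v z * of_real (gauss (e *\<^sub>R v))) * r z)"
        by (intro Bochner_Integration.integral_cong) (auto simp: mult_ac)
      then show ?thesis unfolding gauss_fourier(2)[OF e, symmetric] by simp
    qed
    then show ?thesis by simp
  qed
  also have "\<dots> = ?c * ((e ^ DIM('a)) *\<^sub>R (LINT y|lborel. complex_of_real ((sqrt (2 * pi) / e) ^ DIM('a) * gauss ((1 / e) *\<^sub>R (e *\<^sub>R y))) * r (e *\<^sub>R y)))"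
    by (subst lborel_integral_scale[OF _ e]) auto
  also have "\<dots> = ?c * (complex_of_real (e ^ DIM('a) * (sqrt (2 * pi) / e) ^ DIM('a)) * (LINT y|lborel. of_real (gauss y) * r (e *\<^sub>R y)))"
    using e by (simp add: scaleR_conv_of_real mult.assoc)
  also have "\<dots> = of_real (fconst TYPE('a)) * (LINT y|lborel. of_real (gauss y) * r (e *\<^sub>R y))"
  proof -
    have "(fconst TYPE('a))\<^sup>2 * (e ^ DIM('a) * (sqrt (2 * pi) / e) ^ DIM('a)) = fconst TYPE('a)"
      unfolding power_mult_distrib[symmetric] using e by (simp add: fconst_def power2_eq_square)
    then show ?thesis by (metis (no_types, lifting) mult.assoc of_real_mult)
  qed
  finally show ?thesis unfolding r_def .
qed

text \<open>Let \<open>e\<close> tend to 0 in \<open>fourier_integral_gauss_mean\<close>. On the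
  right the autocorrelation tends to its value at 0, and \<open>fconst\<close> cancels the mass of
  the Gaussian. On the left the weights increase to 1, so monotone convergence yields
  square-integrability together with the value.\<close>

lemma fourier_isometry_bounded:
  fixes m :: "'a::euclidean_space => complex"
  assumes m: "integrable lborel m" and B: "\<And>x. cmod (m x) \<le> B"
  shows "sqi lborel (fourier_integral m)" "sqnorm lborel (fourier_integral m) = sqnorm lborel m"
proof -
  have mm [measurable]: "m \<in> borel_fun" using borel_measurable_integrable[OF m] by simp
  define e where "e k = inverse (real (Suc k))" for k
  have e: "e k > 0" "e k \<le> 1" for k by (auto simp: e_def inverse_le_1_iff)
  have elim: "e ----> 0" unfolding e_def by (rule LIMSEQ_inverse_real_of_nat)
  have edec: "e (Suc k) \<le> e k" for k by (simp add: e_def)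
  let ?F = "\<lambda>k v. gauss (e k *\<^sub>R v) * csq (fourier_integral m v)"
  define r where "r z = (LINT x|lborel. m x * cnj (m (x - z)))" for z
  have [measurable]: "r \<in> borel_fun" unfolding r_def using autocorrelation(2)[OF m B] .
  have "(\<lambda>k. (LINT y|lborel. of_real (gauss y) * r (e k *\<^sub>R y))) ----> (LINT y|lborel. of_real (gauss (y::'a)) * r 0)"
  proof (rule integral_dominated_convergence[where w = "\<lambda>y. gauss y * (B * (LINT x|lborel. cmod (m x)))"])
    show "AE y in lborel. (\<lambda>k. of_real (gauss (y::'a)) * r (e k *\<^sub>R y)) ----> of_real (gauss y) * r 0"
    proof (intro AE_I2 tendsto_intros)
      fix y :: 'a
      have "(\<lambda>k. e k *\<^sub>R y) ----> 0 *\<^sub>R y" by (intro tendsto_intros elim)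
      then have "(\<lambda>k. e k *\<^sub>R y) ----> 0" by simp
      from autocorrelation(4)[OF m B this] show "(\<lambda>k. r (e k *\<^sub>R y)) ----> r 0"
        unfolding r_def by simp
    qed
    show "AE y in lborel. norm (of_real (gauss (y::'a)) * r (e k *\<^sub>R y)) \<le> gauss y * (B * (LINT x|lborel. cmod (m x)))" for k
      using autocorrelation(3)[OF m B] by (auto simp: norm_mult r_def abs_of_pos gauss_pos less_imp_le)
    show "integrable lborel (\<lambda>y::'a. gauss y * (B * (LINT x|lborel. cmod (m x))))"
      by (intro integrable_mult_left gauss_integral)
  qed measurable
  moreover have "(LINT y|lborel. of_real (gauss (y::'a)) * r 0) = of_real (sqrt (2 * pi) ^ DIM('a)) * r 0"
    by (simp only: Bochner_Integration.integral_mult_left_zero integral_complex_of_real gauss_integral(2))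
  ultimately have "(\<lambda>k. of_real (fconst TYPE('a)) * (LINT y|lborel. of_real (gauss y) * r (e k *\<^sub>R y))) ---->
     of_real (fconst TYPE('a)) * (of_real (sqrt (2 * pi) ^ DIM('a)) * r 0)"
    by (intro tendsto_mult_left) (simp only:)
  then have lim: "(\<lambda>k. (LINT v|lborel. complex_of_real (?F k v))) ----> of_real (fconst TYPE('a)) * (of_real (sqrt (2 * pi) ^ DIM('a)) * r 0)"
    unfolding r_def fourier_integral_gauss_mean[OF m B e(1)] .
  have "of_real (fconst TYPE('a)) * (of_real (sqrt (2 * pi) ^ DIM('a)) * r 0) = complex_of_real (sqnorm lborel m)"
    by (simp add: fconst_def r_def ip_self[symmetric] ip_def)
  with lim have lim: "(\<lambda>k. (LINT v|lborel. ?F k v)) ----> sqnorm lborel m"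
    unfolding integral_complex_of_real by (simp add: tendsto_of_real_iff)
  have Fint: "integrable lborel (?F k)" for k
  proof (rule Bochner_Integration.integrable_bound)
    show "integrable lborel (\<lambda>v::'a. gauss (e k *\<^sub>R v) * (fconst TYPE('a) * (LINT x|lborel. cmod (m x)))\<^sup>2)"
      using integrable_Re[OF gauss_fourier(1)[OF e(1), of "0::'a" k]] by simp
    show "AE v in lborel. norm (?F k v) \<le> norm (gauss (e k *\<^sub>R v) * (fconst TYPE('a) * (LINT x|lborel. cmod (m x)))\<^sup>2)"
      using fourier_integral_bound[OF m] by (auto simp: gauss_pos abs_mult abs_of_pos less_imp_le intro!: mult_left_mono power_mono)
  qed measurable
  have mono: "AE v in lborel. mono (\<lambda>k. ?F k v)"
  proof (intro AE_I2)
    fix v :: 'a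
    have "gauss (e k *\<^sub>R v) \<le> gauss (e (Suc k) *\<^sub>R v)" for k
      using e edec[of k] less_imp_le[OF e(1)] by (auto simp: gauss_def power_mult_distrib intro!: mult_right_mono power_mono)
    then show "mono (\<lambda>k. ?F k v)" by (auto simp: incseq_Suc_iff intro!: mult_right_mono)
  qed
  have Flim: "AE v in lborel. (\<lambda>k. ?F k v) ----> csq (fourier_integral m v)"
  proof (intro AE_I2)
    fix v :: 'a
    have "(\<lambda>k. ?F k v) ----> exp (- (norm (0 *\<^sub>R v))\<^sup>2 / 2) * csq (fourier_integral m v)"
      unfolding gauss_def by (intro tendsto_intros elim) auto
    then show "(\<lambda>k. ?F k v) ----> csq (fourier_integral m v)" by simp
  qed
  have meas: "(\<lambda>v. csq (fourier_integral m v)) \<in> borel_measurable lborel" by measurable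
  show "sqi lborel (fourier_integral m)"
    using integrable_monotone_convergence[OF Fint mono Flim lim meas] by (simp add: sqi_def)
  show "sqnorm lborel (fourier_integral m) = sqnorm lborel m"
    unfolding sqnorm_def[of _ "fourier_integral m"]
    using integral_monotone_convergence[OF Fint mono Flim lim meas] .
qed

section \<open>Borel and Lebesgue measurable versions\<close>

lemma borel_imp_lebesgue: "f \<in> borel_fun ==> f \<in> borel_measurable lebesgue"
  by (rule measurable_completion) simp

lemma sqi_lebesgue_iff: "f \<in> borel_fun ==> sqi lebesgue f \<longleftrightarrow> sqi lborel f"
  by (auto simp: sqi_def integrable_completion borel_imp_lebesgue)

lemma sqnorm_lebesgue: "f \<in> borel_fun ==> sqnorm lebesgue f = sqnorm lborel f"
  by (simp add: sqnorm_def integral_completion)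

lemma L2_iff_sqi: "f \<in> L2 \<longleftrightarrow> sqi lebesgue f"
  by (simp add: L2_def sqi_def)

lemma sqnorm_cong_AE:
  assumes "AE x in M. f x = g x" "f \<in> borel_measurable M" "g \<in> borel_measurable M"
  shows "sqnorm M f = sqnorm M g"
  unfolding sqnorm_def using assms by (intro integral_cong_AE) auto

lemma ip_cong_AE:
  assumes "AE x in M. f x = f' x" "AE x in M. g x = g' x"
    "f \<in> borel_measurable M" "g \<in> borel_measurable M" "f' \<in> borel_measurable M" "g' \<in> borel_measurable M"
  shows "ip M f g = ip M f' g'"
  unfolding ip_def using assms by (intro integral_cong_AE) auto

text \<open>Supplies the Borel representatives on which Fubini's theorem for \<open>lborel\<close>
  can act.\<close>

lemma lebesgue_borel_version:
  fixes m :: "'a::euclidean_space => complex"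
  assumes "m \<in> borel_measurable lebesgue"
  obtains m' where "m' \<in> borel_fun" "AE x in lebesgue. m x = m' x"
  using completion_ex_borel_complex[OF assms] by (auto dest: AE_completion)

text \<open>Truncation \<open>m\<^sub>N = m 1\<^bsub>|m| \<le> N\<^esub>\<close> reduces the isometry to bounded functions.\<close>

lemma fourier_isometry_borel:
  fixes m :: "'a::euclidean_space => complex"
  assumes m: "integrable lborel m" and m2: "sqi lborel m"
  shows "sqi lborel (fourier_integral m)" "sqnorm lborel (fourier_integral m) = sqnorm lborel m"
proof -
  have mm [measurable]: "m \<in> borel_fun" using borel_measurable_integrable[OF m] by simp
  define t where "t N x = indicator {y. cmod (m y) \<le> real N} x * m x" for N x
  have tm [measurable]: "t N \<in> borel_fun" for N unfolding t_def by measurable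
  have tle: "cmod (t N x) \<le> cmod (m x)" for N x by (simp add: t_def indicator_def)
  have tN: "cmod (t N x) \<le> real N" for N x by (simp add: t_def indicator_def)
  have t1: "integrable lborel (t N)" for N
    by (rule Bochner_Integration.integrable_bound[OF m]) (auto simp: tle)
  have t2: "sqi lborel (t N)" for N
    by (rule sqi_dominated[OF m2, where C = 1]) (auto simp: tle)
  have tlim: "(\<lambda>N. t N x) ----> m x" for x
  proof (rule tendsto_eventually)
    obtain N0 where "cmod (m x) \<le> real N0" using real_arch_simple by blast
    then have "t N x = m x" if "N \<ge> N0" for N using that by (auto simp: t_def)
    then show "\<forall>\<^sub>F N in sequentially. t N x = m x"
      using eventually_sequentially by blast
  qed
  have diff: "sqi lborel (fourier_integral (\<lambda>x. t M x - t N x))"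
    "sqnorm lborel (fourier_integral (\<lambda>x. t M x - t N x)) = sqnorm lborel (\<lambda>x. t M x - t N x)" for M N
  proof -
    have "cmod (t M x - t N x) \<le> real M + real N" for x
      using norm_triangle_ineq4[of "t M x" "t N x"] tN[of M x] tN[of N x] by linarith
    from fourier_isometry_bounded[of "\<lambda>x. t M x - t N x", OF _ this] t1
    show "sqi lborel (fourier_integral (\<lambda>x. t M x - t N x))"
     "sqnorm lborel (fourier_integral (\<lambda>x. t M x - t N x)) = sqnorm lborel (\<lambda>x. t M x - t N x)" by auto
  qed
  have lin: "fourier_integral (\<lambda>x. t M x - t N x) v = fourier_integral (t M) v - fourier_integral (t N) v" for M N v
    using integrable_exp_mult[OF t1, of "\<lambda>x. v \<bullet> x"]
    by (simp add: fourier_integral_borel right_diff_distrib)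
  have sq: "sqnorm lborel (\<lambda>x. t M x - t N x) \<le> sqnorm lborel (\<lambda>x. m x - t N x)" if "N \<le> M" for M N
    unfolding sqnorm_def
  proof (rule integral_mono)
    show "integrable lborel (\<lambda>x. csq (t M x - t N x))" using sqi_diff[OF t2 t2] by (simp add: sqi_def)
    show "integrable lborel (\<lambda>x. csq (m x - t N x))" using sqi_diff[OF m2 t2] by (simp add: sqi_def)
    fix x show "csq (t M x - t N x) \<le> csq (m x - t N x)"
      using that by (auto simp: t_def indicator_def)
  qed
  have flim: "(\<lambda>M. fourier_integral (t M) v) ----> fourier_integral m v" for v
    unfolding fourier_integral_borel[OF tm] fourier_integral_borel[OF mm]
  proof (intro tendsto_mult_left integral_dominated_convergence[where w = "\<lambda>x. cmod (m x)"])
    show "AE x in lborel. (\<lambda>i. exp (- (\<i> * complex_of_real (v \<bullet> x))) * t i x) ----> exp (- (\<i> * complex_of_real (v \<bullet> x))) * m x"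
      by (intro AE_I2 tendsto_intros tlim)
  qed (use m in \<open>auto simp: norm_mult tle\<close>)
  \<comment> \<open>The transforms of the truncations converge pointwise because \<open>m\<close> is
    integrable. Fatou's lemma thus identifies their limit in norm as the Fourier integral of
    \<open>m\<close>.\<close>
  have F: "sqi lborel (\<lambda>v. fourier_integral m v - fourier_integral (t N) v) \<and>
      sqnorm lborel (\<lambda>v. fourier_integral m v - fourier_integral (t N) v) \<le> sqnorm lborel (\<lambda>x. m x - t N x)" for N
  proof (rule sqi_Fatou[where f = "\<lambda>k v. fourier_integral (\<lambda>x. t (k + N) x - t N x) v"])
    show "AE v in lborel. (\<lambda>k. fourier_integral (\<lambda>x. t (k + N) x - t N x) v) ----> fourier_integral m v - fourier_integral (t N) v"
      unfolding lin by (intro AE_I2 tendsto_intros LIMSEQ_ignore_initial_segment flim)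
    show "sqnorm lborel (fourier_integral (\<lambda>x. t (k + N) x - t N x)) \<le> sqnorm lborel (\<lambda>x. m x - t N x)" for k
      using diff(2) sq by simp
  qed (auto intro: diff)
  have lim0: "(\<lambda>N. sqnorm lborel (\<lambda>x. t N x - m x)) ----> 0"
  proof -
    have "(\<lambda>N. sqnorm lborel (\<lambda>x. t N x - m x)) ----> (\<integral>x. (0::real) \<partial>(lborel::'a measure))"
      unfolding sqnorm_def
    proof (rule integral_dominated_convergence[where w = "\<lambda>x. csq (m x)"])
      show "AE x in lborel. (\<lambda>i. csq (t i x - m x)) ----> 0"
      proof (intro AE_I2)
        fix x
        have "(\<lambda>i. csq (t i x - m x)) ----> csq (m x - m x)" by (intro tendsto_intros tlim)
        then show "(\<lambda>i. csq (t i x - m x)) ----> 0" by simp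
      qed
      show "AE x in lborel. norm (csq (t i x - m x)) \<le> csq (m x)" for i
        by (auto simp: t_def indicator_def)
    qed (use m2 in \<open>auto simp: sqi_def\<close>)
    then show ?thesis by simp
  qed
  have tF: "sqi lborel (fourier_integral (t N))" "sqnorm lborel (fourier_integral (t N)) = sqnorm lborel (t N)" for N
    using fourier_isometry_bounded[OF t1 tN] by auto
  have "sqi lborel (\<lambda>v. (fourier_integral m v - fourier_integral (t 0) v) + fourier_integral (t 0) v)"
    using F tF by (intro sqi_add) auto
  then show s: "sqi lborel (fourier_integral m)" by simp
  have "(\<lambda>N. sqnorm lborel (\<lambda>v. fourier_integral (t N) v - fourier_integral m v)) ----> 0"
  proof (rule tendsto_sandwich[OF _ _ tendsto_const lim0])
    show "\<forall>\<^sub>F N in sequentially. sqnorm lborel (\<lambda>v. fourier_integral (t N) v - fourier_integral m v) \<le> sqnorm lborel (\<lambda>x. t N x - m x)"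
      using F by (simp add: sqnorm_diff_commute[of _ _ m] sqnorm_diff_commute[of _ _ "fourier_integral m"])
  qed simp
  from sqnorm_tendsto[OF tF(1) s this]
  have "(\<lambda>N. sqnorm lborel (t N)) ----> sqnorm lborel (fourier_integral m)" unfolding tF(2) .
  with sqnorm_tendsto[OF t2 m2 lim0] show "sqnorm lborel (fourier_integral m) = sqnorm lborel m"
    using LIMSEQ_unique by blast
qed

lemma fourier_isometry:
  fixes m :: "'a::euclidean_space => complex"
  assumes m: "integrable lebesgue m" and m2: "sqi lebesgue m"
  shows "fourier_integral m \<in> borel_fun" "sqi lebesgue (fourier_integral m)" "sqnorm lebesgue (fourier_integral m) = sqnorm lebesgue m"
proof -
  obtain m' where m' [measurable]: "m' \<in> borel_fun" and eq: "AE x in lebesgue. m x = m' x"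
    using lebesgue_borel_version[of m] m2 by (auto simp: sqi_def)
  note mm = sqi_measurable[OF m2]
  have F: "fourier_integral m = fourier_integral m'"
    using eq mm borel_imp_lebesgue[OF m'] by (rule fourier_integral_cong_AE)
  have "integrable lebesgue m'"
    using m integrable_cong_AE[OF mm borel_imp_lebesgue[OF m'] eq] by simp
  then have 1: "integrable lborel m'" by (simp add: integrable_completion)
  have "sqi lebesgue m'" using sqi_AE_cong[OF m2 borel_imp_lebesgue[OF m'] eq] .
  then have 2: "sqi lborel m'" by (simp add: sqi_lebesgue_iff)
  show "fourier_integral m \<in> borel_fun" unfolding F by measurable
  then show "sqi lebesgue (fourier_integral m)"
    using fourier_isometry_borel(1)[OF 1 2] F by (simp add: sqi_lebesgue_iff)
  have "sqnorm lebesgue (fourier_integral m) = sqnorm lborel m'"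
    using fourier_isometry_borel(2)[OF 1 2] F by (simp add: sqnorm_lebesgue)
  also have "\<dots> = sqnorm lebesgue m"
    using sqnorm_cong_AE[OF eq mm borel_imp_lebesgue[OF m']] by (simp add: sqnorm_lebesgue)
  finally show "sqnorm lebesgue (fourier_integral m) = sqnorm lebesgue m" .
qed

lemma sqi_bounded_support_integrable:
  fixes m :: "'a::euclidean_space => complex"
  assumes m: "sqi lebesgue m"
  shows "integrable lebesgue (\<lambda>x. indicator (cball 0 R) x * m x)" "sqi lebesgue (\<lambda>x. indicator (cball 0 R) x * m x)"
proof -
  have "sqi lebesgue (\<lambda>x::'a. indicator (cball 0 R) x :: complex)"
  proof -
    have "integrable lborel (indicat_real (cball (0::'a) R))"
      using emeasure_bounded_finite[OF bounded_cball, of "0::'a" R] by (simp add: integrable_indicator_iff)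
    moreover have "csq (indicator (cball 0 R) x :: complex) = indicat_real (cball (0::'a) R) x" for x
      by (auto simp: indicator_def)
    ultimately have "sqi lborel (\<lambda>x::'a. indicator (cball 0 R) x :: complex)"
      unfolding sqi_def by (auto intro!: borel_measurable_indicator)
    then show ?thesis by (subst sqi_lebesgue_iff) (auto intro!: borel_measurable_indicator)
  qed
  from sqi_integrable_mult[OF this m] show "integrable lebesgue (\<lambda>x. indicator (cball 0 R) x * m x)" .
  show "sqi lebesgue (\<lambda>x. indicator (cball 0 R) x * m x)"
    by (rule sqi_mult_bounded[OF m, where C = 1]) (auto simp: indicator_def intro!: borel_imp_lebesgue)
qed

abbreviation trunc :: "real => ('a::euclidean_space => complex) => 'a => complex" where
  "trunc R f \<equiv> \<lambda>x. indicator (cball 0 R) x * f x"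

lemma trunc_tendsto:
  fixes f :: "'a::euclidean_space => complex"
  assumes f: "sqi lebesgue f"
  shows "((\<lambda>R. sqnorm lebesgue (\<lambda>x. trunc R f x - f x)) \<longlongrightarrow> 0) at_top"
proof -
  have "((\<lambda>R. sqnorm lebesgue (\<lambda>x. trunc R f x - f x)) \<longlongrightarrow> (\<integral>x. (0::real) \<partial>(lebesgue::'a measure))) at_top"
    unfolding sqnorm_def
  proof (rule integral_dominated_convergence_at_top[where w = "\<lambda>x. csq (f x)"])
    show "(\<lambda>x. csq (trunc R f x - f x)) \<in> borel_measurable lebesgue" for R
      using sqi_integrable[OF sqi_diff[OF sqi_bounded_support_integrable(2)[OF f] f]]
      by (rule borel_measurable_integrable)
    show "AE x in lebesgue. ((\<lambda>R. csq (trunc R f x - f x)) \<longlongrightarrow> 0) at_top"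
    proof (intro AE_I2 tendsto_eventually)
      fix x show "\<forall>\<^sub>F R in at_top. csq (trunc R f x - f x) = 0"
        using eventually_ge_at_top[of "norm x"] by eventually_elim auto
    qed
    show "\<forall>\<^sub>F R in at_top. AE x in lebesgue. norm (csq (trunc R f x - f x)) \<le> csq (f x)"
      by (auto simp: indicator_def intro!: always_eventually)
  qed (use f in \<open>auto simp: sqi_def\<close>)
  then show ?thesis by simp
qed

lemma fourier_integral_diff:
  fixes f g :: "'a::euclidean_space => complex"
  assumes f: "integrable lebesgue f" and g: "integrable lebesgue g"
  shows "fourier_integral (\<lambda>x. a * f x - b * g x) y = a * fourier_integral f y - b * fourier_integral g y"
proof -
  have [measurable]: "(\<lambda>x. y \<bullet> x) \<in> borel_measurable lebesgue"
    by (rule borel_imp_lebesgue) measurable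
  have i: "integrable lebesgue (\<lambda>x. exp (- (\<i> * of_real (y \<bullet> x))) * f x)" if "integrable lebesgue f" for f
    by (rule integrable_exp_mult[OF that]) measurable
  have "(LINT x|lebesgue. exp (- (\<i> * of_real (y \<bullet> x))) * (a * f x - b * g x)) =
    (LINT x|lebesgue. a * (exp (- (\<i> * of_real (y \<bullet> x))) * f x) - b * (exp (- (\<i> * of_real (y \<bullet> x))) * g x))"
    by (intro Bochner_Integration.integral_cong) (auto simp: algebra_simps)
  also have "\<dots> = a * (LINT x|lebesgue. exp (- (\<i> * of_real (y \<bullet> x))) * f x) - b * (LINT x|lebesgue. exp (- (\<i> * of_real (y \<bullet> x))) * g x)"
    using i[OF f] i[OF g] by simp
  finally show ?thesis unfolding fourier_integral_def
    by (simp only: scaleR_diff_right mult_scaleR_right)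
qed

lemma fourier_integral_isometry_diff:
  fixes f g :: "'a::euclidean_space => complex"
  assumes "integrable lebesgue f" "integrable lebesgue g" "sqi lebesgue f" "sqi lebesgue g"
  shows "sqnorm lebesgue (\<lambda>y. fourier_integral f y - fourier_integral g y) = sqnorm lebesgue (\<lambda>x. f x - g x)"
proof -
  have "fourier_integral (\<lambda>x. f x - g x) = (\<lambda>y. fourier_integral f y - fourier_integral g y)"
    using fourier_integral_diff[of f g 1 1] assms by auto
  then show ?thesis
    using fourier_isometry(3)[of "\<lambda>x. f x - g x"] assms by (simp add: sqi_diff)
qed

section \<open>The transform on L^2\<close>

text \<open>The extended integral in the definition is finite for square-integrable data, so the
  convergence can be stated with norms.\<close>

lemma is_fourier_transform_iff:
  "is_fourier_transform f g \<longleftrightarrow> sqi lebesgue f \<and> sqi lebesgue g \<and>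
     ((\<lambda>R. sqnorm lebesgue (\<lambda>y. fourier_integral (trunc R f) y - g y)) \<longlongrightarrow> 0) at_top"
proof (cases "sqi lebesgue f \<and> sqi lebesgue g")
  case True
  have "(\<integral>\<^sup>+y. ennreal (csq (fourier_integral (trunc R f) y - g y)) \<partial>lebesgue) =
      ennreal (sqnorm lebesgue (\<lambda>y. fourier_integral (trunc R f) y - g y))" for R
    unfolding sqnorm_def
  proof (rule nn_integral_eq_integral)
    show "integrable lebesgue (\<lambda>y. csq (fourier_integral (trunc R f) y - g y))"
      using sqi_diff[OF fourier_isometry(2)[OF sqi_bounded_support_integrable], of f g R] True by (simp add: sqi_def)
  qed auto
  then show ?thesis using True
    by (simp add: is_fourier_transform_def L2_iff_sqi ennreal_0[symmetric] tendsto_ennreal_iff del: ennreal_0)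
next
  case False
  then show ?thesis by (auto simp: is_fourier_transform_def L2_iff_sqi)
qed

text \<open>By the isometry the transforms of the truncations form a Cauchy family. Completeness is
  applied along integer radii only.\<close>

lemma is_fourier_transform_exists:
  fixes f :: "'a::euclidean_space => complex"
  assumes f: "sqi lebesgue f"
  shows "\<exists>g. is_fourier_transform f g"
proof -
  let ?F = "\<lambda>R. fourier_integral (trunc R f)"
  note t = sqi_bounded_support_integrable[OF f]
  have F: "sqi lebesgue (?F R)" for R using fourier_isometry(2)[OF t] .
  have D: "sqnorm lebesgue (\<lambda>y. ?F R y - ?F S y) = sqnorm lebesgue (\<lambda>x. trunc R f x - trunc S f x)" for R S
    by (rule fourier_integral_isometry_diff[OF t(1) t(1) t(2) t(2)])
  have lim: "(\<lambda>k::nat. sqnorm lebesgue (\<lambda>x. trunc (real k) f x - f x)) ----> 0"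
    using filterlim_compose[OF trunc_tendsto[OF f] filterlim_real_sequentially] .
  have cau: "\<exists>N. \<forall>m\<ge>N. \<forall>n\<ge>N. sqnorm lebesgue (\<lambda>y. ?F (real m) y - ?F (real n) y) \<le> e" if e: "e > 0" for e
  proof -
    obtain N where N: "\<And>k. k \<ge> N ==> sqnorm lebesgue (\<lambda>x. trunc (real k) f x - f x) < e / 4"
      using LIMSEQ_D[OF lim, of "e/4"] e by auto
    have "sqnorm lebesgue (\<lambda>y. ?F (real m) y - ?F (real n) y) \<le> e" if "m \<ge> N" "n \<ge> N" for m n
    proof -
      have "sqnorm lebesgue (\<lambda>x. (trunc (real m) f x - f x) + (f x - trunc (real n) f x)) \<le>
        2 * sqnorm lebesgue (\<lambda>x. trunc (real m) f x - f x) + 2 * sqnorm lebesgue (\<lambda>x. f x - trunc (real n) f x)"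
        by (intro sqnorm_add_le sqi_diff t f)
      then show ?thesis using N[OF that(1)] N[OF that(2)] D
        by (simp add: sqnorm_diff_commute[of _ f])
    qed
    then show ?thesis by blast
  qed
  have "\<exists>g. sqi lebesgue g \<and> (\<lambda>k. sqnorm lebesgue (\<lambda>y. ?F (real k) y - g y)) ----> 0"
    by (rule riesz_fischer[of lebesgue "\<lambda>k. ?F (real k)", OF F cau]) blast+
  then obtain g where g: "sqi lebesgue g" "(\<lambda>k. sqnorm lebesgue (\<lambda>y. ?F (real k) y - g y)) ----> 0"
    by blast
  \<comment> \<open>Two expressions for one limit: the distance to the limit equals the distance of
    the truncation to \<open>f\<close>. This extends the convergence from integer radii to all real
    \<open>R\<close>.\<close>
  have "sqnorm lebesgue (\<lambda>y. ?F R y - g y) = sqnorm lebesgue (\<lambda>x. trunc R f x - f x)" for R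
  proof (rule LIMSEQ_unique)
    show "(\<lambda>k. sqnorm lebesgue (\<lambda>y. ?F R y - ?F (real k) y)) ----> sqnorm lebesgue (\<lambda>y. ?F R y - g y)"
      using g(2) by (intro sqnorm_tendsto sqi_diff F g(1)) (simp add: sqnorm_diff_commute)
    show "(\<lambda>k. sqnorm lebesgue (\<lambda>y. ?F R y - ?F (real k) y)) ----> sqnorm lebesgue (\<lambda>x. trunc R f x - f x)"
      unfolding D using lim by (intro sqnorm_tendsto sqi_diff t f) (simp add: sqnorm_diff_commute)
  qed
  then show ?thesis unfolding is_fourier_transform_iff using f g(1) trunc_tendsto[OF f] by (intro exI[of _ g]) simp
qed

lemma fourier_spec:
  assumes "sqi lebesgue f"
  shows "sqi lebesgue (fourier f)"
    "((\<lambda>R. sqnorm lebesgue (\<lambda>y. fourier_integral (trunc R f) y - fourier f y)) \<longlongrightarrow> 0) at_top"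
  using someI_ex[OF is_fourier_transform_exists[OF assms]] unfolding fourier_def is_fourier_transform_iff by auto

lemma sqnorm_fourier:
  assumes f: "sqi lebesgue f"
  shows "sqnorm lebesgue (fourier f) = sqnorm lebesgue f"
proof (rule tendsto_unique)
  note t = sqi_bounded_support_integrable[OF f]
  show "((\<lambda>R. sqnorm lebesgue (fourier_integral (trunc R f))) \<longlongrightarrow> sqnorm lebesgue (fourier f)) at_top"
    by (intro sqnorm_tendsto fourier_isometry(2) t fourier_spec f)
  show "((\<lambda>R. sqnorm lebesgue (fourier_integral (trunc R f))) \<longlongrightarrow> sqnorm lebesgue f) at_top"
    unfolding fourier_isometry(3)[OF t] by (intro sqnorm_tendsto t f trunc_tendsto)
qed simp

text \<open>Linearity holds only almost everywhere, since \<open>fourier\<close> picks some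
  representative. The norm of the defect is bounded by approximation errors that vanish as
  \<open>R\<close> grows. The form \<open>a * f - b * g\<close> covers differences and multiples at
  once.\<close>

lemma fourier_linear:
  assumes f: "sqi lebesgue f" and g: "sqi lebesgue g"
  shows "AE y in lebesgue. fourier (\<lambda>x. a * f x - b * g x) y = a * fourier f y - b * fourier g y"
proof -
  let ?h = "\<lambda>x. a * f x - b * g x"
  have h: "sqi lebesgue ?h" by (intro sqi_diff sqi_cmult f g)
  let ?d = "\<lambda>y. fourier ?h y - (a * fourier f y - b * fourier g y)"
  let ?F = "\<lambda>R f. fourier_integral (trunc R f)"
  note tf = sqi_bounded_support_integrable[OF f] and tg = sqi_bounded_support_integrable[OF g]
    and th = sqi_bounded_support_integrable[OF h]
  have d: "sqi lebesgue ?d" by (intro sqi_diff sqi_cmult fourier_spec f g h)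
  have "sqnorm lebesgue ?d \<le> 2 * sqnorm lebesgue (\<lambda>y. ?F R ?h y - fourier ?h y) +
     2 * (2 * (csq a * sqnorm lebesgue (\<lambda>y. ?F R f y - fourier f y)) + 2 * (csq b * sqnorm lebesgue (\<lambda>y. ?F R g y - fourier g y)))" for R
  proof -
    have Fh: "?F R ?h y = a * ?F R f y - b * ?F R g y" for y
      using fourier_integral_diff[OF tf(1)[of R] tg(1)[of R], of a b y] by (simp add: algebra_simps)
    have eq: "?d = (\<lambda>y. - (?F R ?h y - fourier ?h y) + (a * (?F R f y - fourier f y) + - (b * (?F R g y - fourier g y))))"
      unfolding Fh by (auto simp: algebra_simps)
    have s: "sqi lebesgue (\<lambda>y. ?F R ?h y - fourier ?h y)" "sqi lebesgue (\<lambda>y. ?F R f y - fourier f y)"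
      "sqi lebesgue (\<lambda>y. ?F R g y - fourier g y)"
      by (intro sqi_diff fourier_isometry(2) fourier_spec(1) f g h tf tg th)+
    have sc: "sqnorm lebesgue (\<lambda>y. c * k y) = csq c * sqnorm lebesgue k" for c k
      by (simp add: sqnorm_def norm_mult power_mult_distrib)
    have "sqnorm lebesgue ?d \<le> 2 * sqnorm lebesgue (\<lambda>y. - (?F R ?h y - fourier ?h y)) +
      2 * sqnorm lebesgue (\<lambda>y. a * (?F R f y - fourier f y) + - (b * (?F R g y - fourier g y)))"
      unfolding eq by (intro sqnorm_add_le sqi_add sqi_minus sqi_cmult s)
    also have "sqnorm lebesgue (\<lambda>y. a * (?F R f y - fourier f y) + - (b * (?F R g y - fourier g y)))
       \<le> 2 * sqnorm lebesgue (\<lambda>y. a * (?F R f y - fourier f y)) + 2 * sqnorm lebesgue (\<lambda>y. - (b * (?F R g y - fourier g y)))"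
      by (intro sqnorm_add_le sqi_minus sqi_cmult s)
    finally show ?thesis unfolding sqnorm_minus sc by simp
  qed
  moreover have "((\<lambda>R. 2 * sqnorm lebesgue (\<lambda>y. ?F R ?h y - fourier ?h y) +
     2 * (2 * (csq a * sqnorm lebesgue (\<lambda>y. ?F R f y - fourier f y)) + 2 * (csq b * sqnorm lebesgue (\<lambda>y. ?F R g y - fourier g y))))
     \<longlongrightarrow> 2 * 0 + 2 * (2 * (csq a * 0) + 2 * (csq b * 0))) at_top"
    by (intro tendsto_intros fourier_spec f g h)
  ultimately have "sqnorm lebesgue ?d \<le> 2 * 0 + 2 * (2 * (csq a * 0) + 2 * (csq b * 0))"
    by (intro tendsto_lowerbound[of _ _ at_top]) (auto intro!: always_eventually)
  then have "sqnorm lebesgue ?d = 0" using sqnorm_nonneg[of lebesgue ?d] by simp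
  then show ?thesis using sqnorm_eq_0_iff[OF d] by simp
qed

section \<open>The inverse transform of integrable data\<close>

text \<open>The inverse transform as an absolutely convergent integral. Writing it as a reflection
  lets all facts about \<open>fourier_integral\<close> be reused.\<close>

definition inv_fourier :: "('a::euclidean_space => complex) => 'a => complex" where
  "inv_fourier m x = fourier_integral m (- x)"

lemma inv_fourier_isometry:
  fixes m :: "'a::euclidean_space => complex"
  assumes m: "integrable lebesgue m" and m2: "sqi lebesgue m"
  shows "inv_fourier m \<in> borel_fun" "sqi lebesgue (inv_fourier m)" "sqnorm lebesgue (inv_fourier m) = sqnorm lebesgue m"
proof -
  note F [measurable] = fourier_isometry(1)[OF m m2]
  show I: "inv_fourier m \<in> borel_fun" unfolding inv_fourier_def by measurable
  have "sqi lborel (fourier_integral m)" using fourier_isometry(2)[OF m m2] F by (simp add: sqi_lebesgue_iff)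
  then have "sqi lborel (inv_fourier m)"
    using lborel_integral_reflect(2)[of "\<lambda>x. csq (fourier_integral m x)" 0] I by (simp add: sqi_def inv_fourier_def)
  then show "sqi lebesgue (inv_fourier m)" using I by (simp add: sqi_lebesgue_iff)
  have "sqnorm lborel (inv_fourier m) = sqnorm lborel (fourier_integral m)"
    using lborel_integral_reflect(1)[of "\<lambda>x. csq (fourier_integral m x)" 0] by (simp add: sqnorm_def inv_fourier_def)
  then show "sqnorm lebesgue (inv_fourier m) = sqnorm lebesgue m"
    using I F fourier_isometry(3)[OF m m2] by (simp add: sqnorm_lebesgue)
qed

lemma fourier_integral_adjoint:
  fixes f m :: "'a::euclidean_space => complex"
  assumes f: "integrable lebesgue f" and m: "integrable lebesgue m"
  shows "ip lebesgue f (inv_fourier m) = ip lebesgue (fourier_integral f) m"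
proof -
  obtain f' where f' [measurable]: "f' \<in> borel_fun" and eqf: "AE x in lebesgue. f x = f' x"
    using lebesgue_borel_version[of f] f by (auto simp: borel_measurable_integrable)
  obtain m' where m' [measurable]: "m' \<in> borel_fun" and eqm: "AE x in lebesgue. m x = m' x"
    using lebesgue_borel_version[of m] m by (auto simp: borel_measurable_integrable)
  note fm = borel_measurable_integrable[OF f] and mm = borel_measurable_integrable[OF m]
  have Ff: "fourier_integral f = fourier_integral f'" using eqf fm borel_imp_lebesgue[OF f'] by (rule fourier_integral_cong_AE)
  have Fm: "inv_fourier m = inv_fourier m'" unfolding inv_fourier_def[abs_def]
    using fourier_integral_cong_AE[OF eqm mm borel_imp_lebesgue[OF m']] by simp
  have [measurable]: "inv_fourier m' \<in> borel_fun" unfolding inv_fourier_def by measurable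
  have fi: "integrable lborel f'"
    using f integrable_cong_AE[OF fm borel_imp_lebesgue[OF f'] eqf] by (simp add: integrable_completion)
  have mi: "integrable lborel m'"
    using m integrable_cong_AE[OF mm borel_imp_lebesgue[OF m'] eqm] by (simp add: integrable_completion)
  let ?c = "complex_of_real (fconst TYPE('a))"
  have pair: "integrable (lborel \<Otimes>\<^sub>M lborel) (\<lambda>(x, y). exp (- (\<i> * of_real (y \<bullet> x))) * (f' x * cnj (m' y)))"
  proof (rule lborel_pair.Fubini_integrable)
    show "(\<lambda>(x, y). exp (- (\<i> * of_real (y \<bullet> x))) * (f' x * cnj (m' y))) \<in> borel_measurable (lborel \<Otimes>\<^sub>M lborel)"
      by measurable
    show "integrable lborel (\<lambda>x. (LINT y|lborel. norm (case (x, y) of (x, y) => exp (- (\<i> * of_real (y \<bullet> x))) * (f' x * cnj (m' y)))))"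
      using fi by (simp add: norm_mult)
    show "AE x in lborel. integrable lborel (\<lambda>y. case (x, y) of (x, y) => exp (- (\<i> * of_real (y \<bullet> x))) * (f' x * cnj (m' y)))"
      using mi by (auto intro!: integrable_exp_mult integrable_mult_right)
  qed
  have "ip lebesgue f (inv_fourier m) = ip lebesgue f' (inv_fourier m')"
    unfolding Fm by (intro ip_cong_AE eqf fm borel_imp_lebesgue) auto
  also have "\<dots> = (LINT x|lborel. f' x * cnj (inv_fourier m' x))"
    unfolding ip_def by (rule integral_completion) measurable
  also have "\<dots> = (LINT x|lborel. ?c * (LINT y|lborel. exp (- (\<i> * of_real (y \<bullet> x))) * (f' x * cnj (m' y))))"
  proof (rule Bochner_Integration.integral_cong[OF refl])
    fix x
    have "cnj (inv_fourier m' x) = ?c * (LINT y|lborel. exp (- (\<i> * of_real (y \<bullet> x))) * cnj (m' y))"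
      unfolding inv_fourier_def fourier_integral_borel[OF m'] complex_cnj_mult Bochner_Integration.integral_cnj[symmetric]
      by (simp add: exp_cnj inner_commute)
    moreover have "(LINT y|lborel. exp (- (\<i> * of_real (y \<bullet> x))) * (f' x * cnj (m' y))) =
        (LINT y|lborel. f' x * (exp (- (\<i> * of_real (y \<bullet> x))) * cnj (m' y)))"
      by (intro Bochner_Integration.integral_cong) (auto simp: mult_ac)
    ultimately show "f' x * cnj (inv_fourier m' x) = ?c * (LINT y|lborel. exp (- (\<i> * of_real (y \<bullet> x))) * (f' x * cnj (m' y)))"
      by (simp add: mult_ac)
  qed
  also have "\<dots> = ?c * (LINT y|lborel. (LINT x|lborel. exp (- (\<i> * of_real (y \<bullet> x))) * (f' x * cnj (m' y))))"
    using lborel_pair.Fubini_integral[OF pair] by simp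
  also have "\<dots> = ?c * (LINT y|lborel. (LINT x|lborel. exp (- (\<i> * of_real (y \<bullet> x))) * f' x) * cnj (m' y))"
    by (simp flip: mult.assoc)
  also have "\<dots> = (LINT y|lborel. fourier_integral f' y * cnj (m' y))"
    unfolding fourier_integral_borel[OF f'] by (simp add: mult.assoc)
  also have "\<dots> = ip lebesgue (fourier_integral f') m'"
    unfolding ip_def by (rule integral_completion[symmetric]) measurable
  also have "\<dots> = ip lebesgue (fourier_integral f) m"
    unfolding Ff using eqm by (intro ip_cong_AE mm borel_imp_lebesgue) (auto elim: eventually_mono)
  finally show ?thesis .
qed

text \<open>For truncated \<open>f\<close> this is Fubini's theorem; both sides are continuous in
  \<open>L2\<close>.\<close>

lemma parseval:
  fixes f m :: "'a::euclidean_space => complex"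
  assumes f: "sqi lebesgue f" and m: "integrable lebesgue m" "sqi lebesgue m"
  shows "ip lebesgue f (inv_fourier m) = ip lebesgue (fourier f) m"
proof (rule tendsto_unique)
  note t = sqi_bounded_support_integrable[OF f]
  note I = inv_fourier_isometry[OF m]
  have z: "((\<lambda>k. sqnorm lebesgue (\<lambda>x. h x - h x :: complex)) \<longlongrightarrow> 0) F" for h :: "'a => complex" and F :: "real filter"
    by (simp add: sqnorm_def)
  show "((\<lambda>R. ip lebesgue (trunc R f) (inv_fourier m)) \<longlongrightarrow> ip lebesgue f (inv_fourier m)) at_top"
    by (rule ip_tendsto[OF t(2) f I(2) I(2) trunc_tendsto[OF f] z])
  show "((\<lambda>R. ip lebesgue (trunc R f) (inv_fourier m)) \<longlongrightarrow> ip lebesgue (fourier f) m) at_top"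
    unfolding fourier_integral_adjoint[OF t(1) m(1)]
    by (rule ip_tendsto[OF fourier_isometry(2)[OF t] fourier_spec(1)[OF f] m(2) m(2) fourier_spec(2)[OF f] z])
qed simp

lemma sqnorm_diff_ip:
  assumes f: "sqi M f" and g: "sqi M g"
  shows "sqnorm M (\<lambda>x. f x - g x) = sqnorm M f - 2 * Re (ip M f g) + sqnorm M g"
proof -
  have "complex_of_real (sqnorm M (\<lambda>x. f x - g x)) = ip M f f - ip M f g - cnj (ip M f g) + ip M g g"
    unfolding ip_self[symmetric] cnj_ip using f g
    by (simp add: ip_diff_left ip_diff_right sqi_diff)
  then have "Re (complex_of_real (sqnorm M (\<lambda>x. f x - g x))) = Re (ip M f f - ip M f g - cnj (ip M f g) + ip M g g)"
    by simp
  then show ?thesis by (simp add: ip_self)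
qed

text \<open>Expand both squares; Parseval's formula and the two isometries match them term by term.
  It serves as the inversion theorem: if the transform of \<open>f\<close> is \<open>m\<close>
  almost everywhere, then \<open>f\<close> is \<open>inv_fourier m\<close> almost
  everywhere.\<close>

lemma fourier_inversion_dist:
  fixes f m :: "'a::euclidean_space => complex"
  assumes f: "sqi lebesgue f" and m: "integrable lebesgue m" "sqi lebesgue m"
  shows "sqnorm lebesgue (\<lambda>x. f x - inv_fourier m x) = sqnorm lebesgue (\<lambda>y. fourier f y - m y)"
  using sqnorm_diff_ip[OF f inv_fourier_isometry(2)[OF m]] sqnorm_diff_ip[OF fourier_spec(1)[OF f] m(2)]
  by (simp add: parseval[OF f m] sqnorm_fourier[OF f] inv_fourier_isometry(3)[OF m])

subsection \<open>Weak second derivatives\<close>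

definition smooth :: "(real => real) => bool" where
  "smooth g \<longleftrightarrow> (\<forall>k x. (deriv ^^ k) g differentiable (at x))"

text \<open>A class of functions closed under differentiation consists of smooth functions. This
  replaces formulas for iterated derivatives throughout.\<close>

lemma smooth_coinduct:
  assumes "P g" and step: "\<And>g. P g ==> \<exists>g'. P g' \<and> (\<forall>x. (g has_real_derivative g' x) (at x))"
  shows "smooth g"
proof -
  have D: "P h ==> P (deriv h)" for h
    using step[of h] by (metis (no_types, lifting) DERIV_imp_deriv ext)
  have "P ((deriv ^^ k) g)" for k by (induction k) (auto simp: assms(1) D)
  then show ?thesis unfolding smooth_def
    using step real_differentiable_def by blast
qed

lemma smooth_D:
  assumes "smooth g" shows "(g has_real_derivative deriv g x) (at x)" "smooth (deriv g)"
proof -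
  have "(deriv ^^ 0) g differentiable (at x)" using assms unfolding smooth_def by blast
  then show "(g has_real_derivative deriv g x) (at x)"
    by (metis DERIV_deriv_iff_real_differentiable funpow_0)
  show "smooth (deriv g)" using assms unfolding smooth_def
    by (metis comp_apply funpow_Suc_right)
qed

lemma smooth_continuous: "smooth g ==> continuous_on S g"
  using smooth_D(1)[of g] by (meson DERIV_isCont continuous_at_imp_continuous_on)

lemma smooth_antiderivative:
  assumes "\<And>x. (g has_real_derivative g' x) (at x)" "smooth g'"
  shows "smooth g"
  by (rule smooth_coinduct[where P = "\<lambda>h. h = g \<or> smooth h"]) (use assms smooth_D in blast)+

lemma smooth_affine:
  assumes "smooth f" shows "smooth (\<lambda>x. a * f (b * x + c))"
proof (rule smooth_coinduct[where P = "\<lambda>h. \<exists>f a. smooth f \<and> h = (\<lambda>x. a * f (b * x + c))"])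
  show "\<exists>f' a'. smooth f' \<and> (\<lambda>x. a * f (b * x + c)) = (\<lambda>x. a' * f' (b * x + c))" using assms by blast
next
  fix g assume "\<exists>f a. smooth f \<and> g = (\<lambda>x. a * f (b * x + c))"
  then obtain f a where f: "smooth f" and g: "g = (\<lambda>x. a * f (b * x + c))" by blast
  have "(g has_real_derivative (a * b) * deriv f (b * x + c)) (at x)" for x
  proof -
    have "((\<lambda>x. f (b * x + c)) has_real_derivative deriv f (b * x + c) * b) (at x)"
      by (rule DERIV_chain2[OF smooth_D(1)[OF f]]) (auto intro!: derivative_eq_intros)
    from DERIV_cmult[OF this, of a] show ?thesis unfolding g by (simp add: mult_ac)
  qed
  then show "\<exists>g'. (\<exists>f a. smooth f \<and> g' = (\<lambda>x. a * f (b * x + c))) \<and> (\<forall>x. (g has_real_derivative g' x) (at x))"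
    using smooth_D(2)[OF f] by blast
qed

lemma smooth_add:
  assumes "smooth f" "smooth g" shows "smooth (\<lambda>x. f x + g x)"
  by (rule smooth_coinduct[where P = "\<lambda>h. \<exists>f g. smooth f \<and> smooth g \<and> h = (\<lambda>x. f x + g x)"])
     (use assms smooth_D in \<open>blast, blast intro: DERIV_add\<close>)

text \<open>Products alone are not closed under the product rule; their finite sums are.\<close>

inductive sum_of_products :: "(real => real) => bool" where
  "smooth f ==> smooth g ==> sum_of_products (\<lambda>x. f x * g x)"
| "sum_of_products u ==> sum_of_products v ==> sum_of_products (\<lambda>x. u x + v x)"

lemma smooth_mult:
  assumes "smooth f" "smooth g" shows "smooth (\<lambda>x. f x * g x)"
proof (rule smooth_coinduct[where P = sum_of_products])
  show "sum_of_products (\<lambda>x. f x * g x)" using assms by (rule sum_of_products.intros)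
next
  fix u assume "sum_of_products u"
  then show "\<exists>u'. sum_of_products u' \<and> (\<forall>x. (u has_real_derivative u' x) (at x))"
  proof induction
    case (1 f g)
    have "sum_of_products (\<lambda>x. deriv f x * g x + f x * deriv g x)"
      by (intro sum_of_products.intros 1 smooth_D)
    moreover have "((\<lambda>x. f x * g x) has_real_derivative deriv f x * g x + f x * deriv g x) (at x)" for x
      using DERIV_mult[OF smooth_D(1)[OF 1(1)] smooth_D(1)[OF 1(2)], of x] by (simp add: mult.commute add.commute)
    ultimately show ?case by blast
  next
    case (2 u v)
    then show ?case by (blast intro: sum_of_products.intros DERIV_add)
  qed
qed

text \<open>The polynomials in \<open>1/s\<close> are there because every derivative of
  \<open>exp (- 1/s)\<close>, extended by 0, is again of this form.\<close>

definition flat :: "real poly => real => real" where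
  "flat q s = (if s > 0 then poly q (inverse s) * exp (- inverse s) else 0)"

lemma poly_exp_tendsto_0: "((\<lambda>y. poly q y * exp (- y)) \<longlongrightarrow> (0::real)) at_top"
proof -
  have "((\<lambda>y. \<Sum>i\<le>degree q. coeff q i * (y ^ i / exp y)) \<longlongrightarrow> (\<Sum>i\<le>degree q. coeff q i * 0)) at_top"
    by (intro tendsto_sum tendsto_mult_left tendsto_power_div_exp_0)
  moreover have "(\<Sum>i\<le>degree q. coeff q i * (y ^ i / exp y)) = poly q y * exp (- y)" for y
    by (simp add: poly_altdef exp_minus sum_distrib_right divide_inverse mult.assoc)
  ultimately show ?thesis by simp
qed

text \<open>The factor \<open>[:0, 0, 1:]\<close> is the \<open>1/s^2\<close> from the chain rule.
  At 0 the difference quotient is \<open>y q(y) exp (- y)\<close> with \<open>y = 1/s\<close>, which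
  tends to 0.\<close>

lemma flat_derivative: "(flat q has_real_derivative flat ((q - pderiv q) * [:0, 0, 1:]) s) (at s)"
proof -
  consider "s > 0" | "s < 0" | "s = 0" by linarith
  then show ?thesis
  proof cases
    case 1
    have i: "(inverse has_real_derivative - ((inverse s)\<^sup>2)) (at s)"
      using DERIV_inverse[of s UNIV] 1 by (simp add: power2_eq_square)
    have "((\<lambda>s. poly q (inverse s)) has_real_derivative poly (pderiv q) (inverse s) * - ((inverse s)\<^sup>2)) (at s)"
      by (rule DERIV_chain2[OF poly_DERIV i])
    moreover have "((\<lambda>s. exp (- inverse s)) has_real_derivative exp (- inverse s) * (inverse s)\<^sup>2) (at s)"
      using DERIV_fun_exp[OF DERIV_minus[OF i]] by simp
    ultimately have "((\<lambda>s. poly q (inverse s) * exp (- inverse s)) has_real_derivative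
       poly (pderiv q) (inverse s) * - ((inverse s)\<^sup>2) * exp (- inverse s) + exp (- inverse s) * (inverse s)\<^sup>2 * poly q (inverse s)) (at s)"
      by (rule DERIV_mult)
    moreover have "poly (pderiv q) (inverse s) * - ((inverse s)\<^sup>2) * exp (- inverse s) + exp (- inverse s) * (inverse s)\<^sup>2 * poly q (inverse s)
       = flat ((q - pderiv q) * [:0, 0, 1:]) s"
      using 1 by (simp add: flat_def power2_eq_square algebra_simps)
    ultimately have "((\<lambda>s. poly q (inverse s) * exp (- inverse s)) has_real_derivative flat ((q - pderiv q) * [:0, 0, 1:]) s) (at s)"
      by simp
    then show ?thesis
      by (rule has_field_derivative_transform_within_open[of _ _ _ "{0<..}"]) (use 1 in \<open>auto simp: flat_def\<close>)
  next
    case 2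
    have "((\<lambda>s. 0) has_real_derivative flat ((q - pderiv q) * [:0, 0, 1:]) s) (at s)"
      using 2 by (auto simp: flat_def intro!: derivative_eq_intros)
    then show ?thesis
      by (rule has_field_derivative_transform_within_open[of _ _ _ "{..<0}"]) (use 2 in \<open>auto simp: flat_def\<close>)
  next
    case 3
    have "((\<lambda>y. poly (q * [:0, 1:]) y * exp (- y)) \<longlongrightarrow> 0) at_top" by (rule poly_exp_tendsto_0)
    then have "((\<lambda>s. poly (q * [:0, 1:]) (inverse s) * exp (- inverse s)) \<longlongrightarrow> 0) (at_right (0::real))"
      by (rule filterlim_compose[OF _ filterlim_inverse_at_top_right])
    then have R: "((\<lambda>h. (flat q (0 + h) - flat q 0) / h) \<longlongrightarrow> 0) (at_right 0)"
      by (rule Lim_transform_eventually)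
         (auto simp: flat_def eventually_at_right_less inverse_eq_divide field_simps intro!: eventually_at_rightI[of 0 1])
    have L: "((\<lambda>h. (flat q (0 + h) - flat q 0) / h) \<longlongrightarrow> 0) (at_left 0)"
      by (rule Lim_transform_eventually[OF tendsto_const])
         (auto simp: flat_def intro!: eventually_at_leftI[of "-1" 0])
    have "((\<lambda>h. (flat q (0 + h) - flat q 0) / h) \<longlongrightarrow> 0) (at 0)"
      using L R by (simp add: filterlim_at_split)
    then have "(flat q has_real_derivative 0) (at 0)" by (simp add: DERIV_def)
    then show ?thesis using 3 by (simp add: flat_def)
  qed
qed

lemma smooth_flat: "smooth (flat q)"
  by (rule smooth_coinduct[where P = "\<lambda>h. \<exists>q. h = flat q"]) (use flat_derivative in blast)+

lemma bump_exists:
  obtains \<eta> :: "real => real" where "smooth \<eta>" "\<And>x. 0 \<le> \<eta> x" "\<And>x. x \<notin> {-1..1} ==> \<eta> x = 0"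
    "(\<eta> has_integral 1) {-1..1}"
proof -
  define b where "b s = flat 1 (1 + s) * flat 1 (1 - s)" for s
  have b: "smooth b"
    unfolding b_def using smooth_mult[OF smooth_affine[OF smooth_flat, of 1 1 1 1] smooth_affine[OF smooth_flat, of 1 1 "-1" 1]]
    by (simp add: add.commute)
  have nn: "0 \<le> b x" for x by (simp add: b_def flat_def)
  have z: "b x = 0" if "x \<notin> {-1..1}" for x using that by (auto simp: b_def flat_def)
  have c: "continuous_on {-1..1} b" by (rule smooth_continuous[OF b])
  have i: "b integrable_on {-1..1}" using c by (rule integrable_continuous_real)
  have "integral {-1..1} b \<noteq> 0"
  proof
    assume "integral {-1..1} b = 0"
    then have "b 0 = 0"
      using integral_eq_0_iff[OF c] nn by auto
    then show False by (simp add: b_def flat_def)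
  qed
  moreover have "0 \<le> integral {-1..1} b" using nn by (intro integral_nonneg i) auto
  ultimately have I: "0 < integral {-1..1} b" by simp
  show ?thesis
  proof (rule that[of "\<lambda>x. 1 / integral {-1..1} b * b x"])
    show "smooth (\<lambda>x. 1 / integral {-1..1} b * b x)"
      using smooth_affine[OF b, of "1 / integral {-1..1} b" 1 0] by simp
    show "((\<lambda>x. 1 / integral {-1..1} b * b x) has_integral 1) {-1..1}"
      using has_integral_mult_right[OF integrable_integral[OF i], of "1 / integral {-1..1} b"] I by simp
  qed (use I nn z in auto)
qed

lemma integral_eq_on_larger:
  fixes f :: "real => real"
  assumes "\<And>x. x \<notin> {a..b} ==> f x = 0" "{a..b} \<subseteq> S" "(f has_integral I) {a..b}"
  shows "(f has_integral I) S"
  using has_integral_on_superset[OF assms(3) _ assms(2)] assms(1) by auto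

lemma mollify:
  fixes c :: "real => real"
  assumes \<eta>: "smooth \<eta>" "\<And>x. 0 \<le> \<eta> x" "\<And>x. x \<notin> {-1..1} ==> \<eta> x = 0" "(\<eta> has_integral 1) {-1..1}"
    and d: "d > 0" and c: "continuous_on {y-d..y+d} c" and e: "\<And>s. s \<in> {y-d..y+d} ==> \<bar>c s - c y\<bar> \<le> e"
  shows "\<bar>integral {y-d..y+d} (\<lambda>s. c s * (\<eta> ((s - y) / d) / d)) - c y\<bar> \<le> e"
proof -
  let ?k = "\<lambda>s. \<eta> ((s - y) / d) / d"
  have k0: "0 \<le> ?k s" for s using \<eta>(2) d by simp
  have kc: "continuous_on S ?k" for S
  proof -
    have "continuous_on S (\<lambda>s. (s - y) / d)" using d by (intro continuous_intros) auto
    then have "continuous_on S (\<lambda>s. \<eta> ((s - y) / d))"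
      by (rule continuous_on_compose2[OF smooth_continuous[OF \<eta>(1)] _ subset_UNIV])
    then show ?thesis using d by (intro continuous_on_divide continuous_on_const) auto
  qed
  have "((\<lambda>s. \<eta> ((1/d) *\<^sub>R s + - y / d)) has_integral (1 / (\<bar>1/d\<bar> ^ DIM(real))) *\<^sub>R 1) ((\<lambda>x. (1 / (1/d)) *\<^sub>R x + -((1 / (1/d)) *\<^sub>R (- y / d))) ` cbox (-1) 1)"
    by (rule has_integral_affinity) (use \<eta>(4) d in auto)
  moreover have "(\<lambda>x. (1 / (1/d)) *\<^sub>R x + -((1 / (1/d)) *\<^sub>R (- y / d))) ` cbox (-1) 1 = {y-d..y+d}"
  proof -
    have "(\<lambda>x. (1 / (1/d)) *\<^sub>R x + -((1 / (1/d)) *\<^sub>R (- y / d))) ` cbox (-1) 1 = (\<lambda>x. d * x + y) ` {-1..1}"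
      using d by simp
    also have "\<dots> = {y-d..y+d}" using d by (subst image_affinity_atLeastAtMost) (auto simp: algebra_simps)
    finally show ?thesis .
  qed
  moreover have "(\<lambda>s. \<eta> ((1/d) *\<^sub>R s + - y / d)) = (\<lambda>s. \<eta> ((s - y) / d))"
    by (simp add: diff_divide_distrib)
  moreover have "(1 / (\<bar>1/d\<bar> ^ DIM(real))) *\<^sub>R (1::real) = d" using d by simp
  ultimately have "((\<lambda>s. \<eta> ((s - y) / d)) has_integral d) {y-d..y+d}"
    by (simp only:)
  from has_integral_mult_right[OF this, of "1/d"] have k1: "(?k has_integral 1) {y-d..y+d}"
    using d by simp
  have i1: "(\<lambda>s. c s * ?k s) integrable_on {y-d..y+d}"
    by (intro integrable_continuous_real continuous_intros c kc)
  have i2: "((\<lambda>s. c y * ?k s) has_integral c y) {y-d..y+d}"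
    using has_integral_mult_right[OF k1, of "c y"] by simp
  have i3: "((\<lambda>s. e * ?k s) has_integral e) {y-d..y+d}"
    using has_integral_mult_right[OF k1, of e] by simp
  have "integral {y-d..y+d} (\<lambda>s. c s * ?k s) - c y = integral {y-d..y+d} (\<lambda>s. c s * ?k s - c y * ?k s)"
    unfolding Henstock_Kurzweil_Integration.integral_diff[OF i1 has_integral_integrable[OF i2]] integral_unique[OF i2] ..
  also have "\<bar>\<dots>\<bar> \<le> integral {y-d..y+d} (\<lambda>s. e * ?k s)"
    unfolding real_norm_def[symmetric]
  proof (rule integral_norm_bound_integral)
    show "(\<lambda>s. c s * ?k s - c y * ?k s) integrable_on {y-d..y+d}"
      using i1 i2 by (intro integrable_diff) auto
    show "(\<lambda>s. e * ?k s) integrable_on {y-d..y+d}" using i3 by auto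
    fix s assume s: "s \<in> {y-d..y+d}"
    have "norm (c s * ?k s - c y * ?k s) = \<bar>c s - c y\<bar> * ?k s"
      unfolding left_diff_distrib[symmetric] real_norm_def abs_mult abs_of_nonneg[OF k0] ..
    also have "\<dots> \<le> e * ?k s" using e[OF s] k0[of s] by (rule mult_right_mono)
    finally show "norm (c s * ?k s - c y * ?k s) \<le> e * ?k s" .
  qed
  also have "\<dots> = e" using i3 by (rule integral_unique)
  finally show ?thesis .
qed

lemma test_function_iff: "test_function g \<longleftrightarrow> smooth g \<and> (\<exists>a b. 0 < a \<and> (\<forall>x. x \<notin> {a..b} --> g x = 0))"
  unfolding test_function_def smooth_def ..

lemma deriv_zero_outside:
  fixes g :: "real => real"
  assumes "\<And>x. x \<notin> {a..b} ==> g x = 0" "x \<notin> {a..b}"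
  shows "deriv g x = 0"
proof -
  have "((\<lambda>x. 0) has_real_derivative 0) (at x)" by simp
  then have "(g has_real_derivative 0) (at x)"
    by (rule has_field_derivative_transform_within_open[of _ _ _ "- {a..b}"]) (use assms in \<open>auto simp: open_Compl\<close>)
  then show ?thesis by (rule DERIV_imp_deriv)
qed

lemma LINT_half_line:
  fixes f :: "real => real"
  assumes "\<And>x. x \<notin> {a..b} ==> f x = 0" "0 < a" "continuous_on {a..b} f"
  shows "(LINT s:{0..}|lebesgue. f s) = integral {a..b} f"
proof -
  have "(LINT s:{0..}|lebesgue. f s) = (LINT s:{a..b}|lebesgue. f s)"
    unfolding set_lebesgue_integral_def using assms(1,2)
    by (intro Bochner_Integration.integral_cong) (auto simp: indicator_def)
  also have "\<dots> = integral {a..b} f"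
    by (rule set_lebesgue_integral_eq_integral(2)) (use absolutely_integrable_continuous_real[OF assms(3)] in simp)
  finally show ?thesis .
qed

text \<open>Integration by parts twice, in one stroke: \<open>\<Phi> g' - \<Psi> g\<close> is an
  antiderivative of \<open>\<Phi> g'' - \<Theta> g\<close>.\<close>

lemma weak_second_derivative:
  fixes \<Phi> \<Psi> \<Theta> :: "real => real"
  assumes g: "test_function g"
    and D1: "\<And>s. s > 0 ==> (\<Phi> has_real_derivative \<Psi> s) (at s)"
    and D2: "\<And>s. s > 0 ==> (\<Psi> has_real_derivative \<Theta> s) (at s)"
    and C: "continuous_on {0<..} \<Theta>"
  shows "(LINT s:{0..}|lebesgue. \<Phi> s * deriv (deriv g) s) = (LINT s:{0..}|lebesgue. \<Theta> s * g s)"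
proof -
  obtain a b where sm: "smooth g" and a: "0 < a" and z: "\<And>x. x \<notin> {a..b} ==> g x = 0"
    using g by (auto simp: test_function_iff)
  have z1: "deriv g x = 0" if "x \<notin> {a..b}" for x by (rule deriv_zero_outside[OF z that])
  have z2: "deriv (deriv g) x = 0" if "x \<notin> {a..b}" for x by (rule deriv_zero_outside[OF z1 that])
  \<comment> \<open>The endpoints lie strictly outside the support, so that \<open>g\<close> and
    \<open>g'\<close> vanish there.\<close>
  define a' where "a' = a / 2"
  define b' where "b' = max a b + 1"
  have ab: "0 < a'" "a' < a" "b < b'" "a' \<le> b'" using a by (auto simp: a'_def b'_def)
  have Phic: "continuous_on {a'..b'} \<Phi>"
    using ab by (intro continuous_at_imp_continuous_on ballI DERIV_isCont[OF D1]) auto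
  have Thc: "continuous_on {a'..b'} \<Theta>"
    using C ab by (elim continuous_on_subset) auto
  have 1: "(LINT s:{0..}|lebesgue. \<Phi> s * deriv (deriv g) s) = integral {a'..b'} (\<lambda>s. \<Phi> s * deriv (deriv g) s)"
    using z2 ab by (intro LINT_half_line continuous_intros Phic smooth_continuous smooth_D sm) auto
  have 2: "(LINT s:{0..}|lebesgue. \<Theta> s * g s) = integral {a'..b'} (\<lambda>s. \<Theta> s * g s)"
    using z ab by (intro LINT_half_line continuous_intros Thc smooth_continuous sm) auto
  have "((\<lambda>s. \<Phi> s * deriv (deriv g) s - \<Theta> s * g s) has_integral
     (\<Phi> b' * deriv g b' - \<Psi> b' * g b') - (\<Phi> a' * deriv g a' - \<Psi> a' * g a')) {a'..b'}"
  proof (rule fundamental_theorem_of_calculus[OF ab(4)])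
    fix s assume "s \<in> {a'..b'}"
    then have "s > 0" using ab by auto
    have "((\<lambda>s. \<Phi> s * deriv g s - \<Psi> s * g s) has_real_derivative
      (\<Psi> s * deriv g s + deriv (deriv g) s * \<Phi> s) - (\<Theta> s * g s + deriv g s * \<Psi> s)) (at s)"
      using \<open>s > 0\<close> by (intro DERIV_diff DERIV_mult D1 D2 smooth_D sm)
    then show "((\<lambda>s. \<Phi> s * deriv g s - \<Psi> s * g s) has_vector_derivative
      \<Phi> s * deriv (deriv g) s - \<Theta> s * g s) (at s within {a'..b'})"
      unfolding has_real_derivative_iff_has_vector_derivative
      by (simp add: algebra_simps has_vector_derivative_at_within)
  qed
  moreover have "g a' = 0" "g b' = 0" "deriv g a' = 0" "deriv g b' = 0"
    using ab by (auto intro!: z z1)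
  ultimately have "integral {a'..b'} (\<lambda>s. \<Phi> s * deriv (deriv g) s - \<Theta> s * g s) = 0"
    by (simp add: integral_unique)
  moreover have "integral {a'..b'} (\<lambda>s. \<Phi> s * deriv (deriv g) s - \<Theta> s * g s) =
     integral {a'..b'} (\<lambda>s. \<Phi> s * deriv (deriv g) s) - integral {a'..b'} (\<lambda>s. \<Theta> s * g s)"
    by (intro Henstock_Kurzweil_Integration.integral_diff integrable_continuous_real continuous_intros Phic Thc smooth_continuous smooth_D sm)
  ultimately show ?thesis using 1 2 by simp
qed

text \<open>A second difference of a mollifier is the second derivative of a test function.\<close>

lemma weakly_affine_imp_midpoint:
  fixes c :: "real => real"
  assumes c: "continuous_on {0<..} c"
    and w: "\<And>g. test_function g ==> (LINT s:{0..}|lebesgue. c s * deriv (deriv g) s) = 0"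
    and h: "0 < h" "h < x"
  shows "c (x - h) - 2 * c x + c (x + h) = 0"
proof -
  obtain \<eta> :: "real => real" where \<eta>: "smooth \<eta>" "\<And>x. 0 \<le> \<eta> x" "\<And>x. x \<notin> {-1..1} ==> \<eta> x = 0"
    "(\<eta> has_integral 1) {-1..1}" using bump_exists by blast
  have "\<bar>c (x - h) - 2 * c x + c (x + h)\<bar> \<le> 4 * e" if e: "e > 0" for e
  proof -
    have "\<exists>d>0. \<forall>d'. 0 < d' \<and> d' \<le> d --> d' < y \<and> (\<forall>s\<in>{y-d'..y+d'}. \<bar>c s - c y\<bar> \<le> e)" if y: "y > 0" for y
    proof -
      have "isCont c y" using c y by (simp add: continuous_on_eq_continuous_at)
      then obtain d where d: "d > 0" "\<And>s. \<bar>s - y\<bar> < d ==> \<bar>c s - c y\<bar> < e"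
        using e by (auto simp: continuous_at_eps_delta dist_real_def)
      show ?thesis
      proof (intro exI[of _ "min (d/2) (y/2)"] conjI allI impI ballI)
        fix d' s assume "0 < d' \<and> d' \<le> min (d/2) (y/2)" "s \<in> {y-d'..y+d'}"
        then have "\<bar>s - y\<bar> < d" using d(1) by auto
        then show "\<bar>c s - c y\<bar> \<le> e" using d(2) by (simp add: less_imp_le)
      qed (use d y in auto)
    qed
    note near = this
    obtain d1 where d1: "d1 > 0" "\<And>d'. 0 < d' ==> d' \<le> d1 ==> d' < x - h \<and> (\<forall>s\<in>{x-h-d'..x-h+d'}. \<bar>c s - c (x-h)\<bar> \<le> e)"
      using near[of "x - h"] h by auto
    obtain d2 where d2: "d2 > 0" "\<And>d'. 0 < d' ==> d' \<le> d2 ==> d' < x \<and> (\<forall>s\<in>{x-d'..x+d'}. \<bar>c s - c x\<bar> \<le> e)"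
      using near[of x] h by auto
    obtain d3 where d3: "d3 > 0" "\<And>d'. 0 < d' ==> d' \<le> d3 ==> d' < x + h \<and> (\<forall>s\<in>{x+h-d'..x+h+d'}. \<bar>c s - c (x+h)\<bar> \<le> e)"
      using near[of "x + h"] h by auto
    \<comment> \<open>One radius for all three points; \<open>r < x - h\<close> keeps the support of
      the test function inside the open half-line.\<close>
    define r where "r = min d1 (min d2 d3)"
    have r: "r > 0" "r \<le> d1" "r \<le> d2" "r \<le> d3" using d1(1) d2(1) d3(1) by (auto simp: r_def)
    have "r < x - h" using d1(2)[of r] r by simp
    note r = r(1) this r(2-)
    have mol: "\<bar>integral {y-r..y+r} (\<lambda>s. c s * (\<eta> ((s - y) / r) / r)) - c y\<bar> \<le> e" if "y = x - h \<or> y = x \<or> y = x + h" for y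
    proof (rule mollify[OF \<eta> r(1)])
      show "continuous_on {y-r..y+r} c" using c that r h by (elim continuous_on_subset) auto
      show "\<bar>c s - c y\<bar> \<le> e" if "s \<in> {y-r..y+r}" for s
        using \<open>y = x - h \<or> y = x \<or> y = x + h\<close> d1(2)[OF r(1,3)] d2(2)[OF r(1,4)] d3(2)[OF r(1,5)] that by blast
    qed
    \<comment> \<open>\<open>N\<close> rises from 0 on the left of -1 to 1 on the right of 1; its
      antiderivative \<open>B\<close> continues from 0 into an affine function of slope 1.\<close>
    define N where "N s = integral {-1..s} \<eta>" for s
    define B where "B s = integral {-1..s} N" for s
    have \<eta>c: "continuous_on S \<eta>" for S by (rule smooth_continuous[OF \<eta>(1)])
    have antider: "((\<lambda>s. integral {-1..s} f) has_real_derivative f s) (at s)"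
      if f: "continuous_on UNIV f" "\<And>s. s \<le> -1 ==> f s = 0" for f :: "real => real" and s
    proof (cases "s > -1")
      case True
      have "((\<lambda>s. integral {-1..s} f) has_vector_derivative f s) (at s within {-1..s+1})"
        by (rule integral_has_vector_derivative) (use f True in \<open>auto intro: continuous_on_subset\<close>)
      moreover have "at s within {-1..s+1} = at s" using True by (intro at_within_interior) (auto simp: interior_atLeastAtMost_real)
      ultimately show ?thesis by (simp add: has_real_derivative_iff_has_vector_derivative)
    next
      case False
      \<comment> \<open>\<open>{-1..t}\<close> is empty for \<open>t < -1\<close>. As
        \<open>f\<close> vanishes up to -1, moving the base point to \<open>s - 1\<close> changes
        nothing and yields a two-sided derivative.\<close>
      have e: "integral {-1..t} f = integral {s-1..t} f" if "t > s - 1" for t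
      proof (cases "t \<le> -1")
        case True
        have "integral {-1..t} f = 0" using True f(2) by (cases "t = -1") auto
        moreover have "integral {s-1..t} f = integral {s-1..t} (\<lambda>_. 0)"
          using True f(2) by (intro Henstock_Kurzweil_Integration.integral_cong) auto
        ultimately show ?thesis by simp
      next
        case t: False
        have "integral {s-1..-1} f + integral {-1..t} f = integral {s-1..t} f"
          using t False f(1) by (intro Henstock_Kurzweil_Integration.integral_combine integrable_continuous_real) (auto intro: continuous_on_subset)
        moreover have "integral {s-1..-1} f = integral {s-1..-1} (\<lambda>_. 0)"
          using f(2) by (intro Henstock_Kurzweil_Integration.integral_cong) auto
        ultimately show ?thesis by simp
      qed
      have "((\<lambda>t. integral {s-1..t} f) has_vector_derivative f s) (at s within {s-1..s+1})"
        by (rule integral_has_vector_derivative) (use f in \<open>auto intro: continuous_on_subset\<close>)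
      moreover have "at s within {s-1..s+1} = at s" by (intro at_within_interior) (auto simp: interior_atLeastAtMost_real)
      ultimately have "((\<lambda>t. integral {s-1..t} f) has_real_derivative f s) (at s)"
        by (simp add: has_real_derivative_iff_has_vector_derivative)
      then show ?thesis
        by (rule has_field_derivative_transform_within_open[of _ _ _ "{s-1<..}"]) (auto simp: e)
    qed
    have \<eta>0: "\<eta> s = 0" if "s \<le> -1" for s
    proof (cases "s = -1")
      case True
      have "(\<eta> \<longlongrightarrow> \<eta> (-1)) (at_left (-1))" using \<eta>c[of UNIV]
        by (meson continuous_on_eq_continuous_at continuous_at_imp_continuous_at_within continuous_within UNIV_I open_UNIV)
      moreover have "(\<eta> \<longlongrightarrow> 0) (at_left (-1))"
        by (rule tendsto_eventually) (auto intro!: \<eta>(3) eventually_at_leftI[of "-2"])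
      ultimately show ?thesis using True tendsto_unique trivial_limit_at_left_real by blast
    qed (use that \<eta>(3) in auto)
    have N': "(N has_real_derivative \<eta> s) (at s)" for s
      unfolding N_def by (rule antider[OF \<eta>c \<eta>0])
    have N0: "N s = 0" if "s \<le> -1" for s unfolding N_def using that by (cases "s = -1") auto
    have B': "(B has_real_derivative N s) (at s)" for s
      unfolding B_def by (rule antider[OF _ N0]) (meson N' DERIV_isCont continuous_at_imp_continuous_on)
    have B0: "B s = 0" if "s \<le> -1" for s unfolding B_def using that by (cases "s = -1") auto
    have smB: "smooth B" by (rule smooth_antiderivative[OF B' smooth_antiderivative[OF N' \<eta>(1)]])
    have N1: "N s = 1" if "s \<ge> 1" for s
    proof -
      have "(\<eta> has_integral 1) {-1..s}" using integral_eq_on_larger[of "-1" 1 \<eta> "{-1..s}" 1] \<eta>(3,4) that by auto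
      then show ?thesis unfolding N_def by (rule integral_unique)
    qed
    have B1: "B s = B 1 + (s - 1)" if "s \<ge> 1" for s
    proof (cases "s = 1")
      case False
      then have "1 < s" using that by simp
      then obtain z where "1 < z" "z < s" "B s - B 1 = (s - 1) * N z"
        using MVT2[of 1 s B N] B' by blast
      then show ?thesis using N1[of z] by simp
    qed simp
    \<comment> \<open>The weights 1, -2, 1 annihilate affine functions, so the affine ends of the
      three copies of \<open>B\<close> cancel and \<open>g\<close> has compact support. The factor
      \<open>r\<close> makes \<open>g''\<close> a combination of bumps of mass 1.\<close>
    define g where "g s = r * B (1/r * s + - (x - h) / r) + (- 2 * r * B (1/r * s + - x / r) + r * B (1/r * s + - (x + h) / r))" for s
    have smg: "smooth g" unfolding g_def
      by (intro smooth_add smooth_affine smB)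
    have chain: "((\<lambda>s. F (1/r * s + a)) has_real_derivative F' (1/r * s + a) / r) (at s)"
      if "\<And>s. (F has_real_derivative F' s) (at s)" for F F' a s
    proof -
      have "((\<lambda>s. F (1/r * s + a)) has_real_derivative F' (1/r * s + a) * (1/r)) (at s)"
        by (rule DERIV_chain2[OF that]) (use r(1) in \<open>auto intro!: derivative_eq_intros\<close>)
      then show ?thesis by simp
    qed
    have g1: "deriv g s = N (1/r * s + - (x - h) / r) + (- 2 * N (1/r * s + - x / r) + N (1/r * s + - (x + h) / r))" for s
    proof (rule DERIV_imp_deriv)
      show "(g has_real_derivative N (1/r * s + - (x - h) / r) + (- 2 * N (1/r * s + - x / r) + N (1/r * s + - (x + h) / r))) (at s)"
      proof -
        have *: "((\<lambda>s. a * B (1/r * s + b)) has_real_derivative a * (N (1/r * s + b) / r)) (at s)" for a b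
          by (rule DERIV_cmult[OF chain[OF B']])
        show ?thesis unfolding g_def
          using DERIV_add[OF *[of r "- (x - h) / r"] DERIV_add[OF *[of "- 2 * r" "- x / r"] *[of r "- (x + h) / r"]]] r(1) by simp
      qed
    qed
    have g2: "deriv (deriv g) s = \<eta> ((s - (x - h)) / r) / r + (- 2 * (\<eta> ((s - x) / r) / r) + \<eta> ((s - (x + h)) / r) / r)" for s
    proof (rule DERIV_imp_deriv)
      have "(deriv g has_real_derivative \<eta> (1/r * s + - (x - h) / r) / r + (- 2 * (\<eta> (1/r * s + - x / r) / r) + \<eta> (1/r * s + - (x + h) / r) / r)) (at s)"
        unfolding g1[abs_def] by (intro DERIV_add DERIV_cmult chain N')
      then show "(deriv g has_real_derivative \<eta> ((s - (x - h)) / r) / r + (- 2 * (\<eta> ((s - x) / r) / r) + \<eta> ((s - (x + h)) / r) / r)) (at s)"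
        by (simp add: diff_divide_distrib add_divide_distrib algebra_simps)
    qed
    have gz: "g s = 0" if sout: "s \<notin> {x - h - r..x + h + r}" for s
    proof -
      consider "s < x - h - r" | "s > x + h + r" using sout by fastforce
      then show ?thesis
      proof cases
        case 1
        then have "1/r * s + - (x - h) / r \<le> -1" "1/r * s + - x / r \<le> -1" "1/r * s + - (x + h) / r \<le> -1"
          using r h by (auto simp: field_simps)
        then show ?thesis by (simp only: g_def B0)
      next
        case 2
        then have *: "1/r * s + - (x - h) / r \<ge> 1" "1/r * s + - x / r \<ge> 1" "1/r * s + - (x + h) / r \<ge> 1"
          using r h by (auto simp: field_simps)
        show ?thesis unfolding g_def B1[OF *(1)] B1[OF *(2)] B1[OF *(3)] using r by (simp add: field_simps)
      qed
    qed
    have "test_function g" unfolding test_function_iff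
      using smg gz r by (intro conjI exI[of _ "x - h - r"] exI[of _ "x + h + r"]) auto
    have cI: "continuous_on {x-h-r..x+h+r} c" by (rule continuous_on_subset[OF c]) (use r(1,2) h in auto)
    have kI: "continuous_on S (\<lambda>s. \<eta> ((s - y) / r) / r)" for S y
    proof -
      have "continuous_on S (\<lambda>s. (s - y) / r)" using r(1) by (intro continuous_intros) auto
      then have "continuous_on S (\<lambda>s. \<eta> ((s - y) / r))"
        by (rule continuous_on_compose2[OF \<eta>c _ subset_UNIV])
      then show ?thesis using r(1) by (intro continuous_on_divide continuous_on_const) auto
    qed
    from w[OF \<open>test_function g\<close>] have "0 = (LINT s:{0..}|lebesgue. c s * deriv (deriv g) s)" by simp
    also have "\<dots> = integral {x-h-r..x+h+r} (\<lambda>s. c s * deriv (deriv g) s)"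
    proof (rule LINT_half_line)
      show "continuous_on {x-h-r..x+h+r} (\<lambda>s. c s * deriv (deriv g) s)"
        by (intro continuous_on_mult cI smooth_continuous smooth_D smg)
      show "c s * deriv (deriv g) s = 0" if sout: "s \<notin> {x-h-r..x+h+r}" for s
        using deriv_zero_outside[OF deriv_zero_outside[OF gz] sout] by simp
      show "0 < x - h - r" using r(2) by simp
    qed
    also have "\<dots> = integral {x-h-r..x+h+r} (\<lambda>s. c s * (\<eta> ((s - (x - h)) / r) / r)) +
       (- 2 * integral {x-h-r..x+h+r} (\<lambda>s. c s * (\<eta> ((s - x) / r) / r)) + integral {x-h-r..x+h+r} (\<lambda>s. c s * (\<eta> ((s - (x + h)) / r) / r)))"
    proof (rule integral_unique)
      have i: "(\<lambda>s. c s * (\<eta> ((s - y) / r) / r)) integrable_on {x-h-r..x+h+r}" for y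
        by (intro integrable_continuous_real continuous_on_mult cI kI)
      show "((\<lambda>s. c s * deriv (deriv g) s) has_integral integral {x-h-r..x+h+r} (\<lambda>s. c s * (\<eta> ((s - (x - h)) / r) / r)) +
       (- 2 * integral {x-h-r..x+h+r} (\<lambda>s. c s * (\<eta> ((s - x) / r) / r)) + integral {x-h-r..x+h+r} (\<lambda>s. c s * (\<eta> ((s - (x + h)) / r) / r)))) {x-h-r..x+h+r}"
        using has_integral_add[OF integrable_integral[OF i] has_integral_add[OF has_integral_mult_right[OF integrable_integral[OF i], of "-2"] integrable_integral[OF i]]]
        unfolding g2 by (rule has_integral_eq[rotated]) (simp add: algebra_simps)
    qed
    finally have sum0: "0 = integral {x-h-r..x+h+r} (\<lambda>s. c s * (\<eta> ((s - (x - h)) / r) / r)) +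
       (- 2 * integral {x-h-r..x+h+r} (\<lambda>s. c s * (\<eta> ((s - x) / r) / r)) + integral {x-h-r..x+h+r} (\<lambda>s. c s * (\<eta> ((s - (x + h)) / r) / r)))" .
    have loc: "integral {x-h-r..x+h+r} (\<lambda>s. c s * (\<eta> ((s - y) / r) / r)) = integral {y-r..y+r} (\<lambda>s. c s * (\<eta> ((s - y) / r) / r))"
      if "y = x - h \<or> y = x \<or> y = x + h" for y
    proof -
      have zero: "c s * (\<eta> ((s - y) / r) / r) = 0" if "s \<notin> {y-r..y+r}" for s
      proof -
        have "\<eta> ((s - y) / r) = 0" using that r(1) by (intro \<eta>(3)) (auto simp: field_simps)
        then show ?thesis by simp
      qed
      have sub: "{y-r..y+r} \<subseteq> {x-h-r..x+h+r}" using that h by auto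
      have "continuous_on {y-r..y+r} (\<lambda>s. c s * (\<eta> ((s - y) / r) / r))"
        by (intro continuous_on_mult kI continuous_on_subset[OF cI sub])
      then have int: "(\<lambda>s. c s * (\<eta> ((s - y) / r) / r)) integrable_on {y-r..y+r}"
        by (rule integrable_continuous_real)
      show ?thesis
        by (rule integral_unique[OF integral_eq_on_larger[OF zero sub integrable_integral[OF int]]])
    qed
    have near': "\<bar>integral {x-h-r..x+h+r} (\<lambda>s. c s * (\<eta> ((s - y) / r) / r)) - c y\<bar> \<le> e"
      if y: "y = x - h \<or> y = x \<or> y = x + h" for y
      unfolding loc[OF y] by (rule mol[OF y])
    have "\<bar>integral {x-h-r..x+h+r} (\<lambda>s. c s * (\<eta> ((s - (x - h)) / r) / r)) - c (x - h)\<bar> \<le> e"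
      "\<bar>integral {x-h-r..x+h+r} (\<lambda>s. c s * (\<eta> ((s - x) / r) / r)) - c x\<bar> \<le> e"
      "\<bar>integral {x-h-r..x+h+r} (\<lambda>s. c s * (\<eta> ((s - (x + h)) / r) / r)) - c (x + h)\<bar> \<le> e"
      using near'[of "x - h"] near'[of x] near'[of "x + h"] by blast+
    then show ?thesis using sum0 by linarith
  qed
  note bound = this
  have "\<bar>c (x - h) - 2 * c x + c (x + h)\<bar> \<le> 0"
  proof (rule field_le_epsilon)
    fix e :: real assume "0 < e"
    then show "\<bar>c (x - h) - 2 * c x + c (x + h)\<bar> \<le> 0 + e" using bound[of "e / 4"] by simp
  qed
  then show ?thesis by simp
qed

subsection \<open>The profiles\<close>

lemma at_within_half_line: "s \<ge> 0 ==> s < b ==> at s within {0..} = at s within {0..(b::real)}"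
  by (rule at_within_nhd[of _ "{..<b}"]) auto

lemma continuous_on_half_lineI:
  fixes g :: "real => 'b::topological_space"
  assumes "\<And>S. S > 0 ==> continuous_on {0..S} g"
  shows "continuous_on {0..} g"
  unfolding continuous_on_def
proof
  fix x :: real assume "x \<in> {0..}"
  then have "(g \<longlongrightarrow> g x) (at x within {0..x+1})"
    using assms[of "x+1"] by (auto simp: continuous_on_def)
  then show "(g \<longlongrightarrow> g x) (at x within {0..})"
    using at_within_half_line[of x "x+1"] \<open>x \<in> {0..}\<close> by simp
qed

text \<open>Maximum principle: at the leftmost maximum point of a function with vanishing second
  differences the function would have to be even larger nearby.\<close>

lemma midpoint_max:
  fixes e :: "real => real"
  assumes c: "continuous_on {a..b} e" and ab: "a \<le> b"
    and m: "\<And>x h. 0 < h ==> a \<le> x - h ==> x + h \<le> b ==> e (x - h) - 2 * e x + e (x + h) = 0"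
    and z: "e a = 0" "e b = 0" and s: "s \<in> {a..b}"
  shows "e s \<le> 0"
proof (rule ccontr)
  assume pos: "\<not> e s \<le> 0"
  obtain x1 where x1: "x1 \<in> {a..b}" "\<And>y. y \<in> {a..b} ==> e y \<le> e x1"
    using continuous_attains_sup[OF compact_Icc _ c] ab by auto
  define K where "K = {x \<in> {a..b}. e x = e x1}"
  have "closed K" unfolding K_def
    by (rule continuous_closed_preimage_constant[OF c closed_atLeastAtMost])
  moreover have "bounded K" by (rule bounded_subset[of "{a..b}"]) (auto simp: K_def)
  ultimately have "compact K" by (simp add: compact_eq_bounded_closed)
  then obtain x0 where x0: "x0 \<in> K" "\<And>y. y \<in> K ==> x0 \<le> y"
    using compact_attains_inf[of K] x1(1) unfolding K_def by blast
  have M: "e x0 = e x1" "e x1 > 0" "x0 \<in> {a..b}"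
    using x0(1) x1(2)[OF s] pos unfolding K_def by auto
  then have "x0 \<noteq> a" "x0 \<noteq> b" using z by auto
  define h where "h = min (x0 - a) (b - x0)"
  have h: "0 < h" "a \<le> x0 - h" "x0 + h \<le> b"
    using M(3) \<open>x0 \<noteq> a\<close> \<open>x0 \<noteq> b\<close> by (auto simp: h_def)
  have "e (x0 - h) = 2 * e x0 - e (x0 + h)" using m[OF h] by simp
  also have "\<dots> \<ge> e x1" using x1(2)[of "x0 + h"] h M by auto
  finally have "e (x0 - h) = e x1" using x1(2)[of "x0 - h"] h by auto
  then have "x0 - h \<in> K" using h by (auto simp: K_def)
  then show False using x0(2)[of "x0 - h"] h by simp
qed

lemma midpoint_zero:
  fixes e :: "real => real"
  assumes c: "continuous_on {a..b} e" and ab: "a \<le> b"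
    and m: "\<And>x h. 0 < h ==> a \<le> x - h ==> x + h \<le> b ==> e (x - h) - 2 * e x + e (x + h) = 0"
    and z: "e a = 0" "e b = 0" and s: "s \<in> {a..b}"
  shows "e s = 0"
proof (rule antisym)
  show "e s \<le> 0" by (rule midpoint_max[OF assms])
  have m': "- e (x - h) - 2 * - e x + - e (x + h) = 0" if "0 < h" "a \<le> x - h" "x + h \<le> b" for x h
    using m[OF that] by simp
  have "- e s \<le> 0"
    by (rule midpoint_max[of a b "\<lambda>x. - e x", OF continuous_on_minus[OF c] ab m' _ _ s]) (use z in auto)
  then show "0 \<le> e s" by simp
qed

text \<open>On every interval the difference from the chord vanishes by
  \<open>midpoint_zero\<close>; comparison with the interval \<open>{1..2}\<close> puts all chords
  on one line.\<close>

lemma midpoint_affine: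
  fixes c :: "real => real"
  assumes c: "continuous_on {0<..} c"
    and m: "\<And>x h. 0 < h ==> h < x ==> c (x - h) - 2 * c x + c (x + h) = 0"
  shows "\<exists>p q. \<forall>s>0. c s = p + q * s"
proof -
  have aff: "c s = c a + (c b - c a) / (b - a) * (s - a)" if "0 < a" "a < b" "s \<in> {a..b}" for a b s
  proof -
    define k where "k = (c b - c a) / (b - a)"
    define e where "e s = c s - (c a + k * (s - a))" for s
    have "e s = 0"
    proof (rule midpoint_zero[of a b e s])
      show "continuous_on {a..b} e" unfolding e_def
        using that(1) by (intro continuous_intros continuous_on_subset[OF c]) auto
      show "e (x - h) - 2 * e x + e (x + h) = 0" if "0 < h" "a \<le> x - h" "x + h \<le> b" for x h
        using m[of h x] that \<open>0 < a\<close> unfolding e_def by (simp add: algebra_simps)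
    qed (use that in \<open>auto simp: e_def k_def\<close>)
    then show ?thesis by (simp add: e_def k_def)
  qed
  define q where "q = c 2 - c 1"
  have "c s = (c 1 - q) + q * s" if s: "s > 0" for s
  proof -
    consider "s \<in> {1..2}" | "s < 1" | "s > 2" by fastforce
    then show ?thesis
    proof cases
      case 1 then show ?thesis using aff[of 1 2 s] by (simp add: q_def algebra_simps)
    next
      case 2
      have 1: "c 1 = c s + (c 2 - c s) / (2 - s) * (1 - s)" using aff[of s 2 1] s 2 by simp
      have "c 1 * (2 - s) = c s * (2 - s) + (c 2 - c s) * (1 - s)"
        using arg_cong[OF 1, of "\<lambda>t. t * (2 - s)"] 2 by (simp add: distrib_right)
      then show ?thesis by (simp add: q_def algebra_simps)
    next
      case 3
      have 1: "c 2 = c 1 + (c s - c 1) / (s - 1) * (2 - 1)" using aff[of 1 s 2] s 3 by simp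
      have "c 2 * (s - 1) = c 1 * (s - 1) + (c s - c 1)"
        using arg_cong[OF 1, of "\<lambda>t. t * (s - 1)"] 3 by (simp add: distrib_right)
      then show ?thesis by (simp add: q_def algebra_simps)
    qed
  qed
  then show ?thesis by blast
qed

section \<open>Integral equations with the weight A\<close>

text \<open>The properties of \<open>A\<close> that both forms of the regularity hypothesis
  provide.\<close>

locale weight =
  fixes A :: "real => real"
  assumes A_cont: "continuous_on {0<..} A"
    and A_pos: "\<And>s. s > 0 ==> 0 < A s"
    and A_nonneg: "\<And>s. s \<ge> 0 ==> 0 \<le> A s"
    and A_int: "locally_integrable A"
begin

text \<open>\<open>I2 h\<close> solves \<open>w'' = A h\<close> with
  \<open>w(0) = w'(0) = 0\<close>. As \<open>A\<close> may be unbounded near 0, the differential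
  equation is carried up to the boundary in this integrated form.\<close>

definition I1 :: "(real => real) => real => real" where
  "I1 h s = integral {0..s} (\<lambda>r. A r * h r)"

definition I2 :: "(real => real) => real => real" where
  "I2 h s = integral {0..s} (I1 h)"

abbreviation Aint :: "(real => real) => bool" where
  "Aint h \<equiv> \<forall>S\<ge>0. (\<lambda>r. A r * h r) integrable_on {0..S}"

lemma A_abs_int: "S \<ge> 0 ==> A absolutely_integrable_on {0..S}"
  using A_int unfolding locally_integrable_def by auto

lemma Aint_continuous:
  assumes h: "continuous_on {0..} h" shows "Aint h"
proof (intro allI impI)
  fix S :: real assume S: "S \<ge> 0"
  have c: "continuous_on {0..S} h" using h by (rule continuous_on_subset) auto
  have "(\<lambda>r. h r * A r) absolutely_integrable_on {0..S}"
  proof (rule absolutely_integrable_bounded_measurable_product_real)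
    show "h \<in> borel_measurable (lebesgue_on {0..S})"
      by (rule continuous_imp_measurable_on_sets_lebesgue[OF c]) simp
    show "bounded (h ` {0..S})" by (rule compact_imp_bounded[OF compact_continuous_image[OF c compact_Icc]])
  qed (use A_abs_int[OF S] in auto)
  then show "(\<lambda>r. A r * h r) integrable_on {0..S}"
    using set_lebesgue_integral_eq_integral(1) by (simp add: mult.commute)
qed

lemma I1_0 [simp]: "I1 h 0 = 0" and I2_0 [simp]: "I2 h 0 = 0"
  by (simp_all add: I1_def I2_def)

lemma I1_continuous: assumes "Aint h" shows "continuous_on {0..} (I1 h)"
  unfolding I1_def using assms by (intro continuous_on_half_lineI indefinite_integral_continuous_1) auto

lemma I1_deriv:
  assumes h: "Aint h" and s: "s > 0" and c: "continuous_on {0<..} h"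
  shows "(I1 h has_real_derivative A s * h s) (at s)"
proof -
  have "isCont (\<lambda>r. A r * h r) s"
    using continuous_on_mult[OF A_cont c] s by (simp add: continuous_on_eq_continuous_at)
  then have "((\<lambda>u. integral {0..u} (\<lambda>r. A r * h r)) has_vector_derivative A s * h s) (at s within ({0..s+1} - {}))"
    using h s by (intro integral_has_vector_derivative_continuous_at) (auto simp: continuous_at_imp_continuous_at_within)
  moreover have "at s within {0..s+1} = at s" using s by (intro at_within_interior) (auto simp: interior_atLeastAtMost_real)
  ultimately show ?thesis
    unfolding I1_def[abs_def] by (simp add: has_real_derivative_iff_has_vector_derivative)
qed

lemma I2_deriv:
  assumes h: "Aint h" and s: "s \<ge> 0"
  shows "(I2 h has_real_derivative I1 h s) (at s within {0..})"
proof -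
  have "((\<lambda>u. integral {0..u} (I1 h)) has_vector_derivative I1 h s) (at s within {0..s+1})"
    using s by (intro integral_has_vector_derivative continuous_on_subset[OF I1_continuous[OF h]]) auto
  then show ?thesis using at_within_half_line[of s "s+1"] s
    unfolding I2_def[abs_def] by (simp add: has_real_derivative_iff_has_vector_derivative)
qed

lemma at_within_pos: "s > 0 ==> at s within {0..} = at (s::real)"
  by (rule at_within_interior) (simp add: interior_real_atLeast)

lemma I2_deriv_at: "Aint h ==> s > 0 ==> (I2 h has_real_derivative I1 h s) (at s)"
  using I2_deriv[of h s] at_within_pos[of s] by simp

lemma I2_continuous: "Aint h ==> continuous_on {0..} (I2 h)"
  using I2_deriv by (intro DERIV_continuous_on) auto

lemma I1_mono_fun:
  assumes "Aint h" "Aint k" "0 \<le> s" "\<And>r. 0 \<le> r ==> r \<le> s ==> h r \<le> k r"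
  shows "I1 h s \<le> I1 k s"
  unfolding I1_def using assms A_nonneg by (intro integral_le) (auto intro!: mult_left_mono)

lemma I2_mono_fun:
  assumes "Aint h" "Aint k" "0 \<le> s" "\<And>r. 0 \<le> r ==> r \<le> s ==> h r \<le> k r"
  shows "I2 h s \<le> I2 k s"
  unfolding I2_def
  by (intro integral_le integrable_continuous_real continuous_on_subset[OF I1_continuous] assms I1_mono_fun) (use assms in auto)

lemma I1_le:
  assumes "Aint h" "0 \<le> s" "s \<le> t" "\<And>r. 0 \<le> r ==> 0 \<le> h r"
  shows "I1 h s \<le> I1 h t"
  unfolding I1_def using assms A_nonneg
  by (intro integral_subset_le) auto

lemma I1_nonneg: "Aint h ==> 0 \<le> s ==> (\<And>r. 0 \<le> r ==> 0 \<le> h r) ==> 0 \<le> I1 h s"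
  using I1_le[of h 0 s] by simp

lemma I1_diff_le:
  assumes h: "Aint h" and ab: "0 \<le> a" "a \<le> b" and le: "\<And>r. a \<le> r ==> r \<le> b ==> h r \<le> c"
  shows "I1 h b - I1 h a \<le> c * (I1 (\<lambda>_. 1) b - I1 (\<lambda>_. 1) a)"
proof -
  have one: "Aint (\<lambda>_. 1)" by (rule Aint_continuous) (rule continuous_on_const)
  have d: "I1 k b - I1 k a = integral {a..b} (\<lambda>r. A r * k r)" if "Aint k" for k
    using that ab Henstock_Kurzweil_Integration.integral_combine[of 0 a b "\<lambda>r. A r * k r"] by (auto simp: I1_def)
  have i: "(\<lambda>r. A r * k r) integrable_on {a..b}" if "Aint k" for k
  proof (rule integrable_on_subinterval)
    show "(\<lambda>r. A r * k r) integrable_on {0..b}" using that ab by simp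
  qed (use ab in auto)
  have "integral {a..b} (\<lambda>r. A r * h r) \<le> integral {a..b} (\<lambda>r. c * (A r * 1))"
  proof (rule integral_le)
    show "(\<lambda>r. c * (A r * 1)) integrable_on {a..b}" using integrable_on_cmult_left[OF i[OF one], of c] by simp
    fix r assume "r \<in> {a..b}"
    then show "A r * h r \<le> c * (A r * 1)" using mult_left_mono[OF le[of r] A_nonneg[of r]] ab by (simp add: mult.commute)
  qed (rule i[OF h])
  then show ?thesis unfolding d[OF h] d[OF one] by simp
qed

primrec iter :: "real => nat => real => real" where
  "iter l 0 = (\<lambda>_. 1)"
| "iter l (Suc k) = (\<lambda>s. 1 + l * I2 (iter l k) s)"

text \<open>Picard iteration for \<open>p = 1 + l I2 p\<close>, starting from 1. On
  \<open>[0, S]\<close> the iterates stay below \<open>E s = exp (l S W s)\<close> with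
  \<open>W = I1 1\<close>. The iteration reproduces this bound since
  \<open>I2 E s \<le> S * I1 E s\<close> and \<open>l S I1 E = E - 1\<close>.\<close>

lemma iter_props:
  assumes l: "l \<ge> 0"
  shows "continuous_on {0..} (iter l k)" "\<And>s. s \<ge> 0 ==> iter l k s \<le> iter l (Suc k) s" "\<And>s. s \<ge> 0 ==> 1 \<le> iter l k s"
    "\<And>s S. 0 \<le> s ==> s \<le> S ==> iter l k s \<le> exp (l * S * I1 (\<lambda>_. 1) s)"
proof -
  show c: "continuous_on {0..} (iter l k)" for k
    by (induction k) (auto intro!: continuous_intros I2_continuous Aint_continuous)
  note Ai = Aint_continuous[OF c]
  show m: "iter l k s \<le> iter l (Suc k) s" if "s \<ge> 0" for s k
    using that
  proof (induction k arbitrary: s)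
    case 0
    have "0 \<le> I2 (\<lambda>_. 1) s"
      unfolding I2_def using 0 Ai[of 0] by (intro integral_nonneg integrable_continuous_real continuous_on_subset[OF I1_continuous] I1_nonneg) auto
    then show ?case using l by simp
  next
    case (Suc k)
    then show ?case using l I2_mono_fun[OF Ai[of k] Ai[of "Suc k"], of s] by (auto intro!: mult_left_mono)
  qed
  show "1 \<le> iter l k s" if "s \<ge> 0" for s
  proof (induction k)
    case (Suc k) then show ?case using m[OF that, of k] by simp
  qed simp
  show "iter l k s \<le> exp (l * S * I1 (\<lambda>_. 1) s)" if "0 \<le> s" "s \<le> S" for s S
    using that(1,2)
  proof (induction k arbitrary: s)
    case 0
    have "0 \<le> I1 (\<lambda>_. 1) s" using Ai[of 0] 0 by (intro I1_nonneg) auto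
    then show ?case using l 0 by simp
  next
    case (Suc k)
    define E where "E s = exp (l * S * I1 (\<lambda>_. 1) s)" for s
    have one: "Aint (\<lambda>_. 1)" using Ai[of 0] by simp
    have Ec: "continuous_on {0..} E" unfolding E_def by (intro continuous_intros I1_continuous one)
    have "((\<lambda>r. (l * S) * (A r * E r)) has_integral E s - E 0) {0..s}"
    proof (rule fundamental_theorem_of_calculus_interior[OF Suc.prems(1)])
      show "continuous_on {0..s} E" using Ec by (rule continuous_on_subset) auto
      fix r assume "r \<in> {0<..<s}"
      then have "(E has_real_derivative E r * (l * S * (A r * 1))) (at r)"
        unfolding E_def by (intro DERIV_fun_exp DERIV_cmult I1_deriv one) auto
      then show "(E has_vector_derivative (l * S) * (A r * E r)) (at r)"
        by (simp add: has_real_derivative_iff_has_vector_derivative mult_ac)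
    qed
    then have "integral {0..s} (\<lambda>r. (l * S) * (A r * E r)) = E s - E 0" by (rule integral_unique)
    then have EI: "l * S * I1 E s = E s - 1" by (simp add: I1_def E_def)
    have "I2 (iter l k) s \<le> integral {0..s} (\<lambda>_. I1 E s)"
      unfolding I2_def
    proof (rule integral_le)
      show "I1 (iter l k) integrable_on {0..s}"
        by (intro integrable_continuous_real continuous_on_subset[OF I1_continuous[OF Ai]]) auto
      fix r assume r: "r \<in> {0..s}"
      have "I1 (iter l k) r \<le> I1 E r"
        using r Suc by (intro I1_mono_fun Ai Aint_continuous[OF Ec]) (auto simp: E_def)
      also have "\<dots> \<le> I1 E s" using r by (intro I1_le Aint_continuous[OF Ec]) (auto simp: E_def)
      finally show "I1 (iter l k) r \<le> I1 E s" .
    qed auto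
    also have "\<dots> = s * I1 E s" using Suc.prems by simp
    also have "\<dots> \<le> S * I1 E s"
      using Suc.prems by (intro mult_right_mono I1_nonneg Aint_continuous[OF Ec]) (auto simp: E_def)
    finally have "l * I2 (iter l k) s \<le> l * (S * I1 E s)" using l by (rule mult_left_mono)
    then show ?case using EI by (simp add: E_def mult.assoc)
  qed
qed

text \<open>The iterates increase and are bounded, hence converge; dominated convergence, for
  \<open>I1\<close> and then for \<open>I2\<close>, passes to the limit in the recursion. Continuity
  of the limit is read off the integral equation.\<close>

lemma increasing_solution_exists:
  assumes l: "l \<ge> 0"
  shows "\<exists>p. Aint p \<and> continuous_on {0..} p \<and> (\<forall>s\<ge>0. p s \<ge> 1 \<and> p s = 1 + l * I2 p s)"
proof -
  note it = iter_props[OF l]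
  note Ai = Aint_continuous[OF it(1)]
  define p where "p s = lim (\<lambda>k. iter l k s)" for s
  have lim: "(\<lambda>k. iter l k s) ----> p s" if s: "s \<ge> 0" for s
  proof -
    have "incseq (\<lambda>k. iter l k s)" using it(2)[OF s] by (rule incseq_SucI)
    then have "convergent (\<lambda>k. iter l k s)"
    proof (rule incseq_convergent)
      show "\<forall>i. iter l i s \<le> exp (l * s * I1 (\<lambda>_. 1) s)" using it(4)[OF s order_refl] by blast
    qed (use convergentI in blast)
    then show ?thesis by (simp add: p_def convergent_LIMSEQ_iff)
  qed
  have 1: "(\<lambda>r. A r * p r) integrable_on {0..S}" "(\<lambda>k. I1 (iter l k) S) ----> I1 p S" if S: "S \<ge> 0" for S
  proof -
    define E where "E s = exp (l * S * I1 (\<lambda>_. 1) s)" for s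
    have Ec: "continuous_on {0..} E" unfolding E_def
      using Ai[of 0] by (intro continuous_intros I1_continuous) auto
    have b: "norm (A x * iter l k x) \<le> A x * E x" if "x \<in> {0..S}" for k x
      using it(4)[of x S k] it(3)[of x k] that A_nonneg[of x] by (auto simp: E_def abs_mult intro!: mult_left_mono)
    have cv: "(\<lambda>k. A x * iter l k x) ----> A x * p x" if "x \<in> {0..S}" for x
      using that lim by (intro tendsto_mult_left) auto
    have f: "(\<lambda>r. A r * iter l k r) integrable_on {0..S}" for k using Ai[of k] S by blast
    have h: "(\<lambda>r. A r * E r) integrable_on {0..S}" using Aint_continuous[OF Ec] S by blast
    show "(\<lambda>r. A r * p r) integrable_on {0..S}" "(\<lambda>k. I1 (iter l k) S) ----> I1 p S"
      unfolding I1_def using dominated_convergence[OF f h b cv] by auto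
  qed
  have pA: "Aint p" using 1(1) by blast
  have 2: "(\<lambda>k. I2 (iter l k) S) ----> I2 p S" if S: "S \<ge> 0" for S
  proof -
    have f: "I1 (iter l k) integrable_on {0..S}" for k
      by (intro integrable_continuous_real continuous_on_subset[OF I1_continuous[OF Ai]]) auto
    define M where "M = I1 (\<lambda>_. exp (l * S * I1 (\<lambda>_. 1) S)) S"
    have M1: "Aint (\<lambda>_. exp (l * S * I1 (\<lambda>_. 1) S))" by (intro Aint_continuous continuous_on_const)
    have le: "norm (I1 (iter l k) x) \<le> M" if x: "x \<in> {0..S}" for k x
    proof -
      have "I1 (iter l k) x \<le> I1 (\<lambda>_. exp (l * S * I1 (\<lambda>_. 1) S)) x"
      proof (rule I1_mono_fun[OF Ai M1])
        fix r assume r: "0 \<le> r" "r \<le> x"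
        have "iter l k r \<le> exp (l * S * I1 (\<lambda>_. 1) r)" using it(4)[of r S k] r x by auto
        also have "\<dots> \<le> exp (l * S * I1 (\<lambda>_. 1) S)"
          using l x r Ai[of 0] by (auto intro!: mult_left_mono I1_le)
        finally show "iter l k r \<le> exp (l * S * I1 (\<lambda>_. 1) S)" .
      qed (use x in auto)
      also have "\<dots> \<le> M" unfolding M_def using x by (intro I1_le M1) auto
      finally have "I1 (iter l k) x \<le> M" .
      moreover have "0 \<le> iter l k r" if "0 \<le> r" for r using it(3)[OF that, of k] by simp
      then have "0 \<le> I1 (iter l k) x" using x by (intro I1_nonneg Ai) auto
      ultimately show ?thesis by simp
    qed
    have cv: "(\<lambda>k. I1 (iter l k) x) ----> I1 p x" if "x \<in> {0..S}" for x using 1(2) that by simp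
    show ?thesis unfolding I2_def
      by (rule dominated_convergence(2)[OF f _ le cv]) (auto intro: integrable_const_ivl)
  qed
  have eq: "p s = 1 + l * I2 p s" if "s \<ge> 0" for s
  proof (rule LIMSEQ_unique)
    show "(\<lambda>k. iter l (Suc k) s) ----> p s" using lim[OF that] by (rule LIMSEQ_Suc)
    show "(\<lambda>k. iter l (Suc k) s) ----> 1 + l * I2 p s"
      unfolding iter.simps using 2[OF that] by (intro tendsto_intros)
  qed
  have "continuous_on {0..} (\<lambda>s. 1 + l * I2 p s)" by (intro continuous_intros I2_continuous pA)
  then have "continuous_on {0..} p"
    by (rule continuous_on_eq) (metis atLeast_iff eq)
  moreover have "p s \<ge> 1" if "s \<ge> 0" for s
    using LIMSEQ_le_const[OF lim[OF that]] it(3)[OF that] by blast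
  ultimately show ?thesis using pA eq by blast
qed

lemma decreasing_limit:
  fixes \<phi> :: "real => real"
  assumes a: "antimono_on {0..} \<phi>" and nn: "\<And>s. s \<ge> 0 ==> 0 \<le> \<phi> s"
  shows "\<exists>L\<ge>0. (\<phi> \<longlongrightarrow> L) at_top"
proof (intro exI conjI)
  let ?L = "Inf (\<phi> ` {0..})"
  have bdd: "bdd_below (\<phi> ` {0..})" using nn by (intro bdd_belowI[of _ 0]) auto
  show "0 \<le> ?L" using nn by (intro cInf_greatest) auto
  show "(\<phi> \<longlongrightarrow> ?L) at_top"
  proof (rule order_tendstoI)
    fix y assume "y < ?L"
    then have "y < \<phi> s" if "s \<ge> 0" for s using cInf_lower[OF _ bdd, of "\<phi> s"] that by fastforce
    then show "\<forall>\<^sub>F s in at_top. y < \<phi> s" by (rule eventually_mono[OF eventually_ge_at_top[of 0]])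
  next
    fix y assume "?L < y"
    then obtain t where t: "t \<ge> 0" "\<phi> t < y" using cInf_less_iff[OF _ bdd] by auto
    have "\<phi> s < y" if "s \<ge> t" for s
    proof -
      have "\<phi> s \<le> \<phi> t" using a t that by (auto simp: monotone_on_def)
      then show ?thesis using t by simp
    qed
    then show "\<forall>\<^sub>F s in at_top. \<phi> s < y" by (rule eventually_mono[OF eventually_ge_at_top[of t]])
  qed
qed

text \<open>With \<open>p\<close> the increasing solution, the decreasing one is found by reduction of order as the
  limit of the solutions \<open>p (1 - J / J(S))\<close> that vanish at \<open>S\<close>, where \<open>J = \<integral> p\<^sup>-\<^sup>2\<close>.\<close>

lemma is_profile_exists:
  assumes l: "l \<ge> 0"
  shows "\<exists>\<phi>. is_profile A l \<phi>"
proof -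
  obtain p where pA: "Aint p" and pc: "continuous_on {0..} p"
    and p: "\<And>s. s \<ge> 0 ==> p s \<ge> 1" "\<And>s. s \<ge> 0 ==> p s = 1 + l * I2 p s"
    using increasing_solution_exists[OF l] by blast
  have pc0: "continuous_on {0<..} p" using pc by (rule continuous_on_subset) auto
  have pp: "p s > 0" if "s \<ge> 0" for s using p(1)[OF that] by simp
  have p': "(p has_real_derivative l * I1 p s) (at s)" if s: "s > 0" for s
  proof -
    have "((\<lambda>s. 1 + l * I2 p s) has_real_derivative 0 + l * I1 p s) (at s)"
      by (intro DERIV_add DERIV_const DERIV_cmult I2_deriv_at pA s)
    then have "((\<lambda>s. 1 + l * I2 p s) has_real_derivative l * I1 p s) (at s)" by simp
    then show ?thesis
      by (rule has_field_derivative_transform_within_open[of _ _ _ "{0<..}"]) (use p(2) s in auto)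
  qed
  define J where "J s = integral {0..s} (\<lambda>r. 1 / (p r)\<^sup>2)" for s
  have Jint: "continuous_on {0..} (\<lambda>r. 1 / (p r)\<^sup>2)"
    using pp by (intro continuous_intros pc) (auto simp: less_imp_neq[symmetric])
  have Jc: "continuous_on {0..} J" unfolding J_def
    by (intro continuous_on_half_lineI indefinite_integral_continuous_1 integrable_continuous_real continuous_on_subset[OF Jint]) auto
  have J': "(J has_real_derivative 1 / (p s)\<^sup>2) (at s)" if s: "s > 0" for s
  proof -
    have "((\<lambda>u. integral {0..u} (\<lambda>r. 1 / (p r)\<^sup>2)) has_vector_derivative 1 / (p s)\<^sup>2) (at s within {0..s+1})"
      using s by (intro integral_has_vector_derivative continuous_on_subset[OF Jint]) auto
    moreover have "at s within {0..s+1} = at s" using s by (intro at_within_interior) (auto simp: interior_atLeastAtMost_real)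
    ultimately show ?thesis unfolding J_def[abs_def] by (simp add: has_real_derivative_iff_has_vector_derivative)
  qed
  have J0: "J 0 = 0" by (simp add: J_def)
  have Jmono: "J s < J t" if "0 \<le> s" "s < t" for s t
  proof (rule DERIV_pos_imp_increasing_open[OF that(2)])
    show "continuous_on {s..t} J" using that by (intro continuous_on_subset[OF Jc]) auto
    fix x assume "s < x" "x < t"
    then have "x > 0" using that by simp
    then show "\<exists>y. (J has_real_derivative y) (at x) \<and> 0 < y"
      using J'[of x] pp[of x] by (intro exI[of _ "1 / (p x)\<^sup>2"]) simp
  qed
  have Jpos: "J s > 0" if "s > 0" for s using Jmono[of 0 s] that J0 by simp
  \<comment> \<open>\<open>p J\<close> is a second solution since \<open>J' = 1/p^2\<close>;
    \<open>f1 m\<close> is the derivative of \<open>f m\<close>.\<close>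
  define f where "f m s = p s * (1 - m * J s)" for m s
  define f1 where "f1 m s = l * I1 p s * (1 - m * J s) - m / p s" for m s
  have fc: "continuous_on {0..} (f m)" for m unfolding f_def by (intro continuous_intros pc Jc)
  have f': "(f m has_real_derivative f1 m s) (at s)" if s: "s > 0" for m s
  proof -
    have "(f m has_real_derivative l * I1 p s * (1 - m * J s) + (0 - m * (1 / (p s)\<^sup>2)) * p s) (at s)"
      unfolding f_def by (intro DERIV_mult DERIV_diff DERIV_const DERIV_cmult p' J' s)
    then show ?thesis using pp[of s] s by (simp add: f1_def power2_eq_square)
  qed
  have f1': "(f1 m has_real_derivative l * (A s * f m s)) (at s)" if s: "s > 0" for m s
  proof -
    have "(f1 m has_real_derivative (l * (A s * p s) * (1 - m * J s) + (0 - m * (1 / (p s)\<^sup>2)) * (l * I1 p s))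
      - (0 * p s - m * (l * I1 p s)) / (p s * p s)) (at s)"
      unfolding f1_def using pp[of s] s
      by (intro DERIV_diff DERIV_mult DERIV_divide DERIV_const DERIV_cmult J' I1_deriv pA pc0 p' s) auto
    then show ?thesis using pp[of s] s by (simp add: f_def power2_eq_square algebra_simps)
  qed
  \<comment> \<open>\<open>1 / J S\<close> is the parameter whose solution vanishes at
    \<open>S\<close>. It decreases as \<open>S\<close> grows, so the limit exists; it is 0 when
    \<open>J\<close> is unbounded.\<close>
  define m where "m = lim (\<lambda>n. 1 / J (real (Suc n)))"
  have mlim: "(\<lambda>n. 1 / J (real (Suc n))) ----> m"
  proof -
    have "decseq (\<lambda>n. 1 / J (real (Suc n)))"
      using Jmono Jpos by (intro decseq_SucI divide_left_mono less_imp_le mult_pos_pos) auto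
    then have "convergent (\<lambda>n. 1 / J (real (Suc n)))"
      by (rule decseq_convergent[where B = 0]) (use Jpos in \<open>auto intro: convergentI less_imp_le\<close>)
    then show ?thesis by (simp add: m_def convergent_LIMSEQ_iff)
  qed
  have flim: "(\<lambda>n. f (1 / J (real (Suc n))) s) ----> f m s" for s
    unfolding f_def by (intro tendsto_intros mlim)
  have anti_n: "f (1 / J S) t \<le> f (1 / J S) s" "0 \<le> f (1 / J S) s" if st: "0 \<le> s" "s \<le> t" "t \<le> S" "S > 0" for s t S
  proof -
    have nn: "0 \<le> f (1 / J S) x" if "0 \<le> x" "x \<le> S" for x
    proof -
      have "J x \<le> J S" using Jmono[of x S] that by (cases "x = S") auto
      then show ?thesis using pp[of x] Jpos[OF st(4)] that by (simp add: f_def)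
    qed
    show "0 \<le> f (1 / J S) s" using nn st by simp
    \<comment> \<open>At \<open>S\<close> the first term of \<open>f1\<close> drops out and the
      slope is \<open>- 1 / (J S * p S)\<close>. The solution is nonnegative up to \<open>S\<close>,
      hence convex there, and the earlier slopes are at most this one.\<close>
    have f1S: "f1 (1 / J S) S \<le> 0"
      using pp[of S] Jpos[of S] st(4) by (simp add: f1_def)
    have f1n: "f1 (1 / J S) x \<le> 0" if x: "0 < x" "x \<le> S" for x
    proof -
      have "f1 (1 / J S) x \<le> f1 (1 / J S) S"
      proof (rule DERIV_nonneg_imp_nondecreasing[OF x(2)])
        fix y assume y: "x \<le> y" "y \<le> S"
        then show "\<exists>d. (f1 (1 / J S) has_real_derivative d) (at y) \<and> 0 \<le> d"
          using f1'[of y] nn[of y] A_nonneg[of y] l x by (intro exI[of _ "l * (A y * f (1 / J S) y)"]) auto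
      qed
      then show ?thesis using f1S by simp
    qed
    show "f (1 / J S) t \<le> f (1 / J S) s"
    proof (rule DERIV_nonpos_imp_decreasing_open[OF st(2)])
      show "continuous_on {s..t} (f (1 / J S))" using st by (intro continuous_on_subset[OF fc]) auto
      fix x assume "s < x" "x < t"
      then show "\<exists>y. (f (1 / J S) has_real_derivative y) (at x) \<and> y \<le> 0"
        using f'[of x "1 / J S"] f1n[of x] st by (intro exI[of _ "f1 (1 / J S) x"]) auto
    qed
  qed
  have anti: "f m t \<le> f m s" "0 \<le> f m s" if st: "0 \<le> s" "s \<le> t" for s t
  proof -
    have ev: "\<forall>\<^sub>F n in sequentially. t \<le> real (Suc n)"
      using eventually_ge_at_top[of "nat \<lceil>t\<rceil>"] by eventually_elim linarith
    show "f m t \<le> f m s"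
      by (rule tendsto_le[OF _ flim flim]) (use ev in \<open>auto elim!: eventually_mono intro!: anti_n st\<close>)
    show "0 \<le> f m s"
      by (rule tendsto_lowerbound[OF flim]) (use ev in \<open>auto elim!: eventually_mono intro!: anti_n(2)[OF st]\<close>)
  qed
  have "is_profile A l (f m)"
    unfolding is_profile_def
  proof (intro conjI allI impI)
    show a: "antimono_on {0..} (f m)" using anti(1) by (auto simp: monotone_on_def)
    show "continuous_on {0..} (f m)" by (rule fc)
    show "f m 0 = 1" using p(2)[of 0] by (simp add: f_def J0)
    show "\<exists>L\<ge>0. (f m \<longlongrightarrow> L) at_top" by (rule decreasing_limit[OF a]) (rule anti(2)[OF _ order_refl])
    fix g assume g: "test_function g"
    have "continuous_on {0<..} (\<lambda>s. l * (A s * f m s))"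
      by (intro continuous_intros A_cont continuous_on_subset[OF fc]) auto
    from weak_second_derivative[OF g f' f1' this]
    have "(LINT s:{0..}|lebesgue. f m s * deriv (deriv g) s) = (LINT s:{0..}|lebesgue. l * (A s * f m s) * g s)" by simp
    also have "\<dots> = l * (LINT s:{0..}|lebesgue. A s * f m s * g s)"
      by (simp add: mult.assoc set_integral_mult_right)
    finally show "(LINT s:{0..}|lebesgue. f m s * deriv (deriv g) s) = l * (LINT s:{0..}|lebesgue. A s * f m s * g s)" .
  qed
  then show ?thesis by blast
qed

text \<open>\<open>\<phi> - l I2 \<phi>\<close> has vanishing weak second derivative on the open
  half-line, so it is affine there; continuity at 0 fixes its constant term as 1.\<close>

lemma profile_integral_equation:
  assumes "is_profile A l \<phi>"
  shows "\<exists>m. \<forall>s\<ge>0. \<phi> s = 1 - m * s + l * I2 \<phi> s"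
proof -
  have c: "continuous_on {0..} \<phi>" and p0: "\<phi> 0 = 1"
    and w: "\<And>g. test_function g ==> (LINT s:{0..}|lebesgue. \<phi> s * deriv (deriv g) s) = l * (LINT s:{0..}|lebesgue. A s * \<phi> s * g s)"
    using assms by (auto simp: is_profile_def)
  have c0: "continuous_on {0<..} \<phi>" using c by (rule continuous_on_subset) auto
  note Ai = Aint_continuous[OF c]
  define e where "e s = \<phi> s - l * I2 \<phi> s" for s
  have ec: "continuous_on {0..} e" unfolding e_def by (intro continuous_intros c I2_continuous Ai)
  have ec0: "continuous_on {0<..} e" using ec by (rule continuous_on_subset) auto
  have ew: "(LINT s:{0..}|lebesgue. e s * deriv (deriv g) s) = 0" if g: "test_function g" for g
  proof -
    obtain a b where sm: "smooth g" and a: "0 < a" and z: "\<And>x. x \<notin> {a..b} ==> g x = 0"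
      using g by (auto simp: test_function_iff)
    have z2: "deriv (deriv g) x = 0" if "x \<notin> {a..b}" for x
      by (rule deriv_zero_outside[OF deriv_zero_outside[OF z] that])
    have H: "(LINT s:{0..}|lebesgue. h s * deriv (deriv g) s) = integral {a..b} (\<lambda>s. h s * deriv (deriv g) s)"
      and Hi: "(\<lambda>s. h s * deriv (deriv g) s) integrable_on {a..b}"
      if h: "continuous_on {0..} h" for h
    proof -
      have hc: "continuous_on {a..b} (\<lambda>s. h s * deriv (deriv g) s)"
        using a by (intro continuous_on_mult continuous_on_subset[OF h] smooth_continuous smooth_D sm) auto
      show "(LINT s:{0..}|lebesgue. h s * deriv (deriv g) s) = integral {a..b} (\<lambda>s. h s * deriv (deriv g) s)"
        using z2 a hc by (intro LINT_half_line) auto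
      show "(\<lambda>s. h s * deriv (deriv g) s) integrable_on {a..b}" using hc by (rule integrable_continuous_real)
    qed
    note I2c = I2_continuous[OF Ai]
    have "(LINT s:{0..}|lebesgue. I2 \<phi> s * deriv (deriv g) s) = (LINT s:{0..}|lebesgue. A s * \<phi> s * g s)"
      using weak_second_derivative[OF g I2_deriv_at[OF Ai] I1_deriv[OF Ai _ c0] continuous_on_mult[OF A_cont c0]] by simp
    with w[OF g] have *: "integral {a..b} (\<lambda>s. \<phi> s * deriv (deriv g) s) = l * integral {a..b} (\<lambda>s. I2 \<phi> s * deriv (deriv g) s)"
      unfolding H[OF c] H[OF I2c] by simp
    have "integral {a..b} (\<lambda>s. e s * deriv (deriv g) s) = integral {a..b} (\<lambda>s. \<phi> s * deriv (deriv g) s - l * (I2 \<phi> s * deriv (deriv g) s))"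
      by (rule arg_cong[where f = "integral {a..b}"]) (auto simp: e_def algebra_simps)
    also have "\<dots> = integral {a..b} (\<lambda>s. \<phi> s * deriv (deriv g) s) - integral {a..b} (\<lambda>s. l * (I2 \<phi> s * deriv (deriv g) s))"
      using integrable_on_cmult_left[OF Hi[OF I2c], of l]
      by (intro Henstock_Kurzweil_Integration.integral_diff Hi[OF c]) simp
    also have "\<dots> = 0" using * by simp
    finally show ?thesis using H[OF ec] by simp
  qed
  obtain p q where pq: "\<And>s. s > 0 ==> e s = p + q * s"
    using midpoint_affine[OF ec0 weakly_affine_imp_midpoint[OF ec0 ew]] by blast
  have "p = 1"
  proof (rule tendsto_unique[of "at_right 0"])
    have "((\<lambda>s. p + q * s) \<longlongrightarrow> p + q * 0) (at_right 0)" by (intro tendsto_intros)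
    then have "((\<lambda>s. p + q * s) \<longlongrightarrow> p) (at_right 0)" by simp
    then show "(e \<longlongrightarrow> p) (at_right 0)"
      by (rule Lim_transform_eventually) (auto simp: pq eventually_at_right_less intro!: eventually_at_rightI[of 0 1])
    have "(e \<longlongrightarrow> e 0) (at 0 within {0..})" using ec by (auto simp: continuous_on_def)
    then have "(e \<longlongrightarrow> e 0) (at_right 0)" by (rule tendsto_within_subset) auto
    then show "(e \<longlongrightarrow> 1) (at_right 0)" by (simp add: e_def p0)
  qed simp
  have "\<phi> s = 1 - (- q) * s + l * I2 \<phi> s" if "s \<ge> 0" for s
    using pq[of s] \<open>p = 1\<close> that p0 by (cases "s = 0") (auto simp: e_def)
  then show ?thesis by blast
qed

section \<open>Convexity, positivity and decay of the profiles\<close>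

abbreviation "phi \<equiv> profile A"
abbreviation "psi \<equiv> associated_cbf A"

text \<open>The derivative of \<open>phi l\<close> up to the boundary; its value at 0 is
  \<open>- psi l\<close>, in accordance with the definition of the Bernstein function.\<close>

definition dphi :: "real => real => real" where
  "dphi l s = l * I1 (phi l) s - psi l"

lemma profile_is_profile: "l \<ge> 0 ==> is_profile A l (phi l)"
  unfolding profile_def using is_profile_exists by (rule someI_ex)

context
  fixes l :: real
  assumes l: "l \<ge> 0"
begin

lemma phi_continuous: "continuous_on {0..} (phi l)"
  and phi_antimono: "0 \<le> s ==> s \<le> t ==> phi l t \<le> phi l s"
  and phi_0: "phi l 0 = 1"
  using profile_is_profile[OF l] by (auto simp: is_profile_def monotone_on_def)

lemma phi_nonneg: assumes "s \<ge> 0" shows "0 \<le> phi l s"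
proof -
  obtain L where L: "L \<ge> 0" "(phi l \<longlongrightarrow> L) at_top"
    using profile_is_profile[OF l] by (auto simp: is_profile_def)
  have "\<forall>\<^sub>F t in at_top. phi l t \<le> phi l s"
    using phi_antimono[OF assms] by (rule eventually_mono[OF eventually_ge_at_top[of s]])
  then have "L \<le> phi l s" using tendsto_upperbound[OF L(2)] by simp
  then show ?thesis using L by simp
qed

lemma phi_le1: "s \<ge> 0 ==> phi l s \<le> 1"
  using phi_antimono[of 0 s] phi_0 by simp

lemma phi_Aint: "Aint (phi l)"
  by (rule Aint_continuous[OF phi_continuous])

lemma phi_deriv_within: assumes s: "s \<ge> 0" shows "(phi l has_real_derivative dphi l s) (at s within {0..})"
proof -
  obtain m where m: "\<And>s. s \<ge> 0 ==> phi l s = 1 - m * s + l * I2 (phi l) s"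
    using profile_integral_equation[OF profile_is_profile[OF l]] by blast
  have D: "(phi l has_real_derivative l * I1 (phi l) s - m) (at s within {0..})" if s: "s \<ge> 0" for s
  proof -
    have "((\<lambda>s. 1 - m * s + l * I2 (phi l) s) has_real_derivative (0 - m * 1) + l * I1 (phi l) s) (at s within {0..})"
      by (intro DERIV_add DERIV_diff DERIV_const DERIV_cmult DERIV_ident I2_deriv phi_Aint s)
    then have "((\<lambda>s. 1 - m * s + l * I2 (phi l) s) has_real_derivative l * I1 (phi l) s - m) (at s within {0..})" by simp
    then show ?thesis
      by (rule has_field_derivative_transform_within[of _ _ _ _ 1]) (use m s in auto)
  qed
  \<comment> \<open>The free slope \<open>m\<close> of the integral equation is identified here with
    \<open>psi l\<close>.\<close>
  have "(phi l has_vector_derivative - m) (at 0 within {0..})"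
    using D[of 0] by (simp add: has_real_derivative_iff_has_vector_derivative)
  then have "vector_derivative (phi l) (at 0 within {0..}) = - m"
    by (intro vector_derivative_within) (simp_all add: at_within_Ici_at_right)
  then have "psi l = m" by (simp add: associated_cbf_def)
  then show ?thesis using D[OF s] by (simp add: dphi_def)
qed

lemma phi_deriv: "s > 0 ==> (phi l has_real_derivative dphi l s) (at s)"
  using phi_deriv_within[of s] at_within_pos[of s] by simp

lemma dphi_deriv: assumes "s > 0" shows "(dphi l has_real_derivative l * (A s * phi l s)) (at s)"
proof -
  have "continuous_on {0<..} (phi l)" using phi_continuous by (rule continuous_on_subset) auto
  then have "(dphi l has_real_derivative l * (A s * phi l s) - 0) (at s)"
    unfolding dphi_def using assms by (intro DERIV_diff DERIV_const DERIV_cmult I1_deriv phi_Aint)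
  then show ?thesis by simp
qed

lemma dphi_continuous: "continuous_on {0..} (dphi l)"
  unfolding dphi_def by (intro continuous_intros I1_continuous phi_Aint)

lemma dphi_0: "dphi l 0 = - psi l"
  by (simp add: dphi_def)

lemma dphi_mono: "0 \<le> s ==> s \<le> t ==> dphi l s \<le> dphi l t"
  unfolding dphi_def using l I1_le[OF phi_Aint, of s t] phi_nonneg by (auto intro!: mult_left_mono)

lemma dphi_nonpos: assumes s: "s \<ge> 0" shows "dphi l s \<le> 0"
proof (rule ccontr)
  assume "\<not> dphi l s \<le> 0"
  then have pos: "dphi l s > 0" by simp
  have "\<exists>z>s. z < s + 1 \<and> phi l (s+1) - phi l s = (s + 1 - s) * dphi l z"
  proof -
    have "continuous_on {s..s+1} (phi l)" using s by (intro continuous_on_subset[OF phi_continuous]) auto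
    moreover have "(phi l) differentiable (at x)" if "s < x" "x < s + 1" for x
      using phi_deriv[of x] that s by (auto simp: real_differentiable_def)
    ultimately obtain d z where "s < z" "z < s + 1" "(phi l has_real_derivative d) (at z)" "phi l (s+1) - phi l s = (s + 1 - s) * d"
      using MVT[of s "s+1" "phi l"] by auto
    moreover from this have "d = dphi l z" using phi_deriv[of z] s DERIV_unique by auto
    ultimately show ?thesis by blast
  qed
  then obtain z where z: "z > s" "phi l (s+1) - phi l s = dphi l z" by auto
  have "dphi l z > 0" using dphi_mono[of s z] pos s z by simp
  then show False using z phi_antimono[of s "s+1"] s by simp
qed

lemma psi_nonneg: "0 \<le> psi l"
  using dphi_nonpos[of 0] dphi_0 by simp

lemma dphi_abs_le_psi: "s \<ge> 0 ==> \<bar>dphi l s\<bar> \<le> psi l"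
  using dphi_nonpos[of s] dphi_mono[of 0 s] dphi_0 by simp

lemma phi_mvt:
  assumes "0 \<le> a" "a < b"
  shows "\<exists>z>a. z < b \<and> phi l b - phi l a = (b - a) * dphi l z"
proof -
  have "continuous_on {a..b} (phi l)" using assms by (intro continuous_on_subset[OF phi_continuous]) auto
  moreover have "(phi l) differentiable (at x)" if "a < x" "x < b" for x
    using phi_deriv[of x] that assms by (auto simp: real_differentiable_def)
  ultimately obtain d z where "a < z" "z < b" "(phi l has_real_derivative d) (at z)" "phi l b - phi l a = (b - a) * d"
    using MVT[of a b "phi l"] assms by auto
  moreover from this have "d = dphi l z" using phi_deriv[of z] assms DERIV_unique by auto
  ultimately show ?thesis by blast
qed

text \<open>By convexity the slope at \<open>s\<close> is at least that of the chord from 0, which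
  drops by at most 1 over the length \<open>s\<close>. The bound does not depend on
  \<open>l\<close>; it makes the flux through high slices vanish.\<close>

lemma dphi_abs_le: assumes s: "s > 0" shows "\<bar>dphi l s\<bar> \<le> 1 / s"
proof -
  obtain z where z: "z > 0" "z < s" "phi l s - phi l 0 = (s - 0) * dphi l z"
    using phi_mvt[of 0 s] s by auto
  have "s * dphi l s \<ge> s * dphi l z" using dphi_mono[of z s] z s by (intro mult_left_mono) auto
  moreover have "s * dphi l z = phi l s - 1" using z(3) phi_0 by simp
  ultimately have "s * dphi l s \<ge> - 1" using phi_nonneg[of s] s by linarith
  then have "s * \<bar>dphi l s\<bar> \<le> 1" using dphi_nonpos[of s] s by simp
  then show ?thesis using s by (simp add: field_simps)
qed

text \<open>At a first zero \<open>b\<close> the derivative vanishes too, because \<open>b\<close>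
  is a minimum. Going back from \<open>b\<close>, monotonicity gives
  \<open>phi a \<le> phi a * l (b - a) (W b - W a)\<close> with \<open>W = I1 1\<close>, and the
  last factor is below 1 for \<open>a\<close> close to \<open>b\<close>.\<close>

lemma phi_pos: assumes "s \<ge> 0" shows "0 < phi l s"
proof (rule ccontr)
  assume "\<not> 0 < phi l s"
  then have s: "phi l s = 0" using phi_nonneg[OF assms] by simp
  define K where "K = {x \<in> {0..s}. phi l x = 0}"
  have "closed K" unfolding K_def
    by (rule continuous_closed_preimage_constant) (auto intro: continuous_on_subset[OF phi_continuous])
  moreover have "bounded K" by (rule bounded_subset[of "{0..s}"]) (auto simp: K_def)
  ultimately have "compact K" by (simp add: compact_eq_bounded_closed)
  moreover have "s \<in> K" using s assms by (simp add: K_def)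
  ultimately obtain b where b: "b \<in> K" "\<And>y. y \<in> K ==> b \<le> y"
    using compact_attains_inf[of K] by blast
  have bz: "phi l b = 0" "b \<ge> 0" "b \<le> s" using b(1) by (auto simp: K_def)
  then have b0: "b > 0" using phi_0 by (cases "b = 0") auto
  have nz: "phi l a > 0" if "0 \<le> a" "a < b" for a
  proof -
    have "phi l a \<noteq> 0" using b(2)[of a] that bz by (auto simp: K_def)
    then show ?thesis using phi_nonneg[of a] that by simp
  qed
  have dz: "dphi l b = 0"
  proof (rule DERIV_local_min[OF phi_deriv[OF b0] b0])
    show "\<forall>y. \<bar>b - y\<bar> < b --> phi l b \<le> phi l y"
      using bz phi_nonneg by auto
  qed
  define W where "W x = I1 (\<lambda>_. 1) x" for x
  have one: "Aint (\<lambda>_. 1)" by (rule Aint_continuous) (rule continuous_on_const)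
  have Wc: "continuous_on {0..} W" unfolding W_def by (rule I1_continuous[OF one])
  have "isCont W b" using continuous_on_interior[OF Wc, of b] b0 by (simp add: interior_real_atLeast)
  then have "((\<lambda>a. l * (b - a) * (W b - W a)) \<longlongrightarrow> l * (b - b) * (W b - W b)) (at_left b)"
    by (intro tendsto_intros) (auto simp: isCont_def intro: tendsto_within_subset)
  then have "((\<lambda>a. l * (b - a) * (W b - W a)) \<longlongrightarrow> 0) (at_left b)" by simp
  then have "\<forall>\<^sub>F a in at_left b. l * (b - a) * (W b - W a) < 1"
    by (rule order_tendstoD) simp
  moreover have "\<forall>\<^sub>F a in at_left b. 0 < a \<and> a < b"
    using b0 by (intro eventually_at_leftI[of 0]) auto
  ultimately have "\<forall>\<^sub>F a in at_left b. l * (b - a) * (W b - W a) < 1 \<and> 0 < a \<and> a < b"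
    by eventually_elim auto
  then obtain a where a: "l * (b - a) * (W b - W a) < 1" "0 < a" "a < b"
    using eventually_happens[of _ "at_left b"] by auto
  obtain z where z: "z > a" "z < b" "phi l b - phi l a = (b - a) * dphi l z"
    using phi_mvt[of a b] a by auto
  have "- dphi l z = l * (I1 (phi l) b - I1 (phi l) z)"
    using dz by (simp add: dphi_def algebra_simps)
  also have "\<dots> \<le> l * (phi l a * (W b - W z))"
    unfolding W_def using a z l by (intro mult_left_mono I1_diff_le phi_Aint phi_antimono) auto
  also have "\<dots> \<le> l * (phi l a * (W b - W a))"
    unfolding W_def using a z l by (intro mult_left_mono diff_left_mono I1_le one phi_nonneg) auto
  finally have "(b - a) * (- dphi l z) \<le> (b - a) * (l * (phi l a * (W b - W a)))"
    using a by (intro mult_left_mono) auto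
  then have "phi l a \<le> phi l a * (l * (b - a) * (W b - W a))"
    using z bz by (simp add: algebra_simps)
  also have "\<dots> < phi l a * 1"
    using a nz[of a] by (intro mult_strict_left_mono) auto
  finally show False by simp
qed

text \<open>Comparison with the constant weight \<open>\<alpha>\<close>: in effect
  \<open>phi b * cosh (k (b - a)) \<le> phi a\<close> with \<open>k = sqrt (l \<alpha>)\<close>. The
  factor 2 comes from \<open>cosh t \<ge> exp t / 2\<close>.\<close>

lemma phi_decay:
  assumes ab: "0 < a" "a < b" and \<alpha>: "\<alpha> \<ge> 0" "\<And>s. a \<le> s ==> s \<le> b ==> \<alpha> \<le> A s"
  shows "phi l b \<le> 2 * exp (- (sqrt (l * \<alpha>) * (b - a)))"
proof -
  define k where "k = sqrt (l * \<alpha>)"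
  have k: "k \<ge> 0" "k * k = l * \<alpha>" using l \<alpha>(1) by (auto simp: k_def)
  define y where "y s = (dphi l s + k * phi l s) * exp (- (k * s))" for s
  have y': "(y has_real_derivative (l * A s - k * k) * phi l s * exp (- (k * s))) (at s)" if "s > 0" for s
  proof -
    have "(y has_real_derivative (l * (A s * phi l s) + k * dphi l s) * exp (- (k * s)) + (exp (- (k * s)) * - (k * 1)) * (dphi l s + k * phi l s)) (at s)"
      unfolding y_def by (intro DERIV_mult DERIV_add DERIV_cmult DERIV_fun_exp DERIV_minus DERIV_ident phi_deriv dphi_deriv that)
    then show ?thesis by (simp add: algebra_simps)
  qed
  have yle: "y s \<le> y b" if s: "a \<le> s" "s \<le> b" for s
  proof (rule DERIV_nonneg_imp_nondecreasing[OF s(2)])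
    fix x assume x: "s \<le> x" "x \<le> b"
    then have x0: "x > 0" using s ab by simp
    have "k * k \<le> l * A x" unfolding k using \<alpha>(2)[of x] x s l by (intro mult_left_mono) auto
    then show "\<exists>d. (y has_real_derivative d) (at x) \<and> 0 \<le> d"
      using y'[OF x0] phi_nonneg[of x] x0 by (intro exI[of _ "(l * A x - k * k) * phi l x * exp (- (k * x))"]) auto
  qed
  \<comment> \<open>Multiplied by \<open>exp (2 k s)\<close>, the bound \<open>y s \<le> y b\<close>
    becomes a bound for the derivative of \<open>phi * exp (k s)\<close>; the subtracted term of
    \<open>M\<close> is its integral.\<close>
  define M where "M s = phi l s * exp (k * s) - phi l b * exp (2 * k * s - k * b) / 2" for s
  have M': "(M has_real_derivative (dphi l s + k * phi l s) * exp (k * s) - k * phi l b * exp (2 * k * s - k * b)) (at s)" if "s > 0" for s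
  proof -
    have "(M has_real_derivative (dphi l s * exp (k * s) + (exp (k * s) * (k * 1)) * phi l s) - (phi l b * (exp (2 * k * s - k * b) * (2 * k * 1 - 0))) / 2) (at s)"
      unfolding M_def by (intro DERIV_diff DERIV_mult DERIV_cdivide DERIV_cmult DERIV_fun_exp DERIV_ident DERIV_const phi_deriv that)
    then show ?thesis by (simp add: algebra_simps)
  qed
  have "M b \<le> M a"
  proof (rule DERIV_nonpos_imp_nonincreasing[of a b M])
    fix s assume s: "a \<le> s" "s \<le> b"
    have "y b \<le> k * phi l b * exp (- (k * b))"
      unfolding y_def using dphi_nonpos[of b] ab by (intro mult_right_mono) auto
    then have "y s \<le> k * phi l b * exp (- (k * b))" using yle[OF s] by simp
    then have "y s * exp (2 * k * s) \<le> k * phi l b * exp (- (k * b)) * exp (2 * k * s)"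
      by (rule mult_right_mono) simp
    moreover have "y s * exp (2 * k * s) = (dphi l s + k * phi l s) * exp (k * s)"
      unfolding y_def mult.assoc exp_add[symmetric] by (simp add: algebra_simps)
    moreover have "k * phi l b * exp (- (k * b)) * exp (2 * k * s) = k * phi l b * exp (2 * k * s - k * b)"
      unfolding mult.assoc exp_add[symmetric] by (simp add: algebra_simps)
    ultimately show "\<exists>d. (M has_real_derivative d) (at s) \<and> d \<le> 0"
      using M'[of s] s ab by (intro exI[of _ "(dphi l s + k * phi l s) * exp (k * s) - k * phi l b * exp (2 * k * s - k * b)"] conjI) auto
  qed (use ab in auto)
  moreover have "M b = phi l b * exp (k * b) / 2"
    by (simp add: M_def algebra_simps)
  moreover have "M a \<le> 1 * exp (k * a)"
  proof -
    have "phi l a * exp (k * a) \<le> 1 * exp (k * a)" using phi_le1[of a] ab by (intro mult_right_mono) auto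
    moreover have "0 \<le> phi l b * exp (2 * k * a - k * b) / 2" using phi_nonneg[of b] ab by simp
    ultimately show ?thesis unfolding M_def by linarith
  qed
  ultimately have "phi l b * exp (k * b) \<le> 2 * exp (k * a)" by simp
  then have "phi l b * exp (k * b) * exp (- (k * b)) \<le> 2 * exp (k * a) * exp (- (k * b))"
    by (rule mult_right_mono) simp
  then show ?thesis unfolding mult.assoc exp_add[symmetric] k_def[symmetric] by (simp add: algebra_simps)
qed

end

text \<open>The Wronskian \<open>W\<close> increases, and by \<open>dphi_abs_le\<close> it is at
  most \<open>2 / s\<close>, hence nowhere positive. It is the numerator of the derivative of
  \<open>phi l' / phi l\<close>, a quotient that starts at 1.\<close>

lemma phi_mono_param:
  assumes l: "0 \<le> l" "l \<le> l'" and s: "s \<ge> 0"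
  shows "phi l' s \<le> phi l s"
proof -
  have l': "0 \<le> l'" using l by simp
  define W where "W s = phi l s * dphi l' s - phi l' s * dphi l s" for s
  have W': "(W has_real_derivative (l' - l) * (A s * phi l s * phi l' s)) (at s)" if "s > 0" for s
  proof -
    have "(W has_real_derivative (dphi l s * dphi l' s + (l' * (A s * phi l' s)) * phi l s) - (dphi l' s * dphi l s + (l * (A s * phi l s)) * phi l' s)) (at s)"
      unfolding W_def by (intro DERIV_diff DERIV_mult phi_deriv dphi_deriv l l' that)
    then show ?thesis by (simp add: algebra_simps)
  qed
  have Wmono: "W s \<le> W t" if "0 < s" "s \<le> t" for s t
  proof (rule DERIV_nonneg_imp_nondecreasing[OF that(2)])
    fix x assume "s \<le> x" "x \<le> t"
    then have x: "x > 0" using that by simp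
    then show "\<exists>y. (W has_real_derivative y) (at x) \<and> 0 \<le> y"
      using W'[OF x] A_nonneg[of x] phi_nonneg[OF l(1), of x] phi_nonneg[OF l', of x] l
      by (intro exI[of _ "(l' - l) * (A x * phi l x * phi l' x)"]) auto
  qed
  have Wle: "W s \<le> 2 / s" if "s > 0" for s
  proof -
    have "\<bar>phi l s * dphi l' s\<bar> \<le> 1 * (1 / s)"
      unfolding abs_mult using that phi_nonneg[OF l(1), of s] phi_le1[OF l(1), of s] dphi_abs_le[OF l' that] by (intro mult_mono) auto
    moreover have "\<bar>phi l' s * dphi l s\<bar> \<le> 1 * (1 / s)"
      unfolding abs_mult using that phi_nonneg[OF l', of s] phi_le1[OF l', of s] dphi_abs_le[OF l(1) that] by (intro mult_mono) auto
    ultimately show ?thesis unfolding W_def by (auto simp: field_simps abs_le_iff)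
  qed
  have Wneg: "W s \<le> 0" if s: "s > 0" for s
  proof (rule ccontr)
    assume "\<not> W s \<le> 0"
    then have w: "W s > 0" by simp
    \<comment> \<open>Beyond \<open>4 / W s\<close> the upper bound \<open>2 / t\<close> has fallen
      to half of \<open>W s\<close>, which an increasing \<open>W\<close> cannot respect.\<close>
    define t where "t = max s (4 / W s)"
    have t: "t \<ge> s" "t \<ge> 4 / W s" "t > 0" using s by (auto simp: t_def)
    have "W s \<le> 2 / t" using Wmono[OF s t(1)] Wle[OF t(3)] by simp
    then have "W s * t \<le> 2" using t(3) by (simp add: field_simps)
    moreover have "4 \<le> W s * t" using t(2) w by (simp add: field_simps)
    ultimately show False by simp
  qed
  define r where "r s = phi l' s / phi l s" for s
  have "r s \<le> r 0"
  proof (rule DERIV_nonpos_imp_decreasing_open[OF s])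
    show "continuous_on {0..s} r" unfolding r_def
      using phi_pos[OF l(1)] by (intro continuous_on_divide continuous_on_subset[OF phi_continuous] l l') (auto simp: less_imp_neq[symmetric])
    fix x assume "0 < x" "x < s"
    then have x: "x > 0" "phi l x > 0" using phi_pos[OF l(1), of x] by auto
    have "(r has_real_derivative (dphi l' x * phi l x - phi l' x * dphi l x) / (phi l x * phi l x)) (at x)"
      unfolding r_def using x by (intro DERIV_divide phi_deriv l l') auto
    moreover have "(dphi l' x * phi l x - phi l' x * dphi l x) / (phi l x * phi l x) \<le> 0"
      using Wneg[OF x(1)] x(2) by (simp add: W_def divide_le_0_iff mult.commute)
    ultimately show "\<exists>y. (r has_real_derivative y) (at x) \<and> y \<le> 0" by blast
  qed
  also have "r 0 = 1" by (simp add: r_def phi_0 l l')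
  finally show ?thesis using phi_pos[OF l(1) s] by (simp add: r_def)
qed

lemma phi_diff_quotient:
  assumes "l \<ge> 0" "s \<ge> 0"
  shows "((\<lambda>h. (phi l (s + h) - phi l s) / h) \<longlongrightarrow> dphi l s) (at_right 0)"
proof -
  have "((\<lambda>t. (phi l t - phi l s) / (t - s)) \<longlongrightarrow> dphi l s) (at s within {0..})"
    using phi_deriv_within[OF assms] by (simp add: has_field_derivative_iff)
  then have "((\<lambda>t. (phi l t - phi l s) / (t - s)) \<longlongrightarrow> dphi l s) (at_right s)"
    by (rule tendsto_within_subset) (use assms in auto)
  then show ?thesis
    unfolding at_right_to_0[of s] by (simp add: filterlim_filtermap add.commute)
qed

lemma psi_mono:
  assumes l: "0 \<le> l" "l \<le> l'" shows "psi l \<le> psi l'"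
proof -
  have l': "0 \<le> l'" using l by simp
  have "dphi l' 0 \<le> dphi l 0"
  proof (rule tendsto_le[OF _ phi_diff_quotient[OF l(1) order_refl] phi_diff_quotient[OF l' order_refl]])
    show "\<forall>\<^sub>F h in at_right 0. (phi l' (0 + h) - phi l' 0) / h \<le> (phi l (0 + h) - phi l 0) / h"
      using phi_mono_param[OF l] phi_0[OF l(1)] phi_0[OF l']
      by (intro eventually_at_rightI[of 0 1]) (auto intro!: divide_right_mono)
  qed simp
  then show ?thesis by (simp add: dphi_0 l l')
qed

text \<open>Monotone functions are Borel. \<open>max 0\<close> replaces negative parameters, for
  which \<open>profile\<close> is an arbitrary choice.\<close>

lemma phi_measurable: "s \<ge> 0 ==> (\<lambda>l. phi (max 0 l) s) \<in> borel_fun"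
proof -
  assume s: "s \<ge> 0"
  have "mono (\<lambda>l. - phi (max 0 l) s)"
    using phi_mono_param[OF _ _ s] by (intro monoI) (auto simp: max_def)
  from borel_measurable_uminus[OF borel_measurable_mono[OF this]] show ?thesis by simp
qed

lemma psi_measurable: "(\<lambda>l. psi (max 0 l)) \<in> borel_fun"
  using psi_mono by (intro borel_measurable_mono monoI) (auto simp: max_def)

text \<open>A limit of right difference quotients, each a combination of functions measurable in
  \<open>l\<close>.\<close>

lemma dphi_measurable:
  assumes s: "s \<ge> 0" shows "(\<lambda>l. dphi (max 0 l) s) \<in> borel_fun"
proof (rule borel_measurable_LIMSEQ_real)
  define h where "h n = inverse (real (Suc n))" for n
  have h: "filterlim h (at_right 0) sequentially"
    unfolding h_def filterlim_at using LIMSEQ_inverse_real_of_nat by (auto intro: always_eventually)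
  show "(\<lambda>n. (phi (max 0 l) (s + h n) - phi (max 0 l) s) / h n) ----> dphi (max 0 l) s" for l
    using filterlim_compose[OF phi_diff_quotient[OF _ s] h, of "max 0 l"] by simp
  show "(\<lambda>l. (phi (max 0 l) (s + h n) - phi (max 0 l) s) / h n) \<in> borel_fun" for n
    using s by (intro borel_measurable_divide borel_measurable_diff phi_measurable borel_measurable_const) (auto simp: h_def)
qed

end

subsection \<open>Real-analytic Fourier integrals\<close>

lemma locally_lipschitz_continuous:
  assumes "locally_lipschitz_on S f" "open S"
  shows "continuous_on S f"
proof -
  have "isCont f x" if x: "x \<in> S" for x
  proof -
    obtain e L where e: "e > 0" "L-lipschitz_on (ball x e \<inter> S) f"
      using assms(1) x unfolding locally_lipschitz_on_def by blast
    then have "continuous_on (ball x e \<inter> S) f" using lipschitz_on_continuous_on by blast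
    then show ?thesis using continuous_on_eq_continuous_at[OF open_Int[OF open_ball assms(2)], of x e f] x e(1) by auto
  qed
  then show ?thesis by (simp add: continuous_at_imp_continuous_on)
qed

text \<open>\<open>\<sigma>\<close> is continuous, strictly increasing and unbounded, so it maps the
  open half-line onto itself with continuous inverse, and \<open>A\<close> is the square of
  \<open>a\<close> composed with that inverse.\<close>

lemma weight_of_coefficient:
  fixes a :: "real => real"
  assumes a: "coefficient a" "\<forall>t>0. a t > 0" "locally_lipschitz_on {0<..} a"
    and A: "\<forall>t>0. A (change_of_scale a t) = (a t)\<^sup>2"
  shows "continuous_on {0<..} A" "\<forall>s>0. 0 < A s"
proof -
  define \<sigma> where "\<sigma> = change_of_scale a"
  have ac: "continuous_on {0<..} a" by (rule locally_lipschitz_continuous[OF a(3)]) simp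
  define g where "g t = 1 / a t" for t
  have ga: "g absolutely_integrable_on {0..S}" if "S \<ge> 0" for S
    using a(1) that by (auto simp: coefficient_def locally_integrable_def g_def[abs_def])
  have gi: "g integrable_on {0..S}" if "S \<ge> 0" for S
    using set_lebesgue_integral_eq_integral(1)[OF ga[OF that]] .
  have sg: "\<sigma> T = integral {0..T} g" if "T \<ge> 0" for T
    using set_lebesgue_integral_eq_integral(2)[OF ga[OF that]] by (simp add: \<sigma>_def change_of_scale_def g_def)
  have gnn: "0 \<le> g t" if "t \<ge> 0" for t using a(1) that by (auto simp: coefficient_def g_def)
  have gc: "continuous_on {0<..} g" unfolding g_def using a(2) by (intro continuous_intros ac) (auto simp: less_imp_neq[symmetric])
  have \<sigma>c: "continuous_on {0..T} \<sigma>" if "T \<ge> 0" for T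
    using indefinite_integral_continuous_1[OF gi[OF that]] by (rule continuous_on_eq) (simp add: sg)
  have \<sigma>mono: "\<sigma> s < \<sigma> t" if st: "0 \<le> s" "s < t" for s t
  proof -
    define m where "m = (s + t) / 2"
    have m: "s < m" "m < t" "0 < m" using st by (auto simp: m_def)
    have c: "continuous_on {m..t} g" by (rule continuous_on_subset[OF gc]) (use m in auto)
    have "\<sigma> t = integral {0..s} g + integral {s..m} g + integral {m..t} g"
      using st m Henstock_Kurzweil_Integration.integral_combine[of 0 m t g] gi[of t]
        Henstock_Kurzweil_Integration.integral_combine[of 0 s m g] gi[of m] by (simp add: sg)
    moreover have "0 \<le> integral {s..m} g"
      using st m by (intro integral_nonneg integrable_on_subinterval[OF gi[of m]] gnn) auto
    moreover have "0 < integral {m..t} g"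
    proof -
      have nn: "0 \<le> integral {m..t} g" using m by (intro integral_nonneg integrable_continuous_real c gnn) auto
      have "integral {m..t} g \<noteq> 0"
      proof
        assume "integral {m..t} g = 0"
        then have "g m = 0" using integral_eq_0_iff[OF c] m gnn by auto
        then show False using a(2) m by (auto simp: g_def)
      qed
      then show ?thesis using nn by simp
    qed
    ultimately show ?thesis using st by (simp add: sg)
  qed
  have \<sigma>0: "\<sigma> 0 = 0" by (simp add: sg)
  \<comment> \<open>Were \<open>\<sigma>\<close> bounded, monotone convergence would make
    \<open>1/a\<close> integrable on the whole half-line.\<close>
  have unb: "\<exists>T\<ge>0. \<sigma> T > B" for B
  proof (rule ccontr)
    assume "\<not> (\<exists>T\<ge>0. \<sigma> T > B)"
    then have B: "\<sigma> T \<le> B" if "T \<ge> 0" for T using that by force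
    let ?f = "\<lambda>n t. indicat_real {0..real n} t *\<^sub>R g t"
    have fi: "integrable lebesgue (?f n)" for n using ga[of "real n"] by (simp add: set_integrable_def)
    have mono: "AE t in lebesgue. mono (\<lambda>n. ?f n t)"
      using gnn by (intro AE_I2 monoI) (auto simp: indicator_def)
    have lim': "(\<lambda>n. ?f n t) ----> indicator {0..} t *\<^sub>R g t" for t
    proof (rule tendsto_eventually)
      obtain N where "t \<le> real N" using real_arch_simple by blast
      then have "?f n t = indicator {0..} t *\<^sub>R g t" if "n \<ge> N" for n using that by (auto simp: indicator_def)
      then show "\<forall>\<^sub>F n in sequentially. ?f n t = indicator {0..} t *\<^sub>R g t"
        using eventually_sequentially by blast
    qed
    then have lim: "AE t in lebesgue. (\<lambda>n. ?f n t) ----> indicator {0..} t *\<^sub>R g t" by simp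
    have I: "integral\<^sup>L lebesgue (?f n) = \<sigma> (real n)" for n
      by (simp add: \<sigma>_def change_of_scale_def set_lebesgue_integral_def g_def)
    have "incseq (\<lambda>n. \<sigma> (real n))"
      using \<sigma>mono by (intro incseq_SucI less_imp_le) auto
    then have "convergent (\<lambda>n. \<sigma> (real n))"
      by (rule incseq_convergent[where B = B]) (use B in \<open>auto intro: convergentI\<close>)
    then obtain x where "(\<lambda>n. \<sigma> (real n)) ----> x" by (auto simp: convergent_def)
    then have x: "(\<lambda>n. integral\<^sup>L lebesgue (?f n)) ----> x" by (simp only: I)
    have meas: "(\<lambda>t. indicat_real {0..} t *\<^sub>R g t) \<in> borel_measurable lebesgue"
      by (rule borel_measurable_LIMSEQ_real[OF lim']) (rule borel_measurable_integrable[OF fi])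
    have "integrable lebesgue (\<lambda>t. indicat_real {0..} t *\<^sub>R g t)"
      by (rule integrable_monotone_convergence[OF fi mono lim x meas])
    then show False using a(1) by (simp add: coefficient_def set_integrable_def g_def[abs_def])
  qed
  have inv: "\<exists>t>0. \<sigma> t = s" if s: "s > 0" for s
  proof -
    obtain T where T: "T \<ge> 0" "\<sigma> T > s" using unb by blast
    obtain t where "t \<ge> 0" "t \<le> T" "\<sigma> t = s"
      using IVT'[of \<sigma> 0 s T] \<sigma>0 s T \<sigma>c[of T] by auto
    then show ?thesis using \<sigma>0 s by (intro exI[of _ t]) (auto simp: less_le)
  qed
  show "\<forall>s>0. 0 < A s"
    using inv A a(2) unfolding \<sigma>_def by (metis zero_less_power)
  show "continuous_on {0<..} A"
  proof (rule continuous_at_imp_continuous_on, rule ballI)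
    fix s :: real assume "s \<in> {0<..}"
    then obtain t where t: "t > 0" "\<sigma> t = s" using inv by auto
    \<comment> \<open>On a compact interval around \<open>t\<close>, away from 0, the continuous
      injection \<open>\<sigma>\<close> has a continuous inverse.\<close>
    define K where "K = {t/2..t+1}"
    have Kc: "continuous_on K \<sigma>" by (rule continuous_on_subset[OF \<sigma>c[of "t+1"]]) (use t in \<open>auto simp: K_def\<close>)
    have inj: "inj_on \<sigma> K"
    proof (rule inj_onI)
      fix x y assume xy: "x \<in> K" "y \<in> K" "\<sigma> x = \<sigma> y"
      then have "0 \<le> x" "0 \<le> y" using t by (auto simp: K_def)
      then show "x = y" using \<sigma>mono[of x y] \<sigma>mono[of y x] xy(3) by (cases x y rule: linorder_cases) auto
    qed
    have gcont: "continuous_on (\<sigma> ` K) (inv_into K \<sigma>)"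
      by (rule continuous_on_inv[OF Kc]) (auto simp: K_def inv_into_f_f inj[unfolded K_def])
    have sub: "{\<sigma> (t/2)..\<sigma> (t+1)} \<subseteq> \<sigma> ` K"
    proof
      fix y assume "y \<in> {\<sigma> (t/2)..\<sigma> (t+1)}"
      then obtain x where "t/2 \<le> x" "x \<le> t+1" "\<sigma> x = y"
        using IVT'[of \<sigma> "t/2" y "t+1"] Kc t by (auto simp: K_def)
      then show "y \<in> \<sigma> ` K" by (auto simp: K_def)
    qed
    have Aeq: "A y = (a (inv_into K \<sigma> y))\<^sup>2" if "y \<in> \<sigma> ` K" for y
    proof -
      have "inv_into K \<sigma> y \<in> K" using that by (rule inv_into_into)
      then have "inv_into K \<sigma> y > 0" using t by (auto simp: K_def)
      then have "A (\<sigma> (inv_into K \<sigma> y)) = (a (inv_into K \<sigma> y))\<^sup>2" using A by (simp add: \<sigma>_def)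
      then show ?thesis using that by (simp add: f_inv_into_f)
    qed
    have "continuous_on (\<sigma> ` K) (\<lambda>y. (a (inv_into K \<sigma> y))\<^sup>2)"
    proof (intro continuous_on_power continuous_on_compose2[OF ac gcont])
      show "inv_into K \<sigma> ` \<sigma> ` K \<subseteq> {0<..}" using t inv_into_into[of _ \<sigma> K] by (fastforce simp: K_def)
    qed
    then have "continuous_on (\<sigma> ` K) A" by (rule continuous_on_eq) (simp add: Aeq)
    moreover have "s \<in> interior (\<sigma> ` K)"
    proof (rule interiorI)
      show "s \<in> {\<sigma> (t/2)<..<\<sigma> (t+1)}" using \<sigma>mono[of "t/2" t] \<sigma>mono[of t "t+1"] t by auto
      show "{\<sigma> (t/2)<..<\<sigma> (t+1)} \<subseteq> \<sigma> ` K" using sub by (rule order_trans[rotated]) auto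
    qed simp
    ultimately show "isCont A s" by (rule continuous_on_interior)
  qed
qed

lemma dominated_convergence_at:
  fixes q :: "'t::first_countable_topology => 'b => 'c::{banach, second_countable_topology}"
  assumes "\<And>t. t \<in> S ==> q t \<in> borel_measurable M" "q0 \<in> borel_measurable M" "integrable M w"
    and "AE x in M. ((\<lambda>t. q t x) \<longlongrightarrow> q0 x) (at t0 within S)"
    and "\<And>t. t \<in> S ==> t \<noteq> t0 ==> AE x in M. norm (q t x) \<le> w x"
  shows "((\<lambda>t. \<integral>x. q t x \<partial>M) \<longlongrightarrow> (\<integral>x. q0 x \<partial>M)) (at t0 within S)"
  unfolding tendsto_at_iff_sequentially comp_def
proof (intro allI impI)
  fix X :: "nat => 't" assume X: "\<forall>i. X i \<in> S - {t0}" "X ----> t0"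
  show "(\<lambda>i. \<integral>x. q (X i) x \<partial>M) ----> (\<integral>x. q0 x \<partial>M)"
  proof (rule integral_dominated_convergence[OF assms(2) _ assms(3)])
    show "AE x in M. (\<lambda>i. q (X i) x) ----> q0 x"
      using assms(4)
    proof eventually_elim
      case (elim x)
      then show ?case using X unfolding tendsto_at_iff_sequentially comp_def by blast
    qed
  qed (use X assms in auto)
qed

lemma exp_abs_integrable_real:
  assumes c: "c > 0" shows "integrable lborel (\<lambda>x::real. exp (- (c * \<bar>x\<bar>)))"
proof -
  interpret prob_space "density lborel (exponential_density c)" by (rule prob_space_exponential_density[OF c])
  have "integrable (density lborel (exponential_density c)) (\<lambda>_. 1::real)" by simp
  then have 1: "integrable lborel (exponential_density c)"
    by (subst (asm) integrable_density) (auto simp: exponential_density_nonneg[OF c])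
  then have 2: "integrable lborel (\<lambda>x. exponential_density c (0 - x))"
    by (subst lborel_integral_reflect(2)) auto
  show ?thesis
  proof (rule Bochner_Integration.integrable_bound)
    show "integrable lborel (\<lambda>x. (exponential_density c x + exponential_density c (0 - x)) / c)"
      using 1 2 by auto
    show "AE x in lborel. norm (exp (- (c * \<bar>x\<bar>))) \<le> norm ((exponential_density c x + exponential_density c (0 - x)) / c)"
      using c by (auto simp: exponential_density_def field_simps abs_if)
  qed measurable
qed

lemma exp_norm_integrable:
  assumes c: "c > 0" shows "integrable lborel (\<lambda>x::'a::euclidean_space. exp (- (c * norm x)))"
proof -
  \<comment> \<open>The sum of the \<open>|x \<bullet> b|\<close> over the basis is at most
    \<open>DIM('a) * norm x\<close>, so the product of one-dimensional exponentials of rate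
    \<open>c / DIM('a)\<close> is a majorant.\<close>
  define c' where "c' = c / DIM('a)"
  have c': "c' > 0" using c by (simp add: c'_def)
  have "integrable lborel (\<lambda>x::real. complex_of_real (exp (- (c' * \<bar>x\<bar>))))"
    using exp_abs_integrable_real[OF c'] by (rule integrable_of_real)
  then have i: "integrable lborel (\<lambda>x::'a. \<Prod>b\<in>Basis. complex_of_real (exp (- (c' * \<bar>x \<bullet> b\<bar>))))"
    by (intro lborel_integral_prod_Basis(1)[of "\<lambda>b x. complex_of_real (exp (- (c' * \<bar>x\<bar>)))"])
  show ?thesis
  proof (rule Bochner_Integration.integrable_bound[OF i])
    show "AE x in lborel. norm (exp (- (c * norm x))) \<le> norm (\<Prod>b\<in>Basis. complex_of_real (exp (- (c' * \<bar>(x::'a) \<bullet> b\<bar>))))"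
    proof (intro AE_I2)
      fix x :: 'a
      have "(\<Sum>b\<in>Basis. c' * \<bar>x \<bullet> b\<bar>) \<le> (\<Sum>b\<in>(Basis::'a set). c' * norm x)"
        using c' by (intro sum_mono mult_left_mono Basis_le_norm) auto
      also have "\<dots> = c * norm x" by (simp add: c'_def)
      finally have "exp (- (c * norm x)) \<le> exp (\<Sum>b\<in>Basis. - (c' * \<bar>x \<bullet> b\<bar>))" by (simp add: sum_negf)
      also have "\<dots> = (\<Prod>b\<in>Basis. exp (- (c' * \<bar>x \<bullet> b\<bar>)))" by (rule exp_sum) simp
      finally show "norm (exp (- (c * norm x))) \<le> norm (\<Prod>b\<in>Basis. complex_of_real (exp (- (c' * \<bar>x \<bullet> b\<bar>))))"
        by (simp add: prod_norm[symmetric])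
    qed
  qed measurable
qed

lemma linear_le_exp: assumes "c > 0" "t \<ge> 0" shows "t \<le> 1 / c * exp (c * t :: real)"
proof -
  have "c * t \<le> exp (c * t)" using exp_ge_add_one_self[of "c * t"] by linarith
  then show ?thesis using assms by (simp add: field_simps)
qed

lemma sqi_exp_norm:
  assumes c: "c > 0" shows "sqi lborel (\<lambda>x::'a::euclidean_space. complex_of_real (exp (- (c * norm x))))"
proof -
  have "(cmod (complex_of_real (exp (- (c * norm x)))))\<^sup>2 = exp (- (2 * c * norm x))" for x :: 'a
    by (simp add: power2_eq_square flip: exp_add)
  then show ?thesis using exp_norm_integrable[of "2 * c", where 'a = 'a] c by (simp add: sqi_def)
qed

text \<open>Half of the decay pays, by Cauchy-Schwarz, for the integrability of a merely
  square-integrable \<open>F\<close>. The other half survives as the exponential weight that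
  analyticity requires.\<close>

lemma exp_decay_integrable:
  fixes F m :: "'a::euclidean_space => complex"
  assumes F: "sqi lborel F" and m: "m \<in> borel_fun" and c: "c > 0"
    and b: "\<And>y. cmod (m y) \<le> C * exp (- (c * norm y))"
  shows "integrable lborel (\<lambda>y. exp (c / 2 * norm y) * cmod (m y * F y))" "integrable lborel (\<lambda>y. m y * F y)" "sqi lborel (\<lambda>y. m y * F y)"
proof -
  note [measurable] = m sqi_measurable[OF F, simplified]
  have C: "C \<ge> 0" using order_trans[OF norm_ge_zero b[of 0]] by simp
  have i: "integrable lborel (\<lambda>y. C *\<^sub>R (complex_of_real (exp (- (c / 2 * norm y))) * F y))"
    using sqi_integrable_mult[OF sqi_exp_norm[of "c/2"] F] c by simp
  have le: "exp (c / 2 * norm y) * cmod (m y * F y) \<le> cmod (C *\<^sub>R (complex_of_real (exp (- (c / 2 * norm y))) * F y))" for y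
  proof -
    have "exp (c / 2 * norm y) * cmod (m y) \<le> exp (c / 2 * norm y) * (C * exp (- (c * norm y)))"
      by (intro mult_left_mono b) simp
    also have "\<dots> = C * exp (- (c / 2 * norm y))"
      by (simp add: exp_minus field_simps flip: exp_add)
    finally have "exp (c / 2 * norm y) * cmod (m y) * cmod (F y) \<le> C * exp (- (c / 2 * norm y)) * cmod (F y)"
      by (rule mult_right_mono) simp
    then show ?thesis using C by (simp add: norm_mult mult.assoc)
  qed
  show 1: "integrable lborel (\<lambda>y. exp (c / 2 * norm y) * cmod (m y * F y))"
    by (rule Bochner_Integration.integrable_bound[OF i]) (use le in auto)
  show "integrable lborel (\<lambda>y. m y * F y)"
  proof (rule Bochner_Integration.integrable_bound[OF 1])
    show "AE y in lborel. norm (m y * F y) \<le> norm (exp (c / 2 * norm y) * cmod (m y * F y))"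
    proof (intro AE_I2)
      fix y :: 'a
      have "1 * cmod (m y * F y) \<le> exp (c / 2 * norm y) * cmod (m y * F y)"
        using c by (intro mult_right_mono) auto
      then show "norm (m y * F y) \<le> norm (exp (c / 2 * norm y) * cmod (m y * F y))" by simp
    qed
  qed measurable
  show "sqi lborel (\<lambda>y. m y * F y)"
  proof (rule sqi_mult_bounded[OF F, where C = C])
    fix y :: 'a have "C * exp (- (c * norm y)) \<le> C * 1" using C c by (intro mult_left_mono) auto
    then show "cmod (m y) \<le> C" using b[of y] by simp
  qed simp
qed

section \<open>Fourier integrals as functions of a complex variable\<close>

definition osc :: "('a::euclidean_space => complex) => 'a => complex" where
  "osc M x = (LINT y|lborel. exp (\<i> * of_real (x \<bullet> y)) * M y)"

lemma inv_fourier_osc: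
  fixes M :: "'a::euclidean_space => complex"
  assumes "M \<in> borel_fun"
  shows "inv_fourier M x = of_real (fconst TYPE('a)) * osc M x"
  unfolding inv_fourier_def fourier_integral_borel[OF assms] osc_def by simp

text \<open>The function is continued along the line \<open>x + z v\<close> to a strip around the
  real axis. Of the weight \<open>exp (2 c |y|)\<close> one half bounds the phase for
  \<open>|Im z| < c\<close>, and the other absorbs the factor \<open>v \<bullet> y\<close> brought
  down by differentiation.\<close>

lemma osc_complex_derivative:
  fixes M :: "'a::euclidean_space => complex"
  assumes [measurable]: "M \<in> borel_fun" and c: "c > 0"
    and i: "integrable lborel (\<lambda>y. exp (2 * c * norm y) * cmod (M y))" and v: "norm v \<le> 1" and z: "\<bar>Im z\<bar> < c"
  shows "((\<lambda>z. (LINT y|lborel. exp (\<i> * of_real (x \<bullet> y) + \<i> * z * of_real (v \<bullet> y)) * M y)) has_field_derivative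
     (LINT y|lborel. exp (\<i> * of_real (x \<bullet> y) + \<i> * z * of_real (v \<bullet> y)) * (\<i> * of_real (v \<bullet> y) * M y))) (at z)"
proof -
  define S where "S = {w. \<bar>Im w\<bar> < c}"
  have "convex S"
  proof -
    have "S = {w. Im w < c} \<inter> {w. Im w > - c}" by (auto simp: S_def)
    then show ?thesis by (simp add: convex_Int convex_halfspace_Im_lt convex_halfspace_Im_gt)
  qed
  have "open S"
    unfolding S_def by (intro open_Collect_less continuous_intros)
  have zS: "z \<in> S" using z by (simp add: S_def)
  let ?f = "\<lambda>w y. exp (\<i> * of_real (x \<bullet> y) + \<i> * w * of_real (v \<bullet> y)) * M y"
  let ?f' = "\<lambda>w y. exp (\<i> * of_real (x \<bullet> y) + \<i> * w * of_real (v \<bullet> y)) * (\<i> * of_real (v \<bullet> y) * M y)"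
  have d: "((\<lambda>w. ?f w y) has_field_derivative ?f' w y) (at w)" for w y
    by (auto intro!: derivative_eq_intros)
  have vx: "\<bar>v \<bullet> y\<bar> \<le> norm y" for y
    using Cauchy_Schwarz_ineq2[of v y] mult_right_mono[OF v, of "norm y"] by simp
  have eb: "cmod (exp (\<i> * of_real (x \<bullet> y) + \<i> * w * of_real (v \<bullet> y))) \<le> exp (c * norm y)" if "w \<in> S" for w y
  proof -
    have "- Im w * (v \<bullet> y) \<le> \<bar>Im w\<bar> * \<bar>v \<bullet> y\<bar>" by (metis abs_ge_self abs_minus_cancel abs_mult)
    also have "\<dots> \<le> c * norm y" using that vx by (intro mult_mono) (auto simp: S_def)
    finally show ?thesis by (simp add: norm_exp_eq_Re)
  qed
  define w where "w y = 1 / c * (exp (2 * c * norm y) * cmod (M y))" for y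
  have wi: "integrable lborel w" unfolding w_def using i by (rule integrable_mult_right)
  have bd: "cmod (?f' u y) \<le> w y" if "u \<in> S" for u y
  proof -
    have "cmod (?f' u y) = cmod (exp (\<i> * of_real (x \<bullet> y) + \<i> * u * of_real (v \<bullet> y))) * (\<bar>v \<bullet> y\<bar> * cmod (M y))"
      by (simp add: norm_mult)
    also have "\<dots> \<le> exp (c * norm y) * ((1 / c * exp (c * norm y)) * cmod (M y))"
      using vx[of y] linear_le_exp[OF c, of "norm y"] eb[OF that, of y] by (intro mult_mono) auto
    also have "\<dots> = w y" using c by (simp add: w_def flip: exp_add)
    finally show ?thesis .
  qed
  have lip: "cmod (?f u y - ?f z y) \<le> w y * cmod (u - z)" if "u \<in> S" for u y
    by (rule field_differentiable_bound[OF \<open>convex S\<close>, where f = "\<lambda>u. ?f u y"])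
       (use d bd that zS in \<open>auto intro: has_field_derivative_at_within\<close>)
  have fi: "integrable lborel (?f u)" if "u \<in> S" for u
  proof (rule Bochner_Integration.integrable_bound[OF i])
    show "AE y in lborel. norm (?f u y) \<le> norm (exp (2 * c * norm y) * cmod (M y))"
    proof (intro AE_I2)
      fix y :: 'a
      have "exp (c * norm y) \<le> exp (2 * c * norm y)" using c by simp
      then show "norm (?f u y) \<le> norm (exp (2 * c * norm y) * cmod (M y))"
        using eb[OF that, of y] by (simp add: norm_mult mult_right_mono)
    qed
  qed measurable
  have "((\<lambda>u. (LINT y|lborel. (?f u y - ?f z y) / (u - z))) \<longlongrightarrow> (LINT y|lborel. ?f' z y)) (at z within S)"
  proof (rule dominated_convergence_at[OF _ _ wi])
    show "AE y in lborel. ((\<lambda>u. (?f u y - ?f z y) / (u - z)) \<longlongrightarrow> ?f' z y) (at z within S)"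
      using has_field_derivative_at_within[OF d] by (auto simp: has_field_derivative_iff)
    fix u assume "u \<in> S" "u \<noteq> z"
    then show "AE y in lborel. norm ((?f u y - ?f z y) / (u - z)) \<le> w y"
      using lip[of u] by (auto simp: norm_divide divide_le_eq)
  qed measurable
  moreover have "\<forall>\<^sub>F u in at z within S. (LINT y|lborel. (?f u y - ?f z y) / (u - z)) = ((LINT y|lborel. ?f u y) - (LINT y|lborel. ?f z y)) / (u - z)"
    unfolding eventually_at_filter using fi zS by (auto intro!: always_eventually)
  ultimately have "((\<lambda>u. ((LINT y|lborel. ?f u y) - (LINT y|lborel. ?f z y)) / (u - z)) \<longlongrightarrow> (LINT y|lborel. ?f' z y)) (at z within S)"
    by (rule Lim_transform_eventually)
  then show ?thesis
    using at_within_open[OF zS \<open>open S\<close>] by (simp add: has_field_derivative_iff)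
qed

lemma osc_direction_derivative:
  fixes M :: "'a::euclidean_space => complex"
  assumes M: "M \<in> borel_fun" and c: "c > 0"
    and i: "integrable lborel (\<lambda>y. exp (2 * c * norm y) * cmod (M y))" and v: "norm v \<le> 1"
  shows "((\<lambda>t. osc M (x + t *\<^sub>R v)) has_vector_derivative osc (\<lambda>y. \<i> * of_real (v \<bullet> y) * M y) (x + t *\<^sub>R v)) (at t)"
proof -
  have eq: "exp (\<i> * of_real (x \<bullet> y) + \<i> * complex_of_real t * of_real (v \<bullet> y)) = exp (\<i> * of_real ((x + t *\<^sub>R v) \<bullet> y))" for t y
    by (simp add: inner_add_left algebra_simps)
  have "\<bar>Im (complex_of_real t)\<bar> < c" using c by simp
  from has_vector_derivative_real_field[OF osc_complex_derivative[OF M c i v this, of x]]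
  show ?thesis unfolding eq osc_def .
qed

text \<open>On the line from \<open>x0\<close> through \<open>x\<close> the function extends
  holomorphically to a connected strip and vanishes on a real segment starting at 0, so the identity
  theorem applies.\<close>

lemma osc_unique_continuation:
  fixes M :: "'a::euclidean_space => complex"
  assumes M: "M \<in> borel_fun" and c: "c > 0"
    and i: "integrable lborel (\<lambda>y. exp (2 * c * norm y) * cmod (M y))"
    and r: "r > 0" and z: "\<And>x. x \<in> ball x0 r ==> osc M x = 0"
  shows "osc M x = 0"
proof (cases "x = x0")
  case True then show ?thesis using z[of x0] r by simp
next
  case False
  define v where "v = (x - x0) /\<^sub>R norm (x - x0)"
  have v: "norm v = 1" using False by (simp add: v_def)
  have xv: "x = x0 + norm (x - x0) *\<^sub>R v" using False by (simp add: v_def)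
  define h where "h z = (LINT y|lborel. exp (\<i> * of_real (x0 \<bullet> y) + \<i> * z * of_real (v \<bullet> y)) * M y)" for z
  define S where "S = {w. \<bar>Im w\<bar> < c}"
  have hreal: "h (of_real t) = osc M (x0 + t *\<^sub>R v)" for t
    unfolding h_def osc_def by (intro Bochner_Integration.integral_cong) (auto simp: inner_add_left algebra_simps)
  have "convex S"
  proof -
    have "S = {w. Im w < c} \<inter> {w. Im w > - c}" by (auto simp: S_def)
    then show ?thesis by (simp add: convex_Int convex_halfspace_Im_lt convex_halfspace_Im_gt)
  qed
  have "open S" unfolding S_def by (intro open_Collect_less continuous_intros)
  have hol: "h holomorphic_on S"
    unfolding holomorphic_on_def
  proof
    fix z assume "z \<in> S"
    then have "\<bar>Im z\<bar> < c" by (simp add: S_def)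
    from osc_complex_derivative[OF M c i _ this, of v x0] v
    show "h field_differentiable (at z within S)"
      unfolding h_def[abs_def] field_differentiable_def by (blast intro: has_field_derivative_at_within order_eq_refl)
  qed
  have "h (of_real (norm (x - x0))) = 0"
  proof (rule analytic_continuation[OF hol \<open>open S\<close> convex_connected[OF \<open>convex S\<close>], of "complex_of_real ` {0..<r}" 0])
    show "complex_of_real ` {0..<r} \<subseteq> S" "0 \<in> S" using c by (auto simp: S_def)
    show "complex_of_real (norm (x - x0)) \<in> S" using c by (simp add: S_def)
    show "0 islimpt complex_of_real ` {0..<r}"
      unfolding islimpt_approachable
    proof (intro allI impI)
      fix e :: real assume "e > 0"
      then show "\<exists>x'\<in>complex_of_real ` {0..<r}. x' \<noteq> 0 \<and> dist x' 0 < e"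
        using r by (intro bexI[of _ "complex_of_real (min (e/2) (r/2))"]) (auto simp: min_def)
    qed
    show "h w = 0" if wr: "w \<in> complex_of_real ` {0..<r}" for w
    proof -
      obtain t where "w = of_real t" "0 \<le> t" "t < r" using wr by (elim imageE) auto
      then show ?thesis using hreal[of t] z[of "x0 + t *\<^sub>R v"] v by (simp add: dist_norm)
    qed
  qed
  then show ?thesis using hreal xv by simp
qed

subsection \<open>Extensions given by Fourier multipliers\<close>

lemma has_vector_derivative_quotient:
  "(f has_vector_derivative d) (at s within N) \<longleftrightarrow> ((\<lambda>r. (1 / (r - s)) *\<^sub>R (f r - f s)) \<longlongrightarrow> d) (at s within N)"
proof -
  have eq: "norm ((f r - f s) - (r - s) *\<^sub>R d) / \<bar>r - s\<bar> = norm ((1 / (r - s)) *\<^sub>R (f r - f s) - d)" if "r \<noteq> s" for r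
  proof -
    have "(1 / (r - s)) *\<^sub>R (f r - f s) - d = (1 / (r - s)) *\<^sub>R ((f r - f s) - (r - s) *\<^sub>R d)"
      using that by (simp add: scaleR_diff_right)
    then show ?thesis by (simp only: norm_scaleR) simp
  qed
  have "((\<lambda>r. norm ((f r - f s) - (r - s) *\<^sub>R d) / norm (r - s)) \<longlongrightarrow> 0) (at s within N) \<longleftrightarrow>
     ((\<lambda>r. norm ((1 / (r - s)) *\<^sub>R (f r - f s) - d)) \<longlongrightarrow> 0) (at s within N)"
    by (rule filterlim_cong[OF refl refl]) (auto simp: eventually_at_filter eq intro!: always_eventually)
  then show ?thesis
    unfolding has_vector_derivative_def has_derivative_iff_norm tendsto_norm_zero_iff LIM_zero_iff
    by (simp add: bounded_linear_scaleR_left)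
qed

text \<open>Admissible multipliers: exponential decay in the frequency, uniform for \<open>s\<close>
  in compact parts of the open half-line. The constants may degenerate as \<open>s\<close> tends to
  0. The class is stable under differentiation in \<open>x\<close>.\<close>

definition adm :: "(real => 'a::euclidean_space => complex) => bool" where
  "adm m \<longleftrightarrow> (\<forall>s>0. m s \<in> borel_fun) \<and> (\<forall>y. continuous_on {0<..} (\<lambda>s. m s y)) \<and>
     (\<forall>e S. 0 < e --> (\<exists>C c. c > 0 \<and> (\<forall>s\<in>{e..S}. \<forall>y. cmod (m s y) \<le> C * exp (- (c * norm y)))))"

text \<open>The function whose slice at height \<open>s\<close> has Fourier data
  \<open>m s * F\<close>. The value 0 at nonpositive heights lets integrals over the half-space be
  taken with respect to \<open>lborel\<close> on the whole space.\<close>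

definition wave :: "(real => 'a::euclidean_space => complex) => ('a => complex) => real \<times> 'a => complex" where
  "wave m F z = (if fst z > 0 then inv_fourier (\<lambda>y. m (fst z) y * F y) (snd z) else 0)"

lemma adm_measurable: "adm m ==> s > 0 ==> m s \<in> borel_fun"
  and adm_continuous: "adm m ==> continuous_on {0<..} (\<lambda>s. m s y)"
  by (auto simp: adm_def)

lemma adm_bound:
  assumes "adm m" "0 < e"
  obtains C c where "c > 0" "\<And>s y. e \<le> s ==> s \<le> S ==> cmod (m s y) \<le> C * exp (- (c * norm y))"
proof -
  have "\<exists>C c. c > 0 \<and> (\<forall>s\<in>{e..S}. \<forall>y. cmod (m s y) \<le> C * exp (- (c * norm y)))"
    using assms unfolding adm_def by blast
  then show ?thesis using that by (metis atLeastAtMost_iff)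
qed

lemma adm_scale:
  assumes m: "adm m" and a: "continuous_on {0<..} a"
  shows "adm (\<lambda>s y. complex_of_real (a s) * m s y)"
  unfolding adm_def
proof (intro conjI allI impI)
  fix s :: real assume "s > 0"
  note [measurable] = adm_measurable[OF m this]
  show "(\<lambda>y. complex_of_real (a s) * m s y) \<in> borel_fun" by measurable
next
  fix y :: 'a show "continuous_on {0<..} (\<lambda>s. complex_of_real (a s) * m s y)"
    by (rule continuous_on_mult[OF continuous_on_of_real[OF a] adm_continuous[OF m]])
next
  fix d S :: real assume e: "0 < d"
  obtain C c where c: "c > 0" and b: "\<And>s y. d \<le> s ==> s \<le> S ==> cmod (m s y) \<le> C * exp (- (c * norm y))"
    by (rule adm_bound[OF m e, of S], rule that)
  have "continuous_on {d..S} a" by (rule continuous_on_subset[OF a]) (use e in auto)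
  then have "bounded (a ` {d..S})" by (intro compact_imp_bounded compact_continuous_image) auto
  then obtain B where "\<forall>x\<in>a ` {d..S}. norm x \<le> B" unfolding bounded_iff by blast
  then have B: "\<bar>a s\<bar> \<le> B" if "s \<in> {d..S}" for s using that by simp
  show "\<exists>C c. 0 < c \<and> (\<forall>s\<in>{d..S}. \<forall>y. cmod (complex_of_real (a s) * m s y) \<le> C * exp (- (c * norm y)))"
  proof (rule exI[of _ "B * C"], rule exI[of _ c], intro conjI ballI allI c)
    fix s y assume s: "s \<in> {d..S}"
    have "\<bar>a s\<bar> * cmod (m s y) \<le> B * (C * exp (- (c * norm y)))"
      using s b[of s y] B[OF s] by (intro mult_mono) auto
    then show "cmod (complex_of_real (a s) * m s y) \<le> B * C * exp (- (c * norm y))"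
      by (simp add: norm_mult mult.assoc)
  qed
qed

text \<open>This factor is the symbol of the derivative in direction \<open>v\<close>. Half of the
  exponential decay absorbs its linear growth.\<close>

lemma adm_freq:
  assumes m: "adm m" and v: "norm v \<le> 1"
  shows "adm (\<lambda>s y. \<i> * of_real (v \<bullet> y) * m s y)"
  unfolding adm_def
proof (intro conjI allI impI)
  fix s :: real assume "s > 0"
  note [measurable] = adm_measurable[OF m this]
  show "(\<lambda>y. \<i> * of_real (v \<bullet> y) * m s y) \<in> borel_fun" by measurable
next
  fix y :: 'a show "continuous_on {0<..} (\<lambda>s. \<i> * of_real (v \<bullet> y) * m s y)"
    by (rule continuous_on_mult[OF continuous_on_const adm_continuous[OF m]])
next
  fix d S :: real assume e: "0 < d"
  obtain C c where c: "c > 0" and b: "\<And>s y. d \<le> s ==> s \<le> S ==> cmod (m s y) \<le> C * exp (- (c * norm y))"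
    by (rule adm_bound[OF m e, of S], rule that)
  show "\<exists>C c. 0 < c \<and> (\<forall>s\<in>{d..S}. \<forall>y. cmod (\<i> * of_real (v \<bullet> y) * m s y) \<le> C * exp (- (c * norm y)))"
  proof (rule exI[of _ "1 / (c / 2) * C"], rule exI[of _ "c / 2"], intro conjI ballI allI)
    fix s y assume s: "s \<in> {d..S}"
    have "\<bar>v \<bullet> y\<bar> \<le> norm y"
      using Cauchy_Schwarz_ineq2[of v y] mult_right_mono[OF v, of "norm y"] by simp
    also have "\<dots> \<le> 1 / (c / 2) * exp (c / 2 * norm y)" using c by (intro linear_le_exp) auto
    finally have "\<bar>v \<bullet> y\<bar> * cmod (m s y) \<le> 1 / (c / 2) * exp (c / 2 * norm y) * (C * exp (- (c * norm y)))"
      using s b[of s y] c by (intro mult_mono) auto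
    also have "\<dots> = 1 / (c / 2) * C * (exp (c / 2 * norm y) * exp (- (c * norm y)))" by simp
    also have "exp (c / 2 * norm y) * exp (- (c * norm y)) = exp (- (c / 2 * norm y))"
      by (simp add: field_simps flip: exp_add)
    finally show "cmod (\<i> * of_real (v \<bullet> y) * m s y) \<le> 1 / (c / 2) * C * exp (- (c / 2 * norm y))"
      by (simp add: norm_mult)
  qed (use c in auto)
qed

lemma wave_slice: "s > 0 ==> wave m F (s, x) = inv_fourier (\<lambda>y. m s y * F y) x"
  by (simp add: wave_def)

context
  fixes F :: "'a::euclidean_space => complex"
  assumes F: "sqi lborel F"
begin

lemma F_meas [measurable]: "F \<in> borel_fun"
  using F by (simp add: sqi_def)

lemma adm_integrable:
  assumes m: "adm m" and s: "s > 0"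
  shows "\<exists>c>0. integrable lborel (\<lambda>y. exp (2 * c * norm y) * cmod (m s y * F y))"
    "integrable lborel (\<lambda>y. m s y * F y)" "sqi lborel (\<lambda>y. m s y * F y)"
    "(\<lambda>y. m s y * F y) \<in> borel_fun"
proof -
  obtain C c where c: "c > 0" "\<And>r y. s \<le> r ==> r \<le> s ==> cmod (m r y) \<le> C * exp (- (c * norm y))"
    by (rule adm_bound[OF m s, of s], rule that)
  then have b: "cmod (m s y) \<le> C * exp (- (c * norm y))" for y by auto
  note E = exp_decay_integrable[OF F adm_measurable[OF m s] c(1) b]
  show "\<exists>c>0. integrable lborel (\<lambda>y. exp (2 * c * norm y) * cmod (m s y * F y))"
    using E(1) c(1) by (intro exI[of _ "c / 4"]) simp
  show "integrable lborel (\<lambda>y. m s y * F y)" "sqi lborel (\<lambda>y. m s y * F y)" by (fact E)+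
  show "(\<lambda>y. m s y * F y) \<in> borel_fun" using E(3) by (simp add: sqi_def)
qed

lemma wave_osc:
  assumes "adm m" "s > 0"
  shows "wave m F (s, x) = of_real (fconst TYPE('a)) * osc (\<lambda>y. m s y * F y) x"
  unfolding wave_slice[OF assms(2)] by (rule inv_fourier_osc[OF adm_integrable(4)[OF assms]])

lemma wave_L2:
  assumes "adm m" "s > 0"
  shows "(\<lambda>x. wave m F (s, x)) \<in> borel_fun" "sqi lborel (\<lambda>x. wave m F (s, x))"
    "sqnorm lborel (\<lambda>x. wave m F (s, x)) = sqnorm lborel (\<lambda>y. m s y * F y)"
proof -
  note a = adm_integrable[OF assms]
  have 1: "integrable lebesgue (\<lambda>y. m s y * F y)" using a(2,4) by (simp add: integrable_completion)
  have 2: "sqi lebesgue (\<lambda>y. m s y * F y)" using a(3,4) by (simp add: sqi_lebesgue_iff)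
  note I = inv_fourier_isometry[OF 1 2]
  have eq: "(\<lambda>x. wave m F (s, x)) = inv_fourier (\<lambda>y. m s y * F y)"
    by (rule ext) (rule wave_slice[OF assms(2)])
  show "(\<lambda>x. wave m F (s, x)) \<in> borel_fun" unfolding eq by (rule I(1))
  show "sqi lborel (\<lambda>x. wave m F (s, x))" unfolding eq using I(1,2) by (simp add: sqi_lebesgue_iff)
  show "sqnorm lborel (\<lambda>x. wave m F (s, x)) = sqnorm lborel (\<lambda>y. m s y * F y)"
    unfolding eq using I(1,3) a(4) by (simp add: sqnorm_lebesgue)
qed

lemma wave_bound:
  assumes m: "adm m" and e: "0 < d"
  obtains w where "integrable lborel w" "\<And>s y. d \<le> s ==> s \<le> S ==> cmod (m s y * F y) \<le> w y"
proof -
  obtain C c where c: "c > 0" and b: "\<And>s y. d \<le> s ==> s \<le> S ==> cmod (m s y) \<le> C * exp (- (c * norm y))"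
    by (rule adm_bound[OF m e, of S], rule that)
  let ?w = "\<lambda>y. \<bar>C\<bar> * cmod (complex_of_real (exp (- (c * norm y))) * F y)"
  show ?thesis
  proof (rule that[of ?w])
    show "integrable lborel ?w"
      using sqi_integrable_mult[OF sqi_exp_norm[OF c] F] by simp
    fix s y assume s: "d \<le> s" "s \<le> S"
    have "cmod (m s y) \<le> \<bar>C\<bar> * exp (- (c * norm y))"
      by (rule order_trans[OF b[OF s]]) (auto intro: mult_right_mono)
    from mult_right_mono[OF this, of "cmod (F y)"]
    show "cmod (m s y * F y) \<le> ?w y" by (simp add: norm_mult mult.assoc)
  qed
qed

lemma wave_continuous:
  assumes m: "adm m"
  shows "continuous_on half_space (wave m F)"
proof (rule continuous_at_imp_continuous_on, rule ballI)
  fix z :: "real \<times> 'a" assume "z \<in> half_space"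
  then obtain s0 x0 where z: "z = (s0, x0)" "s0 > 0" by (auto simp: half_space_def)
  define N where "N = {s0/2<..<s0+1} \<times> (UNIV :: 'a set)"
  have N: "open N" "z \<in> N" using z by (auto simp: N_def intro: open_Times)
  obtain w where w: "integrable lborel w" "\<And>s y. s0/2 \<le> s ==> s \<le> s0+1 ==> cmod (m s y * F y) \<le> w y"
    by (rule wave_bound[OF m, of "s0/2" "s0+1"]) (use z in auto)
  have pos: "fst p > 0" if "p \<in> N" for p using that z by (auto simp: N_def)
  have "((\<lambda>p. (LINT y|lborel. exp (\<i> * of_real (snd p \<bullet> y)) * (m (fst p) y * F y))) \<longlongrightarrow>
     (LINT y|lborel. exp (\<i> * of_real (snd z \<bullet> y)) * (m (fst z) y * F y))) (at z within N)"
  proof (rule dominated_convergence_at[OF _ _ w(1)])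
    have meas: "(\<lambda>y. exp (\<i> * of_real (snd p \<bullet> y)) * (m (fst p) y * F y)) \<in> borel_measurable lborel" if "p \<in> N" for p
      using adm_integrable(4)[OF m pos[OF that]] by measurable
    then show "p \<in> N ==> (\<lambda>y. exp (\<i> * of_real (snd p \<bullet> y)) * (m (fst p) y * F y)) \<in> borel_measurable lborel" for p .
    show "(\<lambda>y. exp (\<i> * of_real (snd z \<bullet> y)) * (m (fst z) y * F y)) \<in> borel_measurable lborel" by (rule meas[OF N(2)])
    show "AE y in lborel. ((\<lambda>p. exp (\<i> * of_real (snd p \<bullet> y)) * (m (fst p) y * F y)) \<longlongrightarrow> exp (\<i> * of_real (snd z \<bullet> y)) * (m (fst z) y * F y)) (at z within N)"
    proof (intro AE_I2 tendsto_mult tendsto_const)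
      fix y :: 'a
      show "((\<lambda>p. exp (\<i> * complex_of_real (snd p \<bullet> y))) \<longlongrightarrow> exp (\<i> * complex_of_real (snd z \<bullet> y))) (at z within N)"
        by (intro tendsto_intros)
      have "isCont (\<lambda>s. m s y) (fst z)"
        using adm_continuous[OF m, of y] z by (simp add: continuous_on_eq_continuous_at)
      then show "((\<lambda>p. m (fst p) y) \<longlongrightarrow> m (fst z) y) (at z within N)"
        by (rule isCont_tendsto_compose) (intro tendsto_intros)
    qed
    show "AE y in lborel. norm (exp (\<i> * of_real (snd p \<bullet> y)) * (m (fst p) y * F y)) \<le> w y" if "p \<in> N" for p
    proof (intro AE_I2)
      fix y :: 'a
      show "norm (exp (\<i> * of_real (snd p \<bullet> y)) * (m (fst p) y * F y)) \<le> w y"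
        using w(2)[of "fst p" y] that unfolding norm_mult[of "exp _"] norm_exp_i_times by (auto simp: N_def)
    qed
  qed
  then have "((\<lambda>p. of_real (fconst TYPE('a)) * osc (\<lambda>y. m (fst p) y * F y) (snd p)) \<longlongrightarrow> of_real (fconst TYPE('a)) * osc (\<lambda>y. m (fst z) y * F y) (snd z)) (at z within N)"
    unfolding osc_def by (intro tendsto_mult_left)
  then have "((\<lambda>p. of_real (fconst TYPE('a)) * osc (\<lambda>y. m (fst p) y * F y) (snd p)) \<longlongrightarrow> wave m F z) (at z within N)"
    using wave_osc[OF m, of s0 x0] z by simp
  then have "(wave m F \<longlongrightarrow> wave m F z) (at z within N)"
  proof (rule Lim_transform_eventually)
    show "\<forall>\<^sub>F p in at z within N. of_real (fconst TYPE('a)) * osc (\<lambda>y. m (fst p) y * F y) (snd p) = wave m F p"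
      unfolding eventually_at_filter using wave_osc[OF m] pos
      by (intro always_eventually allI impI) (metis prod.collapse)
  qed
  then show "isCont (wave m F) z"
    using at_within_open[OF N(2,1)] by (simp add: isCont_def)
qed

lemma wave_measurable [measurable]:
  assumes m: "adm m" shows "wave m F \<in> borel_fun"
proof -
  have "open (half_space :: (real \<times> 'a) set)" unfolding half_space_def by (intro open_Times) auto
  then have "(half_space :: (real \<times> 'a) set) \<in> sets borel" by simp
  from borel_measurable_continuous_on_indicator[OF this wave_continuous[OF m]]
  have "(\<lambda>z. indicator half_space z *\<^sub>R wave m F z) \<in> borel_fun" .
  moreover have "(\<lambda>z. indicator half_space z *\<^sub>R wave m F z) = wave m F"
    by (auto simp: fun_eq_iff wave_def half_space_def indicator_def)
  ultimately show ?thesis by simp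
qed

lemma wave_space_derivative:
  assumes m: "adm m" and s: "s > 0" and v: "norm v \<le> 1"
  shows "((\<lambda>t. wave m F (s, x + t *\<^sub>R v)) has_vector_derivative wave (\<lambda>s y. \<i> * of_real (v \<bullet> y) * m s y) F (s, x + t *\<^sub>R v)) (at t)"
proof -
  obtain c where c: "c > 0" "integrable lborel (\<lambda>y. exp (2 * c * norm y) * cmod (m s y * F y))"
    using adm_integrable(1)[OF m s] by blast
  have "((\<lambda>t. of_real (fconst TYPE('a)) * osc (\<lambda>y. m s y * F y) (x + t *\<^sub>R v)) has_vector_derivative
     of_real (fconst TYPE('a)) * osc (\<lambda>y. \<i> * of_real (v \<bullet> y) * (m s y * F y)) (x + t *\<^sub>R v)) (at t)"
    by (intro has_vector_derivative_mult_right osc_direction_derivative[OF adm_integrable(4)[OF m s] c v])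
  then show ?thesis
    unfolding wave_osc[OF m s] wave_osc[OF adm_freq[OF m v] s] by (simp add: mult.assoc)
qed

text \<open>Differentiation under the integral. Near \<open>s\<close> the multiplier
  \<open>m'\<close> has an integrable majorant, and by the mean value inequality it bounds the
  difference quotients as well.\<close>

lemma wave_time_derivative:
  assumes m: "adm m" and m': "adm m'" and s: "s > 0"
    and D: "\<And>s y. s > 0 ==> ((\<lambda>s. m s y) has_vector_derivative m' s y) (at s)"
  shows "((\<lambda>s. wave m F (s, x)) has_vector_derivative wave m' F (s, x)) (at s)"
proof -
  define N where "N = {s/2<..<s+1}"
  have N: "open N" "s \<in> N" using s by (auto simp: N_def)
  have pos: "r > 0" if "r \<in> N" for r using that s by (auto simp: N_def)
  obtain w where w: "integrable lborel w" "\<And>r y. s/2 \<le> r ==> r \<le> s+1 ==> cmod (m' r y * F y) \<le> w y"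
    by (rule wave_bound[OF m', of "s/2" "s+1"]) (use s in auto)
  let ?f = "\<lambda>r y. exp (\<i> * of_real (x \<bullet> y)) * (m r y * F y)"
  let ?f' = "\<lambda>r y. exp (\<i> * of_real (x \<bullet> y)) * (m' r y * F y)"
  have d: "((\<lambda>r. ?f r y) has_vector_derivative ?f' r y) (at r)" if "r > 0" for r y
    by (intro has_vector_derivative_mult_right has_vector_derivative_mult_left D that)
  have bd: "cmod (?f' r y) \<le> w y" if "r \<in> N" for r y
    using w(2)[of r y] that unfolding norm_mult[of "exp _"] norm_exp_i_times by (auto simp: N_def)
  have lip: "cmod (?f r y - ?f s y) \<le> w y * norm (r - s)" if "r \<in> N" for r y
  proof (rule differentiable_bound[of N "\<lambda>r. ?f r y" "\<lambda>r h. h *\<^sub>R ?f' r y"])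
    show "convex N" unfolding N_def by simp
    show "((\<lambda>r. ?f r y) has_derivative (\<lambda>h. h *\<^sub>R ?f' q y)) (at q within N)" if "q \<in> N" for q
      using d[OF pos[OF that], of y] by (auto simp: has_vector_derivative_def intro: has_derivative_at_withinI)
    show "onorm (\<lambda>h. h *\<^sub>R ?f' q y) \<le> w y" if "q \<in> N" for q
      by (rule onorm_le) (use mult_right_mono[OF bd[OF that, of y]] in \<open>auto simp: mult.commute\<close>)
  qed (use that N in auto)
  have fi: "integrable lborel (?f r)" if "r \<in> N" for r
    using integrable_exp_mult[OF adm_integrable(2)[OF m pos[OF that]], of "\<lambda>y. - (x \<bullet> y)"] by simp
  have [measurable]: "?f r \<in> borel_fun" if "r \<in> N" for r
    using borel_measurable_integrable[OF fi[OF that]] by simp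
  have fs: "?f' s \<in> borel_fun"
    using adm_integrable(4)[OF m' s] by measurable
  have "((\<lambda>r. (LINT y|lborel. (1 / (r - s)) *\<^sub>R (?f r y - ?f s y))) \<longlongrightarrow> (LINT y|lborel. ?f' s y)) (at s within N)"
  proof (rule dominated_convergence_at[OF _ _ w(1)])
    show "AE y in lborel. ((\<lambda>r. (1 / (r - s)) *\<^sub>R (?f r y - ?f s y)) \<longlongrightarrow> ?f' s y) (at s within N)"
    proof (intro AE_I2)
      fix y :: 'a
      show "((\<lambda>r. (1 / (r - s)) *\<^sub>R (?f r y - ?f s y)) \<longlongrightarrow> ?f' s y) (at s within N)"
        by (rule has_vector_derivative_quotient[THEN iffD1, OF has_vector_derivative_at_within[OF d[OF s]]])
    qed
    show "?f' s \<in> borel_measurable lborel" using fs by simp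
    show "(\<lambda>y. (1 / (r - s)) *\<^sub>R (?f r y - ?f s y)) \<in> borel_measurable lborel" if "r \<in> N" for r
      using that N(2) by measurable
    fix r assume r: "r \<in> N" "r \<noteq> s"
    show "AE y in lborel. norm ((1 / (r - s)) *\<^sub>R (?f r y - ?f s y)) \<le> w y"
    proof (intro AE_I2)
      fix y :: 'a
      have "norm ((1 / (r - s)) *\<^sub>R (?f r y - ?f s y)) \<le> \<bar>1 / (r - s)\<bar> * (w y * norm (r - s))"
        unfolding norm_scaleR by (intro mult_left_mono lip r) auto
      also have "\<dots> = w y" using r by simp
      finally show "norm ((1 / (r - s)) *\<^sub>R (?f r y - ?f s y)) \<le> w y" .
    qed
  qed
  moreover have "\<forall>\<^sub>F r in at s within N. (LINT y|lborel. (1 / (r - s)) *\<^sub>R (?f r y - ?f s y)) = (1 / (r - s)) *\<^sub>R ((LINT y|lborel. ?f r y) - (LINT y|lborel. ?f s y))"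
    unfolding eventually_at_filter using fi N by (auto intro!: always_eventually)
  ultimately have "((\<lambda>r. (1 / (r - s)) *\<^sub>R ((LINT y|lborel. ?f r y) - (LINT y|lborel. ?f s y))) \<longlongrightarrow> (LINT y|lborel. ?f' s y)) (at s within N)"
    by (rule Lim_transform_eventually)
  then have "((\<lambda>r. osc (\<lambda>y. m r y * F y) x) has_vector_derivative osc (\<lambda>y. m' s y * F y) x) (at s)"
    unfolding osc_def at_within_open[OF N(2,1)] by (rule has_vector_derivative_quotient[THEN iffD2])
  then have "((\<lambda>r. of_real (fconst TYPE('a)) * osc (\<lambda>y. m r y * F y) x) has_vector_derivative of_real (fconst TYPE('a)) * osc (\<lambda>y. m' s y * F y) x) (at s)"
    by (rule has_vector_derivative_mult_right)
  then have "((\<lambda>r. of_real (fconst TYPE('a)) * osc (\<lambda>y. m r y * F y) x) has_vector_derivative wave m' F (s, x)) (at s)"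
    by (simp add: wave_osc[OF m' s])
  then show ?thesis
    by (rule has_vector_derivative_transform_within_open[of _ _ _ N]) (use N pos wave_osc[OF m] in auto)
qed

end

subsection \<open>Green's formula with a locally constant cutoff\<close>

text \<open>At a zero of \<open>G\<close> where its derivative vanishes too, a bounded factor cannot
  spoil differentiability, however discontinuous it is.\<close>

lemma bounded_times_flat_derivative:
  fixes k G :: "real => complex"
  assumes G: "(G has_vector_derivative 0) (at t)" "G t = 0" and k: "\<And>s. s \<in> T ==> cmod (k s) \<le> C"
  shows "((\<lambda>s. k s * G s) has_vector_derivative 0) (at t within T)"
  unfolding has_vector_derivative_quotient
proof (rule Lim_null_comparison)
  have "((\<lambda>r. (1 / (r - t)) *\<^sub>R (G r - G t)) \<longlongrightarrow> 0) (at t within T)"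
    using has_vector_derivative_at_within[OF G(1)] unfolding has_vector_derivative_quotient .
  then show "((\<lambda>r. C * cmod ((1 / (r - t)) *\<^sub>R (G r - G t))) \<longlongrightarrow> 0) (at t within T)"
    using tendsto_mult_right_zero tendsto_norm_zero by blast
  show "\<forall>\<^sub>F r in at t within T. norm ((1 / (r - t)) *\<^sub>R (k r * G r - k t * G t)) \<le> C * cmod ((1 / (r - t)) *\<^sub>R (G r - G t))"
    unfolding eventually_at_filter
  proof (intro always_eventually allI impI)
    fix r assume "r \<in> T"
    have "norm ((1 / (r - t)) *\<^sub>R (k r * G r - k t * G t)) = cmod (k r) * cmod ((1 / (r - t)) *\<^sub>R (G r - G t))"
      by (simp add: G(2) norm_mult)
    also have "\<dots> \<le> C * cmod ((1 / (r - t)) *\<^sub>R (G r - G t))"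
      using k[OF \<open>r \<in> T\<close>] by (rule mult_right_mono) simp
    finally show "norm ((1 / (r - t)) *\<^sub>R (k r * G r - k t * G t)) \<le> C * cmod ((1 / (r - t)) *\<^sub>R (G r - G t))" .
  qed
qed

text \<open>The truncations \<open>|y|\<^sup>2 / (|y|\<^sup>2 + \<epsilon>)\<close> vanish to second order on the zero set of \<open>y\<close>, so that multiplying
  by them makes the product with the jumping function \<open>k\<close> differentiable.\<close>

lemma cutoff_ftc:
  fixes y Y y' Y' k :: "real => complex"
  assumes ab: "a \<le> b"
    and y: "\<And>t. t \<in> {a..b} ==> (y has_vector_derivative y' t) (at t)"
    and Y: "\<And>t. t \<in> {a..b} ==> (Y has_vector_derivative Y' t) (at t)"
    and c: "continuous_on {a..b} y'" "continuous_on {a..b} Y'"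
    and kC: "\<And>t. t \<in> {a..b} ==> cmod (k t) \<le> C"
    and k0: "\<And>t. t \<in> {a..b} ==> y t = 0 ==> k t = 0"
    and k1: "\<And>t. t \<in> {a..b} ==> y t \<noteq> 0 ==> \<exists>e>0. \<forall>s\<in>ball t e. k s = k t"
  shows "((\<lambda>t. k t * (y' t * Y t + y t * Y' t)) has_integral k b * (y b * Y b) - k a * (y a * Y a)) {a..b}"
proof -
  have yc: "continuous_on {a..b} y" and Yc: "continuous_on {a..b} Y"
    using has_vector_derivative_continuous[OF y] has_vector_derivative_continuous[OF Y]
    by (auto intro!: continuous_at_imp_continuous_on)
  define e where "e n = inverse (real (Suc n))" for n
  have e: "e n > 0" for n by (simp add: e_def)
  have e0: "e ----> 0" unfolding e_def by (rule LIMSEQ_inverse_real_of_nat)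
  define N where "N t = csq (y t)" for t
  define N' where "N' t = 2 * Re (y' t * cnj (y t))" for t
  define q where "q n t = N t / (N t + e n)" for n t
  define q' where "q' n t = N' t * e n / (N t + e n)\<^sup>2" for n t
  have Nnn: "0 \<le> N t" for t by (simp add: N_def)
  have Npos: "N t + e n > 0" for n t using Nnn[of t] e[of n] by simp
  have N': "(N has_vector_derivative N' t) (at t)" if "t \<in> {a..b}" for t
  proof -
    have R: "((\<lambda>t. Re (y t)) has_real_derivative Re (y' t)) (at t)" and I: "((\<lambda>t. Im (y t)) has_real_derivative Im (y' t)) (at t)"
      using bounded_linear.has_vector_derivative[OF bounded_linear_Re y[OF that]]
        bounded_linear.has_vector_derivative[OF bounded_linear_Im y[OF that]]
      by (simp_all add: has_real_derivative_iff_has_vector_derivative)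
    have "((\<lambda>t. (Re (y t))\<^sup>2 + (Im (y t))\<^sup>2) has_real_derivative (2 * Re (y t) * Re (y' t) + 2 * Im (y t) * Im (y' t))) (at t)"
      using DERIV_add[OF DERIV_power[OF R, of 2] DERIV_power[OF I, of 2]] by (simp add: mult_ac)
    then show ?thesis
      by (simp add: N_def[abs_def] N'_def cmod_power2 has_real_derivative_iff_has_vector_derivative algebra_simps)
  qed
  have q': "(q n has_vector_derivative q' n t) (at t)" if "t \<in> {a..b}" for n t
  proof -
    have "(N has_real_derivative N' t) (at t)" using N'[OF that] by (simp add: has_real_derivative_iff_has_vector_derivative)
    then have "(q n has_real_derivative (N' t * (N t + e n) - N t * (N' t + 0)) / ((N t + e n) * (N t + e n))) (at t)"
      unfolding q_def using Npos[of t n] by (intro DERIV_divide DERIV_add DERIV_const) auto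
    moreover have "(N' t * (N t + e n) - N t * (N' t + 0)) / ((N t + e n) * (N t + e n)) = q' n t"
      by (simp add: q'_def power2_eq_square algebra_simps)
    ultimately show ?thesis by (simp add: has_real_derivative_iff_has_vector_derivative)
  qed
  define G where "G n t = y t * Y t * of_real (q n t)" for n t
  define G' where "G' n t = y t * Y t * of_real (q' n t) + (y t * Y' t + y' t * Y t) * of_real (q n t)" for n t
  have G: "(G n has_vector_derivative G' n t) (at t)" if "t \<in> {a..b}" for n t
    unfolding G_def G'_def
    by (intro has_vector_derivative_mult y[OF that] Y[OF that]
         bounded_linear.has_vector_derivative[OF bounded_linear_of_real] q'[OF that])
  have kG: "((\<lambda>t. k t * G n t) has_vector_derivative k t * G' n t) (at t within {a..b})" if t: "t \<in> {a..b}" for n t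
  proof (cases "y t = 0")
    case True
    then have 0: "G n t = 0" "G' n t = 0" by (simp_all add: G_def G'_def q_def N_def)
    have "(G n has_vector_derivative 0) (at t)" using G[OF t, of n] by (simp only: 0)
    from bounded_times_flat_derivative[OF this 0(1) kC] show ?thesis
      unfolding 0 mult_zero_right .
  next
    case False
    from k1[OF t False] obtain d where d: "d > 0" "\<forall>s\<in>ball t d. k s = k t" by (elim exE conjE)
    have 1: "((\<lambda>s. k t * G n s) has_vector_derivative k t * G' n t) (at t)"
      by (rule has_vector_derivative_mult_right[OF G[OF t]])
    have eq: "k t * G n s = k s * G n s" if "s \<in> ball t d" for s
      using bspec[OF d(2) that] by (simp only:)
    have "t \<in> ball t d" using d(1) by simp
    from has_vector_derivative_transform_within_open[OF 1 open_ball this eq]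
    have "((\<lambda>s. k s * G n s) has_vector_derivative k t * G' n t) (at t)" .
    then show ?thesis by (rule has_vector_derivative_at_within)
  qed
  have I: "((\<lambda>t. k t * G' n t) has_integral k b * G n b - k a * G n a) {a..b}" for n
    by (rule fundamental_theorem_of_calculus[OF ab kG])
  have qb: "0 \<le> q n t" "q n t \<le> 1" for n t using Nnn[of t] e[of n] Npos[of t n] by (auto simp: q_def)
  \<comment> \<open>The derivatives \<open>q'\<close> are not uniformly bounded near zeros of
    \<open>y\<close>, but the product with \<open>|y|\<close> is, because
    \<open>N e \<le> (N + e)^2\<close>. This supplies the dominating function
    \<open>h\<close>.\<close>
  have q'b: "cmod (y t) * \<bar>q' n t\<bar> \<le> 2 * cmod (y' t)" for n t
  proof -
    have "\<bar>N' t\<bar> \<le> 2 * (cmod (y' t) * cmod (y t))"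
      using abs_Re_le_cmod[of "y' t * cnj (y t)"] by (simp add: N'_def norm_mult abs_mult)
    then have "\<bar>q' n t\<bar> \<le> 2 * (cmod (y' t) * cmod (y t)) * e n / (N t + e n)\<^sup>2"
      unfolding q'_def using e[of n] by (simp add: abs_mult abs_divide divide_right_mono mult_right_mono)
    then have "cmod (y t) * \<bar>q' n t\<bar> \<le> cmod (y t) * (2 * (cmod (y' t) * cmod (y t)) * e n / (N t + e n)\<^sup>2)"
      by (rule mult_left_mono) simp
    also have "\<dots> = 2 * cmod (y' t) * (N t * e n / (N t + e n)\<^sup>2)" by (simp add: N_def power2_eq_square)
    also have "N t * e n / (N t + e n)\<^sup>2 \<le> 1"
    proof -
      have "N t * e n \<le> (N t + e n) * (N t + e n)" using Nnn[of t] e[of n] by (intro mult_mono) auto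
      then show ?thesis using Npos[of t n] by (simp add: power2_eq_square divide_le_eq)
    qed
    then have "2 * cmod (y' t) * (N t * e n / (N t + e n)\<^sup>2) \<le> 2 * cmod (y' t) * 1"
      by (rule mult_left_mono) simp
    finally show ?thesis by simp
  qed
  define h where "h t = C * (2 * cmod (Y t) * cmod (y' t) + cmod (y t * Y' t + y' t * Y t))" for t
  have C0: "0 \<le> C" using order_trans[OF norm_ge_zero kC[of a]] ab by simp
  have hi: "h integrable_on {a..b}"
    unfolding h_def by (intro integrable_continuous_real continuous_intros yc Yc c)
  have hb: "norm (k t * G' n t) \<le> h t" if "t \<in> {a..b}" for n t
  proof -
    have "cmod (G' n t) \<le> cmod (y t * Y t * of_real (q' n t)) + cmod ((y t * Y' t + y' t * Y t) * of_real (q n t))"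
      unfolding G'_def by (rule norm_triangle_ineq)
    also have "cmod (y t * Y t * of_real (q' n t)) = cmod (Y t) * (cmod (y t) * \<bar>q' n t\<bar>)"
      by (simp add: norm_mult)
    also have "\<dots> \<le> cmod (Y t) * (2 * cmod (y' t))" by (intro mult_left_mono q'b) simp
    also have "cmod ((y t * Y' t + y' t * Y t) * of_real (q n t)) \<le> cmod (y t * Y' t + y' t * Y t) * 1"
      unfolding norm_mult[of "y t * Y' t + y' t * Y t"] using qb[of n t] by (intro mult_left_mono) auto
    finally have "cmod (G' n t) \<le> 2 * cmod (Y t) * cmod (y' t) + cmod (y t * Y' t + y' t * Y t)" by simp
    then show ?thesis unfolding h_def norm_mult[of "k t"] using kC[OF that] C0 by (intro mult_mono) auto
  qed
  have qlim: "(\<lambda>n. q n t) ----> 1" and q'lim: "(\<lambda>n. q' n t) ----> 0" if "y t \<noteq> 0" for t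
  proof -
    have p: "N t \<noteq> 0" using that by (simp add: N_def)
    have "(\<lambda>n. q n t) ----> N t / (N t + 0)" unfolding q_def using p by (intro tendsto_intros e0) auto
    then show "(\<lambda>n. q n t) ----> 1" using p by simp
    have "(\<lambda>n. q' n t) ----> N' t * 0 / (N t + 0)\<^sup>2" unfolding q'_def using p by (intro tendsto_intros e0) auto
    then show "(\<lambda>n. q' n t) ----> 0" by simp
  qed
  have lim: "(\<lambda>n. k t * G' n t) ----> k t * (y' t * Y t + y t * Y' t)" if "t \<in> {a..b}" for t
  proof (cases "y t = 0")
    case True then show ?thesis using k0[OF that] by simp
  next
    case False
    have "(\<lambda>n. k t * G' n t) ----> k t * (y t * Y t * of_real 0 + (y t * Y' t + y' t * Y t) * of_real 1)"
      unfolding G'_def by (intro tendsto_intros qlim q'lim False)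
    then show ?thesis by (simp add: add.commute)
  qed
  have blim: "(\<lambda>n. k t * G n t) ----> k t * (y t * Y t)" if "t \<in> {a..b}" for t
  proof (cases "y t = 0")
    case True then show ?thesis using k0[OF that] by simp
  next
    case False
    have "(\<lambda>n. k t * G n t) ----> k t * (y t * Y t * of_real 1)"
      unfolding G_def by (intro tendsto_intros qlim False)
    then show ?thesis by simp
  qed
  have fi: "(\<lambda>t. k t * G' n t) integrable_on {a..b}" for n using I by blast
  note dc = dominated_convergence[OF fi hi hb lim]
  have "(\<lambda>n. integral {a..b} (\<lambda>t. k t * G' n t)) ----> k b * (y b * Y b) - k a * (y a * Y a)"
    unfolding integral_unique[OF I] using ab by (intro tendsto_diff blim) auto
  then have "integral {a..b} (\<lambda>t. k t * (y' t * Y t + y t * Y' t)) = k b * (y b * Y b) - k a * (y a * Y a)"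
    using dc(2) LIMSEQ_unique by blast
  then show ?thesis using dc(1) by (metis has_integral_integrable_integral)
qed

text \<open>The case \<open>k = 1\<close> is listed separately: it does not vanish on the zero set
  of \<open>y\<close>, and the ordinary fundamental theorem covers it.\<close>

lemma cutoff_ftc_lebesgue:
  fixes y Y y' Y' k :: "real => complex"
  assumes ab: "a \<le> b"
    and y: "\<And>t. t \<in> {a..b} ==> (y has_vector_derivative y' t) (at t)"
    and Y: "\<And>t. t \<in> {a..b} ==> (Y has_vector_derivative Y' t) (at t)"
    and c: "continuous_on {a..b} y'" "continuous_on {a..b} Y'"
    and kC: "\<And>t. t \<in> {a..b} ==> cmod (k t) \<le> C" and km [measurable]: "k \<in> borel_fun"
    and k: "(\<forall>t\<in>{a..b}. k t = 1) \<or> (\<forall>t\<in>{a..b}. (y t = 0 --> k t = 0) \<and> (y t \<noteq> 0 --> (\<exists>e>0. \<forall>s\<in>ball t e. k s = k t)))"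
  shows "(LINT t:{a..b}|lborel. k t * (y' t * Y t + y t * Y' t)) = k b * (y b * Y b) - k a * (y a * Y a)"
proof -
  have yc: "continuous_on {a..b} y" and Yc: "continuous_on {a..b} Y"
    using has_vector_derivative_continuous[OF y] has_vector_derivative_continuous[OF Y]
    by (auto intro!: continuous_at_imp_continuous_on)
  have hi: "((\<lambda>t. k t * (y' t * Y t + y t * Y' t)) has_integral k b * (y b * Y b) - k a * (y a * Y a)) {a..b}"
  proof (cases "\<forall>t\<in>{a..b}. k t = 1")
    case True
    have "((\<lambda>t. y t * Y' t + y' t * Y t) has_integral y b * Y b - y a * Y a) {a..b}"
      by (rule fundamental_theorem_of_calculus[OF ab has_vector_derivative_at_within[OF has_vector_derivative_mult[OF y Y]]])
    then have "((\<lambda>t. k t * (y' t * Y t + y t * Y' t)) has_integral y b * Y b - y a * Y a) {a..b}"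
    proof (rule has_integral_eq[rotated])
      fix t assume "t \<in> {a..b}"
      then have "k t = 1" using True by blast
      then show "y t * Y' t + y' t * Y t = k t * (y' t * Y t + y t * Y' t)" by simp
    qed
    moreover have "k a = 1" "k b = 1" using True ab by auto
    ultimately show ?thesis by simp
  next
    case False
    from k show ?thesis
    proof
      assume "\<forall>t\<in>{a..b}. k t = 1"
      with False show ?thesis by contradiction
    next
      assume K: "\<forall>t\<in>{a..b}. (y t = 0 --> k t = 0) \<and> (y t \<noteq> 0 --> (\<exists>e>0. \<forall>s\<in>ball t e. k s = k t))"
      have K1: "\<exists>e>0. \<forall>s\<in>ball t e. k s = k t" if "t \<in> {a..b}" "y t \<noteq> 0" for t
        using bspec[OF K that(1)] that(2) by (elim conjE mp)
      have K0: "k t = 0" if "t \<in> {a..b}" "y t = 0" for t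
        using bspec[OF K that(1)] that(2) by (elim conjE mp)
      show ?thesis by (rule cutoff_ftc[OF ab y Y c kC K0 K1])
    qed
  qed
  have cont: "continuous_on {a..b} (\<lambda>t. y' t * Y t + y t * Y' t)"
    by (intro continuous_intros yc Yc c)
  have "set_integrable lborel {a..b} (\<lambda>t. y' t * Y t + y t * Y' t)"
    using cont by (rule borel_integrable_atLeastAtMost')
  then have "set_integrable lborel {a..b} (\<lambda>t. k t * (y' t * Y t + y t * Y' t))"
    unfolding set_integrable_def
  proof -
    assume "integrable lborel (\<lambda>t. indicat_real {a..b} t *\<^sub>R (y' t * Y t + y t * Y' t))"
    then have "integrable lborel (\<lambda>t. complex_of_real C * (indicat_real {a..b} t *\<^sub>R (y' t * Y t + y t * Y' t)))"
      by (rule integrable_mult_right)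
    then show "integrable lborel (\<lambda>t. indicat_real {a..b} t *\<^sub>R (k t * (y' t * Y t + y t * Y' t)))"
    proof (rule Bochner_Integration.integrable_bound)
    have "(\<lambda>t. indicat_real {a..b} t *\<^sub>R (y' t * Y t + y t * Y' t)) \<in> borel_fun"
      using borel_measurable_continuous_on_indicator[OF _ cont] by simp
    then have "(\<lambda>t. k t * (indicat_real {a..b} t *\<^sub>R (y' t * Y t + y t * Y' t))) \<in> borel_fun" by measurable
    then show "(\<lambda>t. indicat_real {a..b} t *\<^sub>R (k t * (y' t * Y t + y t * Y' t))) \<in> borel_measurable lborel" by simp
    have "C \<ge> 0" using order_trans[OF norm_ge_zero kC[of a]] ab by simp
    then show "AE t in lborel. norm (indicat_real {a..b} t *\<^sub>R (k t * (y' t * Y t + y t * Y' t)))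
        \<le> norm (complex_of_real C * (indicat_real {a..b} t *\<^sub>R (y' t * Y t + y t * Y' t)))"
      using kC by (auto simp: indicator_def norm_mult intro!: mult_right_mono)
    qed
  qed
  from set_borel_integral_eq_integral(2)[OF this] show ?thesis
    using integral_unique[OF hi] by simp
qed

text \<open>Integrate the increments over all \<open>x\<close>: translation invariance cancels the
  left side, and Fubini's theorem turns the right side into the integral of \<open>Q\<close>.
  Behaviour at infinity enters only through integrability.\<close>

lemma integral_of_line_derivative:
  fixes P Q :: "'a::euclidean_space => complex"
  assumes P: "integrable lborel P" and Q: "integrable lborel Q"
    and d: "\<And>x. P (x + b) - P x = (LINT t:{0..1}|lborel. Q (x + t *\<^sub>R b))"
  shows "(LINT x|lborel. Q x) = 0"
proof -
  have [measurable]: "P \<in> borel_fun" "Q \<in> borel_fun"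
    using borel_measurable_integrable[OF P] borel_measurable_integrable[OF Q] by simp_all
  have Qt: "integrable lborel (\<lambda>x. Q (x + t *\<^sub>R b))" "(LINT x|lborel. Q (x + t *\<^sub>R b)) = (LINT x|lborel. Q x)"
    "(LINT x|lborel. cmod (Q (x + t *\<^sub>R b))) = (LINT x|lborel. cmod (Q x))" for t
    using lborel_integral_shift(2)[of Q "t *\<^sub>R b"] lborel_integral_shift(1)[of Q "t *\<^sub>R b"]
      lborel_integral_shift(1)[of "\<lambda>x. cmod (Q x)" "t *\<^sub>R b"] Q by simp_all
  have pair: "integrable (lborel \<Otimes>\<^sub>M lborel) (\<lambda>(t, x). indicat_real {0..1} t *\<^sub>R Q (x + t *\<^sub>R b))"
  proof (rule lborel_pair.Fubini_integrable)
    show "(\<lambda>(t, x). indicat_real {0..1} t *\<^sub>R Q (x + t *\<^sub>R b)) \<in> borel_measurable (lborel \<Otimes>\<^sub>M lborel)"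
      by measurable
    show "integrable lborel (\<lambda>t. (LINT x|lborel. norm (case (t, x) of (t, x) => indicat_real {0..1} t *\<^sub>R Q (x + t *\<^sub>R b))))"
      by (simp add: Qt)
    show "AE t in lborel. integrable lborel (\<lambda>x. case (t, x) of (t, x) => indicat_real {0..1} t *\<^sub>R Q (x + t *\<^sub>R b))"
      using Qt(1) by simp
  qed
  have "0 = (LINT x|lborel. P (x + b)) - (LINT x|lborel. P x)"
    using lborel_integral_shift(1)[of P b] by simp
  also have "\<dots> = (LINT x|lborel. P (x + b) - P x)"
    using P lborel_integral_shift(2)[of P b] by simp
  also have "\<dots> = (LINT x|lborel. (LINT t|lborel. indicat_real {0..1} t *\<^sub>R Q (x + t *\<^sub>R b)))"
    unfolding d set_lebesgue_integral_def ..
  also have "\<dots> = (LINT t|lborel. (LINT x|lborel. indicat_real {0..1} t *\<^sub>R Q (x + t *\<^sub>R b)))"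
    using lborel_pair.Fubini_integral[OF pair] by simp
  also have "\<dots> = (LINT t|lborel. indicat_real {0..1::real} t *\<^sub>R (LINT x|lborel. Q x))"
    by (simp only: integral_scaleR_right Qt)
  also have "\<dots> = (LINT t|lborel. indicat_real {0..1::real} t) *\<^sub>R (LINT x|lborel. Q x)"
    by (rule integral_scaleR_left) simp
  also have "\<dots> = (LINT x|lborel. Q x)" by simp
  finally show ?thesis ..
qed

lemma integral_of_time_derivative:
  fixes P Q :: "real \<times> 'a::euclidean_space => complex"
  assumes P: "integrable lborel (\<lambda>x. P (e, x))" "integrable lborel (\<lambda>x. P (S, x))"
    and Q: "integrable lborel (\<lambda>z. indicat_real ({e..S} \<times> UNIV) z *\<^sub>R Q z)"
    and d: "\<And>x. P (S, x) - P (e, x) = (LINT s:{e..S}|lborel. Q (s, x))"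
  shows "(LINT z|lborel. indicat_real ({e..S} \<times> UNIV) z *\<^sub>R Q z) = (LINT x|lborel. P (S, x)) - (LINT x|lborel. P (e, x))"
proof -
  have Q': "integrable (lborel \<Otimes>\<^sub>M lborel) (\<lambda>(s, x). indicat_real {e..S} s *\<^sub>R Q (s, x))"
    using Q unfolding lborel_prod by (simp add: indicator_times case_prod_beta')
  have "(LINT z|lborel. indicat_real ({e..S} \<times> UNIV) z *\<^sub>R Q z) = (\<integral>z. (case z of (s, x) => indicat_real {e..S} s *\<^sub>R Q (s, x)) \<partial>(lborel \<Otimes>\<^sub>M lborel))"
    unfolding lborel_prod by (simp add: indicator_times case_prod_beta')
  also have "\<dots> = (LINT x|lborel. (LINT s|lborel. indicat_real {e..S} s *\<^sub>R Q (s, x)))"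
    using lborel_pair.integral_snd[OF Q'] by simp
  also have "\<dots> = (LINT x|lborel. P (S, x) - P (e, x))"
    unfolding d set_lebesgue_integral_def ..
  also have "\<dots> = (LINT x|lborel. P (S, x)) - (LINT x|lborel. P (e, x))"
    using P by simp
  finally show ?thesis .
qed

lemma adm_zero: "adm (\<lambda>s y. 0)"
  unfolding adm_def by (auto intro!: exI[of _ 0] exI[of _ 1])

lemma adm_add:
  assumes m: "adm m" and n: "adm n"
  shows "adm (\<lambda>s y. m s y + n s y)"
  unfolding adm_def
proof (intro conjI allI impI)
  fix s :: real assume "s > 0"
  note [measurable] = adm_measurable[OF m this] adm_measurable[OF n this]
  show "(\<lambda>y. m s y + n s y) \<in> borel_fun" by measurable
next
  fix y :: 'a show "continuous_on {0<..} (\<lambda>s. m s y + n s y)"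
    by (rule continuous_on_add[OF adm_continuous[OF m] adm_continuous[OF n]])
next
  fix r S :: real assume e: "0 < r"
  obtain C c where c: "c > 0" and b: "\<And>s y. r \<le> s ==> s \<le> S ==> cmod (m s y) \<le> C * exp (- (c * norm y))"
    by (rule adm_bound[OF m e, of S], rule that)
  obtain D d where d: "d > 0" and b': "\<And>s y. r \<le> s ==> s \<le> S ==> cmod (n s y) \<le> D * exp (- (d * norm y))"
    by (rule adm_bound[OF n e, of S], rule that)
  show "\<exists>C c. 0 < c \<and> (\<forall>s\<in>{r..S}. \<forall>y. cmod (m s y + n s y) \<le> C * exp (- (c * norm y)))"
  proof (rule exI[of _ "\<bar>C\<bar> + \<bar>D\<bar>"], rule exI[of _ "min c d"], intro conjI ballI allI)
    fix s and y :: 'a assume s: "s \<in> {r..S}"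
    have "C * exp (- (c * norm y)) \<le> \<bar>C\<bar> * exp (- (min c d * norm y))"
      by (intro mult_mono) (auto intro!: mult_right_mono)
    moreover have "D * exp (- (d * norm y)) \<le> \<bar>D\<bar> * exp (- (min c d * norm y))"
      by (intro mult_mono) (auto intro!: mult_right_mono)
    ultimately show "cmod (m s y + n s y) \<le> (\<bar>C\<bar> + \<bar>D\<bar>) * exp (- (min c d * norm y))"
      using norm_triangle_ineq[of "m s y" "n s y"] b[of s y] b'[of s y] s by (simp add: distrib_right)
  qed (use c d in auto)
qed

lemma adm_sum: "finite I ==> (\<And>i. i \<in> I ==> adm (m i)) ==> adm (\<lambda>s y. \<Sum>i\<in>I. m i s y)"
  by (induction I rule: finite_induct) (auto intro: adm_zero adm_add)

lemma inv_fourier_cmult: "inv_fourier (\<lambda>y. c * M y) x = c * inv_fourier M x"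
proof -
  have "(LINT y|lebesgue. exp (- (\<i> * of_real (- x \<bullet> y))) * (c * M y)) = c * (LINT y|lebesgue. exp (- (\<i> * of_real (- x \<bullet> y))) * M y)"
    by (subst integral_mult_right_zero[symmetric]) (simp add: mult.left_commute)
  then show ?thesis unfolding inv_fourier_def fourier_integral_def by simp
qed

lemma wave_scale: "wave (\<lambda>s y. of_real (a s) * m s y) F z = of_real (a (fst z)) * wave m F z"
  unfolding wave_def by (simp add: mult.assoc inv_fourier_cmult)

lemma wave_sum:
  assumes F: "sqi lborel F" and I: "finite I" and m: "\<And>i. i \<in> I ==> adm (m i)"
  shows "wave (\<lambda>s y. \<Sum>i\<in>I. m i s y) F z = (\<Sum>i\<in>I. wave (m i) F z)"
proof (cases "fst z > 0")
  case True
  obtain s x where z: "z = (s, x)" and s: "s > 0" using True by (cases z) auto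
  have "osc (\<lambda>y. (\<Sum>i\<in>I. m i s y) * F y) x = (LINT y|lborel. (\<Sum>i\<in>I. exp (\<i> * of_real (x \<bullet> y)) * (m i s y * F y)))"
    unfolding osc_def by (simp add: sum_distrib_left sum_distrib_right)
  also have "\<dots> = (\<Sum>i\<in>I. osc (\<lambda>y. m i s y * F y) x)"
    unfolding osc_def
  proof (rule Bochner_Integration.integral_sum)
    fix i assume "i \<in> I"
    from integrable_exp_mult[OF adm_integrable(2)[OF F m[OF this] s], of "\<lambda>y. - (x \<bullet> y)"]
    show "integrable lborel (\<lambda>y. exp (\<i> * of_real (x \<bullet> y)) * (m i s y * F y))" by simp
  qed
  finally show ?thesis
    unfolding z using wave_osc[OF F adm_sum[OF I m] s] wave_osc[OF F m s] by (simp add: sum_distrib_left)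
qed (simp add: wave_def)

lemma wave_diff:
  assumes F: "sqi lborel F" and G: "sqi lborel G" and m: "adm m"
  shows "wave m (\<lambda>y. F y - G y) z = wave m F z - wave m G z"
proof (cases "fst z > 0")
  case True
  obtain s x where z: "z = (s, x)" and s: "s > 0" using True by (cases z) auto
  have i: "integrable lborel (\<lambda>y. exp (\<i> * of_real (x \<bullet> y)) * (m s y * F y))" if "sqi lborel F" for F
    using integrable_exp_mult[OF adm_integrable(2)[OF that m s], of "\<lambda>y. - (x \<bullet> y)"] by simp
  have "osc (\<lambda>y. m s y * (F y - G y)) x = (LINT y|lborel. exp (\<i> * of_real (x \<bullet> y)) * (m s y * F y) - exp (\<i> * of_real (x \<bullet> y)) * (m s y * G y))"
    unfolding osc_def by (simp add: right_diff_distrib)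
  also have "\<dots> = osc (\<lambda>y. m s y * F y) x - osc (\<lambda>y. m s y * G y) x"
    unfolding osc_def using i[OF F] i[OF G] by simp
  finally show ?thesis unfolding z wave_osc[OF F m s] wave_osc[OF G m s] wave_osc[OF sqi_diff[OF F G] m s]
    by (simp add: right_diff_distrib)
qed (simp add: wave_def)

abbreviation strip :: "real => real => (real \<times> 'a::euclidean_space) set" where
  "strip e S \<equiv> {e..S} \<times> UNIV"

lemma strip_measurable: "strip e S \<in> sets borel"
  by (simp add: borel_closed closed_Times)

text \<open>Plancherel's theorem on each slice, with a bound on the multiplier that is uniform for
  heights in the strip.\<close>

lemma wave_strip_sqi:
  assumes F: "sqi lborel F" and m: "adm m" and e: "0 < d"
  shows "sqi lborel (\<lambda>z. indicator (strip d S) z * wave m F z)"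
proof -
  have [measurable]: "wave m F \<in> borel_fun" "strip d S \<in> sets borel"
    by (rule wave_measurable[OF F m], rule strip_measurable)
  obtain C c where c: "c > 0" and b: "\<And>s y. d \<le> s ==> s \<le> S ==> cmod (m s y) \<le> C * exp (- (c * norm y))"
    by (rule adm_bound[OF m e, of S], rule that)
  define h where "h z = ennreal (norm (csq (indicator (strip d S) z * wave m F z)))" for z
  have "h \<in> borel_measurable (lborel \<Otimes>\<^sub>M lborel)" unfolding h_def lborel_prod by simp
  from lborel.nn_integral_fst[OF this]
  have "(\<integral>\<^sup>+z. h z \<partial>lborel) = (\<integral>\<^sup>+s. \<integral>\<^sup>+x. h (s, x) \<partial>lborel \<partial>lborel)"
    unfolding lborel_prod by simp
  then have "(\<integral>\<^sup>+z. ennreal (norm (csq (indicator (strip d S) z * wave m F z))) \<partial>lborel) =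
      (\<integral>\<^sup>+s. \<integral>\<^sup>+x. ennreal (norm (csq (indicator (strip d S) (s, x) * wave m F (s, x)))) \<partial>lborel \<partial>lborel)"
    unfolding h_def .
  also have "\<dots> \<le> (\<integral>\<^sup>+s. indicator {d..S} s * ennreal (C\<^sup>2 * sqnorm lborel F) \<partial>lborel)"
  proof (rule nn_integral_mono)
    fix s :: real
    show "(\<integral>\<^sup>+x. ennreal (norm (csq (indicator (strip d S) (s, x) * wave m F (s, x)))) \<partial>lborel) \<le> indicator {d..S} s * ennreal (C\<^sup>2 * sqnorm lborel F)"
    proof (cases "s \<in> {d..S}")
      case True
      then have s: "s > 0" using e by auto
      have C0: "0 \<le> C" using b[of s 0] True order_trans[OF norm_ge_zero] by fastforce
      have "(\<integral>\<^sup>+x. ennreal (norm (csq (indicator (strip d S) (s, x) * wave m F (s, x)))) \<partial>lborel) = ennreal (sqnorm lborel (\<lambda>x. wave m F (s, x)))"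
        using True sqi_integrable[OF wave_L2(2)[OF F m s]] by (simp add: sqnorm_def nn_integral_eq_integral)
      also have "sqnorm lborel (\<lambda>x. wave m F (s, x)) = sqnorm lborel (\<lambda>y. m s y * F y)" by (rule wave_L2(3)[OF F m s])
      also have "\<dots> \<le> (LINT y|lborel. C\<^sup>2 * csq (F y))"
        unfolding sqnorm_def
      proof (rule integral_mono)
        show "integrable lborel (\<lambda>y. csq (m s y * F y))" by (rule sqi_integrable[OF adm_integrable(3)[OF F m s]])
        show "integrable lborel (\<lambda>y. C\<^sup>2 * csq (F y))" using sqi_integrable[OF F] by simp
        fix y :: 'a
        have "C * exp (- (c * norm y)) \<le> C * 1" using C0 c by (intro mult_left_mono) auto
        then have "cmod (m s y) \<le> C" using b[of s y] True by auto
        then show "csq (m s y * F y) \<le> C\<^sup>2 * csq (F y)"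
          by (simp add: norm_mult power_mult_distrib mult_right_mono power_mono)
      qed
      also have "\<dots> = C\<^sup>2 * sqnorm lborel F" by (simp add: sqnorm_def)
      finally show ?thesis using True by (simp add: ennreal_leI)
    qed simp
  qed
  also have "\<dots> = emeasure lborel {d..S} * ennreal (C\<^sup>2 * sqnorm lborel F)"
    by (subst nn_integral_multc) auto
  also have "\<dots> < \<infinity>" by (simp add: ennreal_mult_less_top emeasure_lborel_Icc_eq)
  finally show ?thesis unfolding sqi_def
    by (intro conjI integrableI_bounded) auto
qed

text \<open>Along a line the derivative of \<open>k u\<close> is \<open>k u'\<close> in both
  alternatives. The first gives the plain energy identity; the second, with \<open>k\<close> zero on
  the nodal set and locally constant off it, is for combinations of nodal domains.\<close>

definition cutoff :: "(real \<times> 'a::euclidean_space => complex) => (real \<times> 'a => complex) => real => bool" where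
  "cutoff k u C \<longleftrightarrow> k \<in> borel_fun \<and> (\<forall>z. cmod (k z) \<le> C) \<and>
     ((\<forall>z. k z = 1) \<or> (\<forall>z\<in>half_space. (u z = 0 --> k z = 0) \<and> (u z \<noteq> 0 --> (\<exists>e>0. \<forall>z'\<in>ball z e. k z' = k z))))"

section \<open>The multipliers of the harmonic extension\<close>

context weight
begin

definition mphi :: "real => 'a::euclidean_space => complex" where
  "mphi s y = of_real (phi (nsq y) s)"

definition mdphi :: "real => 'a::euclidean_space => complex" where
  "mdphi s y = of_real (dphi (nsq y) s)"

definition mpsi :: "'a::euclidean_space => complex" where
  "mpsi y = of_real (psi (nsq y))"

lemma mphi_measurable [measurable]: "s \<ge> 0 ==> (mphi s :: 'a::euclidean_space => complex) \<in> borel_fun"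
proof -
  assume s: "s \<ge> 0"
  have "(\<lambda>y::'a. phi (max 0 (nsq y)) s) \<in> borel_fun"
    by (rule measurable_compose[OF _ phi_measurable[OF s]]) measurable
  then show ?thesis unfolding mphi_def by (simp add: max_def)
qed

lemma mdphi_measurable [measurable]: "s \<ge> 0 ==> (mdphi s :: 'a::euclidean_space => complex) \<in> borel_fun"
proof -
  assume s: "s \<ge> 0"
  have "(\<lambda>y::'a. dphi (max 0 (nsq y)) s) \<in> borel_fun"
    by (rule measurable_compose[OF _ dphi_measurable[OF s]]) measurable
  then show ?thesis unfolding mdphi_def by (simp add: max_def)
qed

lemma psi_norm_measurable [measurable]: "(\<lambda>y::'a::euclidean_space. psi (nsq y)) \<in> borel_fun"
proof -
  have "(\<lambda>y::'a. psi (max 0 (nsq y))) \<in> borel_fun"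
    by (rule measurable_compose[OF _ psi_measurable]) measurable
  then show ?thesis by (simp add: max_def)
qed

text \<open>Apply \<open>phi_decay\<close> on \<open>[d/2, d]\<close>, where \<open>A\<close> has a
  positive minimum. With \<open>l = |y|^2\<close> the square root in the exponent is linear in
  \<open>|y|\<close>, and monotonicity in \<open>s\<close> carries the bound to all higher
  slices.\<close>

lemma phi_exp_bound:
  assumes e: "0 < d"
  shows "\<exists>c>0. \<forall>s\<ge>d. \<forall>y::'a::euclidean_space. phi (nsq y) s \<le> 2 * exp (- (c * norm y))"
proof -
  have "continuous_on {d/2..d} A" by (rule continuous_on_subset[OF A_cont]) (use e in auto)
  then obtain r where r: "r \<in> {d/2..d}" "\<And>s. s \<in> {d/2..d} ==> A r \<le> A s"
    using continuous_attains_inf[of "{d/2..d}" A] e by auto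
  define \<alpha> where "\<alpha> = A r"
  have \<alpha>: "\<alpha> > 0" using A_pos[of r] r(1) e by (auto simp: \<alpha>_def)
  define c where "c = sqrt \<alpha> * (d / 2)"
  have "phi (nsq y) s \<le> 2 * exp (- (c * norm y))" if s: "s \<ge> d" for s and y :: 'a
  proof -
    have "phi (nsq y) s \<le> phi (nsq y) d" using s e by (intro phi_antimono) auto
    also have "\<dots> \<le> 2 * exp (- (sqrt ((norm y)\<^sup>2 * \<alpha>) * (d - d/2)))"
      using e \<alpha> r(2) by (intro phi_decay) (auto simp: \<alpha>_def)
    also have "sqrt ((norm y)\<^sup>2 * \<alpha>) * (d - d/2) = c * norm y"
      by (simp add: c_def real_sqrt_mult)
    finally show ?thesis .
  qed
  then show ?thesis using e \<alpha> by (intro exI[of _ c]) (auto simp: c_def)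
qed

lemma adm_mphi: "adm mphi"
  unfolding adm_def
proof (intro conjI allI impI)
  fix s :: real assume "s > 0" then show "(mphi s :: 'a => complex) \<in> borel_fun" by simp
next
  fix y :: 'a
  have "continuous_on {0<..} (phi (nsq y))" by (rule continuous_on_subset[OF phi_continuous]) auto
  then show "continuous_on {0<..} (\<lambda>s. mphi s y)" unfolding mphi_def by (rule continuous_on_of_real)
next
  fix d S :: real assume e: "0 < d"
  obtain c where c: "c > 0" and b: "\<forall>s\<ge>d. \<forall>y::'a. phi (nsq y) s \<le> 2 * exp (- (c * norm y))"
    using phi_exp_bound[OF e] by blast
  show "\<exists>C c. 0 < c \<and> (\<forall>s\<in>{d..S}. \<forall>y::'a. cmod (mphi s y) \<le> C * exp (- (c * norm y)))"
  proof (rule exI[of _ 2], rule exI[of _ c], intro conjI ballI allI c)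
    fix s and y :: 'a assume s: "s \<in> {d..S}"
    have "0 \<le> phi (nsq y) s" using s e by (intro phi_nonneg) auto
    then show "cmod (mphi s y) \<le> 2 * exp (- (c * norm y))" using b s by (simp add: mphi_def)
  qed
qed

text \<open>By convexity the slope beyond \<open>d\<close> is at most, in modulus, that of the chord
  over \<open>[d/2, d]\<close>. The derivative thus inherits the decay of \<open>phi\<close> at
  \<open>d/2\<close>, at the price of the factor \<open>2 / d\<close>.\<close>

lemma adm_mdphi: "adm mdphi"
  unfolding adm_def
proof (intro conjI allI impI)
  fix s :: real assume "s > 0" then show "(mdphi s :: 'a => complex) \<in> borel_fun" by simp
next
  fix y :: 'a
  have "continuous_on {0<..} (dphi (nsq y))" by (rule continuous_on_subset[OF dphi_continuous]) auto
  then show "continuous_on {0<..} (\<lambda>s. mdphi s y)" unfolding mdphi_def by (rule continuous_on_of_real)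
next
  fix d S :: real assume e: "0 < d"
  then have e2: "0 < d / 2" by simp
  obtain c where c: "c > 0" and b: "\<forall>s\<ge>d/2. \<forall>y::'a. phi (nsq y) s \<le> 2 * exp (- (c * norm y))"
    using phi_exp_bound[OF e2] by blast
  show "\<exists>C c. 0 < c \<and> (\<forall>s\<in>{d..S}. \<forall>y::'a. cmod (mdphi s y) \<le> C * exp (- (c * norm y)))"
  proof (rule exI[of _ "4 / d"], rule exI[of _ c], intro conjI ballI allI c)
    fix s and y :: 'a assume s: "s \<in> {d..S}"
    define l where "l = (norm y)\<^sup>2"
    have l: "l \<ge> 0" by (simp add: l_def)
    obtain z where z: "z > d/2" "z < d" "phi l d - phi l (d/2) = (d - d/2) * dphi l z"
      using phi_mvt[OF l, of "d/2" d] e by auto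
    have "dphi l z \<le> dphi l s" using z s e by (intro dphi_mono l) auto
    then have "d / 2 * - dphi l s \<le> d / 2 * - dphi l z" using e by (intro mult_left_mono) auto
    also have "\<dots> = phi l (d/2) - phi l d" using z(3) by (simp add: algebra_simps)
    also have "\<dots> \<le> 2 * exp (- (c * norm y))"
    proof -
      have "phi l (d/2) \<le> 2 * exp (- (c * norm y))" using b by (auto simp: l_def)
      then show ?thesis using phi_nonneg[OF l, of d] e by linarith
    qed
    finally have "- dphi l s \<le> 4 / d * exp (- (c * norm y))" using e by (simp add: field_simps)
    moreover have "dphi l s \<le> 0" using s e by (intro dphi_nonpos l) auto
    ultimately show "cmod (mdphi s y) \<le> 4 / d * exp (- (c * norm y))" by (simp add: mdphi_def l_def)
  qed
qed

definition grad :: "'a::euclidean_space => real => 'a => complex" where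
  "grad b s y = \<i> * of_real (b \<bullet> y) * mphi s y"

definition grad2 :: "'a::euclidean_space => real => 'a => complex" where
  "grad2 b s y = \<i> * of_real (b \<bullet> y) * grad b s y"

text \<open>The second height derivative, written through the equation
  \<open>u_ss = - A \<Delta>_x u\<close> as a sum over directions. In this form it is admissible and
  ready for integration by parts in \<open>x\<close>.\<close>

definition mddphi :: "real => 'a::euclidean_space => complex" where
  "mddphi s y = (\<Sum>b\<in>Basis. of_real (- A s) * grad2 b s y)"

lemma adm_grad: "b \<in> Basis ==> adm (grad b)"
  unfolding grad_def[abs_def] by (rule adm_freq[OF adm_mphi]) simp

lemma adm_grad2: "b \<in> Basis ==> adm (grad2 b)"
  unfolding grad2_def[abs_def] by (rule adm_freq[OF adm_grad]) simp_all

lemma adm_mddphi: "adm mddphi"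
  unfolding mddphi_def[abs_def]
  by (intro adm_sum finite_Basis adm_scale[OF adm_grad2] continuous_on_minus A_cont)

lemma mddphi_eq: "mddphi s (y::'a::euclidean_space) = of_real ((norm y)\<^sup>2 * (A s * phi (nsq y) s))"
proof -
  have "mddphi s y = (\<Sum>b\<in>Basis. of_real ((b \<bullet> y)\<^sup>2) * of_real (A s * phi (nsq y) s))"
    unfolding mddphi_def grad2_def grad_def mphi_def by (intro sum.cong refl) (simp add: power2_eq_square algebra_simps)
  also have "\<dots> = of_real (\<Sum>b\<in>Basis. (b \<bullet> y)\<^sup>2) * of_real (A s * phi (nsq y) s)"
    by (simp add: sum_distrib_right)
  also have "(\<Sum>b\<in>Basis. (b \<bullet> y)\<^sup>2) = (norm y)\<^sup>2"
    unfolding power2_norm_eq_inner using euclidean_inner[of y y] by (simp add: power2_eq_square inner_commute)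
  finally show ?thesis by simp
qed

lemma mphi_deriv: "s > 0 ==> ((\<lambda>s. mphi s y) has_vector_derivative mdphi s y) (at s)"
  unfolding mphi_def mdphi_def
  by (intro bounded_linear.has_vector_derivative[OF bounded_linear_of_real])
     (simp add: phi_deriv flip: has_real_derivative_iff_has_vector_derivative)

lemma mdphi_deriv: "s > 0 ==> ((\<lambda>s. mdphi s y) has_vector_derivative mddphi s y) (at s)"
  unfolding mddphi_eq mdphi_def
  by (intro bounded_linear.has_vector_derivative[OF bounded_linear_of_real])
     (simp add: dphi_deriv flip: has_real_derivative_iff_has_vector_derivative)

text \<open>Components of the weighted gradient: \<open>None\<close> stands for the height
  derivative, \<open>Some b\<close> for \<open>sqrt A\<close> times the derivative in direction
  \<open>b\<close>. Their squared moduli add up to the energy density.\<close>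

definition comp :: "'a::euclidean_space option => real => 'a => complex" where
  "comp i = (case i of None => mdphi | Some b => (\<lambda>s y. of_real (sqrt (A s)) * grad b s y))"

definition dirs :: "'a::euclidean_space option set" where
  "dirs = insert None (Some ` Basis)"

lemma finite_dirs [simp]: "finite dirs" by (simp add: dirs_def)

lemma sum_dirs: "(\<Sum>i\<in>dirs. f i) = f None + (\<Sum>b\<in>Basis. f (Some b))"
  unfolding dirs_def by (subst sum.insert) (auto simp: sum.reindex)

lemma adm_comp: "i \<in> dirs ==> adm (comp i)"
  by (auto simp: comp_def dirs_def adm_mdphi intro!: adm_scale adm_grad continuous_on_real_sqrt A_cont)

text \<open>The boundary term of Green's formula on the slice at height \<open>s\<close>.\<close>

definition flux :: "(real \<times> 'a::euclidean_space => complex) => ('a => complex) => ('a => complex) => real => complex" where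
  "flux k F1 F2 s = (LINT x|lborel. k (s, x) * (wave mphi F1 (s, x) * cnj (wave mdphi F2 (s, x))))"

end

lemma cutoff_bound: "cutoff k u C ==> cmod (k z) \<le> C"
  and cutoff_measurable: "cutoff k u C ==> k \<in> borel_fun"
  unfolding cutoff_def by (elim conjE allE, assumption, elim conjE, assumption)

lemma cutoff_one: "cutoff (\<lambda>_. 1) u 1"
  by (simp add: cutoff_def)

text \<open>A path that does not increase distances pulls balls back to intervals, so local
  constancy survives restriction and the one-dimensional formula applies.\<close>

lemma cutoff_line:
  fixes p :: "real => real \<times> 'a::euclidean_space"
  assumes k: "cutoff k u C" and p: "\<And>s t. dist (p s) (p t) \<le> dist s t" and H: "\<And>t. t \<in> {a..b} ==> p t \<in> half_space"
  shows "(\<forall>t\<in>{a..b}. k (p t) = 1) \<or> (\<forall>t\<in>{a..b}. (u (p t) = 0 --> k (p t) = 0) \<and> (u (p t) \<noteq> 0 --> (\<exists>e>0. \<forall>s\<in>ball t e. k (p s) = k (p t))))"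
proof (cases "\<forall>z. k z = 1")
  case True
  show ?thesis by (rule disjI1) (use True in blast)
next
  case False
  then have K: "\<forall>z\<in>half_space. (u z = 0 --> k z = 0) \<and> (u z \<noteq> 0 --> (\<exists>e>0. \<forall>z'\<in>ball z e. k z' = k z))"
    using k unfolding cutoff_def by blast
  show ?thesis
  proof (intro disjI2 ballI conjI impI)
    fix t assume t: "t \<in> {a..b}"
    note Kt = bspec[OF K H[OF t]]
    show "k (p t) = 0" if "u (p t) = 0" using Kt that by (elim conjE mp)
    assume "u (p t) \<noteq> 0"
    with Kt have "\<exists>e>0. \<forall>z'\<in>ball (p t) e. k z' = k (p t)" by (elim conjE mp)
    then obtain e where e: "e > 0" "\<forall>z'\<in>ball (p t) e. k z' = k (p t)" by (elim exE conjE)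
    show "\<exists>e>0. \<forall>s\<in>ball t e. k (p s) = k (p t)"
    proof (rule exI[of _ e], intro conjI ballI)
      fix s assume "s \<in> ball t e"
      then have "p s \<in> ball (p t) e" using p[of t s] by simp
      then show "k (p s) = k (p t)" by (rule bspec[OF e(2)])
    qed (rule e(1))
  qed
qed

lemma strip_fubini:
  fixes Q :: "real \<times> 'a::euclidean_space => complex"
  assumes Q: "integrable lborel (\<lambda>z. indicat_real (strip e S) z *\<^sub>R Q z)"
  shows "(LINT z|lborel. indicat_real (strip e S) z *\<^sub>R Q z) = (LINT s|lborel. indicat_real {e..S} s *\<^sub>R (LINT x|lborel. Q (s, x)))"
    "integrable lborel (\<lambda>s. indicat_real {e..S} s *\<^sub>R (LINT x|lborel. Q (s, x)))"
proof -
  have Q': "integrable (lborel \<Otimes>\<^sub>M lborel) (\<lambda>(s, x). indicat_real {e..S} s *\<^sub>R Q (s, x))"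
    using Q unfolding lborel_prod by (simp add: indicator_times case_prod_beta')
  have "(LINT z|lborel. indicat_real (strip e S) z *\<^sub>R Q z) = (\<integral>z. (case z of (s, x) => indicat_real {e..S} s *\<^sub>R Q (s, x)) \<partial>(lborel \<Otimes>\<^sub>M lborel))"
    unfolding lborel_prod by (simp add: indicator_times case_prod_beta')
  also have "\<dots> = (LINT s|lborel. (LINT x|lborel. indicat_real {e..S} s *\<^sub>R Q (s, x)))"
    using lborel_pair.integral_fst'[OF Q'] by simp
  finally show "(LINT z|lborel. indicat_real (strip e S) z *\<^sub>R Q z) = (LINT s|lborel. indicat_real {e..S} s *\<^sub>R (LINT x|lborel. Q (s, x)))"
    by (simp only: integral_scaleR_right)
  show "integrable lborel (\<lambda>s. indicat_real {e..S} s *\<^sub>R (LINT x|lborel. Q (s, x)))"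
    using lborel_pair.integrable_fst'[OF Q'] by (simp only: prod.case integral_scaleR_right)
qed

lemma has_vector_derivative_cnj:
  "(f has_vector_derivative d) F ==> ((\<lambda>t. cnj (f t)) has_vector_derivative cnj d) F"
  by (rule bounded_linear.has_vector_derivative[OF bounded_linear_cnj])

context weight
begin

lemma grad_eq: "(\<lambda>s y. \<i> * of_real (b \<bullet> y) * mphi s y) = grad b"
  and grad2_eq: "(\<lambda>s y. \<i> * of_real (b \<bullet> y) * grad b s y) = grad2 b"
  by (simp_all add: fun_eq_iff grad_def grad2_def)

context
  fixes F1 F2 :: "'a::euclidean_space => complex" and k :: "real \<times> 'a => complex" and C :: real
  assumes F1: "sqi lborel F1" and F2: "sqi lborel F2" and k: "cutoff k (wave mphi F1) C"
begin

lemma slice_integrable: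
  assumes "adm m" "adm n" "s > 0"
  shows "integrable lborel (\<lambda>x. k (s, x) * (wave m F1 (s, x) * cnj (wave n F2 (s, x))))"
proof -
  have [measurable]: "k \<in> borel_fun" by (rule cutoff_measurable[OF k])
  have "sqi lborel (\<lambda>x. k (s, x) * wave m F1 (s, x))"
    by (rule sqi_mult_bounded[OF wave_L2(2)[OF F1 assms(1,3)] _ cutoff_bound[OF k]]) simp
  from sqi_integrable_ip[OF this wave_L2(2)[OF F2 assms(2,3)]] show ?thesis by (simp add: mult.assoc)
qed

lemma strip_integrable:
  assumes "adm m" "adm n" "0 < e"
  shows "integrable lborel (\<lambda>z. indicat_real (strip e S) z *\<^sub>R (k z * (wave m F1 z * cnj (wave n F2 z))))"
proof -
  have [measurable]: "k \<in> borel_fun" by (rule cutoff_measurable[OF k])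
  have "sqi lborel (\<lambda>z. k z * (indicator (strip e S) z * wave m F1 z))"
    by (rule sqi_mult_bounded[OF wave_strip_sqi[OF F1 assms(1,3)] _ cutoff_bound[OF k]]) simp
  from sqi_integrable_ip[OF this wave_strip_sqi[OF F2 assms(2,3), of S]]
  show ?thesis by (rule Bochner_Integration.integrable_cong[THEN iffD1, rotated 2]) (auto simp: indicator_def)
qed

text \<open>The derivative of \<open>k u\<close> times the conjugated derivative of the second
  function along \<open>b\<close> integrates to zero over the slice;
  \<open>cutoff_ftc_lebesgue\<close> justifies treating \<open>k\<close> as a constant.\<close>

lemma space_parts:
  assumes s: "s > 0" and b: "b \<in> Basis"
  shows "(LINT x|lborel. k (s, x) * (wave mphi F1 (s, x) * cnj (wave (grad2 b) F2 (s, x)))) =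
    - (LINT x|lborel. k (s, x) * (wave (grad b) F1 (s, x) * cnj (wave (grad b) F2 (s, x))))"
proof -
  have [measurable]: "k \<in> borel_fun" by (rule cutoff_measurable[OF k])
  let ?Q = "\<lambda>x. k (s, x) * (wave (grad b) F1 (s, x) * cnj (wave (grad b) F2 (s, x)) + wave mphi F1 (s, x) * cnj (wave (grad2 b) F2 (s, x)))"
  note i1 = slice_integrable[OF adm_grad[OF b] adm_grad[OF b] s] and i2 = slice_integrable[OF adm_mphi adm_grad2[OF b] s]
  have "(LINT x|lborel. ?Q x) = 0"
  proof (rule integral_of_line_derivative[where P = "\<lambda>x. k (s, x) * (wave mphi F1 (s, x) * cnj (wave (grad b) F2 (s, x)))" and b = b])
    show "integrable lborel (\<lambda>x. k (s, x) * (wave mphi F1 (s, x) * cnj (wave (grad b) F2 (s, x))))"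
      by (rule slice_integrable[OF adm_mphi adm_grad[OF b] s])
    show "integrable lborel ?Q" unfolding distrib_left by (rule Bochner_Integration.integrable_add[OF i1 i2])
    fix x :: 'a
    define p where "p t = (s, x + t *\<^sub>R b)" for t :: real
    have nb: "norm b \<le> 1" using b by simp
    have pc: "continuous_on S p" for S unfolding p_def by (intro continuous_intros)
    have pH: "p t \<in> half_space" for t using s by (simp add: p_def half_space_def)
    have wc: "continuous_on {0..1} (\<lambda>t. wave m F (p t))" if "sqi lborel F" "adm m" for m F
      by (rule continuous_on_compose2[OF wave_continuous[OF that] pc]) (use pH in auto)
    have "(LINT t:{0..1}|lborel. k (p t) * (wave (grad b) F1 (p t) * cnj (wave (grad b) F2 (p t)) + wave mphi F1 (p t) * cnj (wave (grad2 b) F2 (p t)))) =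
      k (p 1) * (wave mphi F1 (p 1) * cnj (wave (grad b) F2 (p 1))) - k (p 0) * (wave mphi F1 (p 0) * cnj (wave (grad b) F2 (p 0)))"
    proof (rule cutoff_ftc_lebesgue)
      show "((\<lambda>t. wave mphi F1 (p t)) has_vector_derivative wave (grad b) F1 (p t)) (at t)" for t
        using wave_space_derivative[OF F1 adm_mphi s nb] unfolding p_def grad_eq .
      show "((\<lambda>t. cnj (wave (grad b) F2 (p t))) has_vector_derivative cnj (wave (grad2 b) F2 (p t))) (at t)" for t
        using has_vector_derivative_cnj[OF wave_space_derivative[OF F2 adm_grad[OF b] s nb]] unfolding p_def grad2_eq .
      show "continuous_on {0..1} (\<lambda>t. wave (grad b) F1 (p t))" by (rule wc[OF F1 adm_grad[OF b]])
      show "continuous_on {0..1} (\<lambda>t. cnj (wave (grad2 b) F2 (p t)))" by (rule continuous_on_cnj[OF wc[OF F2 adm_grad2[OF b]]])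
      show "cmod (k (p t)) \<le> C" for t by (rule cutoff_bound[OF k])
      show "(\<lambda>t. k (p t)) \<in> borel_fun" unfolding p_def by measurable
      show "(\<forall>t\<in>{0..1}. k (p t) = 1) \<or> (\<forall>t\<in>{0..1}. (wave mphi F1 (p t) = 0 --> k (p t) = 0) \<and> (wave mphi F1 (p t) \<noteq> 0 --> (\<exists>e>0. \<forall>s\<in>ball t e. k (p s) = k (p t))))"
      proof (rule cutoff_line[OF k _ pH])
        show "dist (p r) (p t) \<le> dist r t" for r t
          using b by (simp add: p_def dist_Pair_Pair dist_norm flip: scaleR_diff_left)
      qed
    qed simp
    then show "k (s, x + b) * (wave mphi F1 (s, x + b) * cnj (wave (grad b) F2 (s, x + b))) - k (s, x) * (wave mphi F1 (s, x) * cnj (wave (grad b) F2 (s, x))) =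
        (LINT t:{0..1}|lborel. ?Q (x + t *\<^sub>R b))"
      by (simp add: p_def)
  qed
  then show ?thesis unfolding distrib_left Bochner_Integration.integral_add[OF i1 i2]
    by (simp add: add_eq_0_iff)
qed

lemma time_parts:
  assumes e: "0 < d" "d \<le> S"
  shows "(LINT z|lborel. indicat_real (strip d S) z *\<^sub>R (k z * (wave mdphi F1 z * cnj (wave mdphi F2 z) + wave mphi F1 z * cnj (wave mddphi F2 z)))) =
    flux k F1 F2 S - flux k F1 F2 d"
  unfolding flux_def
proof (rule integral_of_time_derivative)
  have [measurable]: "k \<in> borel_fun" by (rule cutoff_measurable[OF k])
  have S: "0 < S" using e by simp
  show "integrable lborel (\<lambda>x. k (d, x) * (wave mphi F1 (d, x) * cnj (wave mdphi F2 (d, x))))"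
    by (rule slice_integrable[OF adm_mphi adm_mdphi e(1)])
  show "integrable lborel (\<lambda>x. k (S, x) * (wave mphi F1 (S, x) * cnj (wave mdphi F2 (S, x))))"
    by (rule slice_integrable[OF adm_mphi adm_mdphi S])
  show "integrable lborel (\<lambda>z. indicat_real (strip d S) z *\<^sub>R (k z * (wave mdphi F1 z * cnj (wave mdphi F2 z) + wave mphi F1 z * cnj (wave mddphi F2 z))))"
    unfolding distrib_left scaleR_add_right
    by (rule Bochner_Integration.integrable_add[OF strip_integrable[OF adm_mdphi adm_mdphi e(1)] strip_integrable[OF adm_mphi adm_mddphi e(1)]])
  fix x :: 'a
  define p where "p s = (s, x)" for s :: real
  have pc: "continuous_on S p" for S unfolding p_def by (intro continuous_intros)
  have pH: "p t \<in> half_space" if "t \<in> {d..S}" for t using that e by (simp add: p_def half_space_def)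
  have wc: "continuous_on {d..S} (\<lambda>t. wave m F (p t))" if "sqi lborel F" "adm m" for m F
    by (rule continuous_on_compose2[OF wave_continuous[OF that] pc]) (use pH in auto)
  have "(LINT t:{d..S}|lborel. k (p t) * (wave mdphi F1 (p t) * cnj (wave mdphi F2 (p t)) + wave mphi F1 (p t) * cnj (wave mddphi F2 (p t)))) =
    k (p S) * (wave mphi F1 (p S) * cnj (wave mdphi F2 (p S))) - k (p d) * (wave mphi F1 (p d) * cnj (wave mdphi F2 (p d)))"
  proof (rule cutoff_ftc_lebesgue[OF e(2)])
    show "((\<lambda>t. wave mphi F1 (p t)) has_vector_derivative wave mdphi F1 (p t)) (at t)" if "t \<in> {d..S}" for t
      unfolding p_def by (rule wave_time_derivative[OF F1 adm_mphi adm_mdphi _ mphi_deriv]) (use that e in auto)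
    show "((\<lambda>t. cnj (wave mdphi F2 (p t))) has_vector_derivative cnj (wave mddphi F2 (p t))) (at t)" if "t \<in> {d..S}" for t
      unfolding p_def by (rule has_vector_derivative_cnj, rule wave_time_derivative[OF F2 adm_mdphi adm_mddphi _ mdphi_deriv]) (use that e in auto)
    show "continuous_on {d..S} (\<lambda>t. wave mdphi F1 (p t))" by (rule wc[OF F1 adm_mdphi])
    show "continuous_on {d..S} (\<lambda>t. cnj (wave mddphi F2 (p t)))" by (rule continuous_on_cnj[OF wc[OF F2 adm_mddphi]])
    show "cmod (k (p t)) \<le> C" for t by (rule cutoff_bound[OF k])
    show "(\<lambda>t. k (p t)) \<in> borel_fun" unfolding p_def by measurable
    show "(\<forall>t\<in>{d..S}. k (p t) = 1) \<or> (\<forall>t\<in>{d..S}. (wave mphi F1 (p t) = 0 --> k (p t) = 0) \<and> (wave mphi F1 (p t) \<noteq> 0 --> (\<exists>e>0. \<forall>s\<in>ball t e. k (p s) = k (p t))))"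
      by (rule cutoff_line[OF k _ pH]) (simp_all add: p_def dist_Pair_Pair)
  qed
  then show "k (S, x) * (wave mphi F1 (S, x) * cnj (wave mdphi F2 (S, x))) - k (d, x) * (wave mphi F1 (d, x) * cnj (wave mdphi F2 (d, x))) =
    (LINT s:{d..S}|lborel. k (s, x) * (wave mdphi F1 (s, x) * cnj (wave mdphi F2 (s, x)) + wave mphi F1 (s, x) * cnj (wave mddphi F2 (s, x))))"
    by (simp add: p_def)
qed

text \<open>\<open>A\<close> is constant on a slice, so it passes through the integration by parts
  in \<open>x\<close> and is then shared as \<open>sqrt A\<close> between the two gradients.\<close>

lemma slice_parts:
  assumes s: "s > 0"
  shows "(LINT x|lborel. k (s, x) * (wave mphi F1 (s, x) * cnj (wave mddphi F2 (s, x)))) =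
    (\<Sum>b\<in>Basis. (LINT x|lborel. k (s, x) * (wave (comp (Some b)) F1 (s, x) * cnj (wave (comp (Some b)) F2 (s, x)))))"
proof -
  have A: "0 \<le> A s" using A_nonneg s by simp
  have dd: "wave mddphi F2 (s, x) = (\<Sum>b\<in>Basis. of_real (- A s) * wave (grad2 b) F2 (s, x))" for x
    unfolding mddphi_def[abs_def]
    by (subst wave_sum[OF F2 finite_Basis]) (simp_all add: wave_scale adm_scale[OF adm_grad2] continuous_on_minus A_cont del: of_real_minus)
  have comp: "wave (comp (Some b)) F (s, x) = of_real (sqrt (A s)) * wave (grad b) F (s, x)" for b x and F :: "'a => complex"
    by (simp add: comp_def wave_scale)
  have sq: "complex_of_real (sqrt (A s)) * complex_of_real (sqrt (A s)) = complex_of_real (A s)"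
    using A by (simp flip: of_real_mult)
  have "(LINT x|lborel. k (s, x) * (wave mphi F1 (s, x) * cnj (wave mddphi F2 (s, x)))) =
     (LINT x|lborel. (\<Sum>b\<in>Basis. of_real (- A s) * (k (s, x) * (wave mphi F1 (s, x) * cnj (wave (grad2 b) F2 (s, x))))))"
    unfolding dd by (intro Bochner_Integration.integral_cong refl) (simp add: sum_distrib_left sum_negf mult_ac)
  also have "\<dots> = (\<Sum>b\<in>Basis. (LINT x|lborel. of_real (- A s) * (k (s, x) * (wave mphi F1 (s, x) * cnj (wave (grad2 b) F2 (s, x))))))"
    by (intro Bochner_Integration.integral_sum integrable_mult_right slice_integrable[OF adm_mphi adm_grad2 s])
  also have "\<dots> = (\<Sum>b\<in>Basis. (LINT x|lborel. k (s, x) * (wave (comp (Some b)) F1 (s, x) * cnj (wave (comp (Some b)) F2 (s, x)))))"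
  proof (rule sum.cong[OF refl])
    fix b :: 'a assume b: "b \<in> Basis"
    have "(LINT x|lborel. of_real (- A s) * (k (s, x) * (wave mphi F1 (s, x) * cnj (wave (grad2 b) F2 (s, x))))) =
      of_real (A s) * (LINT x|lborel. k (s, x) * (wave (grad b) F1 (s, x) * cnj (wave (grad b) F2 (s, x))))"
      by (simp add: space_parts[OF s b])
    also have "\<dots> = (LINT x|lborel. of_real (A s) * (k (s, x) * (wave (grad b) F1 (s, x) * cnj (wave (grad b) F2 (s, x)))))"
      by simp
    also have "\<dots> = (LINT x|lborel. k (s, x) * (wave (comp (Some b)) F1 (s, x) * cnj (wave (comp (Some b)) F2 (s, x))))"
      unfolding comp sq[symmetric] by (intro Bochner_Integration.integral_cong refl) (simp add: mult_ac)
    finally show "(LINT x|lborel. of_real (- A s) * (k (s, x) * (wave mphi F1 (s, x) * cnj (wave (grad2 b) F2 (s, x))))) =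
       (LINT x|lborel. k (s, x) * (wave (comp (Some b)) F1 (s, x) * cnj (wave (comp (Some b)) F2 (s, x))))" .
  qed
  finally show ?thesis .
qed

text \<open>Integration by parts in the height leaves two fluxes and a term with the second height
  derivative. The equation turns that term into \<open>- A\<close> times a Laplacian, which is
  integrated by parts slice by slice.\<close>

lemma local_green:
  assumes e: "0 < d" "d \<le> S"
  shows "(\<Sum>i\<in>dirs. (LINT z|lborel. indicat_real (strip d S) z *\<^sub>R (k z * (wave (comp i) F1 z * cnj (wave (comp i) F2 z))))) =
    flux k F1 F2 S - flux k F1 F2 d"
proof -
  note i1 = strip_integrable[OF adm_mdphi adm_mdphi e(1), of S] and i2 = strip_integrable[OF adm_mphi adm_mddphi e(1), of S]
  have ib: "integrable lborel (\<lambda>z. indicat_real (strip d S) z *\<^sub>R (k z * (wave (comp (Some b)) F1 z * cnj (wave (comp (Some b)) F2 z))))"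
    if "b \<in> Basis" for b
    by (rule strip_integrable[OF adm_comp adm_comp e(1)]) (use that in \<open>auto simp: dirs_def\<close>)
  have "(LINT z|lborel. indicat_real (strip d S) z *\<^sub>R (k z * (wave mphi F1 z * cnj (wave mddphi F2 z))))
     = (LINT s|lborel. indicat_real {d..S} s *\<^sub>R (LINT x|lborel. k (s, x) * (wave mphi F1 (s, x) * cnj (wave mddphi F2 (s, x)))))"
    by (rule strip_fubini(1)[OF i2])
  also have "\<dots> = (LINT s|lborel. (\<Sum>b\<in>Basis. indicat_real {d..S} s *\<^sub>R (LINT x|lborel. k (s, x) * (wave (comp (Some b)) F1 (s, x) * cnj (wave (comp (Some b)) F2 (s, x))))))"
    by (intro Bochner_Integration.integral_cong refl) (use slice_parts e in \<open>auto simp: indicator_def\<close>)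
  also have "\<dots> = (\<Sum>b\<in>Basis. (LINT s|lborel. indicat_real {d..S} s *\<^sub>R (LINT x|lborel. k (s, x) * (wave (comp (Some b)) F1 (s, x) * cnj (wave (comp (Some b)) F2 (s, x))))))"
    by (rule Bochner_Integration.integral_sum) (rule strip_fubini(2)[OF ib])
  also have "\<dots> = (\<Sum>b\<in>Basis. (LINT z|lborel. indicat_real (strip d S) z *\<^sub>R (k z * (wave (comp (Some b)) F1 z * cnj (wave (comp (Some b)) F2 z)))))"
    by (rule sum.cong[OF refl]) (rule strip_fubini(1)[OF ib, symmetric])
  finally have 2: "(LINT z|lborel. indicat_real (strip d S) z *\<^sub>R (k z * (wave mphi F1 z * cnj (wave mddphi F2 z)))) =
     (\<Sum>b\<in>Basis. (LINT z|lborel. indicat_real (strip d S) z *\<^sub>R (k z * (wave (comp (Some b)) F1 z * cnj (wave (comp (Some b)) F2 z)))))" .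
  have "comp (None :: 'a option) = mdphi" by (simp add: comp_def)
  then show ?thesis
    unfolding sum_dirs time_parts[OF e, symmetric] distrib_left scaleR_add_right Bochner_Integration.integral_add[OF i1 i2] 2
    by simp
qed

text \<open>Cauchy-Schwarz on the slice, with \<open>phi \<le> 1\<close> for the first factor and
  \<open>dphi_abs_le\<close> for the second.\<close>

lemma flux_bound:
  assumes s: "s > 0"
  shows "cmod (flux k F1 F2 s) \<le> C * sqrt (sqnorm lborel F1) * (1 / s * sqrt (sqnorm lborel F2))"
proof -
  have [measurable]: "k \<in> borel_fun" by (rule cutoff_measurable[OF k])
  have C0: "0 \<le> C" using order_trans[OF norm_ge_zero cutoff_bound[OF k]] .
  have l: "0 \<le> (norm y)\<^sup>2" for y :: 'a by simp
  have scale: "sqrt (sqnorm lborel g) \<le> c * sqrt (sqnorm lborel h)"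
    if gh: "sqi lborel g" "sqi lborel h" "\<And>x. cmod (g x) \<le> c * cmod (h x)" "0 \<le> c" for g h :: "'a => complex" and c
  proof -
    have "sqnorm lborel g \<le> (LINT x|lborel. c\<^sup>2 * csq (h x))"
      unfolding sqnorm_def
    proof (rule integral_mono)
      show "csq (g x) \<le> c\<^sup>2 * csq (h x)" for x
        unfolding power_mult_distrib[symmetric] by (rule power_mono[OF gh(3)]) simp
    qed (use sqi_integrable[OF gh(1)] sqi_integrable[OF gh(2)] in simp_all)
    also have "\<dots> = c\<^sup>2 * sqnorm lborel h" by (simp add: sqnorm_def)
    finally have "sqrt (sqnorm lborel g) \<le> sqrt (c\<^sup>2 * sqnorm lborel h)" by simp
    then show ?thesis using gh(4) by (simp add: real_sqrt_mult)
  qed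
  note u = wave_L2[OF F1 adm_mphi s] and v = wave_L2[OF F2 adm_mdphi s]
  have ku: "sqi lborel (\<lambda>x. k (s, x) * wave mphi F1 (s, x))"
    by (rule sqi_mult_bounded[OF u(2) _ cutoff_bound[OF k]]) simp
  have "flux k F1 F2 s = ip lborel (\<lambda>x. k (s, x) * wave mphi F1 (s, x)) (\<lambda>x. wave mdphi F2 (s, x))"
    by (simp add: flux_def ip_def mult.assoc)
  then have "cmod (flux k F1 F2 s) \<le> sqrt (sqnorm lborel (\<lambda>x. k (s, x) * wave mphi F1 (s, x))) * sqrt (sqnorm lborel (\<lambda>x. wave mdphi F2 (s, x)))"
    using cauchy_schwarz[OF ku v(2)] by simp
  also have "\<dots> \<le> (C * sqrt (sqnorm lborel F1)) * (1 / s * sqrt (sqnorm lborel F2))"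
  proof (rule mult_mono)
    have "sqrt (sqnorm lborel (\<lambda>x. k (s, x) * wave mphi F1 (s, x))) \<le> C * sqrt (sqnorm lborel (\<lambda>x. wave mphi F1 (s, x)))"
      by (rule scale[OF ku u(2) _ C0]) (simp add: norm_mult mult_right_mono cutoff_bound[OF k])
    also have "sqrt (sqnorm lborel (\<lambda>x. wave mphi F1 (s, x))) \<le> 1 * sqrt (sqnorm lborel F1)"
      unfolding u(3)
    proof (rule scale[OF adm_integrable(3)[OF F1 adm_mphi s] F1])
      fix y :: 'a
      have "cmod (mphi s y) \<le> 1" using phi_nonneg[OF l, of s] phi_le1[OF l, of s] s by (simp add: mphi_def)
      then show "cmod (mphi s y * F1 y) \<le> 1 * cmod (F1 y)" unfolding norm_mult by (rule mult_right_mono) simp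
    qed simp
    finally show "sqrt (sqnorm lborel (\<lambda>x. k (s, x) * wave mphi F1 (s, x))) \<le> C * sqrt (sqnorm lborel F1)"
      using C0 by (simp add: mult_left_mono)
    show "sqrt (sqnorm lborel (\<lambda>x. wave mdphi F2 (s, x))) \<le> 1 / s * sqrt (sqnorm lborel F2)"
      unfolding v(3)
    proof (rule scale[OF adm_integrable(3)[OF F2 adm_mdphi s] F2])
      fix y :: 'a
      have "cmod (mdphi s y) \<le> 1 / s" using dphi_abs_le[OF l s] by (simp add: mdphi_def)
      then show "cmod (mdphi s y * F2 y) \<le> 1 / s * cmod (F2 y)" unfolding norm_mult by (rule mult_right_mono) simp
    qed (use s in simp)
  qed (use C0 in auto)
  finally show ?thesis by simp
qed

end

end

section \<open>Exhaustion of the half-space by strips\<close>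

definition en :: "nat => real" where "en n = inverse (real (Suc n))"

lemma en_pos: "0 < en n" and en_le: "en n \<le> real (Suc n)" and en_le1: "en n \<le> 1"
proof -
  show 1: "0 < en n" by (simp add: en_def)
  show 2: "en n \<le> 1" by (simp add: en_def inverse_le_1_iff)
  show "en n \<le> real (Suc n)" using 2 by (rule order_trans) simp
qed

lemma en_lim: "en ----> 0"
  unfolding en_def by (rule LIMSEQ_inverse_real_of_nat)

lemma en_antimono: "n \<le> m ==> en m \<le> en n"
  by (simp add: en_def)

abbreviation nstrip :: "nat => (real \<times> 'a::euclidean_space) set" where
  "nstrip n \<equiv> strip (en n) (real (Suc n))"

lemma nstrip_mono: "n \<le> m ==> nstrip n \<subseteq> nstrip m"
  using en_antimono[of n m] by auto

lemma nstrip_eventually: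
  assumes "fst z > 0" shows "\<forall>\<^sub>F n in sequentially. z \<in> nstrip n"
proof -
  have 1: "\<forall>\<^sub>F n in sequentially. en n < fst z" using order_tendstoD(2)[OF en_lim assms] .
  obtain N where "fst z \<le> real N" using real_arch_simple by blast
  then have "fst z \<le> real (Suc n)" if "n \<ge> N" for n
    using that by simp
  then have "\<forall>\<^sub>F n in sequentially. fst z \<le> real (Suc n)"
    by (rule eventually_mono[OF eventually_ge_at_top[of N]])
  with 1 show ?thesis by eventually_elim (auto simp: mem_Times_iff)
qed

lemma nstrip_tendsto:
  fixes w :: "real \<times> 'a::euclidean_space => 'b::real_normed_vector"
  assumes "\<And>z. fst z \<le> 0 ==> w z = 0"
  shows "(\<lambda>n. indicat_real (nstrip n) z *\<^sub>R w z) ----> w z"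
proof (cases "fst z > 0")
  case True
  have "\<forall>\<^sub>F n in sequentially. indicat_real (nstrip n) z *\<^sub>R w z = w z"
    using nstrip_eventually[OF True] by eventually_elim simp
  then show ?thesis by (rule tendsto_eventually)
next
  case False
  then have "w z = 0" using assms by simp
  then show ?thesis by simp
qed

lemma wave_zero: "fst z \<le> 0 ==> wave m F z = 0"
  by (simp add: wave_def)

lemma wave_add_mult:
  assumes F: "sqi lborel F" and m: "adm m" and n: "adm n"
  shows "wave (\<lambda>s y. m s y + n s y) F z = wave m F z + wave n F z"
  using wave_sum[OF F, of "UNIV :: bool set" "\<lambda>b. if b then m else n" z] m n
  by (simp add: UNIV_bool add.commute)

text \<open>Polarisation of Plancherel's identity on a slice, applied to the difference of the two
  multipliers. It delivers real parts, which is how the diagonal flux enters the energy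
  identity.\<close>

lemma Re_ip_wave:
  assumes F: "sqi lborel F" and m: "adm m" and n: "adm n" and s: "s > 0"
  shows "Re (ip lborel (\<lambda>x. wave m F (s, x)) (\<lambda>x. wave n F (s, x))) = Re (ip lborel (\<lambda>y. m s y * F y) (\<lambda>y. n s y * F y))"
proof -
  define d where "d s y = m s y + of_real (- 1) * n s y" for s y
  have n': "adm (\<lambda>s y. of_real (- 1) * n s y)" by (rule adm_scale[OF n continuous_on_const])
  have d: "adm d" unfolding d_def[abs_def] by (rule adm_add[OF m n'])
  have wd: "wave d F (s, x) = wave m F (s, x) - wave n F (s, x)" for x
    unfolding d_def[abs_def] wave_add_mult[OF F m n'] wave_scale by simp
  have "sqnorm lborel (\<lambda>x. wave m F (s, x) - wave n F (s, x)) = sqnorm lborel (\<lambda>y. m s y * F y - n s y * F y)"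
    using wave_L2(3)[OF F d s] unfolding wd by (simp add: d_def left_diff_distrib)
  then show ?thesis
    unfolding sqnorm_diff_ip[OF wave_L2(2)[OF F m s] wave_L2(2)[OF F n s]]
      sqnorm_diff_ip[OF adm_integrable(3)[OF F m s] adm_integrable(3)[OF F n s]]
      wave_L2(3)[OF F m s] wave_L2(3)[OF F n s] by simp
qed

context weight
begin

lemma phi_en_lim: "l \<ge> 0 ==> (\<lambda>n. phi l (en n)) ----> 1"
proof -
  assume l: "l \<ge> 0"
  have "(\<lambda>n. phi l (en n)) ----> phi l 0"
    by (rule continuous_on_tendsto_compose[OF phi_continuous[OF l] en_lim]) (auto simp: less_imp_le[OF en_pos])
  then show ?thesis by (simp add: phi_0[OF l])
qed

lemma dphi_en_lim: "l \<ge> 0 ==> (\<lambda>n. dphi l (en n)) ----> - psi l"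
proof -
  assume l: "l \<ge> 0"
  have "(\<lambda>n. dphi l (en n)) ----> dphi l 0"
    by (rule continuous_on_tendsto_compose[OF dphi_continuous[OF l] en_lim]) (auto simp: less_imp_le[OF en_pos])
  then show ?thesis by (simp add: dphi_0[OF l])
qed

text \<open>The kinetic part of the form domain, on the Fourier side and for Borel
  representatives.\<close>

definition finite_energy :: "('a::euclidean_space => complex) => bool" where
  "finite_energy F \<longleftrightarrow> sqi lborel F \<and> integrable lborel (\<lambda>y. psi (nsq y) * csq (F y))"

lemma finite_energy_sqi: "finite_energy F ==> sqi lborel F"
  by (simp add: finite_energy_def)

lemma flux_lim_infinity:
  assumes F1: "sqi lborel F1" and F2: "sqi lborel F2" and k: "cutoff k (wave mphi F1) C"
  shows "(\<lambda>n. flux k F1 F2 (real (Suc n))) ----> 0"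
proof (rule Lim_null_comparison)
  have "(\<lambda>n. C * sqrt (sqnorm lborel F1) * (en n * sqrt (sqnorm lborel F2))) ----> C * sqrt (sqnorm lborel F1) * (0 * sqrt (sqnorm lborel F2))"
    by (intro tendsto_intros en_lim)
  then show "(\<lambda>n. C * sqrt (sqnorm lborel F1) * (en n * sqrt (sqnorm lborel F2))) ----> 0" by simp
  show "\<forall>\<^sub>F n in sequentially. norm (flux k F1 F2 (real (Suc n))) \<le> C * sqrt (sqnorm lborel F1) * (en n * sqrt (sqnorm lborel F2))"
    using flux_bound[OF F1 F2 k] by (intro always_eventually allI) (simp add: en_def inverse_eq_divide)
qed

lemma Re_flux_one:
  assumes F: "sqi lborel F" and s: "s > 0"
  shows "Re (flux (\<lambda>_. 1) F F s) = (LINT y|lborel. phi (nsq y) s * dphi (nsq y) s * csq (F y))"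
proof -
  have "flux (\<lambda>_. 1) F F s = ip lborel (\<lambda>x. wave mphi F (s, x)) (\<lambda>x. wave mdphi F (s, x))"
    by (simp add: flux_def ip_def)
  then have "Re (flux (\<lambda>_. 1) F F s) = Re (ip lborel (\<lambda>y. mphi s y * F y) (\<lambda>y. mdphi s y * F y))"
    using Re_ip_wave[OF F adm_mphi adm_mdphi s] by simp
  also have "ip lborel (\<lambda>y. mphi s y * F y) (\<lambda>y. mdphi s y * F y) = (LINT y|lborel. complex_of_real (phi (nsq y) s * dphi (nsq y) s * csq (F y)))"
    unfolding ip_def mphi_def mdphi_def of_real_mult complex_norm_square
    by (intro Bochner_Integration.integral_cong refl) (simp add: mult_ac)
  finally show ?thesis unfolding integral_complex_of_real by simp
qed

text \<open>Green's formula with \<open>k = 1\<close> on growing strips: the upper flux vanishes,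
  and the lower one tends to the integral of \<open>psi |F|^2\<close> by dominated convergence,
  since \<open>|phi dphi| \<le> psi\<close>. The strip energies increase, so monotone convergence
  gives finiteness and value together.\<close>

lemma energy_identity:
  fixes F :: "'a::euclidean_space => complex"
  assumes fe: "finite_energy F"
  shows "i \<in> dirs ==> sqi lborel (wave (comp i) F)"
    and "(\<Sum>i\<in>dirs. sqnorm lborel (wave (comp i) F)) = (LINT y|lborel. psi (nsq y) * csq (F y))"
proof -
  have F: "sqi lborel F" and I: "integrable lborel (\<lambda>y. psi (nsq y) * csq (F y))"
    using fe by (auto simp: finite_energy_def)
  have l: "0 \<le> (norm y)\<^sup>2" for y :: 'a by simp
  note [measurable] = F_meas[OF F]
  define w where "w i n z = (indicat_real (nstrip n) z *\<^sub>R wave (comp i) F z)" for i n z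
  define N where "N i n = sqnorm lborel (w i n)" for i n
  have wsqi: "sqi lborel (w i n)" if "i \<in> dirs" for i n
  proof -
    have "(\<lambda>z. indicator (nstrip n) z * wave (comp i) F z) = w i n"
      by (auto simp: fun_eq_iff w_def indicator_def)
    then show ?thesis using wave_strip_sqi[OF F adm_comp[OF that] en_pos, of n "real (Suc n)"] by simp
  qed
  define P where "P = (LINT y|lborel. psi (nsq y) * csq (F y))"
  have sumN: "(\<Sum>i\<in>dirs. N i n) = Re (flux (\<lambda>_. 1) F F (real (Suc n))) - Re (flux (\<lambda>_. 1) F F (en n))" for n
  proof -
    have "(LINT z|lborel. indicat_real (nstrip n) z *\<^sub>R (1 * (wave (comp i) F z * cnj (wave (comp i) F z)))) = complex_of_real (N i n)" for i
      unfolding N_def ip_self[symmetric] ip_def w_def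
      by (intro Bochner_Integration.integral_cong refl) (simp add: indicator_def)
    then have "complex_of_real (\<Sum>i\<in>dirs. N i n) = flux (\<lambda>_. 1) F F (real (Suc n)) - flux (\<lambda>_. 1) F F (en n)"
      using local_green[OF F F cutoff_one en_pos en_le, of n] by simp
    then show ?thesis by (metis Re_complex_of_real minus_complex.sel(1))
  qed
  have "(\<lambda>n. - Re (flux (\<lambda>_. 1) F F (en n))) ----> P"
  proof -
    have "(\<lambda>n. (LINT y|lborel. - (phi (nsq y) (en n) * dphi (nsq y) (en n) * csq (F y)))) ----> P"
      unfolding P_def
    proof (rule integral_dominated_convergence[OF _ _ I])
      show "(\<lambda>y. psi (nsq y) * csq (F y)) \<in> borel_measurable lborel" by measurable
      have "(\<lambda>y::'a. Re (mphi (en n) y) * Re (mdphi (en n) y)) \<in> borel_fun" for n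
        using mphi_measurable[OF less_imp_le[OF en_pos, of n], where 'a = 'a] mdphi_measurable[OF less_imp_le[OF en_pos, of n], where 'a = 'a] by measurable
      then have [measurable]: "(\<lambda>y::'a. phi (nsq y) (en n) * dphi (nsq y) (en n)) \<in> borel_fun" for n
        by (simp add: mphi_def mdphi_def)
      show "(\<lambda>y. - (phi (nsq y) (en n) * dphi (nsq y) (en n) * csq (F y))) \<in> borel_measurable lborel" for n
        by measurable
      show "AE y in lborel. (\<lambda>n. - (phi (nsq y) (en n) * dphi (nsq y) (en n) * csq (F y))) ----> psi (nsq y) * csq (F y)"
      proof (intro AE_I2)
        fix y :: 'a
        have "(\<lambda>n. - (phi (nsq y) (en n) * dphi (nsq y) (en n) * csq (F y))) ----> - (1 * - psi (nsq y) * csq (F y))"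
          by (intro tendsto_intros phi_en_lim dphi_en_lim l)
        then show "(\<lambda>n. - (phi (nsq y) (en n) * dphi (nsq y) (en n) * csq (F y))) ----> psi (nsq y) * csq (F y)" by simp
      qed
      show "AE y in lborel. norm (- (phi (nsq y) (en n) * dphi (nsq y) (en n) * csq (F y))) \<le> psi (nsq y) * csq (F y)" for n
      proof (intro AE_I2)
        fix y :: 'a
        have e: "0 \<le> en n" using en_pos[of n] by simp
        have "\<bar>phi (nsq y) (en n)\<bar> * \<bar>dphi (nsq y) (en n)\<bar> \<le> 1 * psi (nsq y)"
          using phi_nonneg[OF l e] phi_le1[OF l e] dphi_abs_le_psi[OF l e] by (intro mult_mono) auto
        then show "norm (- (phi (nsq y) (en n) * dphi (nsq y) (en n) * csq (F y))) \<le> psi (nsq y) * csq (F y)"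
          by (simp add: abs_mult mult_right_mono)
      qed
    qed
    then show ?thesis by (simp add: Re_flux_one[OF F en_pos])
  qed
  moreover have "(\<lambda>n. Re (flux (\<lambda>_. 1) F F (real (Suc n)))) ----> 0"
    using tendsto_Re[OF flux_lim_infinity[OF F F cutoff_one]] by simp
  ultimately have "(\<lambda>n. Re (flux (\<lambda>_. 1) F F (real (Suc n))) + - Re (flux (\<lambda>_. 1) F F (en n))) ----> 0 + P"
    by (intro tendsto_add)
  then have lim: "(\<lambda>n. \<Sum>i\<in>dirs. N i n) ----> P" unfolding sumN by simp
  have wmono: "csq (w i n z) \<le> csq (w i m z)" if "n \<le> m" for i n m z
  proof -
    have ind: "\<bar>indicat_real A z\<bar> \<le> \<bar>indicat_real B z\<bar>" if "A \<subseteq> B" for A B :: "(real \<times> 'a) set"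
      using that by (auto simp: indicator_def)
    show ?thesis unfolding w_def norm_scaleR
      by (rule power_mono[OF mult_right_mono[OF ind[OF nstrip_mono[OF that]] norm_ge_zero]]) simp
  qed
  have mono: "N i n \<le> N i m" if "i \<in> dirs" "n \<le> m" for i n m
    unfolding N_def sqnorm_def
    by (rule integral_mono[OF sqi_integrable[OF wsqi[OF that(1)]] sqi_integrable[OF wsqi[OF that(1)]] wmono[OF that(2)]])
  have "incseq (\<lambda>n. \<Sum>i\<in>dirs. N i n)" by (rule incseq_SucI, rule sum_mono, erule mono) simp
  then have sumle: "(\<Sum>i\<in>dirs. N i n) \<le> P" for n using incseq_le[OF _ lim] by blast
  have Nle: "N i n \<le> P" if "i \<in> dirs" for i n
  proof -
    have "N i n \<le> (\<Sum>i\<in>dirs. N i n)" by (rule member_le_sum[OF that]) (simp_all add: N_def)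
    then show ?thesis by (rule order_trans[OF _ sumle])
  qed
  \<comment> \<open>Convergence is known for the sum over directions. Each component is monotone and
    bounded by the limit of the sum, so it converges by itself.\<close>
  have conv: "sqi lborel (wave (comp i) F) \<and> (\<lambda>n. N i n) ----> sqnorm lborel (wave (comp i) F)" if i: "i \<in> dirs" for i
  proof -
    have "incseq (N i)" by (rule incseq_SucI, rule mono[OF i]) simp
    then obtain x where x: "N i ----> x" by (rule incseq_convergent[where B = P]) (use Nle[OF i] in simp)
    have wi: "integrable lborel (\<lambda>z. csq (w i n z))" for n by (rule sqi_integrable[OF wsqi[OF i]])
    have wm: "AE z in lborel. mono (\<lambda>n. csq (w i n z))"
      by (rule AE_I2, rule monoI, erule wmono)
    have wl: "AE z in lborel. (\<lambda>n. csq (w i n z)) ----> csq (wave (comp i) F z)"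
      unfolding w_def by (intro AE_I2 tendsto_power tendsto_norm nstrip_tendsto wave_zero)
    have [measurable]: "wave (comp i) F \<in> borel_fun" by (rule wave_measurable[OF F adm_comp[OF i]])
    have wme: "(\<lambda>z. csq (wave (comp i) F z)) \<in> borel_measurable lborel" by measurable
    have x': "(\<lambda>n. (LINT z|lborel. csq (w i n z))) ----> x" using x unfolding N_def sqnorm_def .
    have "sqi lborel (wave (comp i) F)"
      unfolding sqi_def using integrable_monotone_convergence[OF wi wm wl x' wme] by simp
    moreover have "sqnorm lborel (wave (comp i) F) = x"
      unfolding sqnorm_def by (rule integral_monotone_convergence[OF wi wm wl x' wme])
    ultimately show ?thesis using x by simp
  qed
  then show "i \<in> dirs ==> sqi lborel (wave (comp i) F)" by blast
  have "(\<lambda>n. \<Sum>i\<in>dirs. N i n) ----> (\<Sum>i\<in>dirs. sqnorm lborel (wave (comp i) F))"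
    by (intro tendsto_sum) (use conv in blast)
  then show "(\<Sum>i\<in>dirs. sqnorm lborel (wave (comp i) F)) = (LINT y|lborel. psi (nsq y) * csq (F y))"
    using lim LIMSEQ_unique unfolding P_def by blast
qed

text \<open>Only the lower flux remains as the strips grow. It is left as a limit here and
  identified later through boundary values.\<close>

lemma green_limit:
  fixes F1 F2 :: "'a::euclidean_space => complex"
  assumes F1: "finite_energy F1" and F2: "finite_energy F2" and k: "cutoff k (wave mphi F1) C"
  shows "(\<lambda>n. - flux k F1 F2 (en n)) ----> (\<Sum>i\<in>dirs. ip lborel (\<lambda>z. k z * wave (comp i) F1 z) (wave (comp i) F2))"
proof -
  note s1 = finite_energy_sqi[OF F1] and s2 = finite_energy_sqi[OF F2]
  have [measurable]: "k \<in> borel_fun" by (rule cutoff_measurable[OF k])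
  have int: "integrable lborel (\<lambda>z. k z * (wave (comp i) F1 z * cnj (wave (comp i) F2 z)))" if i: "i \<in> dirs" for i
  proof -
    have "sqi lborel (\<lambda>z. k z * wave (comp i) F1 z)"
      by (rule sqi_mult_bounded[OF energy_identity(1)[OF F1 i] _ cutoff_bound[OF k]]) simp
    from sqi_integrable_ip[OF this energy_identity(1)[OF F2 i]] show ?thesis by (simp add: mult.assoc)
  qed
  have "(\<lambda>n. \<Sum>i\<in>dirs. (LINT z|lborel. indicat_real (nstrip n) z *\<^sub>R (k z * (wave (comp i) F1 z * cnj (wave (comp i) F2 z))))) ---->
     (\<Sum>i\<in>dirs. (LINT z|lborel. k z * (wave (comp i) F1 z * cnj (wave (comp i) F2 z))))"
  proof (intro tendsto_sum integral_dominated_convergence)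
    fix i :: "'a option" assume i: "i \<in> dirs"
    show "integrable lborel (\<lambda>z. cmod (k z * (wave (comp i) F1 z * cnj (wave (comp i) F2 z))))" using int[OF i] by simp
    show "(\<lambda>z. k z * (wave (comp i) F1 z * cnj (wave (comp i) F2 z))) \<in> borel_measurable lborel"
      using int[OF i] by (rule borel_measurable_integrable)
    show "(\<lambda>z. indicat_real (nstrip n) z *\<^sub>R (k z * (wave (comp i) F1 z * cnj (wave (comp i) F2 z)))) \<in> borel_measurable lborel" for n
      using strip_integrable[OF s1 s2 k adm_comp[OF i] adm_comp[OF i] en_pos] by (rule borel_measurable_integrable)
    show "AE z in lborel. (\<lambda>n. indicat_real (nstrip n) z *\<^sub>R (k z * (wave (comp i) F1 z * cnj (wave (comp i) F2 z)))) ----> k z * (wave (comp i) F1 z * cnj (wave (comp i) F2 z))"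
      by (intro AE_I2 nstrip_tendsto) (simp add: wave_zero)
    show "AE z in lborel. norm (indicat_real (nstrip n) z *\<^sub>R (k z * (wave (comp i) F1 z * cnj (wave (comp i) F2 z)))) \<le> cmod (k z * (wave (comp i) F1 z * cnj (wave (comp i) F2 z)))" for n
      by (auto simp: indicator_def)
  qed
  then have "(\<lambda>n. flux k F1 F2 (real (Suc n)) - flux k F1 F2 (en n)) ----> (\<Sum>i\<in>dirs. (LINT z|lborel. k z * (wave (comp i) F1 z * cnj (wave (comp i) F2 z))))"
    unfolding local_green[OF s1 s2 k en_pos en_le] .
  from tendsto_diff[OF this flux_lim_infinity[OF s1 s2 k]]
  show ?thesis by (simp add: ip_def mult.assoc)
qed

end

subsection \<open>Boundary values\<close>

text \<open>Cauchy-Schwarz in the height variable. Slices of a function with square-integrable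
  height derivative are therefore Hoelder continuous of order 1/2 in L^2.\<close>

lemma vertical_bound:
  fixes q :: "real \<times> 'a::euclidean_space => complex"
  assumes q: "sqi lborel q" and ab: "a \<le> b"
  shows "(\<lambda>x. LINT s:{a..b}|lborel. q (s, x)) \<in> borel_fun"
    and "sqnorm lborel (\<lambda>x. LINT s:{a..b}|lborel. q (s, x)) \<le> (b - a) * sqnorm lborel q"
proof -
  have [measurable]: "q \<in> borel_fun" by (rule F_meas[OF q])
  have qi: "integrable (lborel \<Otimes>\<^sub>M lborel) (case_prod (\<lambda>s x. csq (q (s, x))))"
    using sqi_integrable[OF q] unfolding lborel_prod by (simp add: case_prod_beta')
  define Q where "Q x = (LINT s:{a..b}|lborel. q (s, x))" for x
  have "(\<lambda>x. (LINT s|lborel. indicat_real {a..b} s *\<^sub>R q (s, x))) \<in> borel_fun"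
    by (rule lborel.borel_measurable_lebesgue_integral) measurable
  then show Qm: "(\<lambda>x. LINT s:{a..b}|lborel. q (s, x)) \<in> borel_fun"
    unfolding set_lebesgue_integral_def .
  have ind: "sqi lborel (indicator {a..b} :: real => complex)" "sqnorm lborel (indicator {a..b} :: real => complex) = b - a"
  proof -
    have eq: "csq (indicator {a..b} s :: complex) = indicat_real {a..b} s" for s :: real by (simp add: indicator_def)
    show "sqi lborel (indicator {a..b} :: real => complex)" using ab by (simp add: sqi_def eq)
    show "sqnorm lborel (indicator {a..b} :: real => complex) = b - a" using ab by (simp add: sqnorm_def eq)
  qed
  have bound: "AE x in lborel. csq (Q x) \<le> (b - a) * (LINT s|lborel. csq (q (s, x)))"
    using lborel_pair.AE_integrable_snd[OF qi]
  proof eventually_elim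
    case (elim x)
    then have s: "sqi lborel (\<lambda>s. q (s, x))" unfolding sqi_def by simp
    have "Q x = ip lborel (\<lambda>s. q (s, x)) (indicator {a..b})"
      unfolding Q_def ip_def set_lebesgue_integral_def
      by (intro Bochner_Integration.integral_cong refl) (simp add: indicator_def)
    then have "cmod (Q x) \<le> sqrt (sqnorm lborel (\<lambda>s. q (s, x))) * sqrt (b - a)"
      using cauchy_schwarz[OF s ind(1)] ind(2) by simp
    then have "csq (Q x) \<le> (sqrt (sqnorm lborel (\<lambda>s. q (s, x))) * sqrt (b - a))\<^sup>2"
      by (rule power_mono) simp
    then show ?case using ab by (simp add: power_mult_distrib sqnorm_def mult.commute)
  qed
  have "sqnorm lborel Q \<le> (LINT x|lborel. (b - a) * (LINT s|lborel. csq (q (s, x))))"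
    unfolding sqnorm_def
  proof (rule integral_mono_AE'[OF _ bound])
    show "integrable lborel (\<lambda>x. (b - a) * (LINT s|lborel. csq (q (s, x))))"
      using lborel_pair.integrable_snd[OF qi] by simp
    show "AE x in lborel. 0 \<le> (b - a) * (LINT s|lborel. csq (q (s, x)))" using ab by simp
  qed
  also have "\<dots> = (b - a) * sqnorm lborel q"
    using lborel_pair.integral_snd[OF qi] unfolding lborel_prod sqnorm_def by (simp add: case_prod_beta')
  finally show "sqnorm lborel (\<lambda>x. LINT s:{a..b}|lborel. q (s, x)) \<le> (b - a) * sqnorm lborel q"
    unfolding Q_def .
qed

lemma sqnorm_cmult: "sqnorm M (\<lambda>x. c * f x) = csq c * sqnorm M f"
  by (simp add: sqnorm_def norm_mult power_mult_distrib)

context weight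
begin

abbreviation slice :: "(real \<times> 'a::euclidean_space => complex) => ('a => complex) => real => 'a => complex" where
  "slice k F s \<equiv> \<lambda>x. k (s, x) * wave mphi F (s, x)"

lemma cutoff_mult_sqi:
  assumes "sqi lborel (w :: real \<times> 'a::euclidean_space => complex)" "cutoff k u C"
  shows "sqi lborel (\<lambda>z. k z * w z)"
  by (rule sqi_mult_bounded[OF assms(1) _ cutoff_bound[OF assms(2)]]) (simp add: cutoff_measurable[OF assms(2)])

lemma slice_sqi:
  assumes F: "sqi lborel F" and k: "cutoff k u C" and s: "s > 0"
  shows "sqi lborel (slice k F s)"
proof (rule sqi_mult_bounded[OF wave_L2(2)[OF F adm_mphi s] _ cutoff_bound[OF k]])
  have [measurable]: "k \<in> borel_fun" by (rule cutoff_measurable[OF k])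
  show "(\<lambda>x. k (s, x)) \<in> borel_measurable lborel" by measurable
qed

lemma cutoff_vertical:
  assumes F: "sqi lborel F" and k: "cutoff k (wave mphi F) C" and ab: "0 < a" "a \<le> b"
  shows "slice k F b x - slice k F a x = (LINT s:{a..b}|lborel. k (s, x) * wave mdphi F (s, x))"
proof -
  have [measurable]: "k \<in> borel_fun" by (rule cutoff_measurable[OF k])
  have pos: "0 < t" if "t \<in> {a..b}" for t using that ab by simp
  have pH: "(t, x) \<in> half_space" if "t \<in> {a..b}" for t using pos[OF that] by (simp add: half_space_def)
  have "(LINT s:{a..b}|lborel. k (s, x) * (wave mdphi F (s, x) * 1 + wave mphi F (s, x) * 0)) =
    k (b, x) * (wave mphi F (b, x) * 1) - k (a, x) * (wave mphi F (a, x) * 1)"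
  proof (rule cutoff_ftc_lebesgue[OF ab(2)])
    show "((\<lambda>s. wave mphi F (s, x)) has_vector_derivative wave mdphi F (t, x)) (at t)" if "t \<in> {a..b}" for t
      by (rule wave_time_derivative[OF F adm_mphi adm_mdphi pos[OF that] mphi_deriv])
    have "continuous_on {a..b} (\<lambda>s. (s, x))" by (intro continuous_intros)
    then show "continuous_on {a..b} (\<lambda>s. wave mdphi F (s, x))"
      by (rule continuous_on_compose2[OF wave_continuous[OF F adm_mdphi]]) (use pH in auto)
    show "cmod (k (s, x)) \<le> C" for s by (rule cutoff_bound[OF k])
    show "(\<lambda>s. k (s, x)) \<in> borel_fun" by measurable
    show "(\<forall>t\<in>{a..b}. k (t, x) = 1) \<or> (\<forall>t\<in>{a..b}. (wave mphi F (t, x) = 0 --> k (t, x) = 0) \<and> (wave mphi F (t, x) \<noteq> 0 --> (\<exists>e>0. \<forall>s\<in>ball t e. k (s, x) = k (t, x))))"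
      by (rule cutoff_line[OF k _ pH]) (simp add: dist_Pair_Pair)
  qed (auto intro: derivative_eq_intros)
  then show ?thesis by simp
qed

text \<open>\<open>g\<close> is the boundary value of \<open>k u\<close>, as the limit in L^2 of its
  slices along the heights \<open>en n\<close>.\<close>

definition has_trace :: "(real \<times> 'a::euclidean_space => complex) => ('a => complex) => ('a => complex) => bool" where
  "has_trace k F g \<longleftrightarrow> sqi lborel g \<and> (\<forall>n. sqi lborel (slice k F (en n))) \<and>
     (\<lambda>n. sqnorm lborel (\<lambda>x. slice k F (en n) x - g x)) ----> 0"

lemma has_traceD:
  assumes "has_trace k F g"
  shows "sqi lborel g" "sqi lborel (slice k F (en n))" "(\<lambda>n. sqnorm lborel (\<lambda>x. slice k F (en n) x - g x)) ----> 0"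
  by (rule assms[unfolded has_trace_def, THEN conjunct1] assms[unfolded has_trace_def, THEN conjunct2, THEN conjunct1, THEN spec]
      assms[unfolded has_trace_def, THEN conjunct2, THEN conjunct2])+

text \<open>The height derivative of \<open>k u\<close> is \<open>k\<close> times that of
  \<open>u\<close>, hence square-integrable; by \<open>vertical_bound\<close> the slices form a
  Cauchy sequence.\<close>

lemma trace_exists:
  fixes F :: "'a::euclidean_space => complex"
  assumes fe: "finite_energy F" and k: "cutoff k (wave mphi F) C"
  shows "\<exists>g. has_trace k F g"
proof -
  note F = finite_energy_sqi[OF fe]
  define P where "P = sqnorm lborel (\<lambda>z. k z * wave mdphi F z)"
  have "sqi lborel (wave (comp None) F)" by (rule energy_identity(1)[OF fe]) (simp add: dirs_def)
  then have q: "sqi lborel (\<lambda>z. k z * wave mdphi F z)"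
    by (intro cutoff_mult_sqi[OF _ k]) (simp add: comp_def)
  have s: "sqi lborel (slice k F (en n))" for n by (rule slice_sqi[OF F k en_pos])
  have le: "sqnorm lborel (\<lambda>x. slice k F (en m) x - slice k F (en n) x) \<le> en N * P" if "N \<le> m" "m \<le> n" for N m n
  proof -
    have "sqnorm lborel (\<lambda>x. slice k F (en m) x - slice k F (en n) x) \<le> (en m - en n) * P"
      using vertical_bound(2)[OF q en_antimono[OF that(2)]] unfolding cutoff_vertical[OF F k en_pos en_antimono[OF that(2)], symmetric] P_def .
    also have "\<dots> \<le> en N * P"
      using en_pos[of n] en_antimono[OF that(1)] by (intro mult_right_mono) (auto simp: P_def)
    finally show ?thesis .
  qed
  have le': "sqnorm lborel (\<lambda>x. slice k F (en m) x - slice k F (en n) x) \<le> en N * P" if "N \<le> m" "N \<le> n" for N m n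
  proof (cases "m \<le> n")
    case True then show ?thesis by (rule le[OF that(1)])
  next
    case False
    then have "n \<le> m" by simp
    from le[OF that(2) this] show ?thesis
      using sqnorm_diff_commute[of lborel "slice k F (en m)" "slice k F (en n)"] by simp
  qed
  have cau: "\<exists>N. \<forall>m\<ge>N. \<forall>n\<ge>N. sqnorm lborel (\<lambda>x. slice k F (en m) x - slice k F (en n) x) \<le> e" if e: "e > 0" for e
  proof -
    have "(\<lambda>N. en N * P) ----> 0 * P" by (intro tendsto_intros en_lim)
    then have "\<forall>\<^sub>F N in sequentially. en N * P < e" using order_tendstoD(2)[of _ "0 * P" sequentially e] e by simp
    then obtain N where "en N * P < e" using eventually_happens trivial_limit_sequentially by blast
    then have N: "en N * P \<le> e" by simp
    show ?thesis
    proof (rule exI[of _ N], intro allI impI)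
      fix m n assume "N \<le> m" "N \<le> n"
      from order_trans[OF le'[OF this] N]
      show "sqnorm lborel (\<lambda>x. slice k F (en m) x - slice k F (en n) x) \<le> e" .
    qed
  qed
  obtain g where g: "sqi lborel g" "(\<lambda>n. sqnorm lborel (\<lambda>x. slice k F (en n) x - g x)) ----> 0"
    by (rule riesz_fischer[of lborel "\<lambda>n. slice k F (en n)", OF s cau]) (assumption, rule that, assumption, assumption)
  show ?thesis unfolding has_trace_def by (rule exI[of _ g], intro conjI allI s g)
qed

text \<open>By \<open>fourier_inversion_dist\<close> the squared distance of a slice to
  \<open>f\<close> is the integral of \<open>|1 - phi|^2 |F|^2\<close>, which tends to 0 by
  dominated convergence.\<close>

lemma has_trace_identity:
  fixes f F :: "'a::euclidean_space => complex"
  assumes f: "sqi lborel f" and F: "sqi lborel F" and fF: "AE y in lebesgue. fourier f y = F y"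
  shows "has_trace (\<lambda>_. 1) F f"
proof -
  have fm [measurable]: "f \<in> borel_fun" by (rule F_meas[OF f])
  note Fm [measurable] = F_meas[OF F]
  have fl: "sqi lebesgue f" using f by (simp add: sqi_lebesgue_iff)
  have Fl: "sqi lebesgue F" using F by (simp add: sqi_lebesgue_iff)
  have l: "0 \<le> (norm y)\<^sup>2" for y :: 'a by simp
  have s: "sqi lborel (slice (\<lambda>_. 1) F (en n))" for n by (rule slice_sqi[OF F cutoff_one en_pos])
  have eq: "sqnorm lborel (\<lambda>x. slice (\<lambda>_. 1) F (en n) x - f x) = sqnorm lborel (\<lambda>y. F y - mphi (en n) y * F y)" for n
  proof -
    note a = adm_integrable[OF F adm_mphi en_pos, of n]
    have m1: "integrable lebesgue (\<lambda>y. mphi (en n) y * F y)" using a(2,4) by (simp add: integrable_completion)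
    have m2: "sqi lebesgue (\<lambda>y. mphi (en n) y * F y)" using a(3,4) by (simp add: sqi_lebesgue_iff)
    have [measurable]: "(\<lambda>y. mphi (en n) y * F y) \<in> borel_fun" by (rule a(4))
    have [measurable]: "(\<lambda>x. wave mphi F (en n, x)) \<in> borel_fun" by (rule wave_L2(1)[OF F adm_mphi en_pos])
    have "sqnorm lebesgue (\<lambda>x. f x - wave mphi F (en n, x)) = sqnorm lebesgue (\<lambda>y. fourier f y - mphi (en n) y * F y)"
      using fourier_inversion_dist[OF fl m1 m2] by (simp add: wave_slice[OF en_pos])
    also have "\<dots> = sqnorm lebesgue (\<lambda>y. F y - mphi (en n) y * F y)"
    proof (rule sqnorm_cong_AE)
      show "(\<lambda>y. fourier f y - mphi (en n) y * F y) \<in> borel_measurable lebesgue"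
        by (rule sqi_measurable[OF sqi_diff[OF fourier_spec(1)[OF fl] m2]])
      show "(\<lambda>y. F y - mphi (en n) y * F y) \<in> borel_measurable lebesgue"
        by (rule sqi_measurable[OF sqi_diff[OF Fl m2]])
    qed (use fF in eventually_elim, simp)
    also have "\<dots> = sqnorm lborel (\<lambda>y. F y - mphi (en n) y * F y)" by (rule sqnorm_lebesgue) measurable
    also have "sqnorm lebesgue (\<lambda>x. f x - wave mphi F (en n, x)) = sqnorm lborel (\<lambda>x. f x - wave mphi F (en n, x))"
      by (rule sqnorm_lebesgue) measurable
    finally show ?thesis by (simp add: sqnorm_diff_commute[of lborel f])
  qed
  have "(\<lambda>n. sqnorm lborel (\<lambda>y. F y - mphi (en n) y * F y)) ----> (\<integral>y. 0 \<partial>(lborel :: 'a measure))"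
    unfolding sqnorm_def
  proof (rule integral_dominated_convergence)
    show "integrable lborel (\<lambda>y. csq (F y))" by (rule sqi_integrable[OF F])
    show "(\<lambda>y. csq (F y - mphi (en n) y * F y)) \<in> borel_measurable lborel" for n
      using mphi_measurable[OF less_imp_le[OF en_pos, of n], where 'a = 'a] by measurable
    show "AE y in lborel. (\<lambda>n. csq (F y - mphi (en n) y * F y)) ----> 0"
    proof (intro AE_I2)
      fix y :: 'a
      have "(\<lambda>n. (cmod (F y - of_real (phi (nsq y) (en n)) * F y))\<^sup>2) ----> csq (F y - of_real 1 * F y)"
        by (intro tendsto_intros phi_en_lim l)
      then show "(\<lambda>n. csq (F y - mphi (en n) y * F y)) ----> 0" by (simp add: mphi_def)
    qed
    show "AE y in lborel. norm (csq (F y - mphi (en n) y * F y)) \<le> csq (F y)" for n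
    proof (intro AE_I2)
      fix y :: 'a
      have e: "0 \<le> en n" using en_pos[of n] by simp
      have "F y - mphi (en n) y * F y = of_real (1 - phi (nsq y) (en n)) * F y" by (simp add: mphi_def algebra_simps)
      then have "cmod (F y - mphi (en n) y * F y) = \<bar>1 - phi (nsq y) (en n)\<bar> * cmod (F y)" by (simp only: norm_mult norm_of_real)
      also have "\<dots> \<le> 1 * cmod (F y)" using phi_nonneg[OF l e] phi_le1[OF l e] by (intro mult_right_mono) auto
      finally show "norm (csq (F y - mphi (en n) y * F y)) \<le> csq (F y)" by (simp add: power_mono)
    qed
  qed simp
  then show ?thesis unfolding has_trace_def eq using f s by simp
qed

lemma has_trace_combination:
  assumes "finite I" "\<And>i. i \<in> I ==> has_trace (k i) F (g i)"
  shows "has_trace (\<lambda>z. \<Sum>i\<in>I. c i * k i z) F (\<lambda>x. \<Sum>i\<in>I. c i * g i x)"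
  using assms
proof (induction I rule: finite_induct)
  case empty
  show ?case by (simp add: has_trace_def) (simp add: sqnorm_def)
next
  case (insert i I)
  let ?k = "\<lambda>z. \<Sum>i\<in>I. c i * k i z" and ?g = "\<lambda>x. \<Sum>i\<in>I. c i * g i x"
  have T: "has_trace ?k F ?g" by (rule insert.IH, rule insert.prems, rule insertI2)
  have Ti: "has_trace (k i) F (g i)" by (rule insert.prems, rule insertI1)
  note g = has_traceD(1)[OF T] has_traceD(1)[OF Ti]
  note s = has_traceD(2)[OF T] has_traceD(2)[OF Ti]
  note lim = has_traceD(3)[OF T] has_traceD(3)[OF Ti]
  define a where "a n x = slice ?k F (en n) x" for n x
  define b where "b n x = slice (k i) F (en n) x" for n x
  have ab: "sqi lborel (a n)" "sqi lborel (b n)" for n unfolding a_def b_def by (rule s)+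
  have eq: "(\<Sum>i\<in>insert i I. c i * k i (en n, x)) * wave mphi F (en n, x) = c i * b n x + a n x" for n x
    using insert(1,2) by (simp add: a_def b_def distrib_right mult.assoc)
  have eq': "(\<Sum>i\<in>insert i I. c i * g i x) = c i * g i x + ?g x" for x using insert(1,2) by simp
  have "(\<lambda>n. sqnorm lborel (\<lambda>x. (c i * b n x + a n x) - (c i * g i x + ?g x))) ----> 0"
  proof (rule tendsto_sandwich[where f = "\<lambda>_. 0"])
    have "(\<lambda>n. 2 * (csq (c i) * sqnorm lborel (\<lambda>x. b n x - g i x)) + 2 * sqnorm lborel (\<lambda>x. a n x - ?g x)) ----> 2 * (csq (c i) * 0) + 2 * 0"
      unfolding a_def b_def by (intro tendsto_intros lim)
    then show "(\<lambda>n. 2 * (csq (c i) * sqnorm lborel (\<lambda>x. b n x - g i x)) + 2 * sqnorm lborel (\<lambda>x. a n x - ?g x)) ----> 0" by simp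
    show "\<forall>\<^sub>F n in sequentially. sqnorm lborel (\<lambda>x. (c i * b n x + a n x) - (c i * g i x + ?g x)) \<le> 2 * (csq (c i) * sqnorm lborel (\<lambda>x. b n x - g i x)) + 2 * sqnorm lborel (\<lambda>x. a n x - ?g x)"
    proof (intro always_eventually allI)
      fix n
      have "(\<lambda>x. (c i * b n x + a n x) - (c i * g i x + ?g x)) = (\<lambda>x. c i * (b n x - g i x) + (a n x - ?g x))"
        by (simp add: fun_eq_iff algebra_simps)
      then show "sqnorm lborel (\<lambda>x. (c i * b n x + a n x) - (c i * g i x + ?g x)) \<le> 2 * (csq (c i) * sqnorm lborel (\<lambda>x. b n x - g i x)) + 2 * sqnorm lborel (\<lambda>x. a n x - ?g x)"
        using sqnorm_add_le[OF sqi_cmult[OF sqi_diff[OF ab(2)[of n] g(2)], of "c i"] sqi_diff[OF ab(1)[of n] g(1)]]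
        by (simp only: sqnorm_cmult)
    qed
  qed simp_all
  then show ?case unfolding has_trace_def eq eq'
    using sqi_add[OF sqi_cmult[OF ab(2)] ab(1)] sqi_add[OF sqi_cmult[OF g(2)] g(1)] by simp
qed

text \<open>The identity and the bounds hold on every slice; they pass to the boundary along a
  subsequence on which the slices of \<open>u\<close>, \<open>k u\<close> and \<open>|k|^2 u\<close>
  converge almost everywhere simultaneously.\<close>

lemma trace_pointwise:
  fixes f F :: "'a::euclidean_space => complex"
  assumes f: "has_trace (\<lambda>_. 1) F f" and g: "has_trace k F g" and h: "has_trace (\<lambda>z. k z * cnj (k z)) F h"
    and C: "\<And>z. cmod (k z) \<le> C"
  shows "AE x in lborel. h x * cnj (f x) = of_real (csq (g x)) \<and> cmod (g x) \<le> C * cmod (f x) \<and> cmod (h x) \<le> C\<^sup>2 * cmod (f x)"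
proof -
  let ?k' = "\<lambda>z. k z * cnj (k z)"
  define D where "D k g n x = csq (slice k F (en n) x - g x)" for k and g :: "'a => complex" and n x
  have Di: "integrable lborel (D k g n)" if "has_trace k F g" for k g n
  proof -
    have "sqi lborel (\<lambda>x. slice k F (en n) x - g x)" by (rule sqi_diff[OF has_traceD(2)[OF that] has_traceD(1)[OF that]])
    then show ?thesis unfolding D_def by (rule sqi_integrable)
  qed
  have Dl: "(\<lambda>n. (LINT x|lborel. D k g n x)) ----> 0" if "has_trace k F g" for k g
    using has_traceD(3)[OF that] unfolding D_def sqnorm_def .
  \<comment> \<open>The sum of the three squared distances tends to 0 in L^1, which gives one
    subsequence for all three.\<close>
  define S where "S n x = D (\<lambda>_. 1) f n x + D k g n x + D ?k' h n x" for n x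
  have D0: "0 \<le> D k g n x" for k g n x by (simp add: D_def)
  have Si: "integrable lborel (S n)" for n unfolding S_def
    by (intro Bochner_Integration.integrable_add Di f g h)
  have "(LINT x|lborel. norm (S n x)) = (LINT x|lborel. D (\<lambda>_. 1) f n x) + (LINT x|lborel. D k g n x) + (LINT x|lborel. D ?k' h n x)" for n
  proof -
    have "norm (S n x) = D (\<lambda>_. 1) f n x + D k g n x + D ?k' h n x" for x
      unfolding S_def by (simp add: D0)
    then show ?thesis
      by (simp only: Bochner_Integration.integral_add[OF Bochner_Integration.integrable_add[OF Di[OF f] Di[OF g]] Di[OF h]] Bochner_Integration.integral_add[OF Di[OF f] Di[OF g]])
  qed
  moreover have "(\<lambda>n. (LINT x|lborel. D (\<lambda>_. 1) f n x) + (LINT x|lborel. D k g n x) + (LINT x|lborel. D ?k' h n x)) ----> 0 + 0 + 0"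
    by (intro tendsto_add Dl f g h)
  ultimately have "(\<lambda>n. (LINT x|lborel. norm (S n x))) ----> 0" by simp
  from tendsto_L1_AE_subseq[OF Si this]
  obtain r :: "nat => nat" where "AE x in lborel. (\<lambda>n. S (r n) x) ----> 0" by blast
  then show ?thesis
  proof eventually_elim
    case (elim x)
    have conv: "(\<lambda>n. slice k F (en (r n)) x) ----> g x" if le: "\<And>n. D k g n x \<le> S n x" for k and g :: "'a => complex"
    proof -
      have "(\<lambda>n. D k g (r n) x) ----> 0"
        by (rule tendsto_sandwich[OF _ _ tendsto_const elim]) (use D0 le in auto)
      then have "(\<lambda>n. sqrt (D k g (r n) x)) ----> sqrt 0" by (rule tendsto_real_sqrt)
      then have "(\<lambda>n. cmod (slice k F (en (r n)) x - g x)) ----> 0" by (simp add: D_def)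
      then show ?thesis by (simp add: tendsto_norm_zero_iff LIM_zero_iff)
    qed
    have fl: "(\<lambda>n. slice (\<lambda>_. 1) F (en (r n)) x) ----> f x" by (rule conv) (simp add: S_def D0)
    have gl: "(\<lambda>n. slice k F (en (r n)) x) ----> g x" by (rule conv) (simp add: S_def D0)
    have hl: "(\<lambda>n. slice ?k' F (en (r n)) x) ----> h x" by (rule conv) (simp add: S_def D0)
    have 1: "h x * cnj (f x) = of_real (csq (g x))"
    proof (rule LIMSEQ_unique)
      show "(\<lambda>n. slice ?k' F (en (r n)) x * cnj (slice (\<lambda>_. 1) F (en (r n)) x)) ----> h x * cnj (f x)"
        by (intro tendsto_mult tendsto_cnj fl hl)
      have "(\<lambda>n. slice k F (en (r n)) x * cnj (slice k F (en (r n)) x)) ----> g x * cnj (g x)"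
        by (intro tendsto_mult tendsto_cnj gl)
      then show "(\<lambda>n. slice ?k' F (en (r n)) x * cnj (slice (\<lambda>_. 1) F (en (r n)) x)) ----> of_real (csq (g x))"
        unfolding complex_norm_square by (simp add: mult_ac)
    qed
    note lim = tendsto_mult[OF tendsto_const tendsto_norm[OF fl]]
    have 2: "cmod (g x) \<le> C * cmod (f x)"
      by (rule LIMSEQ_le[OF tendsto_norm[OF gl] lim]) (simp add: norm_mult mult_right_mono C)
    have "cmod (?k' z) \<le> C\<^sup>2" for z using C[of z] by (simp add: norm_mult power2_eq_square mult_mono')
    then have 3: "cmod (h x) \<le> C\<^sup>2 * cmod (f x)"
      by (intro LIMSEQ_le[OF tendsto_norm[OF hl] lim]) (simp add: norm_mult[of _ "wave mphi F _"] mult_right_mono del: complex_mod_mult_cnj)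
    show ?case by (intro conjI 1 2 3)
  qed
qed

end

lemma inv_fourier_diff:
  fixes a b :: "'a::euclidean_space => complex"
  assumes "integrable lebesgue a" "integrable lebesgue b"
  shows "inv_fourier (\<lambda>y. a y - b y) x = inv_fourier a x - inv_fourier b x"
  using fourier_integral_diff[OF assms, of 1 1 "- x"] by (simp add: inv_fourier_def)

lemma cball_borel [measurable]: "cball (a::'a::euclidean_space) r \<in> sets borel"
  by simp

lemma sqi_trunc: "sqi lborel G ==> sqi lborel (trunc R G)"
  by (rule sqi_mult_bounded[where C = 1]) (auto simp: indicator_def)

lemma trunc_integrable:
  assumes G: "sqi lborel G"
  shows "integrable lborel (trunc R G)"
proof -
  note [measurable] = F_meas[OF G]
  have m: "trunc R G \<in> borel_fun" by (rule F_meas[OF sqi_trunc[OF G]])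
  have "sqi lebesgue G" by (rule sqi_lebesgue_iff[OF F_meas[OF G], THEN iffD2, OF G])
  from sqi_bounded_support_integrable(1)[OF this, of R] show ?thesis
    by (simp add: integrable_completion m)
qed

lemma trunc_sequence:
  fixes F :: "'a::euclidean_space => complex"
  shows "(\<lambda>n. trunc (real n) F x) ----> F x"
proof (rule tendsto_eventually)
  obtain N where "norm x \<le> real N" using real_arch_simple by blast
  then have "trunc (real n) F x = F x" if "n \<ge> N" for n using that by simp
  then show "\<forall>\<^sub>F n in sequentially. trunc (real n) F x = F x"
    by (rule eventually_mono[OF eventually_ge_at_top[of N]])
qed

lemma cmod_trunc_le: "cmod (trunc R F x) \<le> cmod (F x)"
  by (simp add: indicator_def)

section \<open>Dirichlet's principle for the boundary values of the cut-off extension\<close>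

context weight
begin

text \<open>The \<open>psi\<close> part of the quadratic form on the Fourier side, equal to the
  energy of the extension by \<open>energy_identity\<close>. The function \<open>V\<close> does not
  enter.\<close>

definition potential :: "('a::euclidean_space => complex) => real" where
  "potential G = (LINT y|lborel. psi (nsq y) * csq (G y))"

text \<open>The weighted Dirichlet energy of \<open>k u\<close>; the gradient falls on
  \<open>u\<close> alone because \<open>k\<close> is locally constant.\<close>

definition energy :: "(real \<times> 'a::euclidean_space => complex) => ('a => complex) => real" where
  "energy k F = (\<Sum>i\<in>dirs. sqnorm lborel (\<lambda>z. k z * wave (comp i) F z))"

lemma mpsi_measurable [measurable]: "(mpsi :: 'a::euclidean_space => complex) \<in> borel_fun"
  unfolding mpsi_def by measurable

lemma psi_norm_nonneg: "0 \<le> psi ((norm (y :: 'a::euclidean_space))\<^sup>2)"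
  by (rule psi_nonneg) simp

lemma cmod_mpsi: "cmod (mpsi (y :: 'a::euclidean_space)) = psi (nsq y)"
  using psi_norm_nonneg[of y] by (simp add: mpsi_def)

lemma psi_cball: "norm (y :: 'a::euclidean_space) \<le> R ==> psi (nsq y) \<le> psi (R\<^sup>2)"
  by (intro psi_mono power_mono) auto

text \<open>On a ball of frequencies \<open>psi\<close> is bounded by monotonicity. Truncated data
  thus have finite energy, and an integrable normal derivative at the boundary on the Fourier
  side.\<close>

lemma mpsi_trunc:
  assumes G: "sqi lborel G"
  shows "integrable lborel (\<lambda>y. mpsi y * trunc R G y)" "sqi lborel (\<lambda>y. mpsi y * trunc R G y)" "finite_energy (trunc R G)"
proof -
  note [measurable] = F_meas[OF G] F_meas[OF sqi_trunc[OF G]]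
  have p: "psi (nsq y) * cmod (trunc R G y) \<le> psi (R\<^sup>2) * cmod (trunc R G y)" for y
    using psi_cball[of y R] by (auto simp: indicator_def intro: mult_right_mono)
  have b: "cmod (mpsi y * trunc R G y) \<le> psi (R\<^sup>2) * cmod (trunc R G y)" for y
    using p[of y] by (simp only: norm_mult cmod_mpsi)
  have m: "(\<lambda>y. mpsi y * trunc R G y) \<in> borel_measurable lborel"
    using borel_measurable_times[OF mpsi_measurable F_meas[OF sqi_trunc[OF G, of R]]] by simp
  have p0: "0 \<le> psi (R\<^sup>2)" by (rule psi_nonneg) simp
  show "sqi lborel (\<lambda>y. mpsi y * trunc R G y)"
    by (rule sqi_dominated[OF sqi_trunc[OF G, of R] m AE_I2]) (rule b)
  show "integrable lborel (\<lambda>y. mpsi y * trunc R G y)"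
  proof (rule Bochner_Integration.integrable_bound[OF _ m])
    show "integrable lborel (\<lambda>y. psi (R\<^sup>2) * cmod (trunc R G y))"
      using trunc_integrable[OF G, of R] by (intro Bochner_Integration.integrable_mult_right integrable_norm)
    show "AE y in lborel. norm (mpsi y * trunc R G y) \<le> norm (psi (R\<^sup>2) * cmod (trunc R G y))"
      using b p0 by (intro AE_I2) (simp only: real_norm_def abs_mult abs_of_nonneg abs_norm_cancel)
  qed
  have "integrable lborel (\<lambda>y. psi (nsq y) * csq (trunc R G y))"
  proof (rule Bochner_Integration.integrable_bound)
    show "integrable lborel (\<lambda>y. psi (R\<^sup>2) * csq (trunc R G y))"
      by (intro Bochner_Integration.integrable_mult_right sqi_integrable sqi_trunc G)
    show "(\<lambda>y. psi (nsq y) * csq (trunc R G y)) \<in> borel_measurable lborel" by measurable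
    show "AE y in lborel. norm (psi (nsq y) * csq (trunc R G y)) \<le> norm (psi (R\<^sup>2) * csq (trunc R G y))"
    proof (intro AE_I2)
      fix y :: 'a
      have "psi (nsq y) * csq (trunc R G y) \<le> psi (R\<^sup>2) * csq (trunc R G y)"
        using mult_right_mono[OF p[of y], of "cmod (trunc R G y)"] by (simp only: power2_eq_square mult.assoc[symmetric] norm_ge_zero)
      then show "norm (psi (nsq y) * csq (trunc R G y)) \<le> norm (psi (R\<^sup>2) * csq (trunc R G y))"
        using p0 psi_norm_nonneg[of y] by (simp only: real_norm_def abs_mult abs_of_nonneg zero_le_power2)
    qed
  qed
  then show "finite_energy (trunc R G)" unfolding finite_energy_def by (rule conjI[OF sqi_trunc[OF G]])
qed

text \<open>As the height tends to 0 the slices of minus the height derivative converge in L^2 to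
  the inverse transform of \<open>psi F2\<close>, with \<open>|dphi + psi| \<le> psi\<close> as
  domination. Pairing with the trace \<open>g\<close> and Parseval's formula move the limit to the
  Fourier side.\<close>

lemma boundary_limit:
  fixes F F2 :: "'a::euclidean_space => complex"
  assumes F2: "sqi lborel F2" and i: "integrable lborel (\<lambda>y. mpsi y * F2 y)" "sqi lborel (\<lambda>y. mpsi y * F2 y)"
    and T: "has_trace k F g" and gG: "AE y in lebesgue. fourier g y = G y" and G: "sqi lborel G"
  shows "(\<lambda>n. - flux k F F2 (en n)) ----> ip lborel G (\<lambda>y. mpsi y * F2 y)"
proof -
  note g = has_traceD(1)[OF T]
  note [measurable] = F_meas[OF F2] F_meas[OF g] F_meas[OF G]
  let ?P = "\<lambda>y. mpsi y * F2 y"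
  have Pm: "?P \<in> borel_fun" by measurable
  have l: "0 \<le> (norm y)\<^sup>2" for y :: 'a by simp
  define h where "h = inv_fourier ?P"
  have Pl: "integrable lebesgue ?P" "sqi lebesgue ?P"
    using i Pm by (simp_all add: integrable_completion sqi_lebesgue_iff)
  note I = inv_fourier_isometry[OF Pl]
  have hs: "sqi lborel h" unfolding h_def by (rule sqi_lebesgue_iff[OF I(1), THEN iffD1, OF I(2)])
  have gl: "sqi lebesgue g" by (rule sqi_lebesgue_iff[OF F_meas[OF g], THEN iffD2, OF g])
  define w where "w n x = wave mdphi F2 (en n, x)" for n x
  have ws: "sqi lborel (w n)" for n unfolding w_def by (rule wave_L2(2)[OF F2 adm_mdphi en_pos])
  have eq: "sqnorm lborel (\<lambda>x. - w n x - h x) = (LINT y|lborel. (dphi (nsq y) (en n) + psi (nsq y))\<^sup>2 * csq (F2 y))" for n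
  proof -
    note a = adm_integrable[OF F2 adm_mdphi en_pos, of n]
    let ?M = "\<lambda>y. mdphi (en n) y * F2 y" and ?N = "\<lambda>y. (- mpsi y) * F2 y"
    have M: "integrable lebesgue ?M" "sqi lebesgue ?M"
      using a(2,3,4) by (simp_all add: integrable_completion sqi_lebesgue_iff)
    have N: "integrable lebesgue ?N" "sqi lebesgue ?N"
      using Bochner_Integration.integrable_minus[OF Pl(1)] sqi_minus[OF Pl(2)] by simp_all
    have inv: "inv_fourier ?N x = - h x" for x
      using inv_fourier_cmult[of "- 1" ?P x] unfolding h_def by simp
    have [measurable]: "?M \<in> borel_fun" by (rule a(4))
    have m: "inv_fourier (\<lambda>y. ?M y - ?N y) \<in> borel_fun"
      by (rule inv_fourier_isometry(1)[OF Bochner_Integration.integrable_diff[OF M(1) N(1)] sqi_diff[OF M(2) N(2)]])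
    have e: "(\<lambda>x. w n x + h x) = inv_fourier (\<lambda>y. ?M y - ?N y)"
      unfolding fun_eq_iff inv_fourier_diff[OF M(1) N(1)] inv w_def wave_slice[OF en_pos] by simp
    have "sqnorm lborel (\<lambda>x. - w n x - h x) = sqnorm lborel (\<lambda>x. w n x + h x)"
      using sqnorm_minus[of lborel "\<lambda>x. w n x + h x"] by simp
    also have "\<dots> = sqnorm lebesgue (inv_fourier (\<lambda>y. ?M y - ?N y))" unfolding e by (rule sqnorm_lebesgue[OF m, symmetric])
    also have "\<dots> = sqnorm lebesgue (\<lambda>y. ?M y - ?N y)"
      by (rule inv_fourier_isometry(3)[OF Bochner_Integration.integrable_diff[OF M(1) N(1)] sqi_diff[OF M(2) N(2)]])
    also have "\<dots> = sqnorm lborel (\<lambda>y. ?M y - ?N y)" by (rule sqnorm_lebesgue) measurable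
    also have "\<dots> = (LINT y|lborel. (dphi (nsq y) (en n) + psi (nsq y))\<^sup>2 * csq (F2 y))"
      unfolding sqnorm_def
    proof (intro Bochner_Integration.integral_cong refl)
      fix y :: 'a
      have "?M y - ?N y = of_real (dphi (nsq y) (en n) + psi (nsq y)) * F2 y"
        by (simp add: mdphi_def mpsi_def algebra_simps)
      then show "csq (?M y - ?N y) = (dphi (nsq y) (en n) + psi (nsq y))\<^sup>2 * csq (F2 y)"
        by (simp only: norm_mult norm_of_real power_mult_distrib power2_abs)
    qed
    finally show ?thesis .
  qed
  have "(\<lambda>n. (LINT y|lborel. (dphi (nsq y) (en n) + psi (nsq y))\<^sup>2 * csq (F2 y))) ----> (\<integral>y. 0 \<partial>(lborel :: 'a measure))"
  proof (rule integral_dominated_convergence)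
    show "integrable lborel (\<lambda>y. csq (mpsi y * F2 y))" by (rule sqi_integrable[OF i(2)])
    have "(\<lambda>y::'a. Re (mdphi (en n) y)) \<in> borel_fun" for n
      using mdphi_measurable[OF less_imp_le[OF en_pos, of n], where 'a = 'a] by measurable
    then have [measurable]: "(\<lambda>y::'a. dphi (nsq y) (en n)) \<in> borel_fun" for n
      by (simp add: mdphi_def)
    show "(\<lambda>y. (dphi (nsq y) (en n) + psi (nsq y))\<^sup>2 * csq (F2 y)) \<in> borel_measurable lborel" for n
      by measurable
    show "AE y in lborel. (\<lambda>n. (dphi (nsq y) (en n) + psi (nsq y))\<^sup>2 * csq (F2 y)) ----> 0"
    proof (intro AE_I2)
      fix y :: 'a
      have "(\<lambda>n. (dphi (nsq y) (en n) + psi (nsq y))\<^sup>2 * csq (F2 y)) ----> (- psi (nsq y) + psi (nsq y))\<^sup>2 * csq (F2 y)"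
        by (intro tendsto_intros dphi_en_lim l)
      then show "(\<lambda>n. (dphi (nsq y) (en n) + psi (nsq y))\<^sup>2 * csq (F2 y)) ----> 0" by simp
    qed
    show "AE y in lborel. norm ((dphi (nsq y) (en n) + psi (nsq y))\<^sup>2 * csq (F2 y)) \<le> csq (mpsi y * F2 y)" for n
    proof (intro AE_I2)
      fix y :: 'a
      have e: "0 \<le> en n" using en_pos[of n] by simp
      have "(dphi (nsq y) (en n) + psi (nsq y))\<^sup>2 \<le> (psi (nsq y))\<^sup>2"
        using dphi_abs_le_psi[OF l e, of y] dphi_nonpos[OF l e, of y] by (intro power_mono) auto
      then show "norm ((dphi (nsq y) (en n) + psi (nsq y))\<^sup>2 * csq (F2 y)) \<le> csq (mpsi y * F2 y)"
        by (simp add: norm_mult cmod_mpsi power_mult_distrib mult_right_mono)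
    qed
  qed simp
  then have lim: "(\<lambda>n. sqnorm lborel (\<lambda>x. - w n x - h x)) ----> 0" unfolding eq by simp
  have "(\<lambda>n. ip lborel (slice k F (en n)) (\<lambda>x. - w n x)) ----> ip lborel g h"
    by (rule ip_tendsto[OF has_traceD(2)[OF T] g sqi_minus[OF ws] hs has_traceD(3)[OF T] lim])
  moreover have "ip lborel (slice k F (en n)) (\<lambda>x. - w n x) = - flux k F F2 (en n)" for n
    unfolding ip_def flux_def w_def by (simp add: mult.assoc)
  moreover have "ip lborel g h = ip lborel G ?P"
  proof -
    have "(\<lambda>x. g x * cnj (h x)) \<in> borel_fun" using F_meas[OF g] F_meas[OF hs] by measurable
    then have "ip lborel g h = ip lebesgue g h" unfolding ip_def by (simp add: integral_completion)
    also have "\<dots> = ip lebesgue (fourier g) ?P" unfolding h_def by (rule parseval[OF gl Pl])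
    also have "\<dots> = ip lebesgue G ?P"
      by (rule ip_cong_AE[OF gG]) (auto intro: sqi_measurable[OF fourier_spec(1)[OF gl]] borel_imp_lebesgue F_meas[OF G] Pm)
    also have "\<dots> = ip lborel G ?P"
    proof -
      have "(\<lambda>y. G y * cnj (?P y)) \<in> borel_fun" by measurable
      then show ?thesis unfolding ip_def by (simp add: integral_completion)
    qed
    finally show ?thesis .
  qed
  ultimately show ?thesis by simp
qed

text \<open>\<open>g\<close> is the boundary value of \<open>k u\<close>, where \<open>u\<close> is the extension with Fourier data \<open>F\<close>, and \<open>G\<close>
  is its Fourier transform.\<close>

context
  fixes F G g :: "'a::euclidean_space => complex" and k :: "real \<times> 'a => complex" and C :: real
  assumes fe: "finite_energy F" and k: "cutoff k (wave mphi F) C" and T: "has_trace k F g"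
    and gG: "AE y in lebesgue. fourier g y = G y" and G: "sqi lborel G"
begin

lemma cut_sqi: "i \<in> dirs ==> sqi lborel (\<lambda>z. k z * wave (comp i) F z)"
  by (rule cutoff_mult_sqi[OF energy_identity(1)[OF fe] k])

lemma green_truncated:
  assumes H: "sqi lborel H"
  shows "(\<Sum>i\<in>dirs. ip lborel (\<lambda>z. k z * wave (comp i) F z) (wave (comp i) (trunc R H))) = ip lborel G (\<lambda>y. mpsi y * trunc R H y)"
  by (rule LIMSEQ_unique[OF green_limit[OF fe mpsi_trunc(3)[OF H] k] boundary_limit[OF sqi_trunc[OF H] mpsi_trunc(1,2)[OF H] T gG G]])

text \<open>Expansion of the square; Green's formula supplies the mixed term.\<close>

lemma energy_distance:
  assumes H: "finite_energy H"
    and eq: "(\<Sum>i\<in>dirs. ip lborel (\<lambda>z. k z * wave (comp i) F z) (wave (comp i) H)) = of_real (potential H)"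
  shows "(\<Sum>i\<in>dirs. sqnorm lborel (\<lambda>z. k z * wave (comp i) F z - wave (comp i) H z)) = energy k F - potential H"
proof -
  have "(\<Sum>i\<in>dirs. sqnorm lborel (\<lambda>z. k z * wave (comp i) F z - wave (comp i) H z)) =
    (\<Sum>i\<in>dirs. sqnorm lborel (\<lambda>z. k z * wave (comp i) F z) - 2 * Re (ip lborel (\<lambda>z. k z * wave (comp i) F z) (wave (comp i) H)) + sqnorm lborel (wave (comp i) H))"
    by (intro sum.cong refl sqnorm_diff_ip cut_sqi energy_identity(1)[OF H])
  also have "\<dots> = energy k F - 2 * Re (\<Sum>i\<in>dirs. ip lborel (\<lambda>z. k z * wave (comp i) F z) (wave (comp i) H)) + potential H"
    unfolding energy_def potential_def energy_identity(2)[OF H, symmetric]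
    by (simp only: sum.distrib sum_subtractf sum_distrib_left Re_sum)
  finally show ?thesis unfolding eq by simp
qed

lemma trace_energy: "finite_energy G" "potential G \<le> energy k F"
proof -
  note [measurable] = F_meas[OF G]
  \<comment> \<open>The weight \<open>sqrt psi\<close> turns the energy into a plain norm, to which
    \<open>sqi_Fatou\<close> applies.\<close>
  define f where "f n y = complex_of_real (sqrt (psi (nsq y))) * trunc (real n) G y" for n y
  have sq: "(cmod (complex_of_real (sqrt (psi (nsq y))) * c))\<^sup>2 = psi (nsq y) * csq c" for y :: 'a and c
    using psi_norm_nonneg[of y] by (simp add: norm_mult power_mult_distrib)
  have fs: "sqi lborel (f n)" for n
    unfolding sqi_def f_def sq using mpsi_trunc(3)[OF G, of "real n"] by (simp add: finite_energy_def)
  have fn: "sqnorm lborel (f n) = potential (trunc (real n) G)" for n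
    unfolding sqnorm_def f_def sq potential_def ..
  have le: "sqnorm lborel (f n) \<le> energy k F" for n
  proof -
    have "ip lborel G (\<lambda>y. mpsi y * trunc (real n) G y) = (LINT y|lborel. complex_of_real (psi (nsq y) * csq (trunc (real n) G y)))"
      unfolding ip_def of_real_mult complex_norm_square mpsi_def
      by (intro Bochner_Integration.integral_cong refl) (simp add: indicator_def)
    also have "\<dots> = of_real (potential (trunc (real n) G))"
      unfolding potential_def by (rule integral_complex_of_real)
    finally have gr: "(\<Sum>i\<in>dirs. ip lborel (\<lambda>z. k z * wave (comp i) F z) (wave (comp i) (trunc (real n) G))) = of_real (potential (trunc (real n) G))"
      unfolding green_truncated[OF G] .
    have "0 \<le> energy k F - potential (trunc (real n) G)"
      unfolding energy_distance[OF mpsi_trunc(3)[OF G] gr, symmetric] by (rule sum_nonneg) simp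
    then show ?thesis unfolding fn by simp
  qed
  have lim: "(\<lambda>n. f n y) ----> complex_of_real (sqrt (psi (nsq y))) * G y" for y
    unfolding f_def by (intro tendsto_mult tendsto_const trunc_sequence)
  have m: "(\<lambda>y. complex_of_real (sqrt (psi (nsq y))) * G y) \<in> borel_measurable lborel" by measurable
  have fat: "sqi lborel (\<lambda>y. complex_of_real (sqrt (psi (nsq y))) * G y) \<and>
      sqnorm lborel (\<lambda>y. complex_of_real (sqrt (psi (nsq y))) * G y) \<le> energy k F"
    by (rule sqi_Fatou[OF fs m AE_I2[OF lim] le])
  show "finite_energy G"
    unfolding finite_energy_def using G sqi_integrable[OF conjunct1[OF fat]] unfolding sq by (rule conjI)
  show "potential G \<le> energy k F"
    using conjunct2[OF fat] unfolding sqnorm_def sq potential_def .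
qed

text \<open>Truncations of \<open>H\<close> converge to \<open>H\<close> in energy, and
  \<open>energy_identity\<close> for the difference controls the gradients. On the Fourier side
  \<open>psi (|G|^2 + |H|^2)\<close> dominates.\<close>

lemma green_finite:
  assumes H: "finite_energy H"
  shows "(\<Sum>i\<in>dirs. ip lborel (\<lambda>z. k z * wave (comp i) F z) (wave (comp i) H)) =
    (LINT y|lborel. of_real (psi (nsq y)) * (G y * cnj (H y)))"
proof (rule LIMSEQ_unique)
  note Hs = finite_energy_sqi[OF H]
  note [measurable] = F_meas[OF G] F_meas[OF Hs]
  let ?D = "\<lambda>n y. trunc (real n) H y - H y"
  have Ds: "sqi lborel (?D n)" for n by (rule sqi_diff[OF sqi_trunc[OF Hs] Hs])
  have Dle: "cmod (?D n y) \<le> cmod (H y)" for n y by (simp add: indicator_def)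
  have Hi: "integrable lborel (\<lambda>y. psi (nsq y) * csq (H y))" and Gi: "integrable lborel (\<lambda>y. psi (nsq y) * csq (G y))"
    by (rule H[unfolded finite_energy_def, THEN conjunct2] trace_energy(1)[unfolded finite_energy_def, THEN conjunct2])+
  have Dp: "psi (nsq y) * csq (?D n y) \<le> psi (nsq y) * csq (H y)" for n y
    by (intro mult_left_mono power_mono Dle psi_norm_nonneg) simp
  have Dn: "norm (psi (nsq y) * csq (?D n y)) \<le> psi (nsq y) * csq (H y)" for n y
    using Dp[of y n] psi_norm_nonneg[of y] by (simp only: real_norm_def abs_mult abs_of_nonneg zero_le_power2)
  have Dm: "(\<lambda>y. psi (nsq y) * csq (?D n y)) \<in> borel_measurable lborel" for n by measurable
  have Dfe: "finite_energy (?D n)" for n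
    unfolding finite_energy_def
  proof
    show "integrable lborel (\<lambda>y. psi (nsq y) * csq (?D n y))"
      by (rule Bochner_Integration.integrable_bound[OF Hi Dm]) (rule AE_I2, rule order_trans[OF Dn], unfold real_norm_def, rule abs_ge_self)
  qed (rule Ds)
  have "(\<lambda>n. potential (?D n)) ----> (\<integral>y. 0 \<partial>(lborel :: 'a measure))"
    unfolding potential_def
  proof (rule integral_dominated_convergence[OF _ Dm Hi])
    show "AE y in lborel. (\<lambda>n. psi (nsq y) * csq (?D n y)) ----> 0"
    proof (intro AE_I2)
      fix y :: 'a
      have "(\<lambda>n. psi (nsq y) * csq (?D n y)) ----> psi (nsq y) * csq (H y - H y)"
        by (intro tendsto_mult tendsto_const tendsto_power tendsto_norm tendsto_diff trunc_sequence)
      then show "(\<lambda>n. psi (nsq y) * csq (?D n y)) ----> 0" by simp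
    qed
    show "AE y in lborel. norm (psi (nsq y) * csq (?D n y)) \<le> psi (nsq y) * csq (H y)" for n
      by (rule AE_I2) (rule Dn)
  qed simp
  then have pot: "(\<lambda>n. potential (?D n)) ----> 0" by simp
  have wl: "(\<lambda>n. sqnorm lborel (\<lambda>z. wave (comp i) (trunc (real n) H) z - wave (comp i) H z)) ----> 0" if i: "i \<in> dirs" for i
  proof (rule tendsto_sandwich[OF _ _ tendsto_const pot])
    show "\<forall>\<^sub>F n in sequentially. sqnorm lborel (\<lambda>z. wave (comp i) (trunc (real n) H) z - wave (comp i) H z) \<le> potential (?D n)"
    proof (intro always_eventually allI)
      fix n
      have "sqnorm lborel (wave (comp i) (?D n)) \<le> (\<Sum>i\<in>dirs. sqnorm lborel (wave (comp i) (?D n)))"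
        by (rule member_le_sum[OF i]) simp_all
      then show "sqnorm lborel (\<lambda>z. wave (comp i) (trunc (real n) H) z - wave (comp i) H z) \<le> potential (?D n)"
        unfolding energy_identity(2)[OF Dfe] potential_def[symmetric] wave_diff[OF sqi_trunc[OF Hs] Hs adm_comp[OF i], symmetric] .
    qed
  qed simp
  have zero: "(\<lambda>n::nat. sqnorm M (\<lambda>z. f z - f z :: complex)) ----> 0" for f :: "'b => complex" and M by (simp add: sqnorm_def)
  show "(\<lambda>n. \<Sum>i\<in>dirs. ip lborel (\<lambda>z. k z * wave (comp i) F z) (wave (comp i) (trunc (real n) H))) ---->
     (\<Sum>i\<in>dirs. ip lborel (\<lambda>z. k z * wave (comp i) F z) (wave (comp i) H))"
    by (intro tendsto_sum ip_tendsto[OF _ _ _ _ zero] wl cut_sqi energy_identity(1) mpsi_trunc(3) Hs H)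
  show "(\<lambda>n. \<Sum>i\<in>dirs. ip lborel (\<lambda>z. k z * wave (comp i) F z) (wave (comp i) (trunc (real n) H))) ---->
     (LINT y|lborel. of_real (psi (nsq y)) * (G y * cnj (H y)))"
    unfolding green_truncated[OF Hs] unfolding ip_def
  proof (rule integral_dominated_convergence)
    show "integrable lborel (\<lambda>y. psi (nsq y) * csq (G y) + psi (nsq y) * csq (H y))"
      by (rule Bochner_Integration.integrable_add[OF Gi Hi])
    show "(\<lambda>y. of_real (psi (nsq y)) * (G y * cnj (H y))) \<in> borel_measurable lborel" by measurable
    show "(\<lambda>y. G y * cnj (mpsi y * trunc (real n) H y)) \<in> borel_measurable lborel" for n by measurable
    show "AE y in lborel. (\<lambda>n. G y * cnj (mpsi y * trunc (real n) H y)) ----> of_real (psi (nsq y)) * (G y * cnj (H y))"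
    proof (intro AE_I2)
      fix y :: 'a
      have L: "(\<lambda>n. G y * cnj (mpsi y * trunc (real n) H y)) ----> G y * cnj (mpsi y * H y)"
        by (intro tendsto_mult tendsto_const tendsto_cnj trunc_sequence)
      have e: "G y * cnj (mpsi y * H y) = of_real (psi (nsq y)) * (G y * cnj (H y))" by (simp add: mpsi_def)
      show "(\<lambda>n. G y * cnj (mpsi y * trunc (real n) H y)) ----> of_real (psi (nsq y)) * (G y * cnj (H y))" by (rule L[unfolded e])
    qed
    show "AE y in lborel. norm (G y * cnj (mpsi y * trunc (real n) H y)) \<le> psi (nsq y) * csq (G y) + psi (nsq y) * csq (H y)" for n
    proof (intro AE_I2)
      fix y :: 'a
      have "cmod (G y) * cmod (trunc (real n) H y) \<le> cmod (G y) * cmod (H y)" by (rule mult_left_mono[OF cmod_trunc_le]) simp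
      also have "\<dots> \<le> csq (G y) + csq (H y)"
        using two_mult_le[OF zero_less_one, of "cmod (G y)" "cmod (H y)"] mult_nonneg_nonneg[OF norm_ge_zero norm_ge_zero, of "G y" "H y"]
        unfolding mult_1 div_by_1 by linarith
      finally have "psi (nsq y) * (cmod (G y) * cmod (trunc (real n) H y)) \<le> psi (nsq y) * (csq (G y) + csq (H y))"
        by (rule mult_left_mono[OF _ psi_norm_nonneg])
      then show "norm (G y * cnj (mpsi y * trunc (real n) H y)) \<le> psi (nsq y) * csq (G y) + psi (nsq y) * csq (H y)"
        unfolding norm_mult complex_mod_cnj cmod_mpsi distrib_left by (simp only: mult_ac)
    qed
  qed
qed

text \<open>If the boundary values have the same energy as \<open>k u\<close>, then \<open>k u\<close> is itself harmonic.\<close>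

lemma energy_equality:
  assumes eq: "energy k F \<le> potential G" and s: "s > 0"
  shows "AE x in lborel. slice k F s x = wave mphi G (s, x)"
proof -
  note feG = trace_energy(1) and F = finite_energy_sqi[OF fe]
  note g = has_traceD(1)[OF T]
  \<comment> \<open>The height component of the gradient suffices: two functions with equal boundary
    values and equal height derivatives agree.\<close>
  define q where "q z = k z * wave mdphi F z - wave mdphi G z" for z
  have "(LINT y|lborel. of_real (psi (nsq y)) * (G y * cnj (G y))) = complex_of_real (potential G)"
    unfolding potential_def integral_complex_of_real[symmetric] of_real_mult complex_norm_square ..
  with green_finite[OF feG] have "(\<Sum>i\<in>dirs. ip lborel (\<lambda>z. k z * wave (comp i) F z) (wave (comp i) G)) = of_real (potential G)" by simp
  from energy_distance[OF feG this] eq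
  have "(\<Sum>i\<in>dirs. sqnorm lborel (\<lambda>z. k z * wave (comp i) F z - wave (comp i) G z)) \<le> 0" by simp
  moreover have N: "None \<in> dirs" by (simp add: dirs_def)
  moreover have "sqnorm lborel (\<lambda>z. k z * wave (comp None) F z - wave (comp None) G z) \<le>
    (\<Sum>i\<in>dirs. sqnorm lborel (\<lambda>z. k z * wave (comp i) F z - wave (comp i) G z))"
    by (rule member_le_sum[OF N]) simp_all
  ultimately have q0: "sqnorm lborel q \<le> 0" by (simp add: q_def[abs_def] comp_def)
  have qs: "sqi lborel q"
    using sqi_diff[OF cut_sqi[OF N] energy_identity(1)[OF feG N]] by (simp add: q_def[abs_def] comp_def)
  have [measurable]: "k \<in> borel_fun" by (rule cutoff_measurable[OF k])
  note [measurable] = wave_measurable[OF F adm_mdphi] wave_measurable[OF G adm_mdphi]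
  have cut1: "cutoff (\<lambda>_. 1) (wave mphi G) 1" by (rule cutoff_one)
  \<comment> \<open>\<open>q\<close> is null, so the slices of the difference do not depend on the
    height in L^2. They tend to 0, because \<open>k u\<close> and the extension of \<open>G\<close>
    have the same boundary values.\<close>
  define d where "d t x = slice k F t x - wave mphi G (t, x)" for t x
  have ds: "sqi lborel (d t)" if "t > 0" for t
    unfolding d_def by (rule sqi_diff[OF slice_sqi[OF F k that] wave_L2(2)[OF G adm_mphi that]])
  have vert: "d b x - d a x = (LINT t:{a..b}|lborel. q (t, x))" if ab: "0 < a" "a \<le> b" for a b x
  proof -
    have c: "continuous_on {a..b} (\<lambda>t. wave mdphi H (t, x))" if "sqi lborel H" for H
    proof -
      have "continuous_on {a..b} (\<lambda>t. (t, x))" by (intro continuous_intros)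
      then show ?thesis
        by (rule continuous_on_compose2[OF wave_continuous[OF that adm_mdphi]]) (use ab in \<open>auto simp: half_space_def\<close>)
    qed
    have i: "set_integrable lborel {a..b} (\<lambda>t. wave mdphi H (t, x))" if "sqi lborel H" for H
      unfolding set_integrable_def by (rule borel_integrable_compact[OF compact_Icc c[OF that]])
    have "set_integrable lborel {a..b} (\<lambda>t. k (t, x) * wave mdphi F (t, x))"
      unfolding set_integrable_def
    proof (rule Bochner_Integration.integrable_bound)
      show "integrable lborel (\<lambda>t. C *\<^sub>R norm (indicat_real {a..b} t *\<^sub>R wave mdphi F (t, x)))"
        using i[OF F] unfolding set_integrable_def by (intro integrable_scaleR_right integrable_norm)
      show "(\<lambda>t. indicat_real {a..b} t *\<^sub>R (k (t, x) * wave mdphi F (t, x))) \<in> borel_measurable lborel" by measurable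
      show "AE t in lborel. norm (indicat_real {a..b} t *\<^sub>R (k (t, x) * wave mdphi F (t, x))) \<le> norm (C *\<^sub>R norm (indicat_real {a..b} t *\<^sub>R wave mdphi F (t, x)))"
      proof (intro AE_I2)
        fix t
        have "cmod (k (t, x)) \<le> \<bar>C\<bar>" using cutoff_bound[OF k, of "(t, x)"] by simp
        then show "norm (indicat_real {a..b} t *\<^sub>R (k (t, x) * wave mdphi F (t, x))) \<le> norm (C *\<^sub>R norm (indicat_real {a..b} t *\<^sub>R wave mdphi F (t, x)))"
          by (simp add: norm_mult indicator_def mult_right_mono abs_mult)
      qed
    qed
    note int = this
    have "d b x - d a x = (slice k F b x - slice k F a x) - (slice (\<lambda>_. 1) G b x - slice (\<lambda>_. 1) G a x)"
      by (simp add: d_def)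
    also have "\<dots> = (LINT t:{a..b}|lborel. k (t, x) * wave mdphi F (t, x)) - (LINT t:{a..b}|lborel. 1 * wave mdphi G (t, x))"
      unfolding cutoff_vertical[OF F k ab] cutoff_vertical[OF G cut1 ab] ..
    also have "\<dots> = (LINT t:{a..b}|lborel. q (t, x))"
      unfolding q_def set_integral_diff(2)[OF int i[OF G]] by simp
    finally show ?thesis .
  qed
  have trG: "has_trace (\<lambda>_. 1) G g" by (rule has_trace_identity[OF g G gG])
  have le: "sqnorm lborel (d s) \<le> 2 * sqnorm lborel (d (en n))" if n: "en n \<le> s" for n
  proof -
    have "sqnorm lborel (\<lambda>x. d s x - d (en n) x) \<le> (s - en n) * sqnorm lborel q"
      unfolding vert[OF en_pos n] by (rule vertical_bound(2)[OF qs n])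
    also have "\<dots> \<le> 0" using q0 n by (intro mult_nonneg_nonpos) auto
    finally have z: "sqnorm lborel (\<lambda>x. d s x - d (en n) x) \<le> 0" .
    have "sqnorm lborel (\<lambda>x. (d s x - d (en n) x) + d (en n) x) \<le> 2 * sqnorm lborel (\<lambda>x. d s x - d (en n) x) + 2 * sqnorm lborel (d (en n))"
      by (rule sqnorm_add_le[OF sqi_diff[OF ds[OF s] ds[OF en_pos]] ds[OF en_pos]])
    then show ?thesis using z by simp
  qed
  define B where "B n = 2 * sqnorm lborel (\<lambda>x. slice k F (en n) x - g x) + 2 * sqnorm lborel (\<lambda>x. slice (\<lambda>_. 1) G (en n) x - g x)" for n
  have "B ----> 2 * 0 + 2 * 0"
    unfolding B_def by (intro tendsto_add tendsto_mult tendsto_const has_traceD(3) T trG)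
  then have Bl: "B ----> 0" by simp
  have Bd: "sqnorm lborel (d (en n)) \<le> B n" for n
  proof -
    have "sqnorm lborel (\<lambda>x. (slice k F (en n) x - g x) + (g x - slice (\<lambda>_. 1) G (en n) x)) \<le>
      2 * sqnorm lborel (\<lambda>x. slice k F (en n) x - g x) + 2 * sqnorm lborel (\<lambda>x. g x - slice (\<lambda>_. 1) G (en n) x)"
      by (rule sqnorm_add_le[OF sqi_diff[OF has_traceD(2)[OF T] g] sqi_diff[OF g has_traceD(2)[OF trG]]])
    moreover have "d (en n) = (\<lambda>x. (slice k F (en n) x - g x) + (g x - slice (\<lambda>_. 1) G (en n) x))" by (simp add: fun_eq_iff d_def)
    ultimately show ?thesis unfolding B_def by (simp only: sqnorm_diff_commute[of lborel g])
  qed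
  have "(\<lambda>n. sqnorm lborel (d (en n))) ----> 0"
    by (rule tendsto_sandwich[where f = "\<lambda>_. 0" and h = B, OF _ _ tendsto_const Bl]) (simp_all add: Bd)
  then have "(\<lambda>n. 2 * sqnorm lborel (d (en n))) ----> 2 * 0" by (rule tendsto_mult[OF tendsto_const])
  moreover have "\<forall>\<^sub>F n in sequentially. sqnorm lborel (d s) \<le> 2 * sqnorm lborel (d (en n))"
    using order_tendstoD(2)[OF en_lim s] by eventually_elim (intro le less_imp_le)
  ultimately have "sqnorm lborel (d s) \<le> 2 * 0" by (intro tendsto_lowerbound[OF _ _ trivial_limit_sequentially])
  then have "sqnorm lborel (d s) = 0" using sqnorm_nonneg[of lborel "d s"] by linarith
  then show ?thesis unfolding sqnorm_eq_0_iff[OF ds[OF s]] d_def by simp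
qed

end

text \<open>Testing with \<open>|k|\<^sup>2 u\<close>: the energy of \<open>k u\<close> is the pairing of \<open>u\<close> with \<open>|k|\<^sup>2 u\<close>.\<close>

lemma energy_pairing:
  fixes F H :: "'a::euclidean_space => complex"
  assumes fe: "finite_energy F" and k: "cutoff (\<lambda>z. k z * cnj (k z)) (wave mphi F) C" and T: "has_trace (\<lambda>z. k z * cnj (k z)) F h"
    and hH: "AE y in lebesgue. fourier h y = H y" and H: "sqi lborel H"
  shows "(LINT y|lborel. of_real (psi (nsq y)) * (H y * cnj (F y))) = of_real (energy k F)"
proof -
  have "ip lborel (\<lambda>z. k z * cnj (k z) * wave (comp i) F z) (wave (comp i) F) = of_real (sqnorm lborel (\<lambda>z. k z * wave (comp i) F z))" for i
    unfolding ip_self[symmetric] ip_def by (intro Bochner_Integration.integral_cong refl) simp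
  with green_finite[OF fe k T hH H fe] show ?thesis by (simp add: energy_def)
qed

end

subsection \<open>Rayleigh's inequality\<close>

text \<open>\<open>fourier\<close> chooses a representative for each function separately; the
  isometry, applied to the difference, shows that the choices agree up to a null set.\<close>

lemma fourier_cong_AE:
  fixes f g :: "'a::euclidean_space => complex"
  assumes f: "sqi lebesgue f" and g: "sqi lebesgue g" and eq: "AE x in lebesgue. f x = g x"
  shows "AE y in lebesgue. fourier f y = fourier g y"
proof -
  let ?d = "\<lambda>x. 1 * f x - 1 * g x"
  have d: "sqi lebesgue ?d" by (intro sqi_diff sqi_cmult f g)
  have "sqnorm lebesgue ?d = 0"
    unfolding sqnorm_eq_0_iff[OF d] using eq by eventually_elim simp
  then have "sqnorm lebesgue (fourier ?d) = 0" unfolding sqnorm_fourier[OF d] .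
  then have "AE y in lebesgue. fourier ?d y = 0" unfolding sqnorm_eq_0_iff[OF fourier_spec(1)[OF d]] .
  with fourier_linear[OF f g, of 1 1] show ?thesis by eventually_elim simp
qed

text \<open>Gaussian elimination: an unknown with nonzero coefficient in the first equation is
  eliminated from the others, and its value is restored afterwards.\<close>

lemma underdetermined_system:
  fixes M :: "'i => 'j => complex"
  assumes "finite J" "finite I" "card J < card I"
  shows "\<exists>c. (\<exists>i\<in>I. c i \<noteq> 0) \<and> (\<forall>j\<in>J. (\<Sum>i\<in>I. c i * M i j) = 0)"
  using assms
proof (induction J arbitrary: I M rule: finite_induct)
  case empty
  then have "I \<noteq> {}" by auto
  then show ?case by (intro exI[of _ "\<lambda>_. 1"]) auto
next
  case (insert j J)
  have cI: "Suc (card J) < card I" using insert by simp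
  show ?case
  proof (cases "\<forall>i\<in>I. M i j = 0")
    case True
    obtain c where c: "\<exists>i\<in>I. c i \<noteq> 0" "\<forall>j\<in>J. (\<Sum>i\<in>I. c i * M i j) = 0"
      using insert.IH[OF insert.prems(1), of M] cI by auto
    have "(\<Sum>i\<in>I. c i * M i j) = 0" using True by simp
    with c show ?thesis by (intro exI[of _ c]) auto
  next
    case False
    then obtain p where p: "p \<in> I" "M p j \<noteq> 0" by blast
    define I' where "I' = I - {p}"
    have fI: "finite I'" and cI': "card J < card I'" using insert.prems(1) cI p(1) by (auto simp: I'_def)
    obtain c where c: "\<exists>i\<in>I'. c i \<noteq> 0" "\<forall>j'\<in>J. (\<Sum>i\<in>I'. c i * (M i j' - M i j / M p j * M p j')) = 0"
      using insert.IH[OF fI cI', of "\<lambda>i j'. M i j' - M i j / M p j * M p j'"] by blast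
    define d where "d i = (if i = p then - (\<Sum>i\<in>I'. c i * M i j) / M p j else c i)" for i
    have sum: "(\<Sum>i\<in>I. d i * M i j') = - (\<Sum>i\<in>I'. c i * M i j) / M p j * M p j' + (\<Sum>i\<in>I'. c i * M i j')" for j'
    proof -
      have "(\<Sum>i\<in>I'. d i * M i j') = (\<Sum>i\<in>I'. c i * M i j')"
        by (intro sum.cong refl) (simp add: d_def I'_def)
      then show ?thesis unfolding sum.remove[OF insert.prems(1) p(1)] I'_def[symmetric] by (simp add: d_def)
    qed
    have "(\<Sum>i\<in>I. d i * M i j') = 0" if "j' \<in> J" for j'
    proof -
      have "(\<Sum>i\<in>I'. c i * (M i j' - M i j / M p j * M p j')) = (\<Sum>i\<in>I'. c i * M i j') - (\<Sum>i\<in>I'. c i * M i j) / M p j * M p j'"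
        by (simp add: right_diff_distrib sum_subtractf sum_divide_distrib sum_distrib_right mult.assoc)
      with c(2) that show ?thesis unfolding sum by simp
    qed
    moreover have "(\<Sum>i\<in>I. d i * M i j) = 0" unfolding sum using p(2) by simp
    moreover have "\<exists>i\<in>I. d i \<noteq> 0" using c(1) by (auto simp: d_def I'_def)
    ultimately show ?thesis by (intro exI[of _ d]) auto
  qed
qed

lemma confining_bounded_below:
  fixes V :: "'a::euclidean_space => real"
  assumes "confining V" "locally_bounded V"
  shows "\<exists>C. \<forall>x. - C \<le> V x"
proof -
  have "\<forall>\<^sub>F x in at_infinity. 0 \<le> V x"
    using assms(1) unfolding confining_def filterlim_at_top by blast
  then obtain b where b: "\<And>x. b \<le> norm x ==> 0 \<le> V x" unfolding eventually_at_infinity by blast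
  have "bounded (V ` cball 0 b)" using assms(2) unfolding locally_bounded_def by simp
  then obtain B where B: "\<forall>y\<in>V ` cball 0 b. norm y \<le> B" unfolding bounded_iff by blast
  have "- \<bar>B\<bar> \<le> V x" for x
  proof (cases "b \<le> norm x")
    case True then show ?thesis using b[of x] by linarith
  next
    case False
    then have "V x \<in> V ` cball 0 b" by simp
    with B have "\<bar>V x\<bar> \<le> B" by auto
    then show ?thesis by linarith
  qed
  then show ?thesis by blast
qed

section \<open>The quadratic form and its eigenfunctions\<close>

context weight
begin

context
  fixes V :: "'a::euclidean_space => real"
  assumes Vm: "V \<in> borel_measurable lebesgue"
begin

text \<open>With the square roots \<open>rpsi\<close> and \<open>rpot\<close> both parts of the form
  become inner products of square-integrable functions. \<open>V\<close> may be negative on a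
  bounded set, so \<open>rpot\<close> uses \<open>|V|\<close> and the sign is put back as a bounded
  factor.\<close>

definition rpsi :: "'a => complex" where "rpsi y = of_real (sqrt (psi (nsq y)))"

definition rpot :: "'a => complex" where "rpot x = of_real (sqrt \<bar>V x\<bar>)"

lemma rpsi_measurable: "rpsi \<in> borel_measurable lebesgue"
  unfolding rpsi_def[abs_def] by (rule borel_imp_lebesgue) measurable

lemma rpot_measurable: "rpot \<in> borel_measurable lebesgue"
  unfolding rpot_def[abs_def] using Vm by measurable

lemma rpsi_sq: "csq (rpsi y * c) = psi (nsq y) * csq c"
  using psi_norm_nonneg[of y] by (simp add: rpsi_def norm_mult power_mult_distrib)

lemma rpot_sq: "csq (rpot x * c) = \<bar>V x * csq c\<bar>"
  by (simp add: rpot_def norm_mult power_mult_distrib abs_mult)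

lemma form_domain_iff:
  "f \<in> form_domain psi V \<longleftrightarrow> sqi lebesgue f \<and> sqi lebesgue (\<lambda>y. rpsi y * fourier f y) \<and> sqi lebesgue (\<lambda>x. rpot x * f x)"
proof (cases "sqi lebesgue f")
  case True
  note m = sqi_measurable[OF True] and Fm = sqi_measurable[OF fourier_spec(1)[OF True]]
  have c2: "(\<lambda>x. csq (f x)) \<in> borel_measurable lebesgue" using m by measurable
  have Vf: "(\<lambda>x. V x * csq (f x)) \<in> borel_measurable lebesgue" by (rule borel_measurable_times[OF Vm c2])
  note m1 = borel_measurable_times[OF rpsi_measurable Fm] and m2 = borel_measurable_times[OF rpot_measurable m]
  have 1: "sqi lebesgue (\<lambda>y. rpsi y * fourier f y) \<longleftrightarrow> integrable lebesgue (\<lambda>y. psi (nsq y) * csq (fourier f y))"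
    unfolding sqi_def rpsi_sq by (simp only: m1 simp_thms)
  have 2: "sqi lebesgue (\<lambda>x. rpot x * f x) \<longleftrightarrow> integrable lebesgue (\<lambda>x. V x * csq (f x))"
    unfolding sqi_def rpot_sq integrable_abs_iff[OF Vf] by (simp only: m2 simp_thms)
  show ?thesis unfolding 1 2 form_domain_def mem_Collect_eq L2_iff_sqi ..
next
  case False
  then show ?thesis unfolding form_domain_def mem_Collect_eq L2_iff_sqi by (simp only: simp_thms)
qed

lemma form_domainD:
  assumes "f \<in> form_domain psi V"
  shows "sqi lebesgue f" "sqi lebesgue (\<lambda>y. rpsi y * fourier f y)" "sqi lebesgue (\<lambda>x. rpot x * f x)"
  by (rule assms[unfolded form_domain_iff, THEN conjunct1] assms[unfolded form_domain_iff, THEN conjunct2, THEN conjunct1]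
      assms[unfolded form_domain_iff, THEN conjunct2, THEN conjunct2])+

lemma energy_form_eq:
  "energy_form psi V f g = ip lebesgue (\<lambda>y. rpsi y * fourier f y) (\<lambda>y. rpsi y * fourier g y) +
    ip lebesgue (\<lambda>x. of_real (sgn (V x)) * (rpot x * f x)) (\<lambda>x. rpot x * g x)"
proof -
  have 1: "of_real (psi (nsq y)) * (a * cnj b) = rpsi y * a * cnj (rpsi y * b)" for y a b
  proof -
    have "rpsi y * cnj (rpsi y) = of_real (psi (nsq y))"
      using psi_norm_nonneg[of y] by (simp add: rpsi_def flip: of_real_mult)
    then show ?thesis by (simp add: mult_ac)
  qed
  have 2: "of_real (V x) * (a * cnj b) = of_real (sgn (V x)) * (rpot x * a) * cnj (rpot x * b)" for x a b
  proof -
    have "of_real (sgn (V x)) * (rpot x * cnj (rpot x)) = complex_of_real (V x)"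
      by (simp add: rpot_def flip: of_real_mult) (simp add: sgn_mult_abs)
    then show ?thesis by (simp add: mult_ac)
  qed
  show ?thesis unfolding energy_form_def ip_def 1 2 ..
qed

lemma sgn_sqi:
  assumes "sqi lebesgue h" shows "sqi lebesgue (\<lambda>x. complex_of_real (sgn (V x)) * h x)"
proof (rule sqi_mult_bounded[OF assms, where C = 1])
  show "(\<lambda>x. complex_of_real (sgn (V x))) \<in> borel_measurable lebesgue" using Vm by measurable
  show "cmod (complex_of_real (sgn (V x))) \<le> 1" for x by (simp add: sgn_if)
qed

lemma energy_form_cnj: "cnj (energy_form psi V f g) = energy_form psi V g f"
  unfolding energy_form_def complex_cnj_add Bochner_Integration.integral_cnj[symmetric] complex_cnj_mult complex_cnj_cnj complex_cnj_complex_of_real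
  by (simp only: mult.commute)

lemma form_domain_diff:
  assumes f: "f \<in> form_domain psi V" and g: "g \<in> form_domain psi V"
  shows "(\<lambda>x. a * f x - b * g x) \<in> form_domain psi V"
    and "h \<in> form_domain psi V ==> energy_form psi V (\<lambda>x. a * f x - b * g x) h = a * energy_form psi V f h - b * energy_form psi V g h"
proof -
  note f = form_domainD[OF f] and g = form_domainD[OF g]
  let ?d = "\<lambda>x. a * f x - b * g x"
  have d: "sqi lebesgue ?d" by (intro sqi_diff sqi_cmult f g)
  have s: "sqi lebesgue (\<lambda>y. a * (rpsi y * fourier f y) - b * (rpsi y * fourier g y))" by (intro sqi_diff sqi_cmult f g)
  have m: "(\<lambda>y. rpsi y * fourier ?d y) \<in> borel_measurable lebesgue"
    by (rule borel_measurable_times[OF rpsi_measurable sqi_measurable[OF fourier_spec(1)[OF d]]])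
  have e: "AE y in lebesgue. a * (rpsi y * fourier f y) - b * (rpsi y * fourier g y) = rpsi y * fourier ?d y"
    using fourier_linear[OF f(1) g(1), of a b]
  proof eventually_elim
    case (elim y)
    show ?case unfolding elim by (simp add: algebra_simps)
  qed
  have p: "(\<lambda>x. rpot x * ?d x) = (\<lambda>x. a * (rpot x * f x) - b * (rpot x * g x))" by (simp add: fun_eq_iff algebra_simps)
  have P: "sqi lebesgue (\<lambda>x. rpot x * ?d x)" unfolding p by (intro sqi_diff sqi_cmult f g)
  have q: "sqi lebesgue (\<lambda>y. rpsi y * fourier ?d y)" by (rule sqi_AE_cong[OF s m e])
  show "?d \<in> form_domain psi V" unfolding form_domain_iff by (intro conjI d q P)
  assume "h \<in> form_domain psi V"
  note h = form_domainD[OF this]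
  have r: "AE y in lebesgue. rpsi y * fourier ?d y = a * (rpsi y * fourier f y) - b * (rpsi y * fourier g y)"
    using e by eventually_elim simp
  have "ip lebesgue (\<lambda>y. rpsi y * fourier ?d y) (\<lambda>y. rpsi y * fourier h y) =
    ip lebesgue (\<lambda>y. a * (rpsi y * fourier f y) - b * (rpsi y * fourier g y)) (\<lambda>y. rpsi y * fourier h y)"
    by (rule ip_cong_AE[OF r _ m sqi_measurable[OF h(2)] sqi_measurable[OF s] sqi_measurable[OF h(2)]]) simp
  also have "\<dots> = a * ip lebesgue (\<lambda>y. rpsi y * fourier f y) (\<lambda>y. rpsi y * fourier h y) - b * ip lebesgue (\<lambda>y. rpsi y * fourier g y) (\<lambda>y. rpsi y * fourier h y)"
    unfolding ip_diff_left[OF sqi_cmult[OF f(2)] sqi_cmult[OF g(2)] h(2)] ip_cmult_left ..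
  finally have 1: "ip lebesgue (\<lambda>y. rpsi y * fourier ?d y) (\<lambda>y. rpsi y * fourier h y) =
    a * ip lebesgue (\<lambda>y. rpsi y * fourier f y) (\<lambda>y. rpsi y * fourier h y) - b * ip lebesgue (\<lambda>y. rpsi y * fourier g y) (\<lambda>y. rpsi y * fourier h y)" .
  have "(\<lambda>x. complex_of_real (sgn (V x)) * (rpot x * ?d x)) = (\<lambda>x. a * (of_real (sgn (V x)) * (rpot x * f x)) - b * (of_real (sgn (V x)) * (rpot x * g x)))"
    by (simp add: fun_eq_iff algebra_simps)
  then have 2: "ip lebesgue (\<lambda>x. of_real (sgn (V x)) * (rpot x * ?d x)) (\<lambda>x. rpot x * h x) =
    a * ip lebesgue (\<lambda>x. of_real (sgn (V x)) * (rpot x * f x)) (\<lambda>x. rpot x * h x) - b * ip lebesgue (\<lambda>x. of_real (sgn (V x)) * (rpot x * g x)) (\<lambda>x. rpot x * h x)"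
    using ip_diff_left[OF sqi_cmult[OF sgn_sqi[OF f(3)], of a] sqi_cmult[OF sgn_sqi[OF g(3)], of b] h(3)] by (simp only: ip_cmult_left)
  show "energy_form psi V ?d h = a * energy_form psi V f h - b * energy_form psi V g h"
    unfolding energy_form_eq 1 2 by (simp add: algebra_simps)
qed

lemma energy_form_self:
  "energy_form psi V g g = of_real ((LINT y|lebesgue. psi (nsq y) * csq (fourier g y)) + (LINT x|lebesgue. V x * csq (g x)))"
  unfolding energy_form_def of_real_add integral_complex_of_real[symmetric] of_real_mult complex_norm_square ..

text \<open>Keeps the energies of the remainders in Rayleigh's argument from drifting to minus
  infinity while their norms vanish.\<close>

lemma energy_form_lower_bound:
  assumes g: "g \<in> form_domain psi V" and V: "\<And>x. - C \<le> V x"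
  shows "- C * sqnorm lebesgue g \<le> Re (energy_form psi V g g)"
proof -
  note gd = form_domainD[OF g]
  have "(LINT x|lebesgue. - C * csq (g x)) \<le> (LINT x|lebesgue. V x * csq (g x))"
  proof (rule integral_mono)
    show "integrable lebesgue (\<lambda>x. - C * csq (g x))"
      by (intro Bochner_Integration.integrable_mult_right sqi_integrable gd)
    show "integrable lebesgue (\<lambda>x. V x * csq (g x))"
      using g unfolding form_domain_def mem_Collect_eq by (elim conjE)
    show "- C * csq (g x) \<le> V x * csq (g x)" for x by (intro mult_right_mono V) simp
  qed
  moreover have "(LINT x|lebesgue. - C * csq (g x)) = - C * sqnorm lebesgue g" unfolding sqnorm_def by simp
  moreover have "0 \<le> (LINT y|lebesgue. psi (nsq y) * csq (fourier g y))"
    by (rule integral_nonneg_AE) (simp add: psi_norm_nonneg)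
  ultimately show ?thesis unfolding energy_form_self Re_complex_of_real by linarith
qed

context
  fixes f :: "nat => 'a => complex" and \<mu> :: "nat => real"
  assumes eigen: "ordered_eigensystem psi V \<mu> f"
begin

lemmas eigen_parts = eigen[unfolded ordered_eigensystem_def complete_orthonormal_def L2_inner_def, folded ip_def]

lemma eigen_operator:
  assumes "j \<ge> 1"
  shows "f j \<in> form_domain psi V \<and> (\<lambda>x. of_real (\<mu> j) * f j x) \<in> L2 \<and>
    (\<forall>g\<in>form_domain psi V. energy_form psi V (f j) g = L2_inner (\<lambda>x. of_real (\<mu> j) * f j x) g)"
  using eigen_parts[THEN conjunct2, THEN conjunct2, THEN conjunct1, rule_format, OF assms]
  unfolding schroedinger_operator_def mem_Collect_eq prod.case .

lemma eigen_domain: "j \<ge> 1 ==> f j \<in> form_domain psi V"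
  by (rule eigen_operator[THEN conjunct1])

lemma eigen_form:
  assumes "j \<ge> 1" "h \<in> form_domain psi V"
  shows "energy_form psi V (f j) h = of_real (\<mu> j) * ip lebesgue (f j) h"
  using eigen_operator[OF assms(1), THEN conjunct2, THEN conjunct2, rule_format, OF assms(2)]
  unfolding L2_inner_def ip_def[symmetric] ip_cmult_left .

lemma eigen_sqi: "j \<ge> 1 ==> sqi lebesgue (f j)"
  by (rule form_domainD(1)[OF eigen_domain])

lemma eigen_orthonormal: "i \<ge> 1 ==> j \<ge> 1 ==> ip lebesgue (f i) (f j) = (if i = j then 1 else 0)"
  by (rule eigen_parts[THEN conjunct1, THEN conjunct2, THEN conjunct1, rule_format])

lemma eigen_complete:
  assumes g: "sqi lebesgue g" and o: "\<And>j. j \<ge> 1 ==> ip lebesgue g (f j) = 0"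
  shows "AE x in lebesgue. g x = 0"
  by (rule eigen_parts[THEN conjunct1, THEN conjunct2, THEN conjunct2, THEN bspec, THEN mp])
     (use g o in \<open>simp_all add: L2_iff_sqi\<close>)

text \<open>Removing the components along \<open>f 1, f 2, \<dots>\<close> one at a time drives the norm to zero and
  never increases the energy relative to \<open>\<mu> n\<close>.\<close>

lemma rayleigh:
  assumes g: "g \<in> form_domain psi V" and V: "\<And>x. - C \<le> V x" and n: "n \<ge> 1"
    and orth: "\<And>j. 1 \<le> j ==> j < n ==> ip lebesgue g (f j) = 0"
  shows "\<mu> n * sqnorm lebesgue g \<le> Re (energy_form psi V g g)"
proof -
  define a where "a j = ip lebesgue g (f j)" for j
  \<comment> \<open>The remainder after \<open>m\<close> components. By orthonormality the
    coefficients may be computed from \<open>g\<close> itself. The factor 1 fits the shape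
    \<open>a * f - b * g\<close> of \<open>form_domain_diff\<close>.\<close>
  define r where "r = rec_nat g (\<lambda>m r x. 1 * r x - a (Suc m) * f (Suc m) x)"
  have r0: "r 0 = g" and rS: "r (Suc m) = (\<lambda>x. 1 * r m x - a (Suc m) * f (Suc m) x)" for m by (simp_all add: r_def)
  have S1: "1 \<le> Suc m" for m by simp
  have rd: "r m \<in> form_domain psi V" for m
  proof (induction m)
    case 0 show ?case unfolding r0 by (rule g)
  next
    case (Suc m) show ?case unfolding rS by (rule form_domain_diff(1)[OF Suc eigen_domain[OF S1]])
  qed
  note rs = form_domainD(1)[OF rd] and fs = eigen_sqi[OF S1]
  have ipS: "ip lebesgue (r (Suc m)) h = ip lebesgue (r m) h - a (Suc m) * ip lebesgue (f (Suc m)) h" if "sqi lebesgue h" for m h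
    unfolding rS ip_diff_left[OF sqi_cmult[OF rs] sqi_cmult[OF fs] that] ip_cmult_left by simp
  have rf: "ip lebesgue (r m) (f j) = (if j \<le> m then 0 else a j)" if j: "j \<ge> 1" for m j
  proof (induction m)
    case 0 show ?case using j by (simp add: r0 a_def)
  next
    case (Suc m)
    show ?case unfolding ipS[OF eigen_sqi[OF j]] Suc eigen_orthonormal[OF S1 j] by (auto simp: le_Suc_eq)
  qed
  have fr: "ip lebesgue (f j) (r m) = 0" if "1 \<le> j" "j \<le> m" for j m
    using rf[OF that(1), of m] that cnj_ip[of lebesgue "r m" "f j"] by simp
  \<comment> \<open>\<open>r m\<close> is orthogonal to all components removed so far, so an earlier
    remainder may be replaced by \<open>g\<close>. Together with the case \<open>k = m\<close> this
    is Pythagoras' theorem for \<open>norm_diff\<close>.\<close>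
  have nest: "ip lebesgue (r k) (r m) = ip lebesgue g (r m)" if "k \<le> m" for k m
    using that
  proof (induction k)
    case 0 show ?case by (simp add: r0)
  next
    case (Suc k)
    then show ?case unfolding ipS[OF rs] fr[OF S1 Suc.prems] by simp
  qed
  have norm_diff: "sqnorm lebesgue (\<lambda>x. r k x - r m x) = sqnorm lebesgue (r k) - sqnorm lebesgue (r m)" if "k \<le> m" for k m
  proof -
    have "ip lebesgue (r k) (r m) = of_real (sqnorm lebesgue (r m))"
      using nest[OF that] nest[OF order_refl, of m] ip_self[of lebesgue "r m"] by simp
    then show ?thesis unfolding sqnorm_diff_ip[OF rs rs] by simp
  qed
  have dec: "sqnorm lebesgue (r m) \<le> sqnorm lebesgue (r k)" if "k \<le> m" for k m
    using norm_diff[OF that] sqnorm_nonneg[of lebesgue "\<lambda>x. r k x - r m x"] by linarith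
  have "decseq (\<lambda>m. sqnorm lebesgue (r m))" by (rule decseq_SucI, rule dec) simp
  then obtain L where L: "(\<lambda>m. sqnorm lebesgue (r m)) ----> L"
    by (rule decseq_convergent[where B = 0]) simp
  have LD: "L \<le> sqnorm lebesgue (r m)" for m by (rule decseq_ge[OF \<open>decseq _\<close> L])
  have cau: "\<exists>N. \<forall>m\<ge>N. \<forall>k\<ge>N. sqnorm lebesgue (\<lambda>x. r m x - r k x) \<le> e" if e: "e > 0" for e
  proof -
    have "\<forall>\<^sub>F m in sequentially. sqnorm lebesgue (r m) < L + e" using order_tendstoD(2)[OF L] e by simp
    then obtain N where N: "\<And>m. m \<ge> N ==> sqnorm lebesgue (r m) < L + e" unfolding eventually_sequentially by blast
    have "sqnorm lebesgue (\<lambda>x. r m x - r k x) \<le> e" if "N \<le> m" "m \<le> k" for m k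
      using norm_diff[OF that(2)] N[OF that(1)] LD[of k] by linarith
    moreover have "sqnorm lebesgue (\<lambda>x. r m x - r k x) \<le> e" if "N \<le> k" "k \<le> m" for m k
      using norm_diff[OF that(2)] N[OF that(1)] LD[of m] sqnorm_diff_commute[of lebesgue "r m" "r k"] by linarith
    ultimately have "sqnorm lebesgue (\<lambda>x. r m x - r k x) \<le> e" if "N \<le> m" "N \<le> k" for m k using that by (meson nat_le_linear)
    then show ?thesis by blast
  qed
  obtain R where R: "sqi lebesgue R" "(\<lambda>m. sqnorm lebesgue (\<lambda>x. r m x - R x)) ----> 0"
    by (rule riesz_fischer[of lebesgue r, OF rs cau]) (assumption, rule that, assumption, assumption)
  have "AE x in lebesgue. R x = 0"
  proof (rule eigen_complete[OF R(1)])
    fix j :: nat assume j: "j \<ge> 1"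
    have z: "(\<lambda>m. sqnorm lebesgue (\<lambda>x. f j x - f j x)) ----> 0" by (simp add: sqnorm_def)
    have "(\<lambda>m. ip lebesgue (r m) (f j)) ----> ip lebesgue R (f j)"
      by (rule ip_tendsto[OF rs R(1) eigen_sqi[OF j] eigen_sqi[OF j] R(2) z])
    moreover have "\<forall>\<^sub>F m in sequentially. ip lebesgue (r m) (f j) = 0"
      by (rule eventually_mono[OF eventually_ge_at_top[of j]]) (simp add: rf[OF j])
    then have "(\<lambda>m. ip lebesgue (r m) (f j)) ----> 0" by (rule tendsto_eventually)
    ultimately show "ip lebesgue R (f j) = 0" by (rule LIMSEQ_unique)
  qed
  then have "sqnorm lebesgue R = 0" unfolding sqnorm_eq_0_iff[OF R(1)] .
  with sqnorm_tendsto[OF rs R] have rl: "(\<lambda>m. sqnorm lebesgue (r m)) ----> 0" by simp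
  \<comment> \<open>Removing the component \<open>j\<close> lowers \<open>Q\<close> by
    \<open>(\<mu> j - \<mu> n) |a j|^2\<close>.\<close>
  define Q where "Q m = Re (energy_form psi V (r m) (r m)) - \<mu> n * sqnorm lebesgue (r m)" for m
  have "Q (Suc m) \<le> Q m" for m
  proof -
    let ?j = "Suc m"
    have e: "energy_form psi V (r ?j) h = energy_form psi V (r m) h - a ?j * (of_real (\<mu> ?j) * ip lebesgue (f ?j) h)" if h: "h \<in> form_domain psi V" for h
      unfolding rS form_domain_diff(2)[OF rd eigen_domain[OF S1] h] eigen_form[OF S1 h] by simp
    have fj: "ip lebesgue (f ?j) (r m) = cnj (a ?j)" using rf[OF S1, of m m] cnj_ip[of lebesgue "r m" "f ?j"] by simp
    have "energy_form psi V (r ?j) (r ?j) = energy_form psi V (r m) (r ?j)" unfolding e[OF rd] fr[OF S1 order_refl] by simp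
    also have "\<dots> = cnj (energy_form psi V (r ?j) (r m))" by (rule energy_form_cnj[symmetric])
    also have "\<dots> = cnj (energy_form psi V (r m) (r m) - a ?j * (of_real (\<mu> ?j) * cnj (a ?j)))" unfolding e[OF rd] fj ..
    finally have "Re (energy_form psi V (r ?j) (r ?j)) = Re (energy_form psi V (r m) (r m)) - Re (a ?j * (of_real (\<mu> ?j) * cnj (a ?j)))"
      by simp
    also have "a ?j * (of_real (\<mu> ?j) * cnj (a ?j)) = of_real (\<mu> ?j * csq (a ?j))"
      unfolding of_real_mult complex_norm_square by (simp add: mult_ac)
    finally have E: "Re (energy_form psi V (r ?j) (r ?j)) = Re (energy_form psi V (r m) (r m)) - \<mu> ?j * csq (a ?j)" by simp
    have "sqnorm lebesgue (\<lambda>x. r m x - r ?j x) = csq (a ?j)"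
    proof -
      have "(\<lambda>x. r m x - r ?j x) = (\<lambda>x. a ?j * f ?j x)" by (simp add: fun_eq_iff rS)
      moreover have "sqnorm lebesgue (f ?j) = 1" using ip_self[of lebesgue "f ?j"] eigen_orthonormal[OF S1 S1, of m m] by simp
      ultimately show ?thesis by (simp add: sqnorm_cmult)
    qed
    with norm_diff[of m ?j] have N: "sqnorm lebesgue (r ?j) = sqnorm lebesgue (r m) - csq (a ?j)" by simp
    \<comment> \<open>Below \<open>n\<close> the component is absent by orthogonality; from
      \<open>n\<close> on the eigenvalue is at least \<open>\<mu> n\<close>.\<close>
    have "0 \<le> (\<mu> ?j - \<mu> n) * csq (a ?j)"
    proof (cases "?j < n")
      case True
      then have "a ?j = 0" unfolding a_def by (intro orth) simp_all
      then show ?thesis by simp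
    next
      case False
      have "mono_on {1..} \<mu>" by (rule eigen_parts[THEN conjunct2, THEN conjunct2, THEN conjunct2])
      then have "\<mu> n \<le> \<mu> ?j" using n False by (auto elim!: mono_onD)
      then show ?thesis by simp
    qed
    then show ?thesis unfolding Q_def E N by (simp add: algebra_simps)
  qed
  then have "decseq Q" by (rule decseq_SucI)
  then have QD: "Q m \<le> Q 0" for m by (simp add: decseq_def)
  \<comment> \<open>\<open>Q 0\<close> is at least \<open>Q m\<close>, and semiboundedness puts
    \<open>Q m\<close> above a multiple of the vanishing norms.\<close>
  have "(\<lambda>m. (- C - \<mu> n) * sqnorm lebesgue (r m)) ----> (- C - \<mu> n) * 0"
    by (intro tendsto_mult tendsto_const rl)
  then have "(- C - \<mu> n) * 0 \<le> Q 0"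
  proof (rule LIMSEQ_le_const2, intro exI allI impI)
    fix m :: nat
    show "(- C - \<mu> n) * sqnorm lebesgue (r m) \<le> Q 0"
    using QD[of m] energy_form_lower_bound[OF rd V, of m] unfolding Q_def by (simp add: algebra_simps)
  qed
  then show ?thesis by (simp add: Q_def r0)
qed

end

end

end

subsection \<open>Nodal domains\<close>

lemma open_AE_empty:
  assumes "open (S :: 'a::euclidean_space set)" "AE x in lborel. x \<notin> S"
  shows "S = {}"
proof (rule ccontr)
  assume "S \<noteq> {}"
  with assms(1) have "\<not> negligible S" by (rule open_not_negligible)
  moreover have "S \<in> null_sets lborel" using assms by (subst AE_iff_null_sets) auto
  then have "S \<in> null_sets lebesgue" by (rule null_sets_completionI)
  ultimately show False by (simp add: negligible_iff_null_sets)
qed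

lemma continuous_AE_zero:
  fixes f :: "'a::euclidean_space => 'b::real_normed_vector"
  assumes S: "open S" "continuous_on S f" and ae: "AE x in lborel. x \<in> S --> f x = 0" and x: "x \<in> S"
  shows "f x = 0"
proof -
  have "open (S \<inter> f -` (- {0}))" by (rule continuous_open_preimage[OF S(2,1) open_Compl[OF closed_singleton]])
  moreover have "AE x in lborel. x \<notin> S \<inter> f -` (- {0})" using ae by eventually_elim auto
  ultimately have "S \<inter> f -` (- {0}) = {}" by (rule open_AE_empty)
  then show ?thesis using x by auto
qed

text \<open>A ball inside \<open>U\<close> is connected and hence lies in a single component, so one
  radius serves all components at once. This makes combinations of their indicators locally
  constant.\<close>

lemma component_ball:
  fixes U :: "'a::real_normed_vector set"
  assumes "open U" "z \<in> U"
  obtains e where "e > 0" "ball z e \<subseteq> U" "\<And>D z'. D \<in> components U ==> z' \<in> ball z e ==> z' \<in> D \<longleftrightarrow> z \<in> D"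
proof -
  obtain e where e: "e > 0" "ball z e \<subseteq> U" using assms by (meson openE)
  have "z' \<in> D \<longleftrightarrow> z \<in> D" if "D \<in> components U" "z' \<in> ball z e" for D z'
  proof -
    have "ball z e \<subseteq> D" if "D \<inter> ball z e \<noteq> {}"
      by (rule components_maximal[OF \<open>D \<in> components U\<close> connected_ball e(2) that])
    moreover have "z \<in> ball z e" using e(1) by simp
    ultimately show ?thesis using that(2) by blast
  qed
  with e show ?thesis by (rule that)
qed

lemma component_open:
  fixes U :: "'a::real_normed_vector set"
  assumes U: "open U" and D: "D \<in> components U"
  shows "open D"
  unfolding open_contains_ball
proof
  fix z assume z: "z \<in> D"
  with in_components_subset[OF D] have "z \<in> U" by blast
  from component_ball[OF U this] obtain e where "e > 0" "\<And>D z'. D \<in> components U ==> z' \<in> ball z e ==> z' \<in> D \<longleftrightarrow> z \<in> D" by metis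
  then show "\<exists>e>0. ball z e \<subseteq> D" using D z by blast
qed

lemma open_slice: "open D ==> open {x. (s, x) \<in> D}"
  using continuous_open_preimage[of UNIV "\<lambda>x. (s, x)" D] by (simp add: vimage_def continuous_on_Pair)

lemma fourier_borel_version:
  assumes g: "sqi lebesgue g"
  obtains G where "sqi lborel G" "AE y in lebesgue. fourier g y = G y"
proof -
  note Fg = fourier_spec(1)[OF g]
  obtain G where G: "G \<in> borel_fun" "AE y in lebesgue. fourier g y = G y"
    by (rule lebesgue_borel_version[OF sqi_measurable[OF Fg]])
  have "sqi lebesgue G" by (rule sqi_AE_cong[OF Fg borel_imp_lebesgue[OF G(1)] G(2)])
  then have "sqi lborel G" by (rule sqi_lebesgue_iff[OF G(1), THEN iffD1])
  then show ?thesis using G(2) by (rule that)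
qed

lemma sqi_lebesgue: "sqi lborel (g :: 'a::euclidean_space => complex) ==> sqi lebesgue g"
  by (rule sqi_lebesgue_iff[THEN iffD2]) (rule F_meas)

context weight
begin

text \<open>The slice is a Fourier integral of exponentially decaying data, so vanishing on an open
  set spreads to the whole slice. Plancherel's theorem and positivity of the profile then force
  \<open>G\<close> to vanish.\<close>

lemma wave_vanishes:
  fixes G :: "'a::euclidean_space => complex"
  assumes G: "sqi lborel G" and s: "s > 0" and S: "open S" "x0 \<in> S" and z: "AE x in lborel. x \<in> S --> wave mphi G (s, x) = 0"
  shows "AE y in lborel. G y = 0"
proof -
  have c: "continuous_on T (\<lambda>x. wave mphi G (s, x))" for T
  proof -
    have "continuous_on T (\<lambda>x. (s, x))" by (intro continuous_intros)
    then show ?thesis by (rule continuous_on_compose2[OF wave_continuous[OF G adm_mphi]]) (use s in \<open>auto simp: half_space_def\<close>)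
  qed
  obtain r where r: "r > 0" "ball x0 r \<subseteq> S" using S by (meson openE)
  obtain e where e: "e > 0" "integrable lborel (\<lambda>y. exp (2 * e * norm y) * cmod (mphi s y * G y))"
    using adm_integrable(1)[OF G adm_mphi s] by (elim exE conjE)
  have f0: "fconst TYPE('a) \<noteq> 0" using fconst_pos[where 'a = 'a] by simp
  have "osc (\<lambda>y. mphi s y * G y) x = 0" if x: "x \<in> ball x0 r" for x
  proof -
    have "wave mphi G (s, x) = 0" by (rule continuous_AE_zero[OF S(1) c z]) (use x r in blast)
    then show ?thesis unfolding wave_osc[OF G adm_mphi s] using f0 by simp
  qed
  then have "osc (\<lambda>y. mphi s y * G y) x = 0" for x
    by (rule osc_unique_continuation[OF adm_integrable(4)[OF G adm_mphi s] e r(1)])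
  then have "wave mphi G (s, x) = 0" for x unfolding wave_osc[OF G adm_mphi s] by simp
  then have "sqnorm lborel (\<lambda>x. wave mphi G (s, x)) = 0" by (simp add: sqnorm_def)
  then have "sqnorm lborel (\<lambda>y. mphi s y * G y) = 0" unfolding wave_L2(3)[OF G adm_mphi s] .
  then have "AE y in lborel. mphi s y * G y = 0" unfolding sqnorm_eq_0_iff[OF adm_integrable(3)[OF G adm_mphi s]] .
  then show ?thesis
  proof eventually_elim
    case (elim y)
    have "phi (nsq y) s > 0" by (rule phi_pos) (use s in auto)
    then show ?case using elim by (simp add: mphi_def)
  qed
qed

lemma wave_AE_zero:
  fixes G :: "'a::euclidean_space => complex"
  assumes G: "sqi lborel G" and z: "AE y in lborel. G y = 0" and s: "s > 0"
  shows "AE x in lborel. wave mphi G (s, x) = 0"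
proof -
  have "AE y in lborel. mphi s y * G y = 0" using z by eventually_elim simp
  then have "sqnorm lborel (\<lambda>y. mphi s y * G y) = 0" unfolding sqnorm_eq_0_iff[OF adm_integrable(3)[OF G adm_mphi s]] .
  then have "sqnorm lborel (\<lambda>x. wave mphi G (s, x)) = 0" unfolding wave_L2(3)[OF G adm_mphi s] .
  then show ?thesis unfolding sqnorm_eq_0_iff[OF wave_L2(2)[OF G adm_mphi s]] .
qed

text \<open>The kinetic part is finite through \<open>G\<close>, the potential part by domination
  through \<open>f\<close>. It places the boundary values of \<open>k u\<close> and
  \<open>|k|^2 u\<close> in the form domain.\<close>

lemma form_domain_dominated:
  fixes V :: "'a::euclidean_space => real"
  assumes V: "V \<in> borel_measurable lebesgue" and f: "f \<in> form_domain psi V" and g: "sqi lborel g"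
    and G: "finite_energy G" "AE y in lebesgue. fourier g y = G y" and le: "AE x in lebesgue. cmod (g x) \<le> C * cmod (f x)"
  shows "g \<in> form_domain psi V"
proof -
  note gl = sqi_lebesgue[OF g] and Gs = finite_energy_sqi[OF G(1)]
  note [measurable] = F_meas[OF Gs]
  have m: "(\<lambda>y. psi (nsq y) * csq (G y)) \<in> borel_measurable lborel" by measurable
  have "integrable lebesgue (\<lambda>y. psi (nsq y) * csq (G y))"
    unfolding integrable_completion[OF m] by (rule G(1)[unfolded finite_energy_def, THEN conjunct2])
  then have rG: "sqi lebesgue (\<lambda>y. rpsi y * G y)"
    unfolding sqi_def rpsi_sq[OF V]
    using borel_measurable_times[OF rpsi_measurable[OF V] borel_imp_lebesgue[OF F_meas[OF Gs]]] by (intro conjI)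
  have "sqi lebesgue (\<lambda>y. rpsi y * fourier g y)"
  proof (rule sqi_AE_cong[OF rG])
    show "(\<lambda>y. rpsi y * fourier g y) \<in> borel_measurable lebesgue"
      by (rule borel_measurable_times[OF rpsi_measurable[OF V] sqi_measurable[OF fourier_spec(1)[OF gl]]])
    show "AE y in lebesgue. rpsi y * G y = rpsi y * fourier g y" using G(2) by eventually_elim simp
  qed
  moreover have "sqi lebesgue (\<lambda>x. rpot V x * g x)"
  proof (rule sqi_dominated[OF form_domainD(3)[OF V f]])
    show "(\<lambda>x. rpot V x * g x) \<in> borel_measurable lebesgue"
      by (rule borel_measurable_times[OF rpot_measurable[OF V] sqi_measurable[OF gl]])
    show "AE x in lebesgue. cmod (rpot V x * g x) \<le> C * cmod (rpot V x * f x)"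
      using le
    proof eventually_elim
      case (elim x)
      from mult_left_mono[OF elim norm_ge_zero, of "rpot V x"] show ?case by (simp only: norm_mult mult_ac)
    qed
  qed
  ultimately show ?thesis unfolding form_domain_iff[OF V] using gl by (intro conjI)
qed

lemma psi_lebesgue: "(\<lambda>y::'a::euclidean_space. complex_of_real (psi (nsq y))) \<in> borel_measurable lebesgue"
  by (rule borel_imp_lebesgue) measurable

text \<open>\<open>k u\<close> has the energy of an eigenfunction tested with \<open>|k|\<^sup>2 u\<close>; Rayleigh's inequality shows that
  its boundary values \<open>g\<close> carry at least as much.\<close>

lemma combination_energy_le:
  fixes V :: "'a::euclidean_space => real"
  assumes V: "V \<in> borel_measurable lebesgue" "\<And>x. - B \<le> V x" and eigen: "ordered_eigensystem psi V \<mu> f" and n: "n \<ge> 1"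
    and F: "finite_energy F" "AE y in lebesgue. fourier (f n) y = F y"
    and k: "cutoff k (wave mphi F) C" "cutoff (\<lambda>z. k z * cnj (k z)) (wave mphi F) C'" and T: "has_trace k F g"
    and G: "sqi lborel G" "AE y in lebesgue. fourier g y = G y"
    and orth: "\<And>j. 1 \<le> j ==> j < n ==> ip lebesgue g (f j) = 0"
  shows "energy k F \<le> potential G"
proof -
  note Fs = finite_energy_sqi[OF F(1)]
  note fd = eigen_domain[OF V(1) eigen n] and fs = eigen_sqi[OF V(1) eigen n]
  note g = has_traceD(1)[OF T] and feG = trace_energy(1)[OF F(1) k(1) T G(2,1)]
  obtain f' where f': "f' \<in> borel_fun" "AE x in lebesgue. f n x = f' x"
    by (rule lebesgue_borel_version[OF sqi_measurable[OF fs]])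
  have f'l: "sqi lebesgue f'" by (rule sqi_AE_cong[OF fs borel_imp_lebesgue[OF f'(1)] f'(2)])
  then have f's: "sqi lborel f'" by (rule sqi_lebesgue_iff[OF f'(1), THEN iffD1])
  have "AE y in lebesgue. fourier f' y = F y"
    using fourier_cong_AE[OF fs f'l f'(2)] F(2) by eventually_elim simp
  then have T1: "has_trace (\<lambda>_. 1) F f'" by (rule has_trace_identity[OF f's Fs])
  from trace_exists[OF F(1) k(2)] obtain h where Th: "has_trace (\<lambda>z. k z * cnj (k z)) F h" by (elim exE)
  note hs = has_traceD(1)[OF Th]
  obtain H where H: "sqi lborel H" "AE y in lebesgue. fourier h y = H y"
    by (rule fourier_borel_version[OF sqi_lebesgue[OF hs]])
  note feH = trace_energy(1)[OF F(1) k(2) Th H(2,1)]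
  have pw: "AE x in lebesgue. h x * cnj (f n x) = of_real (csq (g x)) \<and> cmod (g x) \<le> C * cmod (f n x) \<and> cmod (h x) \<le> C\<^sup>2 * cmod (f n x)"
    using AE_completion[OF trace_pointwise[OF T1 T Th cutoff_bound[OF k(1)]]] f'(2) by eventually_elim simp
  have gd: "g \<in> form_domain psi V"
    by (rule form_domain_dominated[OF V(1) fd g feG G(2), of C]) (use pw in eventually_elim, simp)
  have hd: "h \<in> form_domain psi V"
    by (rule form_domain_dominated[OF V(1) fd hs feH H(2), of "C\<^sup>2"]) (use pw in eventually_elim, simp)
  note gl = sqi_lebesgue[OF g] and hl = sqi_lebesgue[OF hs]
  note mf = sqi_measurable[OF fs] and mh = sqi_measurable[OF hl] and mg = sqi_measurable[OF gl]
    and mFf = sqi_measurable[OF fourier_spec(1)[OF fs]] and mFh = sqi_measurable[OF fourier_spec(1)[OF hl]]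
  have mcg: "(\<lambda>x. complex_of_real (csq (g x))) \<in> borel_measurable lebesgue" using mg by measurable
  have mhf: "(\<lambda>x. h x * cnj (f n x)) \<in> borel_measurable lebesgue" using mf mh by measurable
  have "ip lebesgue h (f n) = (LINT x|lebesgue. complex_of_real (csq (g x)))"
    unfolding ip_def by (rule integral_cong_AE[OF mhf mcg]) (use pw in eventually_elim, simp)
  then have hf: "ip lebesgue h (f n) = of_real (sqnorm lebesgue g)"
    unfolding sqnorm_def integral_complex_of_real .
  \<comment> \<open>The eigenvalue equation has \<open>f n\<close> in the first argument; the
    symmetry of the form moves the test function \<open>h\<close> there.\<close>
  have "energy_form psi V h (f n) = cnj (energy_form psi V (f n) h)" by (rule energy_form_cnj[OF V(1), symmetric])
  also have "\<dots> = of_real (\<mu> n) * ip lebesgue h (f n)"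
    unfolding eigen_form[OF V(1) eigen n hd] complex_cnj_mult complex_cnj_complex_of_real cnj_ip ..
  finally have e1: "energy_form psi V h (f n) = of_real (\<mu> n * sqnorm lebesgue g)" unfolding hf of_real_mult .
  have m1: "(\<lambda>y. of_real (psi (nsq y)) * (fourier h y * cnj (fourier (f n) y))) \<in> borel_measurable lebesgue"
    using psi_lebesgue mFf mFh by measurable
  have m2: "(\<lambda>y. of_real (psi (nsq y)) * (H y * cnj (F y))) \<in> borel_measurable lborel"
    using F_meas[OF H(1)] F_meas[OF Fs] by measurable
  have m2': "(\<lambda>y. of_real (psi (nsq y)) * (H y * cnj (F y))) \<in> borel_measurable lebesgue"
    by (rule measurable_completion[OF m2])
  have "(LINT y|lebesgue. of_real (psi (nsq y)) * (fourier h y * cnj (fourier (f n) y))) =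
    (LINT y|lebesgue. of_real (psi (nsq y)) * (H y * cnj (F y)))"
    by (rule integral_cong_AE[OF m1 m2']) (use H(2) F(2) in eventually_elim, simp)
  also have "\<dots> = of_real (energy k F)"
    unfolding integral_completion[OF m2] by (rule energy_pairing[OF F(1) k(2) Th H(2,1)])
  finally have e2: "(LINT y|lebesgue. of_real (psi (nsq y)) * (fourier h y * cnj (fourier (f n) y))) = of_real (energy k F)" .
  have m3: "(\<lambda>x. of_real (V x) * (h x * cnj (f n x))) \<in> borel_measurable lebesgue" using V(1) mhf by measurable
  have m4: "(\<lambda>x. complex_of_real (V x * csq (g x))) \<in> borel_measurable lebesgue" using V(1) mg by measurable
  have e3: "(LINT x|lebesgue. of_real (V x) * (h x * cnj (f n x))) = of_real (LINT x|lebesgue. V x * csq (g x))"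
    unfolding integral_complex_of_real[symmetric]
    by (rule integral_cong_AE[OF m3 m4]) (use pw in eventually_elim, simp)
  \<comment> \<open>The same value of the form, now split: the kinetic part is the energy of
    \<open>k u\<close>, and the potential part follows from
    \<open>h * cnj (f n) = |g|^2\<close>.\<close>
  have "complex_of_real (\<mu> n * sqnorm lebesgue g) = of_real (energy k F + (LINT x|lebesgue. V x * csq (g x)))"
    unfolding e1[symmetric] energy_form_def e2 e3 of_real_add ..
  then have E: "\<mu> n * sqnorm lebesgue g = energy k F + (LINT x|lebesgue. V x * csq (g x))"
    unfolding of_real_eq_iff .
  have m5: "(\<lambda>y. psi (nsq y) * csq (G y)) \<in> borel_measurable lborel" using F_meas[OF G(1)] by measurable
  have mp: "(\<lambda>y::'a. psi (nsq y)) \<in> borel_measurable lebesgue" by (rule borel_imp_lebesgue) measurable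
  have m6: "(\<lambda>y. psi (nsq y) * csq (fourier g y)) \<in> borel_measurable lebesgue"
    using mp sqi_measurable[OF fourier_spec(1)[OF gl]] by measurable
  have P: "(LINT y|lebesgue. psi (nsq y) * csq (fourier g y)) = potential G"
    unfolding potential_def integral_completion[OF m5, symmetric]
    by (rule integral_cong_AE[OF m6 measurable_completion[OF m5]]) (use G(2) in eventually_elim, simp)
  have "\<mu> n * sqnorm lebesgue g \<le> Re (energy_form psi V g g)"
    by (rule rayleigh[OF V(1) eigen gd V(2) n orth])
  then have "\<mu> n * sqnorm lebesgue g \<le> potential G + (LINT x|lebesgue. V x * csq (g x))"
    unfolding energy_form_self[OF V(1)] Re_complex_of_real P .
  then show ?thesis unfolding E by simp
qed

lemma nodal_domains_bound:
  fixes V :: "'a::euclidean_space => real"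
  assumes V: "V \<in> borel_measurable lebesgue" "\<And>x. - B \<le> V x" and eigen: "ordered_eigensystem psi V \<mu> f" and n: "n \<ge> 1"
    and F: "finite_energy F" "AE v in lebesgue. fourier (f n) v = F v"
  shows "finite (nodal_domains (wave mphi F)) \<and> card (nodal_domains (wave mphi F)) \<le> n"
proof (rule ccontr)
  assume neg: "\<not> (finite (nodal_domains (wave mphi F)) \<and> card (nodal_domains (wave mphi F)) \<le> n)"
  let ?w = "wave mphi F"
  note Fs = finite_energy_sqi[OF F(1)]
  define U where "U = {z \<in> half_space. ?w z \<noteq> 0}"
  have "open (half_space :: (real \<times> 'a) set)" unfolding half_space_def by (intro open_Times) auto
  then have "open (half_space \<inter> ?w -` (- {0}))" by (intro continuous_open_preimage wave_continuous[OF Fs adm_mphi]) auto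
  moreover have "half_space \<inter> ?w -` (- {0}) = U" by (auto simp: U_def)
  ultimately have U: "open U" by simp
  \<comment> \<open>Treating infinitely many components along with too many of them refutes
    finiteness and the bound together.\<close>
  have "\<exists>T. finite T \<and> card T = Suc n \<and> T \<subseteq> components U"
  proof (cases "finite (components U)")
    case True
    then have "Suc n \<le> card (components U)" using neg unfolding nodal_domains_def U_def[symmetric] by simp
    then show ?thesis by (rule obtain_subset_with_card_n) (intro exI conjI)
  next
    case False
    then show ?thesis by (rule infinite_arbitrarily_large)
  qed
  then obtain T where Tf: "finite T" and Tc: "card T = Suc n" and Ts: "T \<subseteq> components U" by (elim exE conjE)
  then have "T \<noteq> {}" by auto
  then obtain D0 where D0: "D0 \<in> T" by blast
  define I where "I = T - {D0}"
  have If: "finite I" and Ic: "card I = n" using Tf Tc D0 by (simp_all add: I_def)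
  have IU: "D \<in> components U" if "D \<in> I" for D using that Ts by (auto simp: I_def)
  have D0U: "D0 \<in> components U" using D0 Ts by blast
  have disj: "z \<notin> D'" if "D \<in> components U" "D' \<in> components U" "D \<noteq> D'" "z \<in> D" for D D' z
    using components_nonoverlap[OF that(1,2)] that(3,4) by blast
  \<comment> \<open>A criterion for cutoffs that depend only on membership in the chosen domains. It
    serves for single indicators, for their combination \<open>k\<close> and for
    \<open>|k|^2\<close>.\<close>
  have cut: "cutoff k ?w C"
    if m: "k \<in> borel_fun" and b: "\<And>z. cmod (k z) \<le> C"
      and inv: "\<And>z z'. (\<And>D. D \<in> I ==> z' \<in> D \<longleftrightarrow> z \<in> D) ==> k z' = k z" and zero: "\<And>z. (\<And>D. D \<in> I ==> z \<notin> D) ==> k z = 0" for k C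
    unfolding cutoff_def
  proof (intro conjI disjI2 allI ballI impI)
    show "k \<in> borel_fun" by (rule m)
    show "cmod (k z) \<le> C" for z by (rule b)
    fix z :: "real \<times> 'a" assume z: "z \<in> half_space"
    show "k z = 0" if "?w z = 0"
    proof (rule zero)
      fix D assume "D \<in> I"
      from in_components_subset[OF IU[OF this]] that show "z \<notin> D" by (auto simp: U_def)
    qed
    assume "?w z \<noteq> 0"
    with z have "z \<in> U" by (simp add: U_def)
    from component_ball[OF U this] obtain e where e: "e > 0" "\<And>D z'. D \<in> components U ==> z' \<in> ball z e ==> z' \<in> D \<longleftrightarrow> z \<in> D" by metis
    show "\<exists>e>0. \<forall>z'\<in>ball z e. k z' = k z"
    proof (intro exI[of _ e] conjI ballI e(1))
      fix z' assume z': "z' \<in> ball z e"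
      show "k z' = k z" by (rule inv) (rule e(2)[OF IU z'])
    qed
  qed
  have Dm: "indicator D \<in> borel_fun" if "D \<in> I" for D :: "(real \<times> 'a) set"
    using component_open[OF U IU[OF that]] by (intro borel_measurable_indicator) simp
  have "\<exists>g. has_trace (indicator D) F g" if D: "D \<in> I" for D
  proof (rule trace_exists[OF F(1) cut[of "indicator D :: real \<times> 'a => complex" 1]])
    show "indicator D z' = (indicator D z :: complex)" if "\<And>D. D \<in> I ==> z' \<in> D \<longleftrightarrow> z \<in> D" for z z'
      using that[OF D] by (simp add: indicator_def)
    show "indicator D z = (0::complex)" if "\<And>D. D \<in> I ==> z \<notin> D" for z using that[OF D] by simp
  qed (use Dm[OF D] in \<open>simp_all add: indicator_def\<close>)
  then obtain gD where gD: "\<And>D. D \<in> I ==> has_trace (indicator D) F (gD D)" by metis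
  \<comment> \<open>The \<open>n\<close> domains in \<open>I\<close> face the \<open>n - 1\<close>
    orthogonality conditions with indices below \<open>n\<close>.\<close>
  have "card {1..<n} < card I" using n Ic by simp
  from underdetermined_system[OF finite_atLeastLessThan If this, of "\<lambda>D j. ip lebesgue (gD D) (f j)"]
  obtain c where c: "\<exists>D\<in>I. c D \<noteq> 0" "\<forall>j\<in>{1..<n}. (\<Sum>D\<in>I. c D * ip lebesgue (gD D) (f j)) = 0" by (elim exE conjE)
  define k where "k z = (\<Sum>D\<in>I. c D * indicator D z)" for z
  define C where "C = (\<Sum>D\<in>I. cmod (c D))"
  define g where "g x = (\<Sum>D\<in>I. c D * gD D x)" for x
  have km: "k \<in> borel_fun" unfolding k_def
    by (intro borel_measurable_sum borel_measurable_times borel_measurable_const Dm)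
  have kb: "cmod (k z) \<le> C" for z
    unfolding k_def C_def by (rule sum_norm_le) (simp add: norm_mult indicator_def)
  have kinv: "k z' = k z" if "\<And>D. D \<in> I ==> z' \<in> D \<longleftrightarrow> z \<in> D" for z z'
    unfolding k_def by (intro sum.cong refl) (simp add: indicator_def that)
  have kzero: "k z = 0" if "\<And>D. D \<in> I ==> z \<notin> D" for z
    unfolding k_def by (intro sum.neutral ballI) (simp add: that)
  have k1: "cutoff k ?w C" by (rule cut[OF km kb kinv kzero])
  have k2: "cutoff (\<lambda>z. k z * cnj (k z)) ?w (C * C)"
  proof (rule cut)
    show "(\<lambda>z. k z * cnj (k z)) \<in> borel_fun" using km by measurable
    show "cmod (k z * cnj (k z)) \<le> C * C" for z
      unfolding norm_mult complex_mod_cnj by (intro mult_mono' kb norm_ge_zero)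
    show "k z' * cnj (k z') = k z * cnj (k z)" if "\<And>D. D \<in> I ==> z' \<in> D \<longleftrightarrow> z \<in> D" for z z'
    proof -
      have "k z' = k z" by (rule kinv) (rule that)
      then show ?thesis by simp
    qed
    show "k z * cnj (k z) = 0" if "\<And>D. D \<in> I ==> z \<notin> D" for z
    proof -
      have "k z = 0" by (rule kzero) (rule that)
      then show ?thesis by simp
    qed
  qed
  have Tg: "has_trace k F g" unfolding k_def[abs_def] g_def[abs_def] by (rule has_trace_combination[OF If gD])
  note gs = has_traceD(1)[OF Tg]
  obtain G where G: "sqi lborel G" "AE v in lebesgue. fourier g v = G v"
    by (rule fourier_borel_version[OF sqi_lebesgue[OF gs]])
  have orth: "ip lebesgue g (f j) = 0" if j: "1 \<le> j" "j < n" for j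
  proof -
    have "ip lebesgue g (f j) = (\<Sum>D\<in>I. ip lebesgue (\<lambda>x. c D * gD D x) (f j))"
      unfolding g_def[abs_def]
      by (rule ip_sum_left[OF sqi_cmult[OF sqi_lebesgue[OF has_traceD(1)[OF gD]]] eigen_sqi[OF V(1) eigen j(1)]])
    also have "\<dots> = 0" unfolding ip_cmult_left by (rule c(2)[rule_format]) (use j in simp)
    finally show ?thesis .
  qed
  have le: "energy k F \<le> potential G" by (rule combination_energy_le[OF V eigen n F k1 k2 Tg G orth])
  have eq: "AE x in lborel. k (s, x) * ?w (s, x) = wave mphi G (s, x)" if "s > 0" for s
    by (rule energy_equality[OF F(1) k1 Tg G(2,1) le that])
  \<comment> \<open>The omitted domain is open, so its slice through one of its points is an open
    set on which \<open>k\<close> vanishes.\<close>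
  obtain s0 x0 where z0: "(s0, x0) \<in> D0" using in_components_nonempty[OF D0U] by (metis equals0I surj_pair)
  have s0: "s0 > 0" using in_components_subset[OF D0U] z0 by (auto simp: U_def half_space_def)
  have G0: "AE v in lborel. G v = 0"
  proof (rule wave_vanishes[OF G(1) s0 open_slice[OF component_open[OF U D0U]]])
    show "x0 \<in> {x. (s0, x) \<in> D0}" using z0 by simp
    show "AE x in lborel. x \<in> {x. (s0, x) \<in> D0} --> wave mphi G (s0, x) = 0"
      using eq[OF s0]
    proof eventually_elim
      case (elim x)
      have "k (s0, x) = 0" if x: "(s0, x) \<in> D0"
      proof (rule kzero)
        fix D assume D: "D \<in> I"
        then have "D0 \<noteq> D" by (auto simp: I_def)
        then show "(s0, x) \<notin> D" by (rule disj[OF D0U IU[OF D] _ x])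
      qed
      with elim show ?case by auto
    qed
  qed
  from c(1) obtain D where D: "D \<in> I" "c D \<noteq> 0" by blast
  obtain s x where z: "(s, x) \<in> D" using in_components_nonempty[OF IU[OF D(1)]] by (metis equals0I surj_pair)
  have sub: "D \<subseteq> U" by (rule in_components_subset[OF IU[OF D(1)]])
  then have s: "s > 0" using z by (auto simp: U_def half_space_def)
  \<comment> \<open>On \<open>D\<close> the function \<open>k u\<close> is the nonzero multiple
    \<open>c D\<close> of the nonvanishing \<open>u\<close>, yet it is null on almost all of the
    slice; the open slice of \<open>D\<close> would have to be empty.\<close>
  have "AE y in lborel. y \<notin> {y. (s, y) \<in> D}"
    using eq[OF s] wave_AE_zero[OF G(1) G0 s]
  proof eventually_elim
    case (elim y)
    show ?case
    proof
      assume "y \<in> {y. (s, y) \<in> D}"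
      then have y: "(s, y) \<in> D" by simp
      have "k (s, y) = (\<Sum>D'\<in>I. if D' = D then c D else 0)"
        unfolding k_def
      proof (intro sum.cong refl)
        fix D' assume D': "D' \<in> I"
        show "c D' * indicator D' (s, y) = (if D' = D then c D else 0)"
          using disj[OF IU[OF D(1)] IU[OF D'] _ y] y by (cases "D' = D") auto
      qed
      then have "k (s, y) = c D" using If D(1) by simp
      moreover have "?w (s, y) \<noteq> 0" using y sub by (auto simp: U_def)
      ultimately show False using elim D(2) by simp
    qed
  qed
  from open_AE_empty[OF open_slice[OF component_open[OF U IU[OF D(1)]]] this] z show False by blast
qed

text \<open>Links the given continuous version to the explicit integral: on a slice both have the
  same transform, hence agree almost everywhere by \<open>fourier_inversion_dist\<close>, and by
  continuity everywhere.\<close>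

lemma extension_eq_wave:
  fixes f :: "'a::euclidean_space => complex"
  assumes u: "harmonic_extension A f u" "continuous_on half_space u"
    and F: "sqi lborel F" "AE y in lebesgue. fourier f y = F y" and z: "z \<in> half_space"
  shows "u z = wave mphi F z"
proof -
  obtain s x where sx: "z = (s, x)" and s: "s > 0" using z by (auto simp: half_space_def)
  let ?v = "\<lambda>x. u (s, x)"
  have v: "sqi lebesgue ?v" and Fv: "AE y in lebesgue. fourier ?v y = of_real (phi (nsq y) s) * fourier f y"
    using u(1) s unfolding harmonic_extension_def L2_iff_sqi by auto
  note a = adm_integrable[OF F(1) adm_mphi s]
  have m: "integrable lebesgue (\<lambda>y. mphi s y * F y)" "sqi lebesgue (\<lambda>y. mphi s y * F y)"
    using a(2,4) sqi_lebesgue[OF a(3)] by (simp_all add: integrable_completion)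
  have d: "sqi lebesgue (\<lambda>y. fourier ?v y - mphi s y * F y)" by (rule sqi_diff[OF fourier_spec(1)[OF v] m(2)])
  have "AE y in lebesgue. fourier ?v y - mphi s y * F y = 0"
    using Fv F(2) by eventually_elim (simp add: mphi_def)
  then have "sqnorm lebesgue (\<lambda>y. fourier ?v y - mphi s y * F y) = 0" unfolding sqnorm_eq_0_iff[OF d] .
  then have z0: "sqnorm lebesgue (\<lambda>x. ?v x - inv_fourier (\<lambda>y. mphi s y * F y) x) = 0"
    unfolding fourier_inversion_dist[OF v m] .
  have "AE x in lebesgue. ?v x - wave mphi F (s, x) = 0"
    using z0 unfolding sqnorm_eq_0_iff[OF sqi_diff[OF v inv_fourier_isometry(2)[OF m]]] wave_slice[OF s] .
  then have ae: "AE x in lborel. x \<in> UNIV --> ?v x - wave mphi F (s, x) = 0" unfolding AE_completion_iff by simp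
  have p: "continuous_on UNIV (\<lambda>x. (s, x))" by (intro continuous_intros)
  have "continuous_on UNIV (\<lambda>x. ?v x - wave mphi F (s, x))"
    by (intro continuous_on_diff continuous_on_compose2[OF u(2) p] continuous_on_compose2[OF wave_continuous[OF F(1) adm_mphi] p])
       (use s in \<open>auto simp: half_space_def\<close>)
  from continuous_AE_zero[OF open_UNIV this ae UNIV_I, of x] show ?thesis by (simp add: sx)
qed

end

theorem theorem3:
  fixes A :: "real \<Rightarrow> real"
    and V :: "real ^ 'd \<Rightarrow> real"
    and \<mu> :: "nat \<Rightarrow> real"
    and f :: "nat \<Rightarrow> real ^ 'd \<Rightarrow> complex"
    and u :: "real \<times> (real ^ 'd) \<Rightarrow> complex"
    and n :: nat
  assumes A_nonneg: "\<And>s. s \<ge> 0 \<Longrightarrow> A s \<ge> 0"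
    and A_int: "locally_integrable A"
    and A_regular:
      "((\<forall>s>0. A s > 0) \<and> locally_lipschitz_on {0<..} A) \<or>
       (\<exists>a. coefficient a \<and> (\<forall>t>0. a t > 0) \<and> locally_lipschitz_on {0<..} a \<and>
            (\<forall>t>0. A (change_of_scale a t) = (a t)\<^sup>2))"
    and exp_integrable:
      "\<And>t. t > 0 \<Longrightarrow>
         integrable lebesgue (\<lambda>\<xi>::real ^ 'd. exp (- t * associated_cbf A ((norm \<xi>)\<^sup>2)))"
    and V_measurable: "V \<in> borel_measurable lebesgue"
    and V_bounded: "locally_bounded V"
    and V_confining: "confining V"
    and eigen: "ordered_eigensystem (associated_cbf A) V \<mu> f"
    and n: "n \<ge> 1"
    and ext: "harmonic_extension A (f n) u"
    and u_cont: "continuous_on half_space u"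
  shows "finite (nodal_parts u) \<and> card (nodal_parts u) \<le> n"
proof -
  \<comment> \<open>Both forms of the regularity hypothesis are reduced to a continuous positive
    weight.\<close>
  have "continuous_on {0<..} A \<and> (\<forall>s>0. 0 < A s)"
    using A_regular
  proof (elim disjE exE conjE)
    assume "\<forall>s>0. A s > 0" "locally_lipschitz_on {0<..} A"
    then show ?thesis using locally_lipschitz_continuous[of "{0<..}" A] by simp
  next
    fix a assume "coefficient a" "\<forall>t>0. a t > 0" "locally_lipschitz_on {0<..} a" "\<forall>t>0. A (change_of_scale a t) = (a t)\<^sup>2"
    from weight_of_coefficient[OF this] show ?thesis by (rule conjI)
  qed
  then interpret weight A
    using A_nonneg A_int by unfold_locales auto
  from confining_bounded_below[OF V_confining V_bounded] obtain B where "\<forall>x. - B \<le> V x" by (elim exE)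
  then have B: "- B \<le> V x" for x by (rule spec)
  note fs = eigen_sqi[OF V_measurable eigen n]
  obtain F where F: "sqi lborel F" "AE \<xi> in lebesgue. fourier (f n) \<xi> = F \<xi>" by (rule fourier_borel_version[OF fs])
  note [measurable] = F_meas[OF F(1)]
  have m: "(\<lambda>\<xi>. psi ((norm \<xi>)\<^sup>2) * (cmod (F \<xi>))\<^sup>2) \<in> borel_measurable lborel" by measurable
  \<comment> \<open>An eigenfunction lies in the form domain, which is where the finite energy of
    its extension comes from.\<close>
  have "integrable lebesgue (\<lambda>\<xi>. psi ((norm \<xi>)\<^sup>2) * (cmod (fourier (f n) \<xi>))\<^sup>2)"
    using eigen_domain[OF V_measurable eigen n] unfolding form_domain_def mem_Collect_eq by (elim conjE)
  then have "integrable lebesgue (\<lambda>\<xi>. psi ((norm \<xi>)\<^sup>2) * (cmod (F \<xi>))\<^sup>2)"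
    by (rule integrable_cong_AE_imp[OF _ measurable_completion[OF m]]) (use F(2) in eventually_elim, simp)
  then have fe: "finite_energy F" unfolding finite_energy_def integrable_completion[OF m] by (intro conjI F(1))
  have "{z \<in> half_space. u z \<noteq> 0} = {z \<in> half_space. wave mphi F z \<noteq> 0}"
    using extension_eq_wave[OF ext u_cont F] by auto
  then have "nodal_domains u = nodal_domains (wave mphi F)" by (simp add: nodal_domains_def)
  with nodal_domains_bound[OF V_measurable B eigen n fe F(2)]
  have "finite (nodal_domains u)" "card (nodal_domains u) \<le> n" by simp_all
  \<comment> \<open>The nodal parts are an image of the set of nodal domains.\<close>
  then show ?thesis unfolding nodal_parts_def
    using card_image_le[of "nodal_domains u" "\<lambda>D z. indicator D z * u z"] by (auto intro: order_trans)
qed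

end
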